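(* Let $0<\alpha<1$ and let $j,k\in\overline{\mathbf N}$ with $k\ge j$. Let $\{D^t\}_{t\in[0,1]}$ be a smooth family of non-empty bounded domains in $\mathbf C$ with $C^{k+1+\alpha,j}$ boundary and total space $\mathcal D$. Then there exist linear solution operators $S^t$ such that, for every family $f=\{f^t\}\in C^{k+\alpha,j}(\overline{\mathcal D})$ of $(0,1)$-forms $f^t$ on $D^t$, the functions $u^t=S^tf$ satisfy $\overline\partial u^t=f^t$ on $D^t$ and $\{S^tf\}\in C^{k+1+\alpha,j}(\overline{\mathcal D})$.
   Context: $\mathbf N=\{0,1,2,\dots\}$ and $\overline{\mathbf N}=\mathbf N\cup\{\infty\}$. The parameter $t$ ranges over $[0,1]$; $\mathbf C$ is identified with $\mathbf R^2$, with real coordinates $x$. A family $\{D^t\}$ of domains is a continuous family if its total space $\mathcal D=\bigcup_t D^t\times\{t\}$ is open in $\mathbf C\times[0,1]$. Hölder spaces. $|\cdot|_{\Omega;b}$ is the standard Hölder norm of order $b$ on $\Omega$. For finite $b\ge0$ and $j\in\mathbf N$, a family $\{u^t\}$ of functions $u^t$ on $D^t$ is in $C_*^{b,j}(\overline{\mathcal D})$ if all partial derivatives $\partial_t^i\partial_x^Lu^t(x)$ with $i\le j$, $|L|\le b$, defined on $\mathcal D$, extend continuously to $\overline{\mathcal D}$ and $\sup_{0\le i\le j,\,t}|\partial_t^iu^t|_{D^t;b}<\infty$. For $a\ge j$, $C^{a,j}(\overline{\mathcal D})=\bigcap_{i\le j}C_*^{a-i,i}(\overline{\mathcal D})$. The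 family is in $C^{a,j}(\mathcal D)$ if for every relatively compact open subset $\omega$ of $\mathcal D$ its restriction to the sets $\omega^t=\{x:(x,t)\in\omega\}$ is in $C^{a,j}(\overline\omega)$. When an index is infinite, the space is the intersection over all finite admissible smaller indices. A family of $(0,1)$-forms belongs to such a space if the family of its coefficients does. Smooth family with $C^{a,j}$ boundary ($a\ge1$): there are a continuous family of domains $\{U^t\}$ with bounded total space $\mathcal U$ containing $\overline{\mathcal D}$ and real functions $r^t$ on $U^t$ with $\{r^t\}\in C^{a,j}(\mathcal U)$, $D^t=\{r^t<0\}$, and $\nabla_xr^t\ne0$ on $\partial D^t$. *)

theory Defs
  imports "HOL-Analysis.Analysis"
begin

text \<open>
  A family \<open>{u\<^sup>t}\<close> is a function \<open>u t x\<close> of \<open>t \<in> [0,1]\<close> and \<open>x \<in> D\<^sup>t \<subseteq> \<complex> = \<real>\<^sup>2\<close>; its values at other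
  arguments are irrelevant. Iterated derivatives are total operators, so that their existence is
  always asserted separately.
\<close>

definition ddir :: "complex \<Rightarrow> (complex \<Rightarrow> 'b::real_normed_vector) \<Rightarrow> complex \<Rightarrow> 'b" where
  "ddir e u x = vector_derivative (\<lambda>s::real. u (x + s *\<^sub>R e)) (at 0)"

definition has_ddir :: "complex \<Rightarrow> complex set \<Rightarrow> (complex \<Rightarrow> 'b::real_normed_vector) \<Rightarrow> bool" where
  "has_ddir e \<Omega> u \<longleftrightarrow> (\<forall>x\<in>\<Omega>. (\<lambda>s::real. u (x + s *\<^sub>R e)) differentiable (at 0))"

text \<open>\<open>\<partial>\<^sub>x\<^sup>L\<close> for the multi-index \<open>L = (p, q)\<close>.\<close>

definition dx :: "nat \<Rightarrow> nat \<Rightarrow> (complex \<Rightarrow> 'b::real_normed_vector) \<Rightarrow> complex \<Rightarrow> 'b" where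
  "dx p q u = (ddir 1 ^^ p) ((ddir \<i> ^^ q) u)"

definition has_dx :: "nat \<Rightarrow> nat \<Rightarrow> complex set \<Rightarrow> (complex \<Rightarrow> 'b::real_normed_vector) \<Rightarrow> bool" where
  "has_dx p q \<Omega> u \<longleftrightarrow>
     (\<forall>m<q. has_ddir \<i> \<Omega> (dx 0 m u)) \<and> (\<forall>m<p. has_ddir 1 \<Omega> (dx m q u))"

text \<open>One-sided at \<open>t = 0\<close> and \<open>t = 1\<close>. On a total space that is open in \<open>\<complex> \<times> [0,1]\<close> only the
  values of the family on the total space enter.\<close>

definition dt :: "(real \<Rightarrow> complex \<Rightarrow> 'b::real_normed_vector) \<Rightarrow> real \<Rightarrow> complex \<Rightarrow> 'b" where
  "dt u t x = vector_derivative (\<lambda>s. u s x) (at t within {0..1})"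

definition dtx ::
    "nat \<Rightarrow> nat \<Rightarrow> nat \<Rightarrow> (real \<Rightarrow> complex \<Rightarrow> 'b::real_normed_vector) \<Rightarrow> real \<Rightarrow> complex \<Rightarrow> 'b" where
  "dtx i p q u = (dt ^^ i) (\<lambda>t. dx p q (u t))"

definition has_dtx ::
    "nat \<Rightarrow> nat \<Rightarrow> nat \<Rightarrow> (real \<Rightarrow> complex set) \<Rightarrow> (real \<Rightarrow> complex \<Rightarrow> 'b::real_normed_vector) \<Rightarrow> bool" where
  "has_dtx i p q D u \<longleftrightarrow>
     (\<forall>t\<in>{0..1}. has_dx p q (D t) (u t)) \<and>
     (\<forall>m<i. \<forall>t\<in>{0..1}. \<forall>x\<in>D t. (\<lambda>s. dtx m p q u s x) differentiable (at t within {0..1}))"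

definition total_space :: "(real \<Rightarrow> complex set) \<Rightarrow> (complex \<times> real) set" where
  "total_space D = {(x, t). t \<in> {0..1} \<and> x \<in> D t}"

definition continuous_family :: "(real \<Rightarrow> complex set) \<Rightarrow> bool" where
  "continuous_family D \<longleftrightarrow>
     (\<forall>t\<in>{0..1}. open (D t) \<and> connected (D t)) \<and>
     openin (top_of_set (UNIV \<times> {0..1})) (total_space D)"

text \<open>The Hoelder norm of order \<open>b = n + \<beta>\<close>, with \<open>n\<close> an integer and \<open>0 \<le> \<beta> < 1\<close>: the sum of the
  sup norms of the derivatives of order at most \<open>n\<close> and, if \<open>\<beta> > 0\<close>, of the \<open>\<beta>\<close>-Hoelder seminorms of the
  derivatives of order \<open>n\<close>. It is infinite if one of these derivatives does not exist.\<close>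

definition hoelder_norm :: "complex set \<Rightarrow> real \<Rightarrow> (complex \<Rightarrow> 'b::real_normed_vector) \<Rightarrow> ennreal" where
  "hoelder_norm \<Omega> b u =
     (let n = nat \<lfloor>b\<rfloor>; \<beta> = frac b in
      if \<forall>p q. p + q \<le> n \<longrightarrow> has_dx p q \<Omega> u then
        (\<Sum>(p, q)\<in>{(p, q). p + q \<le> n}. SUP x\<in>\<Omega>. ennreal (norm (dx p q u x))) +
        (if \<beta> > 0 then
           (\<Sum>(p, q)\<in>{(p, q). p + q = n}.
              SUP x\<in>\<Omega>. SUP y\<in>\<Omega> - {x}. ennreal (norm (dx p q u x - dx p q u y) / dist x y powr \<beta>))
         else 0)
      else \<infinity>)"

definition hoelder_star ::
    "real \<Rightarrow> nat \<Rightarrow> (real \<Rightarrow> complex set) \<Rightarrow> (real \<Rightarrow> complex \<Rightarrow> 'b::real_normed_vector) set" where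
  "hoelder_star b j D = {u.
     (\<forall>i\<le>j. \<forall>p q. real (p + q) \<le> b \<longrightarrow>
        has_dtx i p q D u \<and>
        (\<exists>g. continuous_on (closure (total_space D)) g \<and>
             (\<forall>(x, t)\<in>total_space D. g (x, t) = dtx i p q u t x))) \<and>
     (SUP i\<in>{..j}. SUP t\<in>{0..1}. hoelder_norm (D t) b ((dt ^^ i) u t)) < \<infinity>}"

definition hoelder_fin ::
    "real \<Rightarrow> nat \<Rightarrow> (real \<Rightarrow> complex set) \<Rightarrow> (real \<Rightarrow> complex \<Rightarrow> 'b::real_normed_vector) set" where
  "hoelder_fin a j D = (\<Inter>i\<le>j. hoelder_star (a - real i) i D)"

text \<open>\<open>C\<^bsup>a,j\<^esup>\<close> on the closed total space, for \<open>a \<ge> j\<close>. A finite index is kept; an infinite one is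
  replaced by all finite values that satisfy \<open>a' \<ge> j'\<close>.\<close>

definition hoelder_closed ::
    "ereal \<Rightarrow> enat \<Rightarrow> (real \<Rightarrow> complex set) \<Rightarrow> (real \<Rightarrow> complex \<Rightarrow> 'b::real_normed_vector) set" where
  "hoelder_closed a j D = {u. ereal_of_enat j \<le> a \<and>
     (\<forall>a' j'. real j' \<le> a' \<and> (a \<noteq> \<infinity> \<longrightarrow> ereal a' = a) \<and> (j \<noteq> \<infinity> \<longrightarrow> enat j' = j) \<longrightarrow>
        u \<in> hoelder_fin a' j' D)}"

text \<open>\<open>C\<^bsup>a,j\<^esup>\<close> on the total space itself.\<close>

definition hoelder_local ::
    "ereal \<Rightarrow> enat \<Rightarrow> (real \<Rightarrow> complex set) \<Rightarrow> (real \<Rightarrow> complex \<Rightarrow> 'b::real_normed_vector) set" where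
  "hoelder_local a j D = {u. \<forall>\<omega>.
     openin (top_of_set (total_space D)) \<omega> \<and> compact (closure \<omega>) \<and> closure \<omega> \<subseteq> total_space D \<longrightarrow>
     u \<in> hoelder_closed a j (\<lambda>t. {x. (x, t) \<in> \<omega>})}"

definition smooth_family :: "ereal \<Rightarrow> enat \<Rightarrow> (real \<Rightarrow> complex set) \<Rightarrow> bool" where
  "smooth_family a j D \<longleftrightarrow>
     (\<exists>U (r :: real \<Rightarrow> complex \<Rightarrow> real).
        continuous_family U \<and> bounded (total_space U) \<and>
        closure (total_space D) \<subseteq> total_space U \<and>
        r \<in> hoelder_local a j U \<and>
        (\<forall>t\<in>{0..1}. D t = {x \<in> U t. r t x < 0}) \<and>
        (\<forall>t\<in>{0..1}. \<forall>x\<in>frontier (D t). (ddir 1 (r t) x, ddir \<i> (r t) x) \<noteq> (0, 0)))"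

text \<open>A \<open>(0,1)\<close>-form on a planar domain is represented by its coefficient with respect to the conjugate
  differential; \<open>dbar u\<close> is the coefficient \<open>(\<partial>\<^sub>1 u + \<i> \<partial>\<^sub>2 u) / 2\<close> of the form.\<close>

definition dbar :: "(complex \<Rightarrow> complex) \<Rightarrow> complex \<Rightarrow> complex" where
  "dbar u x = (ddir 1 u x + \<i> * ddir \<i> u x) / 2"

end

theory Submission
  imports Defs
begin

text \<open>The coefficient \<open>f\<^sup>t\<close> is extended to a compactly supported function on the whole plane, without loss of
  regularity in \<open>x\<close> and \<open>t\<close>, and the extension is convolved with the Cauchy kernel.

  Near a boundary point the defining function \<open>r\<close> decreases at a fixed rate in a fixed direction \<open>e\<close>. Seeley's
  method replaces the value at a point with \<open>r > 0\<close> by a weighted series of the values at the points that are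
  shifted along \<open>e\<close> by \<open>2\<^sup>l\<close> times a constant multiple of \<open>r\<close>. The weights have moments that make all
  derivatives match across \<open>r = 0\<close>, and the shift has the regularity of \<open>r\<close>. These extensions are linear and act
  for each \<open>t\<close> separately; cutoff functions glue finitely many of them.

  The Cauchy kernel is a sum of dyadic rescalings of one smooth kernel supported in an annulus. Its second
  derivatives have mean zero, so for a density that is Hoelder continuous in \<open>x\<close> the differentiated series
  converges and is again Hoelder continuous; derivatives in \<open>t\<close> fall on the density.\<close>

subsection \<open>Function spaces\<close>

text \<open>A Cauchy integral over D^t, differentiated in t, would bring in the moving boundary.
  After extension the density lives on the fixed plane and the kernel is independent of t, so only
  the density is differentiated in t. Seeley's infinite series is preferred to a finite reflection
  because one sequence of weights serves every order: when k or j is infinite, a single operator has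
  to work for all finite indices at once. Boundary values of f^t are read off as limits along
  \<open>e\<close> from f^t alone, which keeps the operator slice by slice. Only the part of the
  Cauchy kernel near 0 is kept. Its d-bar derivative is a point mass minus a smooth ring, and the
  ring is made so large that, seen from a point of D^t, the density vanishes on it. A further
  obstacle is that a point of the closed total space need not, a priori, lie in the closure of its
  own slice, whereas the gradient condition speaks only of the frontiers of the slices.\<close>

definition slab :: "(complex \<times> real) set" where "slab = UNIV \<times> {0..1}"

text \<open>The times that enter the difference quotients of \<open>has_grad\<close>. The singleton
  for j = 0 suppresses every increment in time, so that one predicate covers families with and
  without t-derivatives.\<close>

definition tdom :: "nat \<Rightarrow> real \<Rightarrow> real set" where
  "tdom j t = (if j = 0 then {t} else {0..1})"

definition gradmap :: "'b \<Rightarrow> 'b \<Rightarrow> 'b \<Rightarrow> complex \<times> real \<Rightarrow> 'b::real_normed_vector" where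
  "gradmap a b c w = Re (fst w) *\<^sub>R a + Im (fst w) *\<^sub>R b + snd w *\<^sub>R c"

text \<open>For \<open>j = 0\<close> only the derivative in \<open>x\<close> at fixed \<open>t\<close> is asserted and \<open>ut\<close> is irrelevant; for \<open>j > 0\<close> it
  is the joint derivative, one-sided at \<open>t = 0\<close> and \<open>t = 1\<close>.\<close>

definition has_grad ::
    "nat \<Rightarrow> (complex \<times> real) set \<Rightarrow> (complex \<times> real \<Rightarrow> 'b::real_normed_vector) \<Rightarrow>
     (complex \<times> real \<Rightarrow> 'b) \<Rightarrow> (complex \<times> real \<Rightarrow> 'b) \<Rightarrow> (complex \<times> real \<Rightarrow> 'b) \<Rightarrow> bool" where
  "has_grad j V u u1 u2 ut \<longleftrightarrow>
     (\<forall>z\<in>V. (u has_derivative gradmap (u1 z) (u2 z) (ut z)) (at z within UNIV \<times> tdom j (snd z)))"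

text \<open>The Hoelder condition compares points of one slice, with a constant uniform in t; in t
  there is only joint continuity. These are the data that a supremum over t of Hoelder norms and a
  continuous extension to the closure provide.\<close>

definition hcont :: "real \<Rightarrow> (complex \<times> real) set \<Rightarrow> (complex \<times> real \<Rightarrow> 'b::real_normed_vector) \<Rightarrow> bool" where
  "hcont \<alpha> S u \<longleftrightarrow> continuous_on S u \<and> (\<exists>B. \<forall>z\<in>S. norm (u z) \<le> B) \<and>
     (\<exists>H. \<forall>t x y. (x, t) \<in> S \<longrightarrow> (y, t) \<in> S \<longrightarrow> norm (u (x, t) - u (y, t)) \<le> H * dist x y powr \<alpha>)"

text \<open>\<open>C\<^bsup>n+\<alpha>,j\<^esup>\<close>: the derivatives are taken on \<open>V\<close>, and they are bounded, continuous and Hoelder in \<open>x\<close> on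
  the set \<open>S\<close>, which contains \<open>V\<close> and part of its boundary.\<close>

primrec hreg :: "real \<Rightarrow> nat \<Rightarrow> nat \<Rightarrow> (complex \<times> real) set \<Rightarrow> (complex \<times> real) set \<Rightarrow>
    (complex \<times> real \<Rightarrow> 'b::real_normed_vector) \<Rightarrow> bool" where
  "hreg \<alpha> 0 = (\<lambda>j V S u. hcont \<alpha> S u)"
| "hreg \<alpha> (Suc n) = (\<lambda>j V S u. hcont \<alpha> S u \<and> (\<exists>u1 u2 ut. has_grad j V u u1 u2 ut \<and>
     hreg \<alpha> n j V S u1 \<and> hreg \<alpha> n j V S u2 \<and> (0 < j \<longrightarrow> hreg \<alpha> n (j - 1) V S ut)))"

declare hreg.simps [simp del]

lemma dist_prod_le: "dist z w \<le> dist (fst z) (fst w) + dist (snd z) (snd w)"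
  unfolding dist_prod_def by (rule sqrt_sum_squares_le_sum) auto

text \<open>For d at most 1 the Lipschitz bound is used with d \<le> d^\<beta>, for larger d the
  uniform bound B with 1 \<le> d^\<beta>.\<close>

lemma lipschitz_imp_hoelder:
  fixes a :: real
  assumes "0 < \<beta>" "\<beta> \<le> 1" "a \<le> L * d" "a \<le> B" "0 \<le> d" "0 \<le> L" "0 \<le> B"
  shows "a \<le> (L + B) * d powr \<beta>"
proof (cases "d \<le> 1")
  case True
  have "d \<le> d powr \<beta>"
    using powr_mono'[of \<beta> 1 d] assms True by simp
  hence "L * d \<le> L * d powr \<beta>" using assms by (intro mult_left_mono) auto
  also have "\<dots> \<le> (L + B) * d powr \<beta>" using assms by (intro mult_right_mono) auto
  finally show ?thesis using assms by linarith
next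
  case False
  have "1 \<le> d powr \<beta>" using False assms by (simp add: ge_one_powr_ge_zero)
  hence "(L + B) * 1 \<le> (L + B) * d powr \<beta>" using assms by (intro mult_left_mono) auto
  moreover have "a \<le> (L + B) * 1" using assms by simp
  ultimately show ?thesis by (rule order_trans[rotated])
qed

lemma tdom_subset: "t \<in> {0..1} \<Longrightarrow> tdom j t \<subseteq> {0..1}"
  by (auto simp: tdom_def)

lemma tdom_mem: "t \<in> {0..1} \<Longrightarrow> t \<in> tdom j t"
  by (auto simp: tdom_def)

lemma slab_tdom: "z \<in> slab \<Longrightarrow> UNIV \<times> tdom j (snd z) \<subseteq> slab"
  using tdom_subset[of "snd z" j] by (fastforce simp: slab_def)

lemma linear_gradmap: "bounded_linear (gradmap a b c)"
proof -
  have "bounded_linear (\<lambda>w::complex\<times>real. Re (fst w) *\<^sub>R a + Im (fst w) *\<^sub>R b + snd w *\<^sub>R c)"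
    by (intro bounded_linear_add bounded_linear_scaleR_const bounded_linear_compose[OF bounded_linear_Re]
        bounded_linear_compose[OF bounded_linear_Im] bounded_linear_fst bounded_linear_snd)
  thus ?thesis by (simp add: gradmap_def[abs_def])
qed

lemma norm_gradmap_xt_le:
  "norm (gradmap a b c (h, s)) \<le> (norm a + norm b) * norm h + norm c * \<bar>s\<bar>"
proof -
  have "norm (gradmap a b c (h, s)) \<le> \<bar>Re h\<bar> * norm a + \<bar>Im h\<bar> * norm b + \<bar>s\<bar> * norm c"
    unfolding gradmap_def fst_conv snd_conv by (intro norm_triangle_le add_mono) auto
  also have "\<dots> \<le> norm h * norm a + norm h * norm b + \<bar>s\<bar> * norm c"
    by (intro add_mono mult_right_mono abs_Re_le_cmod abs_Im_le_cmod) auto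
  finally show ?thesis by (simp add: algebra_simps)
qed

lemma has_gradD:
  "has_grad j V u u1 u2 ut \<Longrightarrow> z \<in> V \<Longrightarrow>
    (u has_derivative gradmap (u1 z) (u2 z) (ut z)) (at z within UNIV \<times> tdom j (snd z))"
  by (simp add: has_grad_def)

lemma has_grad_subset: "has_grad j V u u1 u2 ut \<Longrightarrow> W \<subseteq> V \<Longrightarrow> has_grad j W u u1 u2 ut"
  by (auto simp: has_grad_def)

lemma has_grad_mono:
  assumes "has_grad j V u u1 u2 ut" "j' \<le> j" "V \<subseteq> slab"
  shows "has_grad j' V u u1 u2 ut"
  unfolding has_grad_def
proof
  fix z assume "z \<in> V"
  hence "snd z \<in> {0..1}" using assms(3) by (auto simp: slab_def)
  hence "UNIV \<times> tdom j' (snd z) \<subseteq> UNIV \<times> tdom j (snd z)" using assms(2) by (auto simp: tdom_def)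
  thus "(u has_derivative gradmap (u1 z) (u2 z) (ut z)) (at z within UNIV \<times> tdom j' (snd z))"
    using has_gradD[OF assms(1) \<open>z \<in> V\<close>] has_derivative_subset by blast
qed

lemma openin_slab_ball:
  assumes "openin (top_of_set slab) V" "z \<in> V"
  obtains d where "d > 0" "\<And>w. w \<in> slab \<Longrightarrow> dist w z < d \<Longrightarrow> w \<in> V"
  using assms by (metis openin_euclidean_subtopology_iff)

text \<open>Near a point of V all points of the slab lie in V, so values off V do not enter. For j =
  0 the third component is free, because increments within one slice have zero time
  component.\<close>

lemma has_grad_cong:
  assumes "has_grad j V u u1 u2 ut" "openin (top_of_set slab) V"
    "\<And>z. z \<in> V \<Longrightarrow> v z = u z" "\<And>z. z \<in> V \<Longrightarrow> v1 z = u1 z" "\<And>z. z \<in> V \<Longrightarrow> v2 z = u2 z"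
    "\<And>z. z \<in> V \<Longrightarrow> 0 < j \<Longrightarrow> vt z = ut z"
  shows "has_grad j V v v1 v2 vt"
  unfolding has_grad_def
proof
  fix z assume z: "z \<in> V"
  have zs: "z \<in> slab" using assms(2) z openin_subset by fastforce
  obtain d where d: "d > 0" "\<And>w. w \<in> slab \<Longrightarrow> dist w z < d \<Longrightarrow> w \<in> V"
    using openin_slab_ball[OF assms(2) z] by blast
  have g: "(u has_derivative gradmap (v1 z) (v2 z) (vt z)) (at z within UNIV \<times> tdom j (snd z))"
  proof (cases "j = 0")
    case False
    thus ?thesis using has_gradD[OF assms(1) z] assms(4-6)[OF z] by simp
  next
    case True
    have h: "(u has_derivative gradmap (u1 z) (u2 z) (ut z)) (at z within UNIV \<times> {snd z})"
      using has_gradD[OF assms(1) z] True by (simp add: tdom_def)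
    have "(u has_derivative gradmap (u1 z) (u2 z) (vt z)) (at z within UNIV \<times> {snd z})"
      unfolding has_derivative_within_alt
    proof (intro conjI linear_gradmap allI impI)
      fix e :: real assume "0 < e"
      then obtain d where "0 < d" "\<forall>y\<in>UNIV \<times> {snd z}. norm (y - z) < d \<longrightarrow> norm (u y - u z - gradmap (u1 z) (u2 z) (ut z) (y - z)) \<le> e * norm (y - z)"
        using h unfolding has_derivative_within_alt by blast
      thus "\<exists>d>0. \<forall>y\<in>UNIV \<times> {snd z}. norm (y - z) < d \<longrightarrow> norm (u y - u z - gradmap (u1 z) (u2 z) (vt z) (y - z)) \<le> e * norm (y - z)"
        by (intro exI[of _ d]) (auto simp: gradmap_def)
    qed
    thus ?thesis using True assms(4,5)[OF z] by (simp add: tdom_def)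
  qed
  show "(v has_derivative gradmap (v1 z) (v2 z) (vt z)) (at z within UNIV \<times> tdom j (snd z))"
  proof (rule has_derivative_transform_within[OF g d(1)])
    show "z \<in> UNIV \<times> tdom j (snd z)" using zs by (auto simp: slab_def mem_Times_iff tdom_mem)
    show "u w = v w" if "w \<in> UNIV \<times> tdom j (snd z)" "dist w z < d" for w
      using assms(3)[OF d(2)[OF subsetD[OF slab_tdom[OF zs] that(1)] that(2)]] by simp
  qed
qed

lemma has_grad_add:
  assumes "has_grad j V u u1 u2 ut" "has_grad j V v v1 v2 vt"
  shows "has_grad j V (\<lambda>z. u z + v z) (\<lambda>z. u1 z + v1 z) (\<lambda>z. u2 z + v2 z) (\<lambda>z. ut z + vt z)"
  (is "has_grad j V ?u ?u1 ?u2 ?ut")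
  unfolding has_grad_def
proof
  fix z assume z: "z \<in> V"
  show "(?u has_derivative gradmap (?u1 z) (?u2 z) (?ut z)) (at z within UNIV \<times> tdom j (snd z))"
    by (rule has_derivative_eq_rhs[OF has_derivative_add[OF has_gradD[OF assms(1) z] has_gradD[OF assms(2) z]]])
       (simp add: gradmap_def algebra_simps fun_eq_iff)
qed

lemma has_grad_scaleR:
  assumes "has_grad j V a a1 a2 at'" "has_grad j V v v1 v2 vt"
  shows "has_grad j V (\<lambda>z. a z *\<^sub>R v z) (\<lambda>z. a z *\<^sub>R v1 z + a1 z *\<^sub>R v z)
     (\<lambda>z. a z *\<^sub>R v2 z + a2 z *\<^sub>R v z) (\<lambda>z. a z *\<^sub>R vt z + at' z *\<^sub>R v z)"
  (is "has_grad j V ?u ?u1 ?u2 ?ut")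
  unfolding has_grad_def
proof
  fix z assume z: "z \<in> V"
  show "(?u has_derivative gradmap (?u1 z) (?u2 z) (?ut z)) (at z within UNIV \<times> tdom j (snd z))"
    by (rule has_derivative_eq_rhs[OF has_derivative_scaleR[OF has_gradD[OF assms(1) z] has_gradD[OF assms(2) z]]])
       (simp add: gradmap_def algebra_simps fun_eq_iff)
qed

lemma has_grad_bounded_linear:
  assumes "bounded_linear L" "has_grad j V v v1 v2 vt"
  shows "has_grad j V (\<lambda>z. L (v z)) (\<lambda>z. L (v1 z)) (\<lambda>z. L (v2 z)) (\<lambda>z. L (vt z))"
  unfolding has_grad_def
proof
  fix z assume z: "z \<in> V"
  interpret L: bounded_linear L by fact
  show "((\<lambda>z. L (v z)) has_derivative gradmap (L (v1 z)) (L (v2 z)) (L (vt z))) (at z within UNIV \<times> tdom j (snd z))"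
    by (rule has_derivative_eq_rhs[OF L.has_derivative[OF has_gradD[OF assms(2) z]]])
       (simp add: gradmap_def L.add L.scaleR fun_eq_iff)
qed

lemma has_grad_compose_real:
  assumes "\<And>x. (b has_real_derivative b' x) (at x)" "has_grad j V u u1 u2 ut"
  shows "has_grad j V (\<lambda>z. b (u z)) (\<lambda>z. b' (u z) *\<^sub>R u1 z) (\<lambda>z. b' (u z) *\<^sub>R u2 z) (\<lambda>z. b' (u z) *\<^sub>R ut z)"
  unfolding has_grad_def
proof
  fix z assume z: "z \<in> V"
  have b: "(b has_derivative (\<lambda>h. h * b' (u z))) (at (u z))"
    using assms(1)[of "u z"] by (simp add: has_field_derivative_def mult_commute_abs)
  show "((\<lambda>z. b (u z)) has_derivative gradmap (b' (u z) *\<^sub>R u1 z) (b' (u z) *\<^sub>R u2 z) (b' (u z) *\<^sub>R ut z)) (at z within UNIV \<times> tdom j (snd z))"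
    by (rule has_derivative_eq_rhs[OF has_derivative_compose[OF has_gradD[OF assms(2) z] b]])
       (simp add: gradmap_def algebra_simps fun_eq_iff)
qed

lemma has_grad_const: "has_grad j V (\<lambda>z. c) (\<lambda>z. 0) (\<lambda>z. 0) (\<lambda>z. 0)"
  by (simp add: has_grad_def gradmap_def[abs_def])

subsection \<open>Directional derivatives\<close>

lemma has_grad_dir:
  assumes "has_grad j V u u1 u2 ut" "(x, t) \<in> V" "t \<in> {0..1}"
  shows "((\<lambda>s. u (x + s *\<^sub>R e, t)) has_vector_derivative (Re e *\<^sub>R u1 (x, t) + Im e *\<^sub>R u2 (x, t))) (at 0)"
proof -
  have 1: "((\<lambda>s::real. (x + s *\<^sub>R e, t)) has_derivative (\<lambda>s. (s *\<^sub>R e, 0))) (at 0)"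
    by (auto intro!: derivative_eq_intros)
  have 2: "(u has_derivative gradmap (u1 (x,t)) (u2 (x,t)) (ut (x,t))) (at ((\<lambda>s::real. (x + s *\<^sub>R e, t)) 0) within UNIV \<times> tdom j t)"
    using has_gradD[OF assms(1,2)] by simp
  have 3: "(u has_derivative gradmap (u1 (x,t)) (u2 (x,t)) (ut (x,t))) (at ((\<lambda>s::real. (x + s *\<^sub>R e, t)) 0) within ((\<lambda>s::real. (x + s *\<^sub>R e, t)) ` UNIV))"
    by (rule has_derivative_subset[OF 2]) (use assms(3) tdom_mem in auto)
  show ?thesis unfolding has_vector_derivative_def
    by (rule has_derivative_eq_rhs[OF diff_chain_within[unfolded o_def, OF 1 3]]) (auto simp: gradmap_def algebra_simps fun_eq_iff)
qed

lemma has_grad_dir_at: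
  assumes "has_grad j V u u1 u2 ut" "(x + s0 *\<^sub>R e, t) \<in> V" "t \<in> {0..1}"
  shows "((\<lambda>s. u (x + s *\<^sub>R e, t)) has_vector_derivative
     (Re e *\<^sub>R u1 (x + s0 *\<^sub>R e, t) + Im e *\<^sub>R u2 (x + s0 *\<^sub>R e, t))) (at s0)"
proof -
  have 1: "((\<lambda>s. u (x + s0 *\<^sub>R e + s *\<^sub>R e, t)) has_derivative (\<lambda>h. h *\<^sub>R (Re e *\<^sub>R u1 (x + s0 *\<^sub>R e, t) + Im e *\<^sub>R u2 (x + s0 *\<^sub>R e, t)))) (at (s0 - s0))"
    using has_grad_dir[OF assms] by (simp add: has_vector_derivative_def)
  have 2: "((\<lambda>s. s - s0) has_derivative (\<lambda>h. h)) (at s0)"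
    by (auto intro!: derivative_eq_intros)
  show ?thesis
    using has_derivative_compose[OF 2 1] by (simp add: has_vector_derivative_def algebra_simps)
qed

lemma has_grad_time:
  assumes "has_grad j V u u1 u2 ut" "(x, t) \<in> V" "t \<in> {0..1}" "0 < j"
  shows "((\<lambda>s. u (x, s)) has_vector_derivative ut (x, t)) (at t within {0..1})"
proof -
  have 1: "((\<lambda>s::real. (x, s)) has_derivative (\<lambda>s. (0, s))) (at t within {0..1})"
    by (auto intro!: derivative_eq_intros)
  have 2: "(u has_derivative gradmap (u1 (x,t)) (u2 (x,t)) (ut (x,t))) (at (x, t) within UNIV \<times> {0..1})"
    using has_gradD[OF assms(1,2)] assms(4) by (simp add: tdom_def)
  have 3: "(u has_derivative gradmap (u1 (x,t)) (u2 (x,t)) (ut (x,t))) (at (x, t) within (\<lambda>s::real. (x, s)) ` {0..1})"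
    by (rule has_derivative_subset[OF 2]) auto
  show ?thesis unfolding has_vector_derivative_def
    by (rule has_derivative_eq_rhs[OF diff_chain_within[unfolded o_def, OF 1 3]]) (auto simp: gradmap_def algebra_simps fun_eq_iff)
qed

lemma has_grad_ddir:
  assumes "has_grad j V u u1 u2 ut" "(x, t) \<in> V" "t \<in> {0..1}"
  shows "ddir e (\<lambda>x. u (x, t)) x = Re e *\<^sub>R u1 (x, t) + Im e *\<^sub>R u2 (x, t)"
  unfolding ddir_def using has_grad_dir[OF assms] by (rule vector_derivative_at)

lemma has_grad_dt:
  assumes "has_grad j V u u1 u2 ut" "(x, t) \<in> V" "t \<in> {0..1}" "0 < j"
  shows "dt (\<lambda>t x. u (x, t)) t x = ut (x, t)"
  unfolding dt_def
  using assms(3) by (intro vector_derivative_within has_grad_time[OF assms]) (simp add: trivial_limit_within)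

lemma has_grad_unique:
  assumes "has_grad j V u u1 u2 ut" "has_grad j V u v1 v2 vt" "z \<in> V" "V \<subseteq> slab"
  shows "u1 z = v1 z" "u2 z = v2 z" "0 < j \<Longrightarrow> ut z = vt z"
proof -
  obtain x t where z: "z = (x, t)" by force
  have t: "t \<in> {0..1}" "(x, t) \<in> V" using assms z by (auto simp: slab_def)
  show "u1 z = v1 z"
    using has_grad_ddir[OF assms(1) t(2,1), of 1] has_grad_ddir[OF assms(2) t(2,1), of 1] z by simp
  show "u2 z = v2 z"
    using has_grad_ddir[OF assms(1) t(2,1), of \<i>] has_grad_ddir[OF assms(2) t(2,1), of \<i>] z by simp
  show "ut z = vt z" if "0 < j"
    using has_grad_dt[OF assms(1) t(2,1) that] has_grad_dt[OF assms(2) t(2,1) that] z by simp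
qed

lemma has_grad_zero:
  assumes "has_grad j V u u1 u2 ut" "openin (top_of_set slab) W" "W \<subseteq> V" "\<And>z. z \<in> W \<Longrightarrow> u z = 0" "z \<in> W"
  shows "u1 z = 0" "u2 z = 0" "0 < j \<Longrightarrow> ut z = 0"
proof -
  have "has_grad j W (\<lambda>z. 0) u1 u2 ut"
    by (rule has_grad_cong[OF has_grad_subset[OF assms(1,3)] assms(2)]) (use assms(4) in auto)
  from has_grad_unique[OF this has_grad_const assms(5)] openin_subset[OF assms(2)]
  show "u1 z = 0" "u2 z = 0" "0 < j \<Longrightarrow> ut z = 0" by auto
qed

lemma vector_derivative_bound:
  fixes f :: "real \<Rightarrow> 'b::real_normed_vector"
  assumes "\<And>s. s \<in> closed_segment a b \<Longrightarrow> (f has_vector_derivative f' s) (at s)"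
    and "\<And>s. s \<in> closed_segment a b \<Longrightarrow> norm (f' s) \<le> B"
  shows "norm (f b - f a) \<le> B * \<bar>b - a\<bar>"
proof -
  have "norm (f b - f a) \<le> B * norm (b - a)"
  proof (rule differentiable_bound[where S = "closed_segment a b" and f' = "\<lambda>s h. h *\<^sub>R f' s"])
    show "(f has_derivative (\<lambda>h. h *\<^sub>R f' s)) (at s within closed_segment a b)" if "s \<in> closed_segment a b" for s
      using assms(1)[OF that] by (auto simp: has_vector_derivative_def intro: has_derivative_at_withinI)
    show "onorm (\<lambda>h. h *\<^sub>R f' s) \<le> B" if "s \<in> closed_segment a b" for s
      using assms(2)[OF that] by (intro onorm_le) (simp add: mult.commute[of B] mult_left_mono)
  qed auto
  thus ?thesis by simp
qed

text \<open>The increment is split into a step along i and a step along 1, both taken at the new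
  time s, and a step in t at the fixed point x. The first two are mean value estimates that use the
  continuity of \<open>u1\<close> and \<open>u2\<close>; the last is the definition of the
  derivative in t at z itself.\<close>

lemma has_grad_partials:
  assumes V: "openin (top_of_set slab) V"
    and c1: "continuous_on V u1" and c2: "continuous_on V u2"
    and d1: "\<And>x t. (x, t) \<in> V \<Longrightarrow> ((\<lambda>s. u (x + s *\<^sub>R 1, t)) has_vector_derivative u1 (x, t)) (at 0)"
    and d2: "\<And>x t. (x, t) \<in> V \<Longrightarrow> ((\<lambda>s. u (x + s *\<^sub>R \<i>, t)) has_vector_derivative u2 (x, t)) (at 0)"
    and d3: "\<And>x t. (x, t) \<in> V \<Longrightarrow> 0 < j \<Longrightarrow> ((\<lambda>s. u (x, s)) has_vector_derivative ut (x, t)) (at t within {0..1})"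
  shows "has_grad j V u u1 u2 ut"
  unfolding has_grad_def
proof
  fix z assume z: "z \<in> V"
  obtain x t where zx: "z = (x, t)" by force
  have zs: "z \<in> slab" using openin_subset[OF V] z by auto
  hence t: "t \<in> {0..1}" using zx by (auto simp: slab_def)
  have shift: "((\<lambda>s. u (p + s *\<^sub>R e, \<tau>)) has_vector_derivative D) (at s0)"
    if "((\<lambda>s. u ((p + s0 *\<^sub>R e) + s *\<^sub>R e, \<tau>)) has_vector_derivative D) (at 0)" for p e \<tau> D s0
  proof -
    have 1: "((\<lambda>s. u (p + s0 *\<^sub>R e + s *\<^sub>R e, \<tau>)) has_derivative (\<lambda>h. h *\<^sub>R D)) (at (s0 - s0))"
      using that by (simp add: has_vector_derivative_def)
    have 2: "((\<lambda>s. s - s0) has_derivative (\<lambda>h. h)) (at s0)"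
      by (auto intro!: derivative_eq_intros)
    show ?thesis
      using has_derivative_compose[OF 2 1] by (simp add: has_vector_derivative_def algebra_simps)
  qed
  show "(u has_derivative gradmap (u1 z) (u2 z) (ut z)) (at z within UNIV \<times> tdom j (snd z))"
    unfolding has_derivative_within_alt
  proof (intro conjI linear_gradmap allI impI)
    fix e :: real assume e: "0 < e"
    obtain d0 where d0: "d0 > 0" "\<And>w. w \<in> slab \<Longrightarrow> dist w z < d0 \<Longrightarrow> w \<in> V"
      using openin_slab_ball[OF V z] by blast
    obtain e1 where e1: "e1 > 0" "\<And>w. w \<in> V \<Longrightarrow> dist w z < e1 \<Longrightarrow> dist (u1 w) (u1 z) < e/3"
      using c1[unfolded continuous_on_iff, rule_format, OF z, of "e/3"] e by auto
    obtain e2 where e2: "e2 > 0" "\<And>w. w \<in> V \<Longrightarrow> dist w z < e2 \<Longrightarrow> dist (u2 w) (u2 z) < e/3"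
      using c2[unfolded continuous_on_iff, rule_format, OF z, of "e/3"] e by auto
    have "\<exists>e3>0. \<forall>s\<in>tdom j t. \<bar>s - t\<bar> < e3 \<longrightarrow> norm (u (x, s) - u (x, t) - (s - t) *\<^sub>R ut z) \<le> e/3 * \<bar>s - t\<bar>"
    proof (cases "j = 0")
      case True
      thus ?thesis by (intro exI[of _ 1]) (auto simp: tdom_def)
    next
      case False
      have "((\<lambda>s. u (x, s)) has_derivative (\<lambda>h. h *\<^sub>R ut z)) (at t within {0..1})"
        using d3[of x t] z zx False by (simp add: has_vector_derivative_def)
      hence "\<exists>d>0. \<forall>y\<in>{0..1}. norm (y - t) < d \<longrightarrow> norm (u (x, y) - u (x, t) - (y - t) *\<^sub>R ut z) \<le> e/3 * norm (y - t)"
        unfolding has_derivative_within_alt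
        by (elim conjE allE[of _ "e/3"]) (use e in simp)
      thus ?thesis using False by (simp add: tdom_def)
    qed
    then obtain e3 where e3: "e3 > 0" "\<And>s. s \<in> tdom j t \<Longrightarrow> \<bar>s - t\<bar> < e3 \<Longrightarrow> norm (u (x, s) - u (x, t) - (s - t) *\<^sub>R ut z) \<le> e/3 * \<bar>s - t\<bar>"
      by blast
    define d where "d = min (min d0 e1) (min e2 e3)"
    have dpos: "d > 0" using d0 e1 e2 e3 by (simp add: d_def)
    show "\<exists>d>0. \<forall>y\<in>UNIV \<times> tdom j (snd z). norm (y - z) < d \<longrightarrow> norm (u y - u z - gradmap (u1 z) (u2 z) (ut z) (y - z)) \<le> e * norm (y - z)"
    proof (intro exI[of _ d] conjI dpos ballI impI)
      fix y assume y: "y \<in> UNIV \<times> tdom j (snd z)" and yd: "norm (y - z) < d"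
      obtain x' s where yx: "y = (x', s)" by force
      have s: "s \<in> tdom j t" "s \<in> {0..1}" using y yx zx subsetD[OF tdom_subset[OF t]] by auto
      have N: "norm (y - z) = sqrt ((norm (x' - x))\<^sup>2 + (s - t)\<^sup>2)" by (simp add: yx zx norm_prod_def)
      define h where "h = x' - x"
      \<comment> \<open>Shrinking the coordinates of h does not increase the distance to z, so the
        intermediate points of the three steps stay in V and in the range of \<open>e1\<close> and
        \<open>e2\<close>.\<close>
      have mem: "(x + a *\<^sub>R 1 + b *\<^sub>R \<i>, s) \<in> V \<and> dist (x + a *\<^sub>R 1 + b *\<^sub>R \<i>, s) z < d" if "\<bar>a\<bar> \<le> \<bar>Re h\<bar>" "\<bar>b\<bar> \<le> \<bar>Im h\<bar>" for a b
      proof -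
        have "norm (a *\<^sub>R 1 + b *\<^sub>R \<i>) \<le> norm h"
          unfolding cmod_def using that by (intro real_sqrt_le_mono add_mono) (simp_all add: abs_le_square_iff)
        hence "(norm (a *\<^sub>R 1 + b *\<^sub>R \<i>))\<^sup>2 \<le> (norm h)\<^sup>2" by (simp add: power_mono)
        hence "sqrt ((dist (x + a *\<^sub>R 1 + b *\<^sub>R \<i>) x)\<^sup>2 + (dist s t)\<^sup>2) \<le> sqrt ((norm h)\<^sup>2 + (s - t)\<^sup>2)"
          by (intro real_sqrt_le_mono add_mono) (simp_all add: dist_norm add.assoc)
        hence "dist (x + a *\<^sub>R 1 + b *\<^sub>R \<i>, s) z \<le> norm (y - z)"
          by (simp only: zx dist_Pair_Pair) (simp only: N h_def zx[symmetric])
        hence "dist (x + a *\<^sub>R 1 + b *\<^sub>R \<i>, s) z < d" using yd by simp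
        thus ?thesis using d0(2)[of "(x + a *\<^sub>R 1 + b *\<^sub>R \<i>, s)"] s d_def by (auto simp: slab_def)
      qed
      have seg: "c \<in> closed_segment 0 b \<Longrightarrow> \<bar>c\<bar> \<le> \<bar>b\<bar>" for b c :: real
        by (auto simp: closed_segment_eq_real_ivl split: if_splits)
      define p1 where "p1 = x + Re h *\<^sub>R 1"
      have xh: "x' = p1 + Im h *\<^sub>R \<i>" by (simp add: p1_def h_def complex_eq_iff)
      have A: "norm ((u (p1 + Im h *\<^sub>R \<i>, s) - Im h *\<^sub>R u2 z) - (u (p1 + 0 *\<^sub>R \<i>, s) - 0 *\<^sub>R u2 z)) \<le> e/3 * \<bar>Im h - 0\<bar>"
      proof (rule vector_derivative_bound[where f = "\<lambda>c. u (p1 + c *\<^sub>R \<i>, s) - c *\<^sub>R u2 z" and f' = "\<lambda>c. u2 (p1 + c *\<^sub>R \<i>, s) - u2 z"])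
        fix c assume "c \<in> closed_segment 0 (Im h)"
        hence m: "(p1 + c *\<^sub>R \<i>, s) \<in> V" "dist (p1 + c *\<^sub>R \<i>, s) z < d"
          using mem[of "Re h" c] seg by (auto simp: p1_def)
        show "((\<lambda>c. u (p1 + c *\<^sub>R \<i>, s) - c *\<^sub>R u2 z) has_vector_derivative u2 (p1 + c *\<^sub>R \<i>, s) - u2 z) (at c)"
          by (rule has_vector_derivative_diff[OF shift[OF d2[OF m(1)]]])
             (auto intro!: derivative_eq_intros simp: has_vector_derivative_def)
        show "norm (u2 (p1 + c *\<^sub>R \<i>, s) - u2 z) \<le> e/3"
          using e2(2)[OF m(1)] m(2) by (auto simp: d_def dist_norm)
      qed
      have B: "norm ((u (x + Re h *\<^sub>R 1, s) - Re h *\<^sub>R u1 z) - (u (x + 0 *\<^sub>R 1, s) - 0 *\<^sub>R u1 z)) \<le> e/3 * \<bar>Re h - 0\<bar>"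
      proof (rule vector_derivative_bound[where f = "\<lambda>c. u (x + c *\<^sub>R 1, s) - c *\<^sub>R u1 z" and f' = "\<lambda>c. u1 (x + c *\<^sub>R 1, s) - u1 z"])
        fix c assume "c \<in> closed_segment 0 (Re h)"
        hence m: "(x + c *\<^sub>R 1, s) \<in> V" "dist (x + c *\<^sub>R 1, s) z < d"
          using mem[of c 0] seg by auto
        show "((\<lambda>c. u (x + c *\<^sub>R 1, s) - c *\<^sub>R u1 z) has_vector_derivative u1 (x + c *\<^sub>R 1, s) - u1 z) (at c)"
          by (rule has_vector_derivative_diff[OF shift[OF d1[OF m(1)]]])
             (auto intro!: derivative_eq_intros simp: has_vector_derivative_def)
        show "norm (u1 (x + c *\<^sub>R 1, s) - u1 z) \<le> e/3"
          using e1(2)[OF m(1)] m(2) by (auto simp: d_def dist_norm)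
      qed
      have st: "\<bar>s - t\<bar> \<le> norm (y - z)" "norm h \<le> norm (y - z)"
        unfolding N h_def by (simp_all add: real_le_rsqrt)
      have C: "norm (u (x, s) - u (x, t) - (s - t) *\<^sub>R ut z) \<le> e/3 * \<bar>s - t\<bar>"
        using e3(2)[OF s(1)] st yd by (auto simp: d_def)
      have "u y - u z - gradmap (u1 z) (u2 z) (ut z) (y - z) =
         ((u (p1 + Im h *\<^sub>R \<i>, s) - Im h *\<^sub>R u2 z) - (u (p1 + 0 *\<^sub>R \<i>, s) - 0 *\<^sub>R u2 z))
        + ((u (x + Re h *\<^sub>R 1, s) - Re h *\<^sub>R u1 z) - (u (x + 0 *\<^sub>R 1, s) - 0 *\<^sub>R u1 z))
        + (u (x, s) - u (x, t) - (s - t) *\<^sub>R ut z)"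
        unfolding gradmap_def yx zx fst_diff snd_diff fst_conv snd_conv xh[symmetric] h_def[symmetric] by (simp add: p1_def algebra_simps)
      also have "norm \<dots> \<le> e/3 * \<bar>Im h - 0\<bar> + e/3 * \<bar>Re h - 0\<bar> + e/3 * \<bar>s - t\<bar>"
        using A B C by (intro norm_triangle_le add_mono) auto
      also have "\<dots> \<le> e/3 * norm (y - z) + e/3 * norm (y - z) + e/3 * norm (y - z)"
        using st e abs_Re_le_cmod[of h] abs_Im_le_cmod[of h] by (intro add_mono mult_left_mono) auto
      finally show "norm (u y - u z - gradmap (u1 z) (u2 z) (ut z) (y - z)) \<le> e * norm (y - z)" by simp
    qed
  qed
qed

section \<open>Hoelder continuous functions and calculus in the classes \<open>hreg\<close>\<close>

lemma hcontI:
  assumes "continuous_on S u" "\<And>z. z \<in> S \<Longrightarrow> norm (u z) \<le> B"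
    "\<And>t x y. (x, t) \<in> S \<Longrightarrow> (y, t) \<in> S \<Longrightarrow> norm (u (x, t) - u (y, t)) \<le> H * dist x y powr \<alpha>"
  shows "hcont \<alpha> S u"
  using assms unfolding hcont_def by blast

lemma hcontE:
  assumes "hcont \<alpha> S u"
  obtains B H where "continuous_on S u" "0 \<le> B" "0 \<le> H" "\<And>z. z \<in> S \<Longrightarrow> norm (u z) \<le> B"
    "\<And>t x y. (x, t) \<in> S \<Longrightarrow> (y, t) \<in> S \<Longrightarrow> norm (u (x, t) - u (y, t)) \<le> H * dist x y powr \<alpha>"
proof -
  obtain B H where *: "continuous_on S u" "\<And>z. z \<in> S \<Longrightarrow> norm (u z) \<le> B"
    "\<And>t x y. (x, t) \<in> S \<Longrightarrow> (y, t) \<in> S \<Longrightarrow> norm (u (x, t) - u (y, t)) \<le> H * dist x y powr \<alpha>"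
    using assms unfolding hcont_def by blast
  show ?thesis
  proof (rule that[of "max 0 B" "max 0 H"])
    show "norm (u z) \<le> max 0 B" if "z \<in> S" for z using *(2)[OF that] by simp
    show "norm (u (x, t) - u (y, t)) \<le> max 0 H * dist x y powr \<alpha>" if "(x, t) \<in> S" "(y, t) \<in> S" for x y t
    proof -
      have "H * dist x y powr \<alpha> \<le> max 0 H * dist x y powr \<alpha>" by (intro mult_right_mono) auto
      thus ?thesis using *(3)[OF that] by linarith
    qed
  qed (use * in auto)
qed

lemma hcont_imp_continuous_on: "hcont \<alpha> S u \<Longrightarrow> continuous_on S u"
  by (simp add: hcont_def)

lemma hcont_subset: "hcont \<alpha> S u \<Longrightarrow> T \<subseteq> S \<Longrightarrow> hcont \<alpha> T u"
  unfolding hcont_def by (meson continuous_on_subset subsetD)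

lemma hcont_cong:
  assumes "hcont \<alpha> S u" "\<And>z. z \<in> S \<Longrightarrow> v z = u z"
  shows "hcont \<alpha> S v"
proof -
  obtain B H where *: "continuous_on S u" "\<And>z. z \<in> S \<Longrightarrow> norm (u z) \<le> B"
    "\<And>t x y. (x, t) \<in> S \<Longrightarrow> (y, t) \<in> S \<Longrightarrow> norm (u (x, t) - u (y, t)) \<le> H * dist x y powr \<alpha>"
    using assms(1) by (rule hcontE) blast
  show ?thesis
  proof (rule hcontI)
    show "continuous_on S v" using *(1) assms(2) by (simp cong: continuous_on_cong)
    show "norm (v z) \<le> B" if "z \<in> S" for z using *(2) assms(2) that by simp
    show "norm (v (x, t) - v (y, t)) \<le> H * dist x y powr \<alpha>" if "(x, t) \<in> S" "(y, t) \<in> S" for x y t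
      using *(3)[OF that] assms(2) that by simp
  qed
qed

lemma hcont_const: "hcont \<alpha> S (\<lambda>z. c)"
  by (rule hcontI[of _ _ "norm c" 0]) auto

lemma hcont_add:
  assumes "hcont \<alpha> S u" "hcont \<alpha> S v"
  shows "hcont \<alpha> S (\<lambda>z. u z + v z)"
proof -
  obtain B H where u: "continuous_on S u" "\<And>z. z \<in> S \<Longrightarrow> norm (u z) \<le> B"
    "\<And>t x y. (x, t) \<in> S \<Longrightarrow> (y, t) \<in> S \<Longrightarrow> norm (u (x, t) - u (y, t)) \<le> H * dist x y powr \<alpha>"
    using assms(1) by (rule hcontE) blast
  obtain C I where v: "continuous_on S v" "\<And>z. z \<in> S \<Longrightarrow> norm (v z) \<le> C"
    "\<And>t x y. (x, t) \<in> S \<Longrightarrow> (y, t) \<in> S \<Longrightarrow> norm (v (x, t) - v (y, t)) \<le> I * dist x y powr \<alpha>"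
    using assms(2) by (rule hcontE) blast
  show ?thesis
  proof (rule hcontI)
    show "continuous_on S (\<lambda>z. u z + v z)" using u v by (intro continuous_intros)
    show "norm (u z + v z) \<le> B + C" if "z \<in> S" for z using u(2)[OF that] v(2)[OF that] by norm
    show "norm (u (x, t) + v (x, t) - (u (y, t) + v (y, t))) \<le> (H + I) * dist x y powr \<alpha>"
      if "(x, t) \<in> S" "(y, t) \<in> S" for x y t
      unfolding add_diff_add distrib_right by (rule norm_triangle_mono[OF u(3)[OF that] v(3)[OF that]])
  qed
qed

lemma hcont_bounded_linear:
  assumes "bounded_linear L" "hcont \<alpha> S u"
  shows "hcont \<alpha> S (\<lambda>z. L (u z))"
proof -
  interpret L: bounded_linear L by fact
  obtain K where K: "K > 0" "\<And>x. norm (L x) \<le> norm x * K" using L.pos_bounded by blast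
  obtain B H where u: "continuous_on S u" "\<And>z. z \<in> S \<Longrightarrow> norm (u z) \<le> B"
    "\<And>t x y. (x, t) \<in> S \<Longrightarrow> (y, t) \<in> S \<Longrightarrow> norm (u (x, t) - u (y, t)) \<le> H * dist x y powr \<alpha>"
    using assms(2) by (rule hcontE) blast
  show ?thesis
  proof (rule hcontI)
    show "continuous_on S (\<lambda>z. L (u z))" using u(1) by (rule L.continuous_on)
    show "norm (L (u z)) \<le> B * K" if "z \<in> S" for z
      using K(2)[of "u z"] mult_right_mono[OF u(2)[OF that], of K] K(1) by linarith
    show "norm (L (u (x, t)) - L (u (y, t))) \<le> (H * K) * dist x y powr \<alpha>"
      if "(x, t) \<in> S" "(y, t) \<in> S" for x y t
    proof -
      have "norm (L (u (x, t)) - L (u (y, t))) \<le> norm (u (x, t) - u (y, t)) * K"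
        using K(2)[of "u (x, t) - u (y, t)"] by (simp add: L.diff)
      also have "\<dots> \<le> (H * dist x y powr \<alpha>) * K" using u(3)[OF that] K(1) by (intro mult_right_mono) auto
      finally show ?thesis by (simp add: mult_ac)
    qed
  qed
qed

lemma hcont_scaleR:
  fixes a :: "complex \<times> real \<Rightarrow> real"
  assumes "hcont \<alpha> S a" "hcont \<alpha> S v"
  shows "hcont \<alpha> S (\<lambda>z. a z *\<^sub>R v z)"
proof -
  obtain B H where u: "continuous_on S a" "0 \<le> B" "0 \<le> H" "\<And>z. z \<in> S \<Longrightarrow> norm (a z) \<le> B"
    "\<And>t x y. (x, t) \<in> S \<Longrightarrow> (y, t) \<in> S \<Longrightarrow> norm (a (x, t) - a (y, t)) \<le> H * dist x y powr \<alpha>"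
    using assms(1) by (rule hcontE) blast
  obtain C I where v: "continuous_on S v" "0 \<le> C" "0 \<le> I" "\<And>z. z \<in> S \<Longrightarrow> norm (v z) \<le> C"
    "\<And>t x y. (x, t) \<in> S \<Longrightarrow> (y, t) \<in> S \<Longrightarrow> norm (v (x, t) - v (y, t)) \<le> I * dist x y powr \<alpha>"
    using assms(2) by (rule hcontE) blast
  show ?thesis
  proof (rule hcontI)
    show "continuous_on S (\<lambda>z. a z *\<^sub>R v z)" using u v by (intro continuous_intros)
    show "norm (a z *\<^sub>R v z) \<le> B * C" if "z \<in> S" for z
      using u(2) u(4)[OF that] v(4)[OF that] by (auto intro!: mult_mono)
    show "norm (a (x, t) *\<^sub>R v (x, t) - a (y, t) *\<^sub>R v (y, t)) \<le> (B * I + H * C) * dist x y powr \<alpha>"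
      if "(x, t) \<in> S" "(y, t) \<in> S" for x y t
    proof -
      have "a (x, t) *\<^sub>R v (x, t) - a (y, t) *\<^sub>R v (y, t) =
          a (x, t) *\<^sub>R (v (x, t) - v (y, t)) + (a (x, t) - a (y, t)) *\<^sub>R v (y, t)"
        by (simp add: algebra_simps)
      also have "norm \<dots> \<le> B * (I * dist x y powr \<alpha>) + (H * dist x y powr \<alpha>) * C"
        using u(2,3) v(2,3) u(4)[OF that(1)] v(4)[OF that(2)] u(5)[OF that] v(5)[OF that]
        by (intro norm_triangle_le add_mono) (auto intro!: mult_mono)
      finally show ?thesis by (simp add: algebra_simps)
    qed
  qed
qed

lemma hcont_compose_real:
  fixes u :: "complex \<times> real \<Rightarrow> real"
  assumes "hcont \<alpha> S u" and b: "\<And>x. (b has_real_derivative b' x) (at x)" and b': "continuous_on UNIV b'"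
  shows "hcont \<alpha> S (\<lambda>z. b (u z))"
proof -
  obtain B H where u: "continuous_on S u" "0 \<le> B" "0 \<le> H" "\<And>z. z \<in> S \<Longrightarrow> norm (u z) \<le> B"
    "\<And>t x y. (x, t) \<in> S \<Longrightarrow> (y, t) \<in> S \<Longrightarrow> norm (u (x, t) - u (y, t)) \<le> H * dist x y powr \<alpha>"
    using assms(1) by (rule hcontE) blast
  have cb: "continuous_on UNIV b"
    using b by (auto intro!: continuous_at_imp_continuous_on DERIV_isCont)
  have "bounded (b ` {-B..B})" "bounded (b' ` {-B..B})"
    by (auto intro!: compact_imp_bounded compact_continuous_image intro: continuous_on_subset[OF cb] continuous_on_subset[OF b'])
  then obtain C L where C: "\<And>x. x \<in> {-B..B} \<Longrightarrow> norm (b x) \<le> C" and L: "\<And>x. x \<in> {-B..B} \<Longrightarrow> norm (b' x) \<le> L"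
    unfolding bounded_iff by (meson imageI)
  have L0: "0 \<le> L" using L[of 0] u(2) norm_ge_zero[of "b' 0"] by simp
  have mem: "u z \<in> {-B..B}" if "z \<in> S" for z using u(4)[OF that] by (auto simp: abs_le_iff)
  have lip: "norm (b p - b q) \<le> L * norm (p - q)" if "p \<in> {-B..B}" "q \<in> {-B..B}" for p q
    by (rule field_differentiable_bound[where S = "{-B..B}" and f' = b'])
       (use b L that in \<open>auto intro: has_field_derivative_at_within\<close>)
  show ?thesis
  proof (rule hcontI)
    show "continuous_on S (\<lambda>z. b (u z))"
      by (rule continuous_on_compose2[OF cb u(1)]) auto
    show "norm (b (u z)) \<le> C" if "z \<in> S" for z using C mem[OF that] by blast
    show "norm (b (u (x, t)) - b (u (y, t))) \<le> (L * H) * dist x y powr \<alpha>" if "(x, t) \<in> S" "(y, t) \<in> S" for x y t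
      using lip[OF mem[OF that(1)] mem[OF that(2)]] mult_left_mono[OF u(5)[OF that] L0] by (simp add: mult_ac)
  qed
qed

text \<open>\<open>hreg\<close> asks for a Hoelder bound at every order, a Hoelder norm only at the
  top one. Below the top order the bound comes from the next derivatives by the mean value theorem
  on segments.\<close>

lemma hcont_of_grad:
  assumes g: "has_grad j S u u1 u2 ut" and S: "S \<subseteq> slab" "\<And>t. convex {x. (x, t) \<in> S}"
    and c: "continuous_on S u"
    and B: "\<And>z. z \<in> S \<Longrightarrow> norm (u z) \<le> B" "\<And>z. z \<in> S \<Longrightarrow> norm (u1 z) \<le> B1" "\<And>z. z \<in> S \<Longrightarrow> norm (u2 z) \<le> B2"
    and \<beta>: "0 < \<beta>" "\<beta> \<le> 1"
  shows "hcont \<beta> S u"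
proof (cases "S = {}")
  case True
  thus ?thesis by (auto simp: hcont_def)
next
  case False
  then obtain w where w: "w \<in> S" by blast
  have pos: "0 \<le> B" "0 \<le> B1" "0 \<le> B2" using B[OF w] norm_ge_zero order_trans by blast+
  show ?thesis
  proof (rule hcontI[OF c B(1)])
    fix x y t assume xy: "(x, t) \<in> S" "(y, t) \<in> S"
    have t: "t \<in> {0..1}" using xy S by (auto simp: slab_def)
    define e where "e = y - x"
    have m: "(x + s *\<^sub>R e, t) \<in> S" if "s \<in> closed_segment 0 1" for s :: real
    proof -
      have "(1 - s) *\<^sub>R x + s *\<^sub>R y \<in> {x. (x, t) \<in> S}"
        using that xy by (intro convexD[OF S(2)]) (auto simp: closed_segment_eq_real_ivl)
      thus ?thesis by (simp add: e_def algebra_simps)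
    qed
    have "norm (u (x + 1 *\<^sub>R e, t) - u (x + 0 *\<^sub>R e, t)) \<le> (norm e * B1 + norm e * B2) * \<bar>1 - 0\<bar>"
    proof (rule vector_derivative_bound[where f = "\<lambda>s. u (x + s *\<^sub>R e, t)"])
      fix s :: real assume s: "s \<in> closed_segment 0 1"
      show "((\<lambda>s. u (x + s *\<^sub>R e, t)) has_vector_derivative
        (Re e *\<^sub>R u1 (x + s *\<^sub>R e, t) + Im e *\<^sub>R u2 (x + s *\<^sub>R e, t))) (at s)"
        by (rule has_grad_dir_at[OF g m[OF s] t])
      show "norm (Re e *\<^sub>R u1 (x + s *\<^sub>R e, t) + Im e *\<^sub>R u2 (x + s *\<^sub>R e, t)) \<le> norm e * B1 + norm e * B2"
        using B(2)[OF m[OF s]] B(3)[OF m[OF s]] pos abs_Re_le_cmod[of e] abs_Im_le_cmod[of e]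
        by (intro norm_triangle_le add_mono) (auto intro!: mult_mono)
    qed
    hence l: "norm (u (x, t) - u (y, t)) \<le> (B1 + B2) * dist x y"
      by (simp add: e_def norm_minus_commute dist_norm algebra_simps)
    have "norm (u (x, t) - u (y, t)) \<le> 2 * B"
      using B(1)[OF xy(1)] B(1)[OF xy(2)] by norm
    from lipschitz_imp_hoelder[OF \<beta> l this] pos
    show "norm (u (x, t) - u (y, t)) \<le> (B1 + B2 + 2 * B) * dist x y powr \<beta>" by simp
  qed
qed

lemma hreg_Suc: "hreg \<alpha> (Suc n) j V S u \<longleftrightarrow> hcont \<alpha> S u \<and> (\<exists>u1 u2 ut. has_grad j V u u1 u2 ut \<and>
     hreg \<alpha> n j V S u1 \<and> hreg \<alpha> n j V S u2 \<and> (0 < j \<longrightarrow> hreg \<alpha> n (j - 1) V S ut))"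
  by (simp add: hreg.simps)

lemma hreg_0: "hreg \<alpha> 0 j V S u \<longleftrightarrow> hcont \<alpha> S u"
  by (simp add: hreg.simps)

lemma hreg_SucE:
  assumes "hreg \<alpha> (Suc n) j V S u"
  obtains u1 u2 ut where "hcont \<alpha> S u" "has_grad j V u u1 u2 ut" "hreg \<alpha> n j V S u1"
    "hreg \<alpha> n j V S u2" "0 < j \<longrightarrow> hreg \<alpha> n (j - 1) V S ut"
  using assms by (auto simp: hreg_Suc)

lemma hreg_SucI:
  assumes "hcont \<alpha> S u" "has_grad j V u u1 u2 ut" "hreg \<alpha> n j V S u1"
    "hreg \<alpha> n j V S u2" "0 < j \<Longrightarrow> hreg \<alpha> n (j - 1) V S ut"
  shows "hreg \<alpha> (Suc n) j V S u"
  using assms by (auto simp: hreg_Suc)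

lemma hreg_imp_hcont: "hreg \<alpha> n j V S u \<Longrightarrow> hcont \<alpha> S u"
  by (cases n) (auto simp: hreg_0 hreg_Suc)

lemma hreg_mono:
  assumes "hreg \<alpha> n j V S u" "n' \<le> n" "j' \<le> j" "V' \<subseteq> V" "S' \<subseteq> S" "V \<subseteq> slab"
  shows "hreg \<alpha> n' j' V' S' u"
  using assms
proof (induction n' arbitrary: n j j' u)
  case 0
  thus ?case using hcont_subset hreg_imp_hcont by (metis hreg_0)
next
  case (Suc n')
  then obtain m where m: "n = Suc m" "n' \<le> m" by (metis Suc_le_D Suc_le_mono)
  obtain u1 u2 ut where *: "hcont \<alpha> S u" "has_grad j V u u1 u2 ut" "hreg \<alpha> m j V S u1"
    "hreg \<alpha> m j V S u2" "0 < j \<longrightarrow> hreg \<alpha> m (j - 1) V S ut"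
    using Suc.prems(1) unfolding m(1) by (rule hreg_SucE)
  show ?case
  proof (rule hreg_SucI)
    show "hcont \<alpha> S' u" by (rule hcont_subset[OF *(1) Suc.prems(5)])
    show "has_grad j' V' u u1 u2 ut"
      by (rule has_grad_subset[OF has_grad_mono[OF *(2) Suc.prems(3,6)] Suc.prems(4)])
    show "hreg \<alpha> n' j' V' S' u1" "hreg \<alpha> n' j' V' S' u2"
      using Suc.IH[OF *(3) m(2)] Suc.IH[OF *(4) m(2)] Suc.prems by auto
    show "hreg \<alpha> n' (j' - 1) V' S' ut" if "0 < j'"
      by (rule Suc.IH[OF *(5)[rule_format] m(2)]) (use that Suc.prems in auto)
  qed
qed

lemma hreg_down: "hreg \<alpha> (Suc n) j V S u \<Longrightarrow> V \<subseteq> slab \<Longrightarrow> hreg \<alpha> n j V S u"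
  by (rule hreg_mono[where V=V and S=S and j=j and n="Suc n"]) auto

lemma hreg_down': "hreg \<alpha> (Suc n) j V S u \<Longrightarrow> V \<subseteq> slab \<Longrightarrow> hreg \<alpha> n (j - 1) V S u"
  by (rule hreg_mono[where V=V and S=S and j=j and n="Suc n"]) auto

lemma hreg_cong:
  assumes "hreg \<alpha> n j V S u" "\<And>z. z \<in> S \<Longrightarrow> v z = u z" "openin (top_of_set slab) V" "V \<subseteq> S"
  shows "hreg \<alpha> n j V S v"
proof (cases n)
  case 0
  thus ?thesis using assms(1) hcont_cong[OF _ assms(2)] by (simp add: hreg_0)
next
  case (Suc m)
  obtain u1 u2 ut where *: "hcont \<alpha> S u" "has_grad j V u u1 u2 ut" "hreg \<alpha> m j V S u1"
    "hreg \<alpha> m j V S u2" "0 < j \<longrightarrow> hreg \<alpha> m (j - 1) V S ut"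
    using assms(1) unfolding Suc by (rule hreg_SucE)
  show ?thesis unfolding Suc
  proof (rule hreg_SucI[OF _ _ *(3,4) *(5)[rule_format]])
    show "hcont \<alpha> S v" using hcont_cong[OF *(1) assms(2)] .
    show "has_grad j V v u1 u2 ut"
      by (rule has_grad_cong[OF *(2) assms(3)]) (use assms in auto)
  qed
qed

lemma hreg_const: "hreg \<alpha> n j V S (\<lambda>z. c)"
proof (induction n arbitrary: j c)
  case 0
  thus ?case by (simp add: hreg_0 hcont_const)
next
  case (Suc n)
  show ?case by (rule hreg_SucI[OF hcont_const has_grad_const]) (rule Suc.IH)+
qed

lemma hreg_add:
  assumes "hreg \<alpha> n j V S u" "hreg \<alpha> n j V S v"
  shows "hreg \<alpha> n j V S (\<lambda>z. u z + v z)"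
  using assms
proof (induction n arbitrary: j u v)
  case 0
  thus ?case by (simp add: hreg_0 hcont_add)
next
  case (Suc n)
  show ?case
    by (rule hreg_SucE[OF Suc.prems(1)], rule hreg_SucE[OF Suc.prems(2)],
        rule hreg_SucI[OF hcont_add has_grad_add], assumption+) (simp_all add: Suc.IH)
qed

lemma hreg_bounded_linear:
  assumes "bounded_linear L" "hreg \<alpha> n j V S u"
  shows "hreg \<alpha> n j V S (\<lambda>z. L (u z))"
  using assms(2)
proof (induction n arbitrary: j u)
  case 0
  thus ?case by (simp add: hreg_0 hcont_bounded_linear[OF assms(1)])
next
  case (Suc n)
  show ?case
    by (rule hreg_SucE[OF Suc.prems(1)],
        rule hreg_SucI[OF hcont_bounded_linear[OF assms(1)] has_grad_bounded_linear[OF assms(1)]], assumption+) (simp_all add: Suc.IH)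
qed

lemma hreg_scaleR:
  fixes a :: "complex \<times> real \<Rightarrow> real"
  assumes "hreg \<alpha> n j V S a" "hreg \<alpha> n j V S v" "V \<subseteq> slab"
  shows "hreg \<alpha> n j V S (\<lambda>z. a z *\<^sub>R v z)"
  using assms(1,2)
proof (induction n arbitrary: j a v)
  case 0
  thus ?case by (simp add: hreg_0 hcont_scaleR)
next
  case (Suc n)
  obtain a1 a2 at' where a: "hcont \<alpha> S a" "has_grad j V a a1 a2 at'" "hreg \<alpha> n j V S a1"
    "hreg \<alpha> n j V S a2" "0 < j \<longrightarrow> hreg \<alpha> n (j - 1) V S at'"
    using Suc.prems(1) by (rule hreg_SucE)
  obtain v1 v2 vt where v: "hcont \<alpha> S v" "has_grad j V v v1 v2 vt" "hreg \<alpha> n j V S v1"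
    "hreg \<alpha> n j V S v2" "0 < j \<longrightarrow> hreg \<alpha> n (j - 1) V S vt"
    using Suc.prems(2) by (rule hreg_SucE)
  note d = hreg_down[OF _ assms(3)] hreg_down'[OF _ assms(3)]
  show ?case
    by (rule hreg_SucI[OF hcont_scaleR[OF a(1) v(1)] has_grad_scaleR[OF a(2) v(2)]])
       (simp_all add: hreg_add Suc.IH a v d[OF Suc.prems(1)] d[OF Suc.prems(2)] del: One_nat_def)
qed

lemma hreg_mult:
  fixes a v :: "complex \<times> real \<Rightarrow> real"
  assumes "hreg \<alpha> n j V S a" "hreg \<alpha> n j V S v" "V \<subseteq> slab"
  shows "hreg \<alpha> n j V S (\<lambda>z. a z * v z)"
  using hreg_scaleR[OF assms] by simp

section \<open>Functions of class C^n of one real variable and composition with them\<close>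

primrec smooth_upto :: "nat \<Rightarrow> (real \<Rightarrow> real) \<Rightarrow> bool" where
  "smooth_upto 0 = (\<lambda>b. continuous_on UNIV b)"
| "smooth_upto (Suc n) = (\<lambda>b. \<exists>b'. (\<forall>x. (b has_real_derivative b' x) (at x)) \<and> smooth_upto n b')"

declare smooth_upto.simps [simp del]

lemma smooth_upto_0: "smooth_upto 0 b \<longleftrightarrow> continuous_on UNIV b"
  by (simp add: smooth_upto.simps)

lemma smooth_upto_Suc: "smooth_upto (Suc n) b \<longleftrightarrow> (\<exists>b'. (\<forall>x. (b has_real_derivative b' x) (at x)) \<and> smooth_upto n b')"
  by (simp add: smooth_upto.simps)

lemma smooth_upto_SucI:
  "(\<And>x. (b has_real_derivative b' x) (at x)) \<Longrightarrow> smooth_upto n b' \<Longrightarrow> smooth_upto (Suc n) b"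
  by (auto simp: smooth_upto_Suc)

lemma smooth_upto_down: "smooth_upto (Suc n) b \<Longrightarrow> smooth_upto n b"
proof (induction n arbitrary: b)
  case 0
  then obtain b' where "\<And>x. (b has_real_derivative b' x) (at x)" unfolding smooth_upto_Suc by blast
  hence "isCont b x" for x by (rule DERIV_isCont)
  thus ?case unfolding smooth_upto_0 by (simp add: continuous_at_imp_continuous_on)
next
  case (Suc n)
  then obtain b' where b': "\<And>x. (b has_real_derivative b' x) (at x)" "smooth_upto (Suc n) b'"
    unfolding smooth_upto_Suc[of "Suc n"] by blast
  show ?case unfolding smooth_upto_Suc[of n b] using b'(1) Suc.IH[OF b'(2)] by blast
qed

lemma smooth_upto_imp_continuous: "smooth_upto n b \<Longrightarrow> continuous_on UNIV b"
  by (induction n) (auto simp: smooth_upto_0 dest: smooth_upto_down)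

lemma smooth_upto_const: "smooth_upto n (\<lambda>x. c)"
  by (induction n arbitrary: c) (auto simp: smooth_upto_0 smooth_upto_Suc intro!: exI[of _ "\<lambda>_. 0"])

lemma smooth_upto_ident: "smooth_upto n (\<lambda>x. x)"
proof (cases n)
  case 0
  thus ?thesis by (simp add: smooth_upto_0)
next
  case (Suc m)
  thus ?thesis using smooth_upto_const[of m 1]
    by (auto simp: smooth_upto_Suc intro!: exI[of _ "\<lambda>_. 1"] derivative_eq_intros)
qed

lemma smooth_upto_add: "smooth_upto n a \<Longrightarrow> smooth_upto n b \<Longrightarrow> smooth_upto n (\<lambda>x. a x + b x)"
proof (induction n arbitrary: a b)
  case 0
  thus ?case by (auto simp: smooth_upto_0 intro!: continuous_intros)
next
  case (Suc n)
  then obtain a' b' where *: "\<And>x. (a has_real_derivative a' x) (at x)" "smooth_upto n a'"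
    "\<And>x. (b has_real_derivative b' x) (at x)" "smooth_upto n b'"
    unfolding smooth_upto_Suc by blast
  show ?case unfolding smooth_upto_Suc
    by (intro exI[of _ "\<lambda>x. a' x + b' x"] conjI allI Suc.IH * DERIV_add)
qed

lemma smooth_upto_mult: "smooth_upto n a \<Longrightarrow> smooth_upto n b \<Longrightarrow> smooth_upto n (\<lambda>x. a x * b x)"
proof (induction n arbitrary: a b)
  case 0
  thus ?case by (auto simp: smooth_upto_0 intro!: continuous_intros)
next
  case (Suc n)
  then obtain a' b' where *: "\<And>x. (a has_real_derivative a' x) (at x)" "smooth_upto n a'"
    "\<And>x. (b has_real_derivative b' x) (at x)" "smooth_upto n b'"
    unfolding smooth_upto_Suc by blast
  show ?case unfolding smooth_upto_Suc
    by (intro exI[of _ "\<lambda>x. a' x * b x + b' x * a x"] conjI allI smooth_upto_add Suc.IH * DERIV_mult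
        smooth_upto_down[OF Suc.prems(1)] smooth_upto_down[OF Suc.prems(2)])
qed

lemma smooth_upto_affine: "smooth_upto n a \<Longrightarrow> smooth_upto n (\<lambda>x. a (m * x + c))"
proof (induction n arbitrary: a)
  case 0
  have "continuous_on UNIV (\<lambda>x. m * x + c)" by (intro continuous_intros)
  thus ?case using 0 continuous_on_compose2[of UNIV a UNIV "\<lambda>x. m * x + c"] by (simp add: smooth_upto_0)
next
  case (Suc n)
  then obtain a' where *: "\<And>x. (a has_real_derivative a' x) (at x)" "smooth_upto n a'"
    unfolding smooth_upto_Suc by blast
  have "((\<lambda>x. a (m * x + c)) has_real_derivative a' (m * x + c) * m) (at x)" for x
    by (rule DERIV_chain2[OF *(1)]) (auto intro!: derivative_eq_intros)
  moreover have "smooth_upto n (\<lambda>x. a' (m * x + c) * m)"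
    using smooth_upto_mult[OF Suc.IH[OF *(2)] smooth_upto_const[of n m]] .
  ultimately show ?case by (rule smooth_upto_SucI)
qed

lemma smooth_upto_inverse: "smooth_upto n a \<Longrightarrow> (\<And>x. a x \<noteq> 0) \<Longrightarrow> smooth_upto n (\<lambda>x. inverse (a x))"
proof (induction n)
  case 0
  thus ?case by (auto simp: smooth_upto_0 intro!: continuous_intros)
next
  case (Suc n)
  then obtain a' where *: "\<And>x. (a has_real_derivative a' x) (at x)" "smooth_upto n a'"
    unfolding smooth_upto_Suc by blast
  have I: "smooth_upto n (\<lambda>x. inverse (a x))" using Suc.IH smooth_upto_down Suc.prems by blast
  have "((\<lambda>x. inverse (a x)) has_real_derivative (- 1) * (a' x * (inverse (a x) * inverse (a x)))) (at x)" for x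
    using DERIV_inverse_fun[OF *(1) Suc.prems(2)] by (simp add: power2_eq_square)
  moreover have "smooth_upto n (\<lambda>x. (- 1) * (a' x * (inverse (a x) * inverse (a x))))"
    using smooth_upto_mult[OF smooth_upto_const[of n "-1"] smooth_upto_mult[OF *(2) smooth_upto_mult[OF I I]]] .
  ultimately show ?case by (rule smooth_upto_SucI)
qed

text \<open>The outer function has one derivative more than the class: already for n = 0 the Hoelder
  bound of the composition comes from b being Lipschitz on the range of u.\<close>

lemma hreg_compose_real:
  fixes u :: "complex \<times> real \<Rightarrow> real"
  assumes "hreg \<alpha> n j V S u" "smooth_upto (Suc n) b" "V \<subseteq> slab"
  shows "hreg \<alpha> n j V S (\<lambda>z. b (u z))"
  using assms(1,2)
proof (induction n arbitrary: j b)
  case 0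
  then obtain b' where b': "\<And>x. (b has_real_derivative b' x) (at x)" "continuous_on UNIV b'"
    unfolding smooth_upto_Suc smooth_upto_0 by blast
  show ?case using hcont_compose_real[OF _ b'] 0 by (simp add: hreg_0)
next
  case (Suc n)
  obtain u1 u2 ut where u: "hcont \<alpha> S u" "has_grad j V u u1 u2 ut" "hreg \<alpha> n j V S u1"
    "hreg \<alpha> n j V S u2" "0 < j \<longrightarrow> hreg \<alpha> n (j - 1) V S ut"
    using Suc.prems(1) by (rule hreg_SucE)
  obtain b' where b': "\<And>x. (b has_real_derivative b' x) (at x)" "smooth_upto (Suc n) b'"
    using Suc.prems(2) unfolding smooth_upto_Suc[of "Suc n"] by blast
  note d = hreg_down[OF Suc.prems(1) assms(3)] hreg_down'[OF Suc.prems(1) assms(3)]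
  show ?case
    by (rule hreg_SucI[OF hcont_compose_real[OF u(1) b'(1) smooth_upto_imp_continuous[OF b'(2)]] has_grad_compose_real[OF b'(1) u(2)]])
       (simp_all add: hreg_mult[OF _ _ assms(3)] Suc.IH u d b'(2) del: One_nat_def)
qed

lemma hreg_linear:
  fixes L :: "complex \<times> real \<Rightarrow> 'b::real_normed_vector"
  assumes "bounded_linear L" "bounded S" "0 < \<alpha>" "\<alpha> < 1"
  shows "hreg \<alpha> n j V S L"
proof -
  interpret L: bounded_linear L by fact
  have hc: "hcont \<alpha> S L"
  proof -
    obtain K where K: "K > 0" "\<And>x. norm (L x) \<le> norm x * K" using L.pos_bounded by blast
    obtain B where B: "B > 0" "\<And>z. z \<in> S \<Longrightarrow> norm z \<le> B" using assms(2) bounded_pos by blast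
    have b: "norm (L z) \<le> B * K" if "z \<in> S" for z
      using K(2)[of z] mult_right_mono[OF B(2)[OF that], of K] K(1) by linarith
    show ?thesis
    proof (rule hcontI[OF L.continuous_on[OF continuous_on_id, unfolded id_def] b])
      fix t x y assume xy: "(x, t) \<in> S" "(y, t) \<in> S"
      have l: "norm (L (x, t) - L (y, t)) \<le> K * dist x y"
        using K(2)[of "(x - y, 0)"] by (simp add: L.diff[symmetric] dist_norm mult.commute)
      have "norm (L (x, t) - L (y, t)) \<le> 2 * (B * K)"
        using b[OF xy(1)] b[OF xy(2)] norm_triangle_ineq4[of "L (x, t)" "L (y, t)"] by linarith
      from lipschitz_imp_hoelder[OF assms(3) _ l this] assms(4) K B
      show "norm (L (x, t) - L (y, t)) \<le> (K + 2 * (B * K)) * dist x y powr \<alpha>" by simp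
    qed
  qed
  show ?thesis
  proof (cases n)
    case 0
    thus ?thesis using hc by (simp add: hreg_0)
  next
    case (Suc m)
    have "gradmap (L (1, 0)) (L (\<i>, 0)) (L (0, 1)) = L"
    proof
      fix w :: "complex \<times> real"
      have "w = Re (fst w) *\<^sub>R (1, 0) + Im (fst w) *\<^sub>R (\<i>, 0) + snd w *\<^sub>R (0, 1)"
        by (simp add: prod_eq_iff complex_eq_iff)
      hence "L w = L (Re (fst w) *\<^sub>R (1, 0) + Im (fst w) *\<^sub>R (\<i>, 0) + snd w *\<^sub>R (0, 1))" by simp
      thus "gradmap (L (1, 0)) (L (\<i>, 0)) (L (0, 1)) w = L w"
        unfolding gradmap_def by (simp only: L.add L.scaleR)
    qed
    hence "has_grad j V L (\<lambda>z. L (1, 0)) (\<lambda>z. L (\<i>, 0)) (\<lambda>z. L (0, 1))"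
      by (simp add: has_grad_def L.has_derivative[OF has_derivative_ident])
    thus ?thesis unfolding Suc by (rule hreg_SucI[OF hc]) (rule hreg_const)+
  qed
qed

text \<open>The only new Hoelder estimate is between a point x in V and a point y outside. Either
  u(x) = 0, or x is in F and then |u(x)| \<le> B \<le> (B / d0^\<alpha>) |x - y|^\<alpha>.
  Derivatives vanish on V - F as well, because that set is relatively open, so the induction passes
  to them.\<close>

lemma hreg_zero_extend:
  assumes V: "openin (top_of_set slab) V" and F: "closed F" "F \<subseteq> V" and d0: "0 < d0"
    and sep: "\<And>x y t. (x, t) \<in> F \<Longrightarrow> (y, t) \<in> slab - V \<Longrightarrow> d0 \<le> dist x y"
    and \<alpha>: "0 < \<alpha>"
    and u: "hreg \<alpha> n j V V u" "\<And>z. z \<in> V - F \<Longrightarrow> u z = 0"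
  shows "hreg \<alpha> n j slab slab (\<lambda>z. if z \<in> V then u z else 0)"
  using u
proof (induction n arbitrary: j u)
  case (0 j u)
  have oF: "openin (top_of_set slab) (slab - F)"
    using openin_open_Int[of "- F" slab] F(1) by (simp add: Diff_eq open_Compl)
  have Vs: "V \<subseteq> slab" using openin_subset[OF V] by simp
  obtain B H where b: "continuous_on V u" "0 \<le> B" "0 \<le> H" "\<And>z. z \<in> V \<Longrightarrow> norm (u z) \<le> B"
    "\<And>t x y. (x, t) \<in> V \<Longrightarrow> (y, t) \<in> V \<Longrightarrow> norm (u (x, t) - u (y, t)) \<le> H * dist x y powr \<alpha>"
    using 0(1) unfolding hreg_0 by (rule hcontE) blast
  have un: "slab = V \<union> (slab - F)" using F Vs by blast
  have "continuous_on (V \<union> (slab - F)) (\<lambda>z. if z \<in> V then u z else 0)"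
    by (rule continuous_on_cases_local_open)
       (use V oF b(1) 0(2) un in auto)
  hence c: "continuous_on slab (\<lambda>z. if z \<in> V then u z else 0)" using un by simp
  have key: "norm (u (x, t)) \<le> (B / d0 powr \<alpha>) * dist x y powr \<alpha>"
    if "(x, t) \<in> V" "(y, t) \<in> slab" "(y, t) \<notin> V" for x y t
  proof (cases "(x, t) \<in> F")
    case True
    have "d0 \<le> dist x y" using sep[OF True] that by auto
    hence "d0 powr \<alpha> \<le> dist x y powr \<alpha>" using d0 \<alpha> by (intro powr_mono2) auto
    hence "B / d0 powr \<alpha> * d0 powr \<alpha> \<le> B / d0 powr \<alpha> * dist x y powr \<alpha>"
      using b(2) by (intro mult_left_mono) auto
    moreover have "B / d0 powr \<alpha> * d0 powr \<alpha> = B" using d0 by simp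
    ultimately show ?thesis using b(4)[OF that(1)] by linarith
  next
    case False
    thus ?thesis using 0(2)[of "(x, t)"] that(1) b(2) by simp
  qed
  have kpos: "0 \<le> B / d0 powr \<alpha>" using b(2) by simp
  show ?case unfolding hreg_0
  proof (rule hcontI[OF c])
    show "norm (if z \<in> V then u z else 0) \<le> B" if "z \<in> slab" for z using b(2,4) by auto
    fix t x y assume xy: "(x, t) \<in> slab" "(y, t) \<in> slab"
    have "H + B / d0 powr \<alpha> \<ge> H" "H + B / d0 powr \<alpha> \<ge> B / d0 powr \<alpha>" "H + B / d0 powr \<alpha> \<ge> 0"
      using kpos b(3) by auto
    hence H1: "H * dist x y powr \<alpha> \<le> (H + B / d0 powr \<alpha>) * dist x y powr \<alpha>"
      and H2: "(B / d0 powr \<alpha>) * dist x y powr \<alpha> \<le> (H + B / d0 powr \<alpha>) * dist x y powr \<alpha>"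
      and H3: "0 \<le> (H + B / d0 powr \<alpha>) * dist x y powr \<alpha>"
      by (intro mult_right_mono mult_nonneg_nonneg; simp)+
    show "norm ((if (x, t) \<in> V then u (x, t) else 0) - (if (y, t) \<in> V then u (y, t) else 0))
        \<le> (H + B / d0 powr \<alpha>) * dist x y powr \<alpha>"
    proof (cases "(x, t) \<in> V"; cases "(y, t) \<in> V")
      assume "(x, t) \<in> V" "(y, t) \<in> V"
      thus ?thesis using b(5)[of x t y] H1 by simp
    next
      assume "(x, t) \<in> V" "(y, t) \<notin> V"
      thus ?thesis using key[of x t y] xy H2 by simp
    next
      assume "(x, t) \<notin> V" "(y, t) \<in> V"
      thus ?thesis using key[of y t x] xy H2 by (simp add: dist_commute)
    next
      assume "(x, t) \<notin> V" "(y, t) \<notin> V"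
      thus ?thesis using H3 by simp
    qed
  qed
next
  case (Suc n j u)
  have Vs: "V \<subseteq> slab" using openin_subset[OF V] by simp
  have oF: "openin (top_of_set slab) (slab - F)"
    using openin_open_Int[of "- F" slab] F(1) by (simp add: Diff_eq open_Compl)
  have "V \<inter> (slab - F) = V - F" using Vs by blast
  hence VF: "openin (top_of_set slab) (V - F)"
    using openin_Int[OF V oF] by simp
  obtain u1 u2 ut where u: "hcont \<alpha> V u" "has_grad j V u u1 u2 ut" "hreg \<alpha> n j V V u1"
    "hreg \<alpha> n j V V u2" "0 < j \<longrightarrow> hreg \<alpha> n (j - 1) V V ut"
    using Suc.prems(1) by (rule hreg_SucE)
  let ?E = "\<lambda>f z. if z \<in> V then f z else 0"
  have z: "u1 z = 0" "u2 z = 0" "0 < j \<Longrightarrow> ut z = 0" if "z \<in> V - F" for z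
    using has_grad_zero[OF u(2) VF _ _ that] Suc.prems(2) by auto
  have g1: "has_grad j V (?E u) (?E u1) (?E u2) (?E ut)"
    by (rule has_grad_cong[OF u(2) V]) auto
  have g2: "has_grad j (slab - F) (?E u) (?E u1) (?E u2) (?E ut)"
    by (rule has_grad_cong[OF has_grad_const[of _ _ 0] oF]) (use z Suc.prems(2) in auto)
  have g: "has_grad j slab (?E u) (?E u1) (?E u2) (?E ut)"
    using g1 g2 F unfolding has_grad_def by blast
  have h0: "hcont \<alpha> slab (?E u)"
    using Suc.IH[OF hreg_down[OF Suc.prems(1) Vs] Suc.prems(2)] hreg_imp_hcont by blast
  show ?case
    by (rule hreg_SucI[OF h0 g]) (use Suc.IH u z in auto)
qed

text \<open>A table \<open>w i p q\<close> of candidates for the derivatives of t-order i and space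
  orders p, q is turned into membership in \<open>hreg\<close>. Each t-derivative uses up one unit
  of the time index, hence J - i.\<close>

lemma hreg_jet:
  fixes w :: "nat \<Rightarrow> nat \<Rightarrow> nat \<Rightarrow> complex \<times> real \<Rightarrow> 'b::real_normed_vector"
  assumes "\<And>i p q. i \<le> J \<Longrightarrow> i + p + q \<le> N \<Longrightarrow> hcont \<alpha> S (w i p q)"
    and "\<And>i p q. i \<le> J \<Longrightarrow> i + p + q < N \<Longrightarrow>
      has_grad (J - i) V (w i p q) (w i (Suc p) q) (w i p (Suc q)) (w (Suc i) p q)"
    and "i \<le> J" "i + p + q + n \<le> N"
  shows "hreg \<alpha> n (J - i) V S (w i p q)"
  using assms(3,4)
proof (induction n arbitrary: i p q)
  case 0
  thus ?case using assms(1) by (simp add: hreg_0)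
next
  case (Suc n)
  show ?case
  proof (rule hreg_SucI)
    show "hcont \<alpha> S (w i p q)" using assms(1) Suc.prems by simp
    show "has_grad (J - i) V (w i p q) (w i (Suc p) q) (w i p (Suc q)) (w (Suc i) p q)"
      using assms(2) Suc.prems by simp
    show "hreg \<alpha> n (J - i) V S (w i (Suc p) q)" "hreg \<alpha> n (J - i) V S (w i p (Suc q))"
      using Suc.prems by (auto intro!: Suc.IH)
    show "hreg \<alpha> n (J - i - 1) V S (w (Suc i) p q)" if "0 < J - i"
    proof -
      have "J - i - 1 = J - Suc i" by simp
      thus ?thesis using Suc.IH[of "Suc i" p q] Suc.prems that by simp
    qed
  qed
qed

subsection \<open>Smooth cutoff functions\<close>

text \<open>The factor s^(-k) closes the family under differentiation up to linear combinations, so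
  that smoothness of exp(-1/s), extended by 0, is an induction.\<close>

definition expinv :: "nat \<Rightarrow> real \<Rightarrow> real" where
  "expinv k s = (if s \<le> 0 then 0 else (1 / s) ^ k * exp (- 1 / s))"

lemma expinv_tendsto_0: "((\<lambda>s. expinv k s) \<longlongrightarrow> 0) (at 0)"
proof -
  have l: "(expinv k \<longlongrightarrow> 0) (at_left 0)"
    by (rule tendsto_eventually) (auto simp: eventually_at_left_field expinv_def intro!: exI[of _ "-1"])
  have "((\<lambda>s::real. inverse s ^ k / exp (inverse s)) \<longlongrightarrow> 0) (at_right 0)"
    by (rule filterlim_compose[OF tendsto_power_div_exp_0 filterlim_inverse_at_top_right])
  moreover have "\<forall>\<^sub>F s in at_right 0. inverse s ^ k / exp (inverse s) = expinv k s"
    unfolding eventually_at_right_field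
    by (intro exI[of _ 1]) (auto simp: expinv_def exp_minus field_simps)
  ultimately have "(expinv k \<longlongrightarrow> 0) (at_right 0)"
    using tendsto_cong by fastforce
  with l show ?thesis by (simp add: filterlim_at_split)
qed

lemma expinv_deriv: "(expinv k has_real_derivative (- real k * expinv (Suc k) s + expinv (Suc (Suc k)) s)) (at s)"
proof -
  consider "s < 0" | "s = 0" | "s > 0" by linarith
  thus ?thesis
  proof cases
    case 1
    have "((\<lambda>s. 0) has_real_derivative 0) (at s)" by simp
    hence "(expinv k has_real_derivative 0) (at s)"
      by (rule has_field_derivative_transform_within_open[of _ _ _ "{..<0}"]) (use 1 in \<open>auto simp: expinv_def\<close>)
    thus ?thesis using 1 by (simp add: expinv_def)
  next
    case 2
    \<comment> \<open>The difference quotient of \<open>expinv k\<close> at 0 is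
      \<open>expinv (Suc k)\<close>, which tends to 0.\<close>
    have "((\<lambda>h. (expinv k (0 + h) - expinv k 0) / h) \<longlongrightarrow> 0) (at 0)"
      using expinv_tendsto_0[of "Suc k"]
      by (rule Lim_transform_eventually) (auto simp: eventually_at_filter expinv_def)
    thus ?thesis using 2 by (simp add: DERIV_def expinv_def)
  next
    case 3
    have "((\<lambda>s. (1 / s) ^ k * exp (- 1 / s)) has_real_derivative
        (- real k * ((1 / s) ^ Suc k * exp (- 1 / s)) + (1 / s) ^ Suc (Suc k) * exp (- 1 / s))) (at s)"
    proof -
      define y where "y = 1 / s"
      have i: "((\<lambda>s. 1 / s) has_real_derivative - y\<^sup>2) (at s)"
        unfolding y_def using 3 by (auto intro!: derivative_eq_intros simp: power2_eq_square)
      have p: "((\<lambda>s. (1 / s) ^ k) has_real_derivative - real k * y ^ Suc k) (at s)"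
        by (rule DERIV_cong[OF DERIV_power[OF i, of k]]) (cases k; simp add: y_def[symmetric] power2_eq_square algebra_simps)
      have e: "((\<lambda>s. exp (- 1 / s)) has_real_derivative exp (- 1 / s) * y\<^sup>2) (at s)"
        using DERIV_fun_exp[OF DERIV_minus[OF i]] by simp
      show ?thesis
        by (rule DERIV_cong[OF DERIV_mult[OF p e]]) (simp add: y_def[symmetric] power2_eq_square algebra_simps)
    qed
    hence "(expinv k has_real_derivative
        (- real k * ((1 / s) ^ Suc k * exp (- 1 / s)) + (1 / s) ^ Suc (Suc k) * exp (- 1 / s))) (at s)"
      by (rule has_field_derivative_transform_within_open[of _ _ _ "{0<..}"]) (use 3 in \<open>auto simp: expinv_def\<close>)
    thus ?thesis using 3 by (simp add: expinv_def)
  qed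
qed

lemma smooth_upto_expinv: "smooth_upto n (expinv k)"
proof (induction n arbitrary: k)
  case 0
  have "isCont (expinv k) x" for x using expinv_deriv by (rule DERIV_isCont)
  thus ?case by (simp add: smooth_upto_0 continuous_at_imp_continuous_on)
next
  case (Suc n)
  show ?case
    by (rule smooth_upto_SucI[OF expinv_deriv])
       (intro smooth_upto_add smooth_upto_mult smooth_upto_const Suc.IH)
qed

lemma expinv_pos: "0 < s \<Longrightarrow> 0 < expinv k s"
  by (simp add: expinv_def)

lemma expinv_nonneg: "0 \<le> expinv k s"
  by (simp add: expinv_def)

lemma expinv_mono: "s \<le> s' \<Longrightarrow> expinv 0 s \<le> expinv 0 s'"
  by (auto simp: expinv_def field_simps)

text \<open>The standard smooth step that falls from 1 at s = 1 to 0 at s = 2. The denominator is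
  positive because 2 - s and s - 1 are never both nonpositive.\<close>

definition cutoff :: "real \<Rightarrow> real" where
  "cutoff s = expinv 0 (2 - s) * inverse (expinv 0 (2 - s) + expinv 0 (s - 1))"

lemma cutoff_denom: "0 < expinv 0 (2 - s) + expinv 0 (s - 1)"
proof (cases "s < 2")
  case True
  thus ?thesis using expinv_pos[of "2 - s" 0] expinv_nonneg[of 0 "s - 1"] by linarith
next
  case False
  thus ?thesis using expinv_pos[of "s - 1" 0] expinv_nonneg[of 0 "2 - s"] by linarith
qed

lemma smooth_upto_cutoff: "smooth_upto n cutoff"
proof -
  have 1: "smooth_upto n (\<lambda>s. expinv 0 (2 - s))" and 2: "smooth_upto n (\<lambda>s. expinv 0 (s - 1))"
    using smooth_upto_affine[OF smooth_upto_expinv[of n 0], of "-1" 2]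
      smooth_upto_affine[OF smooth_upto_expinv[of n 0], of 1 "-1"] by simp_all
  have "smooth_upto n (\<lambda>s. inverse (expinv 0 (2 - s) + expinv 0 (s - 1)))"
    using smooth_upto_inverse[OF smooth_upto_add[OF 1 2]] cutoff_denom by (metis less_irrefl)
  from smooth_upto_mult[OF 1 this] show ?thesis by (simp add: cutoff_def[abs_def])
qed

lemma cutoff_eq_1: "s \<le> 1 \<Longrightarrow> cutoff s = 1"
  using expinv_pos[of "2 - s" 0] by (simp add: cutoff_def expinv_def[of 0 "s - 1"])

lemma cutoff_eq_0: "2 \<le> s \<Longrightarrow> cutoff s = 0"
  by (simp add: cutoff_def expinv_def[of 0 "2 - s"])

lemma cutoff_antimono:
  assumes "s \<le> s'" shows "cutoff s' \<le> cutoff s"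
proof -
  have a: "expinv 0 (2 - s') \<le> expinv 0 (2 - s)" and b: "expinv 0 (s - 1) \<le> expinv 0 (s' - 1)"
    using assms by (auto intro: expinv_mono)
  have "expinv 0 (2 - s') * expinv 0 (s - 1) \<le> expinv 0 (2 - s) * expinv 0 (s' - 1)"
    using a b expinv_nonneg by (intro mult_mono) auto
  hence "expinv 0 (2 - s') / (expinv 0 (2 - s') + expinv 0 (s' - 1)) \<le> expinv 0 (2 - s) / (expinv 0 (2 - s) + expinv 0 (s - 1))"
    unfolding pos_divide_le_eq[OF cutoff_denom] times_divide_eq_left pos_le_divide_eq[OF cutoff_denom]
    by (simp add: algebra_simps)
  thus ?thesis by (simp add: cutoff_def divide_inverse)
qed

text \<open>Up to sign the derivative is a bump on [1,2], not identically zero by the mean value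
  theorem. It later becomes the radial profile of the approximate identity produced by the Cauchy
  kernel.\<close>

lemma cutoff_derivative:
  obtains \<theta> where "\<And>s. (cutoff has_real_derivative \<theta> s) (at s)" "\<And>n. smooth_upto n \<theta>"
    "\<And>s. \<theta> s \<le> 0" "\<And>s. s < 1 \<Longrightarrow> \<theta> s = 0" "\<And>s. s > 2 \<Longrightarrow> \<theta> s = 0" "\<exists>s. 1 < s \<and> s < 2 \<and> \<theta> s < 0"
proof -
  define \<theta> where "\<theta> = deriv cutoff"
  have d: "(cutoff has_real_derivative \<theta> s) (at s)" for s
  proof -
    obtain b' where "\<And>x. (cutoff has_real_derivative b' x) (at x)"
      using smooth_upto_cutoff[of "Suc 0"] unfolding smooth_upto_Suc by blast
    thus ?thesis unfolding \<theta>_def using DERIV_imp_deriv by metis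
  qed
  have sm: "smooth_upto n \<theta>" for n
  proof -
    obtain b' where b': "\<And>x. (cutoff has_real_derivative b' x) (at x)" "smooth_upto n b'"
      using smooth_upto_cutoff[of "Suc n"] unfolding smooth_upto_Suc by blast
    have "b' = \<theta>" using b'(1) d DERIV_unique by blast
    thus ?thesis using b'(2) by simp
  qed
  have np: "\<theta> s \<le> 0" for s
  proof (rule ccontr)
    assume "\<not> \<theta> s \<le> 0"
    then obtain e where e: "e > 0" "\<And>h. 0 < h \<Longrightarrow> h < e \<Longrightarrow> cutoff s < cutoff (s + h)"
      using DERIV_pos_inc_right[OF d[of s]] by fastforce
    show False using e(2)[of "e / 2"] e(1) cutoff_antimono[of s "s + e / 2"] by simp
  qed
  have z1: "\<theta> s = 0" if "s < 1" for s
  proof -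
    have "((\<lambda>s. 1) has_real_derivative 0) (at s)" by simp
    hence "(cutoff has_real_derivative 0) (at s)"
      by (rule has_field_derivative_transform_within_open[of _ _ _ "{..<1}"]) (use that in \<open>auto simp: cutoff_eq_1\<close>)
    thus ?thesis using d DERIV_unique by blast
  qed
  have z2: "\<theta> s = 0" if "s > 2" for s
  proof -
    have "((\<lambda>s. 0) has_real_derivative 0) (at s)" by simp
    hence "(cutoff has_real_derivative 0) (at s)"
      by (rule has_field_derivative_transform_within_open[of _ _ _ "{2<..}"]) (use that in \<open>auto simp: cutoff_eq_0\<close>)
    thus ?thesis using d DERIV_unique by blast
  qed
  obtain z where "1 < z" "z < 2" "cutoff 2 - cutoff 1 = (2 - 1) * \<theta> z"
    using MVT2[of 1 2 cutoff \<theta>] d by auto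
  hence "\<exists>s. 1 < s \<and> s < 2 \<and> \<theta> s < 0" by (intro exI[of _ z]) (auto simp: cutoff_eq_1 cutoff_eq_0)
  from that[OF d sm np z1 z2 this] show ?thesis .
qed

lemma slab_box_open: "openin (top_of_set slab) ((ball x0 \<rho> \<times> ball t0 \<tau>) \<inter> slab)"
  by (metis Int_commute open_Times open_ball openin_open)

lemma hreg_normsq:
  assumes "bounded V" "0 < \<alpha>" "\<alpha> < 1" "V \<subseteq> slab"
  shows "hreg \<alpha> n j V V (\<lambda>z. (norm (fst z - x0))\<^sup>2)"
    and "hreg \<alpha> n j V V (\<lambda>z. (snd z - t0)\<^sup>2)"
proof -
  have L: "bounded_linear (\<lambda>z::complex\<times>real. Re (fst z))" "bounded_linear (\<lambda>z::complex\<times>real. Im (fst z))"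
    "bounded_linear (\<lambda>z::complex\<times>real. snd z)"
    by (auto intro!: bounded_linear_compose[OF bounded_linear_Re] bounded_linear_compose[OF bounded_linear_Im] bounded_linear_fst bounded_linear_snd)
  have a: "hreg \<alpha> n j V V (\<lambda>z. L z + c)" if "bounded_linear L" for L :: "complex \<times> real \<Rightarrow> real" and c
    by (intro hreg_add hreg_const hreg_linear[OF that assms(1-3)])
  have sq: "hreg \<alpha> n j V V (\<lambda>z. (L z + c) * (L z + c))" if "bounded_linear L" for L :: "complex \<times> real \<Rightarrow> real" and c
    by (intro hreg_mult a that assms)
  have e: "(norm (fst z - x0))\<^sup>2 = (Re (fst z) + - Re x0) * (Re (fst z) + - Re x0) + (Im (fst z) + - Im x0) * (Im (fst z) + - Im x0)" for z :: "complex \<times> real"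
    unfolding cmod_power2 by (simp add: power2_eq_square)
  show "hreg \<alpha> n j V V (\<lambda>z. (norm (fst z - x0))\<^sup>2)"
    unfolding e by (intro hreg_add sq L)
  show "hreg \<alpha> n j V V (\<lambda>z. (snd z - t0)\<^sup>2)"
    using sq[OF L(3), of "- t0"] by (simp add: power2_eq_square)
qed

text \<open>Squared distances keep the function smooth at the centre. It equals 1 up to half the
  radii and vanishes from radius \<rho>/sqrt 2 on; 3/4 in \<open>boxsupp\<close> is a rational
  number above 1/sqrt 2.\<close>

definition boxbump :: "complex \<Rightarrow> real \<Rightarrow> real \<Rightarrow> real \<Rightarrow> complex \<times> real \<Rightarrow> real" where
  "boxbump x0 \<rho> t0 \<tau> z =
     cutoff (4 / \<rho>\<^sup>2 * (norm (fst z - x0))\<^sup>2) * cutoff (4 / \<tau>\<^sup>2 * (snd z - t0)\<^sup>2)"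

lemma boxbump_eq_1:
  assumes "0 < \<rho>" "0 < \<tau>" "dist x x0 \<le> \<rho> / 2" "\<bar>t - t0\<bar> \<le> \<tau> / 2"
  shows "boxbump x0 \<rho> t0 \<tau> (x, t) = 1"
proof -
  have "(norm (x - x0))\<^sup>2 \<le> (\<rho> / 2)\<^sup>2" "(t - t0)\<^sup>2 \<le> (\<tau> / 2)\<^sup>2"
    using assms by (auto simp: dist_norm power_mono abs_le_square_iff[symmetric])
  hence "4 / \<rho>\<^sup>2 * (norm (x - x0))\<^sup>2 \<le> 1" "4 / \<tau>\<^sup>2 * (t - t0)\<^sup>2 \<le> 1"
    using assms by (auto simp: field_simps power_divide)
  thus ?thesis by (simp add: boxbump_def cutoff_eq_1)
qed

definition boxsupp :: "complex \<Rightarrow> real \<Rightarrow> real \<Rightarrow> real \<Rightarrow> (complex \<times> real) set" where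
  "boxsupp x0 \<rho> t0 \<tau> = (cball x0 (3/4 * \<rho>) \<times> cball t0 (3/4 * \<tau>)) \<inter> slab"

lemma boxbump_eq_0:
  assumes "0 < \<rho>" "0 < \<tau>" "(x, t) \<notin> boxsupp x0 \<rho> t0 \<tau>" "(x, t) \<in> slab"
  shows "boxbump x0 \<rho> t0 \<tau> (x, t) = 0"
proof -
  have "3/4 * \<rho> < dist x x0 \<or> 3/4 * \<tau> < \<bar>t - t0\<bar>"
    using assms by (auto simp: boxsupp_def dist_commute dist_real_def abs_minus_commute)
  thus ?thesis
  proof
    assume "3/4 * \<rho> < dist x x0"
    hence "(3/4 * \<rho>)\<^sup>2 \<le> (norm (x - x0))\<^sup>2" using assms(1) by (intro power_mono) (auto simp: dist_norm)
    hence "\<rho>\<^sup>2 \<le> 2 * (norm (x - x0))\<^sup>2" 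
      using zero_le_power2[of \<rho>] unfolding power_mult_distrib power2_abs power_divide by (simp; linarith)
    hence "2 \<le> 4 / \<rho>\<^sup>2 * (norm (x - x0))\<^sup>2" using assms(1) by (simp add: field_simps)
    thus ?thesis by (simp add: boxbump_def cutoff_eq_0)
  next
    assume "3/4 * \<tau> < \<bar>t - t0\<bar>"
    hence "(3/4 * \<tau>)\<^sup>2 \<le> \<bar>t - t0\<bar>\<^sup>2" using assms(2) by (intro power_mono) auto
    hence "\<tau>\<^sup>2 \<le> 2 * (t - t0)\<^sup>2" 
      using zero_le_power2[of \<tau>] unfolding power_mult_distrib power2_abs power_divide by (simp; linarith)
    hence "2 \<le> 4 / \<tau>\<^sup>2 * (t - t0)\<^sup>2" using assms(2) by (simp add: field_simps)
    thus ?thesis by (simp add: boxbump_def cutoff_eq_0)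
  qed
qed

lemma hreg_boxbump_local:
  assumes "0 < \<alpha>" "\<alpha> < 1" "bounded V" "V \<subseteq> slab"
  shows "hreg \<alpha> n j V V (boxbump x0 \<rho> t0 \<tau>)"
proof -
  note N = hreg_normsq[OF assms(3,1,2,4)]
  have c: "smooth_upto (Suc n) (\<lambda>s. cutoff (m * s))" for m
    using smooth_upto_affine[OF smooth_upto_cutoff, of _ m 0] by simp
  show ?thesis unfolding boxbump_def[abs_def]
    by (intro hreg_mult hreg_compose_real[OF N(1) c] hreg_compose_real[OF N(2) c] assms)
qed

lemma hreg_box_extend:
  assumes "0 < \<rho>" "0 < \<tau>" "0 < \<alpha>"
    and V: "V = (ball x0 \<rho> \<times> ball t0 \<tau>) \<inter> slab"
    and u: "hreg \<alpha> n j V V u" "\<And>z. z \<in> V - boxsupp x0 \<rho> t0 \<tau> \<Longrightarrow> u z = 0"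
  shows "hreg \<alpha> n j slab slab (\<lambda>z. if z \<in> V then u z else 0)"
proof (rule hreg_zero_extend[OF _ _ _ _ _ _ u(1,2)])
  show "openin (top_of_set slab) V" unfolding V by (rule slab_box_open)
  show "closed (boxsupp x0 \<rho> t0 \<tau>)"
    unfolding boxsupp_def slab_def by (intro closed_Int closed_Times) auto
  show "boxsupp x0 \<rho> t0 \<tau> \<subseteq> V" using assms(1,2) by (auto simp: boxsupp_def V)
  show "0 < \<rho> / 4" using assms by simp
  fix x y t assume 1: "(x, t) \<in> boxsupp x0 \<rho> t0 \<tau>" and 2: "(y, t) \<in> slab - V"
  \<comment> \<open>Both points have the same time, which is inside the time interval of the box, so
    y can leave V only through the lateral boundary. The gap between the radii 3/4 \<rho> and \<rho>
    is \<rho>/4.\<close>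
  have "dist t0 t < \<tau>" using 1 assms(2) by (auto simp: boxsupp_def)
  hence "\<rho> \<le> dist x0 y" using 2 by (auto simp: V)
  thus "\<rho> / 4 \<le> dist x y" using 1 dist_triangle[of x0 y x] by (auto simp: boxsupp_def)
qed (use assms in auto)

lemma hreg_boxbump:
  assumes "0 < \<rho>" "0 < \<tau>" "0 < \<alpha>" "\<alpha> < 1"
  shows "hreg \<alpha> n j slab slab (boxbump x0 \<rho> t0 \<tau>)"
proof -
  define V where "V = (ball x0 \<rho> \<times> ball t0 \<tau>) \<inter> slab"
  have b: "bounded V" unfolding V_def by (intro bounded_Int disjI1 bounded_Times) auto
  have s: "boxsupp x0 \<rho> t0 \<tau> \<subseteq> V" using assms(1,2) by (auto simp: boxsupp_def V_def)
  have "hreg \<alpha> n j slab slab (\<lambda>z. if z \<in> V then boxbump x0 \<rho> t0 \<tau> z else 0)"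
    by (rule hreg_box_extend[OF assms(1-3) V_def hreg_boxbump_local[OF assms(3,4) b]])
       (use assms(1,2) boxbump_eq_0 in \<open>auto simp: V_def\<close>)
  thus ?thesis
  proof (rule hreg_cong)
    show "boxbump x0 \<rho> t0 \<tau> z = (if z \<in> V then boxbump x0 \<rho> t0 \<tau> z else 0)" if "z \<in> slab" for z
      using that s boxbump_eq_0[OF assms(1,2), of "fst z" "snd z" x0 t0] by auto
  qed auto
qed

subsection \<open>Reflection coefficients\<close>

text \<open>The power series \<open>Q(z) = \<Sum> c\<^sub>l z\<^sup>l\<close> is the product of the factors \<open>1 - z/2\<^sup>k\<close>, \<open>k \<ge> 1\<close>. It satisfies
  \<open>Q(2z) = (1 - z) Q(z)\<close>, so it vanishes at \<open>2\<^sup>m\<close> for \<open>m \<ge> 1\<close> but not at \<open>1\<close>.\<close>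

primrec reflc :: "nat \<Rightarrow> real" where
  "reflc 0 = 1"
| "reflc (Suc l) = - reflc l / (2 ^ Suc l - 1)"

text \<open>The functional equation Q(2z) = (1 - z) Q(z), read off coefficient by
  coefficient.\<close>

lemma reflc_rec: "reflc (Suc l) * 2 ^ Suc l = reflc (Suc l) - reflc l"
proof -
  have "(2::real) ^ Suc l - 1 \<noteq> 0"
    using one_less_power[of "2::real" "Suc l"] by (metis less_irrefl one_less_numeral_iff right_minus_eq semiring_norm(76) zero_less_Suc)
  hence "reflc (Suc l) * (2 ^ Suc l - 1) = - reflc l" by simp
  thus ?thesis unfolding right_diff_distrib by linarith
qed

declare reflc.simps(2) [simp del]

text \<open>Consecutive terms have the ratio b / (2^(l+1) - 1), at most 1/2 once 2^N exceeds 2b + 1.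
  Convergence for every b is needed because the moment of order m is a power series evaluated at
  2^m.\<close>

lemma reflc_summable: "summable (\<lambda>l. \<bar>reflc l\<bar> * b ^ l)" if "0 \<le> b" for b :: real
proof -
  obtain N where N: "2 * b + 1 < 2 ^ N" using real_arch_pow[of 2 "2 * b + 1"] by auto
  have "summable (\<lambda>l. \<bar>reflc l\<bar> * b ^ l)"
  proof (rule summable_ratio_test[where c = "1/2" and N = N])
    fix l assume "N \<le> l"
    hence "(2::real) ^ N \<le> 2 ^ Suc l" by (intro power_increasing) auto
    hence d: "2 * b \<le> 2 ^ Suc l - 1" "0 < (2::real) ^ Suc l - 1" using N that by linarith+
    have "\<bar>reflc (Suc l)\<bar> * b ^ Suc l = (b / (2 ^ Suc l - 1)) * (\<bar>reflc l\<bar> * b ^ l)"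
      using d(2) by (simp add: abs_mult reflc.simps)
    also have "\<dots> \<le> 1/2 * (\<bar>reflc l\<bar> * b ^ l)"
      using d that by (intro mult_right_mono) (auto simp: field_simps)
    finally show "norm (\<bar>reflc (Suc l)\<bar> * b ^ Suc l) \<le> 1 / 2 * norm (\<bar>reflc l\<bar> * b ^ l)"
      using that by (simp add: abs_mult)
  qed simp
  thus ?thesis .
qed

lemma reflc_summable': "summable (\<lambda>l. reflc l * z ^ l)"
proof (rule summable_norm_cancel)
  show "summable (\<lambda>l. norm (reflc l * z ^ l))"
    using reflc_summable[of "\<bar>z\<bar>"] by (simp add: abs_mult power_abs)
qed

definition reflQ :: "real \<Rightarrow> real" where "reflQ z = (\<Sum>l. reflc l * z ^ l)"

lemma reflQ_double: "reflQ (2 * z) = (1 - z) * reflQ z"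
proof -
  have s: "summable (\<lambda>l. reflc l * z ^ l)" "summable (\<lambda>l. reflc l * (2 * z) ^ l)" by (rule reflc_summable')+
  have s1: "summable (\<lambda>l. reflc (Suc l) * z ^ Suc l)" "summable (\<lambda>l. reflc (Suc l) * (2 * z) ^ Suc l)"
    using s by (subst summable_Suc_iff, simp)+
  have "reflQ (2 * z) = (\<Sum>l. reflc (Suc l) * (2 * z) ^ Suc l) + 1"
    unfolding reflQ_def using suminf_split_head[OF s(2)] by simp
  also have "(\<Sum>l. reflc (Suc l) * (2 * z) ^ Suc l) = (\<Sum>l. reflc (Suc l) * z ^ Suc l - z * (reflc l * z ^ l))"
  proof (rule suminf_cong)
    fix l
    have "reflc (Suc l) * (2 * z) ^ Suc l = (reflc (Suc l) * 2 ^ Suc l) * z ^ Suc l"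
      by (simp only: power_mult_distrib mult.assoc)
    also have "\<dots> = reflc (Suc l) * z ^ Suc l - z * (reflc l * z ^ l)"
      unfolding reflc_rec by (simp add: algebra_simps)
    finally show "reflc (Suc l) * (2 * z) ^ Suc l = reflc (Suc l) * z ^ Suc l - z * (reflc l * z ^ l)" .
  qed
  also have "\<dots> = (\<Sum>l. reflc (Suc l) * z ^ Suc l) - z * reflQ z"
    unfolding reflQ_def suminf_mult[OF s(1)]
    using suminf_diff[OF s1(1) summable_mult[OF s(1), of z]] suminf_mult[OF s(1), of z] by simp
  also have "(\<Sum>l. reflc (Suc l) * z ^ Suc l) = reflQ z - 1"
    unfolding reflQ_def using suminf_split_head[OF s(1)] by simp
  finally show ?thesis by (simp add: algebra_simps)
qed

lemma reflQ_pow2: "reflQ (2 ^ Suc m) = 0"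
proof (induction m)
  case 0
  thus ?case using reflQ_double[of 1] by simp
next
  case (Suc m)
  thus ?case using reflQ_double[of "2 ^ Suc m"] by simp
qed

text \<open>If Q(1) were 0, the functional equation, whose factor 1 - z is nonzero for z = 1/2, 1/4,
  ..., would give Q(2^(-m)) = 0 for all m, against continuity at 0 and Q(0) = 1.\<close>

lemma reflQ_1_neq_0: "reflQ 1 \<noteq> 0"
proof
  assume 0: "reflQ 1 = 0"
  have z: "reflQ ((1/2) ^ m) = 0" for m
  proof (induction m)
    case 0
    thus ?case using \<open>reflQ 1 = 0\<close> by simp
  next
    case (Suc m)
    have "(1/2::real) ^ Suc m < 1" by (rule power_Suc_less_one) auto
    thus ?case using reflQ_double[of "(1/2) ^ Suc m"] Suc by simp
  qed
  have "isCont reflQ 0"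
    unfolding reflQ_def[abs_def] using isCont_powser[of reflc 1 0] reflc_summable'[of 1] by simp
  moreover have "(\<lambda>m. (1/2::real) ^ m) \<longlonglongrightarrow> 0" by (intro LIMSEQ_power_zero) auto
  ultimately have "(\<lambda>m. reflQ ((1/2) ^ m)) \<longlonglongrightarrow> reflQ 0" by (rule isCont_tendsto_compose)
  moreover have "reflQ 0 = 1" unfolding reflQ_def by (simp add: powser_zero)
  ultimately show False using z LIMSEQ_unique by fastforce
qed

definition seeley :: "nat \<Rightarrow> real" where "seeley l = reflc l / reflQ 1"

lemma seeley_summable: "summable (\<lambda>l. \<bar>seeley l\<bar> * (2 ^ l) ^ m)"
proof -
  have "summable (\<lambda>l. inverse \<bar>reflQ 1\<bar> * (\<bar>reflc l\<bar> * (2 ^ m) ^ l))"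
    by (intro summable_mult reflc_summable) simp
  thus ?thesis by (simp add: seeley_def abs_mult divide_inverse mult_ac power_mult[symmetric])
qed

text \<open>The moment of order m is Q(2^m) / Q(1). The moment of order 0 preserves the function on
  r \<le> 0, and the vanishing of the others removes there every term produced by differentiating
  the shift.\<close>

lemma seeley_moments: "(\<Sum>l. seeley l * (2 ^ l) ^ m) = (if m = 0 then 1 else 0)"
proof -
  have "(\<Sum>l. seeley l * (2 ^ l) ^ m) = (\<Sum>l. inverse (reflQ 1) * (reflc l * (2 ^ m) ^ l))"
    by (simp add: seeley_def divide_inverse mult_ac power_mult[symmetric])
  also have "\<dots> = inverse (reflQ 1) * reflQ (2 ^ m)"
    unfolding reflQ_def by (rule suminf_mult) (rule reflc_summable')
  also have "\<dots> = (if m = 0 then 1 else 0)"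
    using reflQ_pow2 reflQ_1_neq_0 by (cases m) auto
  finally show ?thesis .
qed

subsection \<open>One-sided paths and crossing a hypersurface\<close>

text \<open>A mean value inequality with differentiability only at interior points of the segment,
  since its end points may lie on the boundary of V, where u is merely continuous.\<close>

lemma affine_path_bound:
  fixes u :: "complex \<times> real \<Rightarrow> 'b::real_normed_vector"
  assumes g: "has_grad j V u u1 u2 ut"
    and c: "continuous_on {0..1} (\<lambda>s. u (a + s *\<^sub>R h))"
    and V: "\<And>s. 0 < s \<Longrightarrow> s < 1 \<Longrightarrow> a + s *\<^sub>R h \<in> V"
    and dom: "j = 0 \<Longrightarrow> snd h = 0" "snd a \<in> {0..1}" "snd a + snd h \<in> {0..1}"
    and B: "\<And>s. 0 < s \<Longrightarrow> s < 1 \<Longrightarrow> norm (gradmap (u1 (a + s *\<^sub>R h)) (u2 (a + s *\<^sub>R h)) (ut (a + s *\<^sub>R h)) h) \<le> B"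
  shows "norm (u (a + h) - u a) \<le> B"
proof -
  have seg: "snd a + s * snd h \<in> {0..1}" if "s \<in> {0..1}" for s
  proof -
    have "(1 - s) *\<^sub>R snd a + s *\<^sub>R (snd a + snd h) \<in> {0..1::real}"
      using that dom(2,3) by (intro convexD) auto
    thus ?thesis by (simp add: algebra_simps)
  qed
  have d: "((\<lambda>s. u (a + s *\<^sub>R h)) has_vector_derivative
      gradmap (u1 (a + s *\<^sub>R h)) (u2 (a + s *\<^sub>R h)) (ut (a + s *\<^sub>R h)) h) (at s)" if s: "0 < s" "s < 1" for s
  proof -
    let ?p = "a + s *\<^sub>R h"
    have 1: "((\<lambda>s::real. a + s *\<^sub>R h) has_derivative (\<lambda>s. s *\<^sub>R h)) (at s within {0<..<1})"
      by (auto intro!: derivative_eq_intros)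
    have sub: "(\<lambda>s. a + s *\<^sub>R h) ` {0<..<1} \<subseteq> UNIV \<times> tdom j (snd ?p)"
    proof (rule image_subsetI)
      fix s' :: real assume "s' \<in> {0<..<1}"
      thus "a + s' *\<^sub>R h \<in> UNIV \<times> tdom j (snd ?p)" using seg[of s'] dom(1) by (auto simp: tdom_def mem_Times_iff)
    qed
    have 2: "(u has_derivative gradmap (u1 ?p) (u2 ?p) (ut ?p)) (at ?p within (\<lambda>s. a + s *\<^sub>R h) ` {0<..<1})"
      by (rule has_derivative_subset[OF has_gradD[OF g V[OF s]] sub])
    have "((\<lambda>s. u (a + s *\<^sub>R h)) has_derivative (\<lambda>s. gradmap (u1 ?p) (u2 ?p) (ut ?p) (s *\<^sub>R h))) (at s within {0<..<1})"
      using diff_chain_within[OF 1 2] by (simp add: o_def)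
    hence "((\<lambda>s. u (a + s *\<^sub>R h)) has_vector_derivative gradmap (u1 ?p) (u2 ?p) (ut ?p) h) (at s within {0<..<1})"
      unfolding has_vector_derivative_def
      by (simp add: bounded_linear.linear[OF linear_gradmap] linear_cmul)
    thus ?thesis using s by (simp add: at_within_open[of s "{0<..<1}"])
  qed
  have "norm (u (a + 1 *\<^sub>R h) - u (a + 0 *\<^sub>R h)) \<le> B * 1 - B * 0"
    by (rule differentiable_bound_general[where f = "\<lambda>s. u (a + s *\<^sub>R h)" and \<phi> = "\<lambda>s. B * s" and \<phi>' = "\<lambda>s. B"])
       (use c d B in \<open>auto intro!: continuous_intros derivative_eq_intros simp: has_vector_derivative_def\<close>)
  thus ?thesis by simp
qed

text \<open>Two points of \<open>{r \<le> 0}\<close> are joined by a path of three segments, of length comparable to their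
  distance, that stays in \<open>{r < 0}\<close> apart from its end points.\<close>

lemma path_bound:
  fixes r :: "complex \<times> real \<Rightarrow> real" and u :: "complex \<times> real \<Rightarrow> 'b::real_normed_vector"
  assumes Q: "Q = (ball x0 R \<times> ball t0 \<tau>) \<inter> slab"
    and ne: "norm e = 1" and c: "0 < c" and L: "0 \<le> L"
    and mono: "\<And>x t s. (x, t) \<in> Q \<Longrightarrow> 0 \<le> s \<Longrightarrow> (x + s *\<^sub>R e, t) \<in> Q \<Longrightarrow> r (x + s *\<^sub>R e, t) \<le> r (x, t) - c * s"
    and lip: "\<And>z w. z \<in> Q \<Longrightarrow> w \<in> Q \<Longrightarrow> (j = 0 \<Longrightarrow> snd z = snd w) \<Longrightarrow> \<bar>r z - r w\<bar> \<le> L * (dist (fst z) (fst w) + dist (snd z) (snd w))"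
    and V: "V = {z \<in> Q. r z < 0}" and S: "S = {z \<in> Q. r z \<le> 0}"
    and g: "has_grad j V u u1 u2 ut" and cu: "continuous_on S u"
    and z: "z \<in> S" "w \<in> S" "j = 0 \<Longrightarrow> snd z = snd w"
    and h: "h = (L / c + 1) * (dist (fst z) (fst w) + dist (snd z) (snd w))"
    and room: "dist (fst z) x0 + h < R" "dist (fst w) x0 + h < R"
    and B: "\<And>p. p \<in> V \<Longrightarrow> dist (fst p) (fst z) \<le> h + dist (fst z) (fst w) \<Longrightarrow> dist (snd p) (snd z) \<le> dist (snd z) (snd w) \<Longrightarrow>
       norm (u1 p) \<le> B \<and> norm (u2 p) \<le> B \<and> (0 < j \<longrightarrow> norm (ut p) \<le> B)"
  shows "norm (u z - u w) \<le> (4 * (L / c + 1) + 2) * B * (dist (fst z) (fst w) + dist (snd z) (snd w))"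
proof -
  obtain x t y s where zw: "z = (x, t)" "w = (y, s)" by (metis surj_pair)
  define d where "d = dist x y + dist t s"
  show ?thesis
  proof (cases "d = 0")
    case True
    hence "dist x y = 0" "dist t s = 0" using zero_le_dist[of x y] zero_le_dist[of t s] unfolding d_def by linarith+
    thus ?thesis by (simp add: zw)
  next
    case False
    hence d0: "0 < d" unfolding d_def using zero_le_dist[of x y] zero_le_dist[of t s] by linarith
    have hd: "h = (L / c + 1) * d" by (simp add: h zw d_def)
    have Lc: "0 \<le> L / c" using L c by simp
    have h0: "0 < h" "d \<le> h"
    proof -
      show "0 < h" unfolding hd using d0 Lc by (intro mult_pos_pos) auto
      have "1 * d \<le> (L / c + 1) * d" using d0 Lc by (intro mult_right_mono) auto
      thus "d \<le> h" by (simp add: hd)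
    qed
    have xy: "dist x y \<le> d" "dist t s \<le> d" by (auto simp: d_def)
    have Qx: "(p, q) \<in> Q \<longleftrightarrow> dist p x0 < R \<and> dist q t0 < \<tau> \<and> q \<in> {0..1}" for p q
      by (auto simp: Q slab_def dist_commute)
    have zQ: "(x, t) \<in> Q" "(y, s) \<in> Q" "r (x, t) \<le> 0" "r (y, s) \<le> 0" using z by (auto simp: S zw)
    have tt: "t \<in> {0..1}" "s \<in> {0..1}" "dist t t0 < \<tau>" "dist s t0 < \<tau>" using zQ by (auto simp: Qx)
    have tdiff: "j = 0 \<Longrightarrow> t = s" using z(3) by (simp add: zw)
    have up: "(p + \<sigma> *\<^sub>R e, q) \<in> Q" if "dist p x0 + h < R" "0 \<le> \<sigma>" "\<sigma> \<le> h" "dist q t0 < \<tau>" "q \<in> {0..1}" for p q \<sigma>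
      using that norm_triangle_ineq[of "p - x0" "\<sigma> *\<^sub>R e"] ne by (auto simp: Qx dist_norm algebra_simps)
    have upV: "(p + \<sigma> *\<^sub>R e, q) \<in> V" if "(p, q) \<in> Q" "r (p, q) \<le> 0" "dist p x0 + h < R" "0 < \<sigma>" "\<sigma> \<le> h" for p q \<sigma>
    proof -
      have m: "(p + \<sigma> *\<^sub>R e, q) \<in> Q" using that by (intro up) (auto simp: Qx)
      have "0 < c * \<sigma>" using c that by simp
      thus ?thesis using mono[OF that(1) _ m] that m by (auto simp: V)
    qed
    have rx: "dist x x0 + h < R" "dist y x0 + h < R" using room by (auto simp: zw)
    \<comment> \<open>The choice of h: rising by h along e lowers r by c h = (L + c) d, while the
      middle segment of length d raises it by at most L d. So r stays below 0 on the whole segment.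
      The total length 2h + d gives the constant of the lemma.\<close>
    have mid: "(x + h *\<^sub>R e, t) + \<sigma> *\<^sub>R (y - x, s - t) \<in> V" if "0 \<le> \<sigma>" "\<sigma> \<le> 1" for \<sigma>
    proof -
      have p: "(x + h *\<^sub>R e, t) + \<sigma> *\<^sub>R (y - x, s - t) = (((1 - \<sigma>) *\<^sub>R (x + h *\<^sub>R e) + \<sigma> *\<^sub>R (y + h *\<^sub>R e)), ((1 - \<sigma>) *\<^sub>R t + \<sigma> *\<^sub>R s))"
        by (simp add: algebra_simps)
      have cQ: "convex Q" unfolding Q slab_def by (intro convex_Int convex_Times) auto
      have e1: "(x + h *\<^sub>R e, t) \<in> Q" "(y + h *\<^sub>R e, s) \<in> Q" using rx tt h0 by (auto intro!: up)
      have "(1 - \<sigma>) *\<^sub>R (x + h *\<^sub>R e, t) + \<sigma> *\<^sub>R (y + h *\<^sub>R e, s) \<in> Q"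
        using convexD[OF cQ e1] that by auto
      hence pQ: "(x + h *\<^sub>R e, t) + \<sigma> *\<^sub>R (y - x, s - t) \<in> Q" unfolding p by simp
      have "r (x + h *\<^sub>R e, t) \<le> r (x, t) - c * h" using mono[OF zQ(1) _ e1(1)] h0 by simp
      moreover have "\<bar>r ((x + h *\<^sub>R e, t) + \<sigma> *\<^sub>R (y - x, s - t)) - r (x + h *\<^sub>R e, t)\<bar> \<le> L * (dist (x + h *\<^sub>R e + \<sigma> *\<^sub>R (y - x)) (x + h *\<^sub>R e) + dist (t + \<sigma> * (s - t)) t)"
        using lip[OF pQ e1(1)] tdiff by simp
      moreover have "dist (x + h *\<^sub>R e + \<sigma> *\<^sub>R (y - x)) (x + h *\<^sub>R e) + dist (t + \<sigma> * (s - t)) t = \<sigma> * d"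
      proof -
        have "dist (x + h *\<^sub>R e + \<sigma> *\<^sub>R (y - x)) (x + h *\<^sub>R e) = \<sigma> * dist x y"
          using that by (simp add: dist_norm norm_minus_commute)
        moreover have "dist (t + \<sigma> * (s - t)) t = \<sigma> * dist t s"
          using that by (simp add: dist_real_def abs_mult abs_minus_commute)
        ultimately show ?thesis by (simp add: d_def distrib_left)
      qed
      moreover have "L * (\<sigma> * d) \<le> L * (1 * d)" using L d0 that by (intro mult_left_mono mult_right_mono) auto
      moreover have "c * h = L * d + c * d" using c by (simp add: hd field_simps)
      moreover have "0 < c * d" using c d0 by simp
      ultimately have "r ((x + h *\<^sub>R e, t) + \<sigma> *\<^sub>R (y - x, s - t)) < 0" using zQ(3) by simp
      thus ?thesis using pQ by (simp add: V)
    qed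
    have VS: "V \<subseteq> S" by (auto simp: V S)
    have cont: "continuous_on {0..1} (\<lambda>\<sigma>. u (a + \<sigma> *\<^sub>R k))" if "\<And>\<sigma>. 0 \<le> \<sigma> \<Longrightarrow> \<sigma> \<le> 1 \<Longrightarrow> a + \<sigma> *\<^sub>R k \<in> S" for a k :: "complex \<times> real"
      by (rule continuous_on_compose2[OF cu]) (use that in \<open>auto intro!: continuous_intros\<close>)
    have Bz: "norm (u1 p) \<le> B \<and> norm (u2 p) \<le> B \<and> (0 < j \<longrightarrow> norm (ut p) \<le> B)"
      if "p \<in> V" "dist (fst p) x \<le> h + dist x y" "dist (snd p) t \<le> dist t s" for p
      using B[of p] that by (simp add: zw)
    have Bpos: "0 \<le> B"
    proof -
      have "(x + h *\<^sub>R e, t) \<in> V" using mid[of 0] by simp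
      from Bz[OF this] have "norm (u1 (x + h *\<^sub>R e, t)) \<le> B" using h0 ne by (simp add: dist_norm)
      thus ?thesis using norm_ge_zero order_trans by blast
    qed
    have A1: "norm (u ((x, t) + (h *\<^sub>R e, 0)) - u (x, t)) \<le> 2 * B * h"
    proof (rule affine_path_bound[OF g])
      show "continuous_on {0..1} (\<lambda>\<sigma>. u ((x, t) + \<sigma> *\<^sub>R (h *\<^sub>R e, 0)))"
      proof (rule cont)
        fix \<sigma> :: real assume "0 \<le> \<sigma>" "\<sigma> \<le> 1"
        thus "(x, t) + \<sigma> *\<^sub>R (h *\<^sub>R e, 0) \<in> S"
          using upV[OF zQ(1,3) rx(1), of "\<sigma> * h"] h0 zQ VS by (cases "\<sigma> = 0") (auto simp: S mult_left_le_one_le)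
      qed
      fix \<sigma> :: real assume \<sigma>: "0 < \<sigma>" "\<sigma> < 1"
      show m: "(x, t) + \<sigma> *\<^sub>R (h *\<^sub>R e, 0) \<in> V"
        using upV[OF zQ(1,3) rx(1), of "\<sigma> * h"] h0 \<sigma> by (auto simp: mult_left_le_one_le)
      have "dist (fst ((x, t) + \<sigma> *\<^sub>R (h *\<^sub>R e, 0))) x \<le> h + dist x y"
        using \<sigma> h0 ne mult_left_le_one_le[of h \<sigma>] by (auto simp: dist_norm intro: add_increasing2)
      from Bz[OF m this] have b: "norm (u1 ((x, t) + \<sigma> *\<^sub>R (h *\<^sub>R e, 0))) + norm (u2 ((x, t) + \<sigma> *\<^sub>R (h *\<^sub>R e, 0))) \<le> 2 * B"
        by simp
      show "norm (gradmap (u1 ((x, t) + \<sigma> *\<^sub>R (h *\<^sub>R e, 0))) (u2 ((x, t) + \<sigma> *\<^sub>R (h *\<^sub>R e, 0))) (ut ((x, t) + \<sigma> *\<^sub>R (h *\<^sub>R e, 0))) (h *\<^sub>R e, 0)) \<le> 2 * B * h"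
        by (rule order_trans[OF norm_gradmap_xt_le]) (use mult_right_mono[OF b, of h] h0 ne in simp)
    qed (use tt in auto)
    have A3: "norm (u ((y, s) + (h *\<^sub>R e, 0)) - u (y, s)) \<le> 2 * B * h"
    proof (rule affine_path_bound[OF g])
      show "continuous_on {0..1} (\<lambda>\<sigma>. u ((y, s) + \<sigma> *\<^sub>R (h *\<^sub>R e, 0)))"
      proof (rule cont)
        fix \<sigma> :: real assume "0 \<le> \<sigma>" "\<sigma> \<le> 1"
        thus "(y, s) + \<sigma> *\<^sub>R (h *\<^sub>R e, 0) \<in> S"
          using upV[OF zQ(2,4) rx(2), of "\<sigma> * h"] h0 zQ VS by (cases "\<sigma> = 0") (auto simp: S mult_left_le_one_le)
      qed
      fix \<sigma> :: real assume \<sigma>: "0 < \<sigma>" "\<sigma> < 1"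
      show m: "(y, s) + \<sigma> *\<^sub>R (h *\<^sub>R e, 0) \<in> V"
        using upV[OF zQ(2,4) rx(2), of "\<sigma> * h"] h0 \<sigma> by (auto simp: mult_left_le_one_le)
      have "dist (y + (\<sigma> * h) *\<^sub>R e) x \<le> dist y x + norm ((\<sigma> * h) *\<^sub>R e)"
        using norm_triangle_ineq[of "y - x" "(\<sigma> * h) *\<^sub>R e"] by (simp add: dist_norm algebra_simps)
      hence "dist (fst ((y, s) + \<sigma> *\<^sub>R (h *\<^sub>R e, 0))) x \<le> h + dist x y"
      proof -
        have "norm ((\<sigma> * h) *\<^sub>R e) \<le> h" using \<sigma> h0 ne by simp
        moreover have "dist y x = dist x y" by (rule dist_commute)
        ultimately have "dist (y + (\<sigma> * h) *\<^sub>R e) x \<le> h + dist x y"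
          using \<open>dist (y + (\<sigma> * h) *\<^sub>R e) x \<le> dist y x + norm ((\<sigma> * h) *\<^sub>R e)\<close> by linarith
        thus ?thesis by simp
      qed
      from Bz[OF m this] have b: "norm (u1 ((y, s) + \<sigma> *\<^sub>R (h *\<^sub>R e, 0))) + norm (u2 ((y, s) + \<sigma> *\<^sub>R (h *\<^sub>R e, 0))) \<le> 2 * B"
        by (simp add: dist_commute)
      show "norm (gradmap (u1 ((y, s) + \<sigma> *\<^sub>R (h *\<^sub>R e, 0))) (u2 ((y, s) + \<sigma> *\<^sub>R (h *\<^sub>R e, 0))) (ut ((y, s) + \<sigma> *\<^sub>R (h *\<^sub>R e, 0))) (h *\<^sub>R e, 0)) \<le> 2 * B * h"
        by (rule order_trans[OF norm_gradmap_xt_le]) (use mult_right_mono[OF b, of h] h0 ne in simp)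
    qed (use tt in auto)
    have A2: "norm (u ((x + h *\<^sub>R e, t) + (y - x, s - t)) - u (x + h *\<^sub>R e, t)) \<le> 2 * B * d"
    proof (rule affine_path_bound[OF g])
      show "continuous_on {0..1} (\<lambda>\<sigma>. u ((x + h *\<^sub>R e, t) + \<sigma> *\<^sub>R (y - x, s - t)))"
        by (rule cont) (use mid VS in blast)
      show "snd (y - x, s - t) = 0" if "j = 0" using tdiff[OF that] by simp
      fix \<sigma> :: real assume \<sigma>: "0 < \<sigma>" "\<sigma> < 1"
      show m: "(x + h *\<^sub>R e, t) + \<sigma> *\<^sub>R (y - x, s - t) \<in> V" using mid[of \<sigma>] \<sigma> by simp
      let ?p = "(x + h *\<^sub>R e, t) + \<sigma> *\<^sub>R (y - x, s - t)"
      have "norm (h *\<^sub>R e + \<sigma> *\<^sub>R (y - x)) \<le> h + \<sigma> * norm (y - x)"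
        by (rule order_trans[OF norm_triangle_ineq]) (use h0 ne \<sigma> in simp)
      moreover have "\<sigma> * norm (y - x) \<le> dist x y"
        using mult_left_le_one_le[of "norm (y - x)" \<sigma>] \<sigma> by (simp add: dist_norm norm_minus_commute)
      ultimately have "dist (fst ?p) x \<le> h + dist x y" by (simp add: dist_norm add.assoc)
      moreover have "dist (snd ?p) t \<le> dist t s"
        using mult_left_le_one_le[of "\<bar>s - t\<bar>" \<sigma>] \<sigma> by (simp add: dist_real_def abs_mult abs_minus_commute)
      ultimately have b: "norm (u1 ?p) + norm (u2 ?p) \<le> 2 * B" "0 < j \<longrightarrow> norm (ut ?p) \<le> B"
        using Bz[OF m] by auto
      have "norm (ut ?p) * \<bar>s - t\<bar> \<le> 2 * B * \<bar>s - t\<bar>"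
      proof (cases "j = 0")
        case True
        thus ?thesis using tdiff by simp
      next
        case False
        thus ?thesis using b(2) Bpos by (intro mult_right_mono) auto
      qed
      moreover have "(norm (u1 ?p) + norm (u2 ?p)) * norm (y - x) \<le> 2 * B * norm (y - x)"
        using b(1) by (intro mult_right_mono) auto
      moreover have "2 * B * norm (y - x) + 2 * B * \<bar>s - t\<bar> = 2 * B * d"
        by (simp add: d_def dist_norm norm_minus_commute dist_real_def abs_minus_commute algebra_simps)
      ultimately show "norm (gradmap (u1 ?p) (u2 ?p) (ut ?p) (y - x, s - t)) \<le> 2 * B * d"
        using norm_gradmap_xt_le[of "u1 ?p" "u2 ?p" "ut ?p" "y - x" "s - t"] by linarith
    qed (use tt in auto)
    have eq: "(x + h *\<^sub>R e, t) + (y - x, s - t) = (y, s) + (h *\<^sub>R e, 0)" "(x, t) + (h *\<^sub>R e, 0) = (x + h *\<^sub>R e, t)"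
      by simp_all
    have "norm (u (x, t) - u (y, s)) \<le> 2 * B * h + 2 * B * d + 2 * B * h"
      using A1 A2 A3 unfolding eq by norm
    also have "\<dots> = (4 * (L / c + 1) + 2) * B * d" unfolding hd by (simp only: ring_distribs) (simp add: mult_ac)
    finally show ?thesis by (simp add: zw d_def)
  qed
qed

lemma continuous_on_suminf:
  fixes g :: "nat \<Rightarrow> 'a::topological_space \<Rightarrow> 'b::banach"
  assumes "\<And>l. continuous_on S (g l)" "\<And>l z. z \<in> S \<Longrightarrow> norm (g l z) \<le> B l" "summable B"
  shows "continuous_on S (\<lambda>z. \<Sum>l. g l z)"
proof -
  have "uniform_limit S (\<lambda>n z. \<Sum>l<n. g l z) (\<lambda>z. \<Sum>l. g l z) sequentially"
    by (rule Weierstrass_m_test[OF _ assms(3)]) (use assms(2) in auto)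
  thus ?thesis
    by (rule uniform_limit_theorem[rotated]) (auto intro!: continuous_intros assms(1) always_eventually)
qed

lemma hcont_suminf:
  fixes g :: "nat \<Rightarrow> complex \<times> real \<Rightarrow> 'b::banach"
  assumes c: "\<And>l. continuous_on S (g l)" and B: "\<And>l z. z \<in> S \<Longrightarrow> norm (g l z) \<le> B l" "summable B"
    and H: "\<And>l x y t. (x, t) \<in> S \<Longrightarrow> (y, t) \<in> S \<Longrightarrow> norm (g l (x, t) - g l (y, t)) \<le> H l * dist x y powr \<alpha>" "summable H"
  shows "hcont \<alpha> S (\<lambda>z. \<Sum>l. g l z)"
proof (rule hcontI[where B = "suminf B" and H = "suminf H"])
  show "continuous_on S (\<lambda>z. \<Sum>l. g l z)" by (rule continuous_on_suminf[OF c B])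
  have s: "summable (\<lambda>l. g l z)" if "z \<in> S" for z
    by (rule summable_comparison_test'[OF B(2)]) (use B(1)[OF that] in auto)
  show "norm (\<Sum>l. g l z) \<le> suminf B" if "z \<in> S" for z
    by (rule norm_suminf_le[OF B(1)[OF that] B(2)])
  fix t x y assume xy: "(x, t) \<in> S" "(y, t) \<in> S"
  have "(\<Sum>l. g l (x, t)) - (\<Sum>l. g l (y, t)) = (\<Sum>l. g l (x, t) - g l (y, t))"
    by (rule suminf_diff[OF s[OF xy(1)] s[OF xy(2)]])
  also have "norm \<dots> \<le> (\<Sum>l. H l * dist x y powr \<alpha>)"
    by (rule norm_suminf_le[OF H(1)[OF xy] summable_mult2[OF H(2)]])
  also have "\<dots> = suminf H * dist x y powr \<alpha>" by (rule suminf_mult2[OF H(2), symmetric])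
  finally show "norm ((\<Sum>l. g l (x, t)) - (\<Sum>l. g l (y, t))) \<le> suminf H * dist x y powr \<alpha>" .
qed

section \<open>Boxes, and Seeley's extension in a chart\<close>

definition tbox :: "complex \<Rightarrow> real \<Rightarrow> real \<Rightarrow> real \<Rightarrow> (complex \<times> real) set" where
  "tbox x0 s t0 \<tau> = (ball x0 s \<times> ball t0 \<tau>) \<inter> slab"

lemma tbox_iff: "(x, t) \<in> tbox x0 s t0 \<tau> \<longleftrightarrow> dist x x0 < s \<and> dist t t0 < \<tau> \<and> t \<in> {0..1}"
  by (auto simp: tbox_def slab_def dist_commute)

lemma tbox_mono: "s \<le> s' \<Longrightarrow> tbox x0 s t0 \<tau> \<subseteq> tbox x0 s' t0 \<tau>"
  by (auto simp: tbox_def)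

lemma tbox_subset_slab: "tbox x0 s t0 \<tau> \<subseteq> slab"
  by (auto simp: tbox_def)

lemma tbox_open: "openin (top_of_set slab) (tbox x0 s t0 \<tau>)"
  unfolding tbox_def by (rule slab_box_open)

lemma convex_tbox: "convex (tbox x0 s t0 \<tau>)"
  unfolding tbox_def slab_def by (intro convex_Int convex_Times) auto

text \<open>Straight segments suffice because Q is convex. For j = 0 nothing is known across slices,
  so only points at the same time are compared.\<close>

lemma lipschitz_of_grad:
  fixes u :: "complex \<times> real \<Rightarrow> 'b::real_normed_vector"
  assumes g: "has_grad j Q u u1 u2 ut" and Q: "Q \<subseteq> slab" "convex Q" and c: "continuous_on Q u"
    and b: "\<And>z. z \<in> Q \<Longrightarrow> norm (u1 z) \<le> B" "\<And>z. z \<in> Q \<Longrightarrow> norm (u2 z) \<le> B" "\<And>z. z \<in> Q \<Longrightarrow> 0 < j \<Longrightarrow> norm (ut z) \<le> B"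
    and zw: "z \<in> Q" "w \<in> Q" "j = 0 \<Longrightarrow> snd z = snd w"
  shows "norm (u z - u w) \<le> 2 * B * (dist (fst z) (fst w) + dist (snd z) (snd w))"
proof -
  have B0: "0 \<le> B" using b(1)[OF zw(1)] norm_ge_zero order_trans by blast
  have m: "w + s *\<^sub>R (z - w) \<in> Q" if "0 \<le> s" "s \<le> 1" for s
  proof -
    have "(1 - s) *\<^sub>R w + s *\<^sub>R z \<in> Q" using that zw by (intro convexD[OF Q(2)]) auto
    thus ?thesis by (simp add: algebra_simps)
  qed
  have "norm (u (w + (z - w)) - u w) \<le> 2 * B * (dist (fst z) (fst w) + dist (snd z) (snd w))"
  proof (rule affine_path_bound[OF g])
    show "continuous_on {0..1} (\<lambda>s. u (w + s *\<^sub>R (z - w)))"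
      by (rule continuous_on_compose2[OF c]) (use m in \<open>auto intro!: continuous_intros\<close>)
    show "snd (z - w) = 0" if "j = 0" using zw(3)[OF that] by simp
    show "snd w \<in> {0..1}" "snd w + snd (z - w) \<in> {0..1}" using zw Q by (auto simp: slab_def)
    fix s :: real assume s: "0 < s" "s < 1"
    let ?p = "w + s *\<^sub>R (z - w)"
    show p: "?p \<in> Q" using m s by simp
    have "norm (ut ?p) * \<bar>snd (z - w)\<bar> \<le> 2 * B * \<bar>snd (z - w)\<bar>"
    proof (cases "j = 0")
      case True
      thus ?thesis using zw(3) by simp
    next
      case False
      thus ?thesis using b(3)[OF p] B0 by (intro mult_right_mono) auto
    qed
    moreover have "(norm (u1 ?p) + norm (u2 ?p)) * norm (fst (z - w)) \<le> 2 * B * norm (fst (z - w))"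
      using b(1,2)[OF p] by (intro mult_right_mono) auto
    ultimately show "norm (gradmap (u1 ?p) (u2 ?p) (ut ?p) (z - w)) \<le> 2 * B * (dist (fst z) (fst w) + dist (snd z) (snd w))"
      using norm_gradmap_xt_le[of "u1 ?p" "u2 ?p" "ut ?p" "fst (z - w)" "snd (z - w)"]
      unfolding prod.collapse by (simp add: dist_norm distrib_left)
  qed
  thus ?thesis by simp
qed

text \<open>Near a boundary point the domain is \<open>{r < 0}\<close> and \<open>r\<close> decreases at rate at least \<open>c\<close> in the
  direction \<open>e\<close>. A function on \<open>{r \<le> 0}\<close> is extended across \<open>{r = 0}\<close> by averaging its values at the points
  \<open>x + 2\<^sup>l \<delta> e\<close>, where \<open>\<delta> = 2 r\<^sup>+ / c\<close>: the moments of the reflection coefficients make all derivatives match.\<close>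

locale refl_chart =
  fixes x0 :: complex and R \<rho> t0 \<tau> c :: real and e :: complex and r :: "complex \<times> real \<Rightarrow> real"
  assumes pos: "0 < R" "0 < \<rho>" "0 < \<tau>" "0 < c" "3 * \<rho> \<le> R" and ne: "norm e = 1"
    and mono: "\<And>x t s. (x, t) \<in> tbox x0 R t0 \<tau> \<Longrightarrow> 0 \<le> s \<Longrightarrow> (x + s *\<^sub>R e, t) \<in> tbox x0 R t0 \<tau> \<Longrightarrow>
        r (x + s *\<^sub>R e, t) \<le> r (x, t) - c * s"
    and small: "\<And>z. z \<in> tbox x0 \<rho> t0 \<tau> \<Longrightarrow> r z < c * (R / 3)"
begin

text \<open>Three nested radii: \<rho> \<le> R/3 for the points where the extension is formed, 2R/3
  for their shifts, and R, so that paths between shifted points have room.\<close>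

definition "Q = tbox x0 R t0 \<tau>"
definition "Q1 = tbox x0 \<rho> t0 \<tau>"
definition "V2 = {z \<in> tbox x0 (2 * R / 3) t0 \<tau>. r z < 0}"
definition "S2 = {z \<in> tbox x0 (2 * R / 3) t0 \<tau>. r z \<le> 0}"

text \<open>The shift of index l. The cap R/3 keeps shifted points within radius 2R/3. It causes a
  kink at the value R/3, which is invisible because the factor \<eta> of \<open>extend\<close> will
  vanish beyond R/4; the kink at r = 0 is the one that the moments repair.\<close>

definition "\<sigma> l z = min (2 ^ l * (2 / c * max 0 (r z))) (R / 3)"
definition "P l z = (fst z + \<sigma> l z *\<^sub>R e, snd z)"

text \<open>Differentiating the shift of index l produces a factor 2^l, and differentiating the
  cutoff replaces \<eta> by its derivative. Keeping m and \<eta> as parameters makes the family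
  stable under differentiation; the extension proper is m = 0.\<close>

definition extend :: "nat \<Rightarrow> (real \<Rightarrow> real) \<Rightarrow> (complex \<times> real \<Rightarrow> 'b::banach) \<Rightarrow> complex \<times> real \<Rightarrow> 'b" where
  "extend m \<eta> f z = (\<Sum>l. (seeley l * (2 ^ l) ^ m * \<eta> (\<sigma> l z)) *\<^sub>R f (P l z))"

lemma Q1_Q: "Q1 \<subseteq> Q"
  unfolding Q1_def Q_def using pos by (intro tbox_mono) auto

lemma Q_slab: "Q \<subseteq> slab" "Q1 \<subseteq> slab" "V2 \<subseteq> slab"
  unfolding Q_def Q1_def V2_def by (blast intro: subsetD[OF tbox_subset_slab])+

lemma \<sigma>_bounds: "0 \<le> \<sigma> l z" "\<sigma> l z \<le> R / 3"
proof -
  show "\<sigma> l z \<le> R / 3" unfolding \<sigma>_def by (rule min.cobounded2)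
  show "0 \<le> \<sigma> l z" using pos by (simp add: \<sigma>_def)
qed

text \<open>An uncapped shift is at least 2r/c, so it lowers r by at least 2r and makes it negative;
  this is the origin of the factor 2. A capped shift lowers r by c R/3, which exceeds r by
  \<open>small\<close>.\<close>

lemma P_mem:
  assumes "z \<in> Q1"
  shows "P l z \<in> S2" "0 < r z \<Longrightarrow> P l z \<in> V2"
proof -
  obtain x t where z: "z = (x, t)" by force
  have b: "dist x x0 < \<rho>" "dist t t0 < \<tau>" "t \<in> {0..1}" using assms by (auto simp: z Q1_def tbox_iff)
  have "dist (x + \<sigma> l z *\<^sub>R e) x0 \<le> dist x x0 + norm (\<sigma> l z *\<^sub>R e)"
    using norm_triangle_ineq[of "x - x0" "\<sigma> l z *\<^sub>R e"] by (simp add: dist_norm algebra_simps)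
  hence "dist (x + \<sigma> l z *\<^sub>R e) x0 < 2 * R / 3" using b(1) pos \<sigma>_bounds[of l z] ne by simp
  hence P2: "P l z \<in> tbox x0 (2 * R / 3) t0 \<tau>" using b by (simp add: P_def z tbox_iff)
  hence PQ: "(x + \<sigma> l z *\<^sub>R e, t) \<in> tbox x0 R t0 \<tau>"
    using tbox_mono[of "2 * R / 3" R] pos by (auto simp: P_def z)
  have zQ: "(x, t) \<in> tbox x0 R t0 \<tau>" using assms Q1_Q by (auto simp: z Q_def)
  have m: "r (P l z) \<le> r z - c * \<sigma> l z" using mono[OF zQ \<sigma>_bounds(1) PQ] by (simp add: P_def z)
  have key: "r (P l z) \<le> 0 \<and> (0 < r z \<longrightarrow> r (P l z) < 0)"
  proof (cases "2 ^ l * (2 / c * max 0 (r z)) \<le> R / 3")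
    case True
    have "c * \<sigma> l z = 2 ^ l * (2 * max 0 (r z))" using True pos by (simp add: \<sigma>_def min_def)
    moreover have "1 * (2 * max 0 (r z)) \<le> 2 ^ l * (2 * max 0 (r z))" by (intro mult_right_mono) auto
    ultimately show ?thesis using m by (auto simp: max_def split: if_splits)
  next
    case False
    hence "\<sigma> l z = R / 3" by (simp add: \<sigma>_def min_def)
    hence "c * \<sigma> l z = c * (R / 3)" by simp
    hence "r (P l z) < 0" using m small[of z] assms unfolding Q1_def by linarith
    thus ?thesis by simp
  qed
  show "P l z \<in> S2" "0 < r z \<Longrightarrow> P l z \<in> V2" using P2 key by (auto simp: S2_def V2_def)
qed

lemma extend_inside:
  assumes "r z \<le> 0"
  shows "extend m \<eta> f z = (if m = 0 then \<eta> 0 *\<^sub>R f z else 0)"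
proof -
  have s: "\<sigma> l z = 0" for l using assms pos by (simp add: \<sigma>_def)
  have sm: "summable (\<lambda>l. seeley l * (2 ^ l) ^ m)"
    by (rule summable_norm_cancel) (use seeley_summable[of m] in \<open>simp add: abs_mult\<close>)
  have "extend m \<eta> f z = (\<Sum>l. (seeley l * (2 ^ l) ^ m) *\<^sub>R (\<eta> 0 *\<^sub>R f z))"
    by (simp add: extend_def s P_def)
  also have "\<dots> = (\<Sum>l. seeley l * (2 ^ l) ^ m) *\<^sub>R (\<eta> 0 *\<^sub>R f z)"
    by (rule bounded_linear.suminf[OF bounded_linear_scaleR_left sm, symmetric])
  finally show ?thesis by (simp add: seeley_moments)
qed

text \<open>The term of index l has a Hoelder constant of order 2^l, like the Lipschitz constant of
  its shift. The weights absorb this factor: the sum of constants is an absolute moment of order m +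
  1.\<close>

lemma extend_hcont:
  fixes f :: "complex \<times> real \<Rightarrow> 'b::banach"
  assumes \<alpha>: "0 < \<alpha>" "\<alpha> < 1" and f: "hcont \<alpha> S2 f"
    and cr: "continuous_on Q r" and L: "0 \<le> L"
    and lip: "\<And>x y t. (x, t) \<in> Q \<Longrightarrow> (y, t) \<in> Q \<Longrightarrow> \<bar>r (x, t) - r (y, t)\<bar> \<le> L * dist x y"
    and \<eta>: "smooth_upto (Suc 0) \<eta>"
  shows "hcont \<alpha> Q1 (extend m \<eta> f)"
proof -
  obtain B H where b: "continuous_on S2 f" "0 \<le> B" "0 \<le> H" "\<And>z. z \<in> S2 \<Longrightarrow> norm (f z) \<le> B"
    "\<And>t x y. (x, t) \<in> S2 \<Longrightarrow> (y, t) \<in> S2 \<Longrightarrow> norm (f (x, t) - f (y, t)) \<le> H * dist x y powr \<alpha>"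
    using f by (rule hcontE) blast
  obtain \<eta>' where \<eta>': "\<And>x. (\<eta> has_real_derivative \<eta>' x) (at x)" "continuous_on UNIV \<eta>'"
    using \<eta> unfolding smooth_upto_Suc smooth_upto_0 by blast
  have c\<eta>: "continuous_on UNIV \<eta>" using smooth_upto_imp_continuous[OF \<eta>] .
  have "bounded (\<eta> ` {0..R/3})" "bounded (\<eta>' ` {0..R/3})"
    by (auto intro!: compact_imp_bounded compact_continuous_image intro: continuous_on_subset[OF c\<eta>] continuous_on_subset[OF \<eta>'(2)])
  then obtain C L' where C: "\<And>x. x \<in> {0..R/3} \<Longrightarrow> norm (\<eta> x) \<le> C" and L': "\<And>x. x \<in> {0..R/3} \<Longrightarrow> norm (\<eta>' x) \<le> L'"
    unfolding bounded_iff by (meson imageI)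
  have zero: "(0::real) \<in> {0..R/3}" using pos by simp
  have C0: "0 \<le> C" "0 \<le> L'" using C[OF zero] L'[OF zero] norm_ge_zero order_trans by blast+
  have l\<eta>: "\<bar>\<eta> p - \<eta> q\<bar> \<le> L' * \<bar>p - q\<bar>" if "p \<in> {0..R/3}" "q \<in> {0..R/3}" for p q
    using field_differentiable_bound[where S = "{0..R/3}" and f = \<eta> and f' = \<eta>' and B = L' and x = p and y = q]
      \<eta>'(1) L' that by (auto intro: has_field_derivative_at_within)
  have \<sigma>m: "\<sigma> l z \<in> {0..R/3}" for l z using \<sigma>_bounds by simp
  \<comment> \<open>Chosen so that 2^l K is a Lipschitz constant in x of the shifted point
    \<open>P l\<close>.\<close>
  define K where "K = 1 + 2 / c * L"
  have K1: "1 \<le> K" using pos L by (simp add: K_def)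
  have \<sigma>lip: "\<bar>\<sigma> l (x, t) - \<sigma> l (y, t)\<bar> \<le> 2 ^ l * (2 / c * L) * dist x y" if "(x, t) \<in> Q" "(y, t) \<in> Q" for l x y t
  proof -
    have "\<bar>\<sigma> l (x, t) - \<sigma> l (y, t)\<bar> \<le> \<bar>2 ^ l * (2 / c * max 0 (r (x, t))) - 2 ^ l * (2 / c * max 0 (r (y, t)))\<bar>"
      unfolding \<sigma>_def by (auto simp: min_def)
    also have "\<dots> = 2 ^ l * (2 / c) * \<bar>max 0 (r (x, t)) - max 0 (r (y, t))\<bar>"
    proof -
      have "2 ^ l * (2 / c * a) - 2 ^ l * (2 / c * b) = (2 ^ l * (2 / c)) * (a - b)" for a b :: real
        by (simp only: right_diff_distrib mult.assoc)
      thus ?thesis using pos by (simp add: abs_mult)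
    qed
    also have "\<dots> \<le> 2 ^ l * (2 / c) * \<bar>r (x, t) - r (y, t)\<bar>"
      using pos by (intro mult_left_mono) auto
    also have "\<dots> \<le> 2 ^ l * (2 / c) * (L * dist x y)"
      using pos lip[OF that] by (intro mult_left_mono) auto
    finally show ?thesis by (simp add: mult_ac)
  qed
  have c\<sigma>: "continuous_on Q1 (\<sigma> l)" for l
    unfolding \<sigma>_def by (intro continuous_intros continuous_on_subset[OF cr Q1_Q])
  have cP: "continuous_on Q1 (P l)" for l
    unfolding P_def by (intro continuous_intros c\<sigma>)
  define M where "M = L' * (K + R / 3) * B + C * (H * K)"
  have M0: "0 \<le> M" unfolding M_def using C0 b K1 pos by (intro add_nonneg_nonneg mult_nonneg_nonneg) auto
  have trm: "norm (\<eta> (\<sigma> l (x, t)) *\<^sub>R f (P l (x, t)) - \<eta> (\<sigma> l (y, t)) *\<^sub>R f (P l (y, t))) \<le> 2 ^ l * M * dist x y powr \<alpha>"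
    if xy: "(x, t) \<in> Q1" "(y, t) \<in> Q1" for l x y t
  proof -
    have xyQ: "(x, t) \<in> Q" "(y, t) \<in> Q" using xy Q1_Q by auto
    have p2: "(1::real) \<le> 2 ^ l" by simp
    have a1: "\<bar>\<sigma> l (x, t) - \<sigma> l (y, t)\<bar> \<le> (2 ^ l * K + R / 3) * dist x y powr \<alpha>"
    proof (rule lipschitz_imp_hoelder)
      have "2 ^ l * (2 / c * L) * dist x y \<le> 2 ^ l * K * dist x y" by (intro mult_right_mono mult_left_mono) (auto simp: K_def)
      thus "\<bar>\<sigma> l (x, t) - \<sigma> l (y, t)\<bar> \<le> 2 ^ l * K * dist x y" using \<sigma>lip[OF xyQ, of l] by linarith
      show "\<bar>\<sigma> l (x, t) - \<sigma> l (y, t)\<bar> \<le> R / 3" using \<sigma>_bounds[of l "(x, t)"] \<sigma>_bounds[of l "(y, t)"] unfolding abs_le_iff by linarith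
    qed (use \<alpha> K1 pos in auto)
    have "1 * (R / 3) \<le> 2 ^ l * (R / 3)" using p2 pos by (intro mult_right_mono) auto
    hence "(2 ^ l * K + R / 3) * dist x y powr \<alpha> \<le> 2 ^ l * (K + R / 3) * dist x y powr \<alpha>"
      by (intro mult_right_mono) (simp_all add: distrib_left)
    hence a2: "\<bar>\<eta> (\<sigma> l (x, t)) - \<eta> (\<sigma> l (y, t))\<bar> \<le> L' * (2 ^ l * (K + R / 3) * dist x y powr \<alpha>)"
      using l\<eta>[OF \<sigma>m[of l "(x, t)"] \<sigma>m[of l "(y, t)"]] a1 C0(2)
      by (meson mult_left_mono order_trans)
    have P: "P l (x, t) = (x + \<sigma> l (x, t) *\<^sub>R e, t)" "P l (y, t) = (y + \<sigma> l (y, t) *\<^sub>R e, t)" by (simp_all add: P_def)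
    have Lpos: "2 ^ l * dist x y \<ge> dist x y" using p2 mult_right_mono[OF p2, of "dist x y"] by simp
    have "dist (x + \<sigma> l (x, t) *\<^sub>R e) (y + \<sigma> l (y, t) *\<^sub>R e) = norm ((x - y) + (\<sigma> l (x, t) - \<sigma> l (y, t)) *\<^sub>R e)"
      by (simp add: dist_norm algebra_simps)
    also have "\<dots> \<le> dist x y + \<bar>\<sigma> l (x, t) - \<sigma> l (y, t)\<bar>"
      by (rule order_trans[OF norm_triangle_ineq]) (simp add: ne dist_norm)
    also have "\<dots> \<le> 2 ^ l * dist x y + 2 ^ l * (2 / c * L) * dist x y"
      using \<sigma>lip[OF xyQ, of l] Lpos by linarith
    finally have "dist (x + \<sigma> l (x, t) *\<^sub>R e) (y + \<sigma> l (y, t) *\<^sub>R e) \<le> 2 ^ l * K * dist x y"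
      by (simp add: K_def distrib_left distrib_right)
    hence "dist (x + \<sigma> l (x, t) *\<^sub>R e) (y + \<sigma> l (y, t) *\<^sub>R e) powr \<alpha> \<le> (2 ^ l * K * dist x y) powr \<alpha>"
      using \<alpha> by (intro powr_mono2) auto
    also have "\<dots> = (2 ^ l * K) powr \<alpha> * dist x y powr \<alpha>" using K1 by (simp add: powr_mult)
    also have "\<dots> \<le> (2 ^ l * K) * dist x y powr \<alpha>"
    \<comment> \<open>Since 2^l K is at least 1, its power of exponent \<alpha> < 1 is at most
      itself.\<close>
    proof (rule mult_right_mono)
      have "1 \<le> 2 ^ l * K" using mult_mono[OF p2 K1] by simp
      thus "(2 ^ l * K) powr \<alpha> \<le> 2 ^ l * K" using powr_mono[of \<alpha> 1 "2 ^ l * K"] \<alpha> by simp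
    qed simp
    finally have "H * dist (x + \<sigma> l (x, t) *\<^sub>R e) (y + \<sigma> l (y, t) *\<^sub>R e) powr \<alpha> \<le> H * (2 ^ l * K * dist x y powr \<alpha>)"
      using b(3) by (rule mult_left_mono)
    hence a3: "norm (f (P l (x, t)) - f (P l (y, t))) \<le> H * (2 ^ l * K * dist x y powr \<alpha>)"
      using b(5)[of "x + \<sigma> l (x, t) *\<^sub>R e" t "y + \<sigma> l (y, t) *\<^sub>R e"] P_mem(1)[OF xy(1), of l] P_mem(1)[OF xy(2), of l]
      unfolding P by linarith
    have "\<eta> (\<sigma> l (x, t)) *\<^sub>R f (P l (x, t)) - \<eta> (\<sigma> l (y, t)) *\<^sub>R f (P l (y, t)) =
       (\<eta> (\<sigma> l (x, t)) - \<eta> (\<sigma> l (y, t))) *\<^sub>R f (P l (x, t)) + \<eta> (\<sigma> l (y, t)) *\<^sub>R (f (P l (x, t)) - f (P l (y, t)))"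
      by (simp add: algebra_simps)
    also have "norm \<dots> \<le> (L' * (2 ^ l * (K + R / 3) * dist x y powr \<alpha>)) * B + C * (H * (2 ^ l * K * dist x y powr \<alpha>))"
    proof (intro norm_triangle_le add_mono)
      show "norm ((\<eta> (\<sigma> l (x, t)) - \<eta> (\<sigma> l (y, t))) *\<^sub>R f (P l (x, t))) \<le> (L' * (2 ^ l * (K + R / 3) * dist x y powr \<alpha>)) * B"
        unfolding norm_scaleR using a2 b(4)[OF P_mem(1)[OF xy(1)], of l]
        by (intro mult_mono) (use order_trans[OF abs_ge_zero a2] in auto)
      show "norm (\<eta> (\<sigma> l (y, t)) *\<^sub>R (f (P l (x, t)) - f (P l (y, t)))) \<le> C * (H * (2 ^ l * K * dist x y powr \<alpha>))"
        unfolding norm_scaleR using C[OF \<sigma>m, of l "(y, t)"] a3 C0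
        by (intro mult_mono) auto
    qed
    also have "\<dots> = 2 ^ l * M * dist x y powr \<alpha>" by (simp add: M_def algebra_simps)
    finally show ?thesis .
  qed
  show ?thesis unfolding extend_def[abs_def]
  proof (rule hcont_suminf[where B = "\<lambda>l. (\<bar>seeley l\<bar> * (2 ^ l) ^ m) * (C * B)" and H = "\<lambda>l. (\<bar>seeley l\<bar> * (2 ^ l) ^ Suc m) * M"])
    show "summable (\<lambda>l. (\<bar>seeley l\<bar> * (2 ^ l) ^ m) * (C * B))" "summable (\<lambda>l. (\<bar>seeley l\<bar> * (2 ^ l) ^ Suc m) * M)"
      using seeley_summable by (rule summable_mult2)+
    fix l
    show "continuous_on Q1 (\<lambda>z. (seeley l * (2 ^ l) ^ m * \<eta> (\<sigma> l z)) *\<^sub>R f (P l z))"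
    proof (intro continuous_on_scaleR continuous_on_mult continuous_on_const)
      show "continuous_on Q1 (\<lambda>z. \<eta> (\<sigma> l z))" by (rule continuous_on_compose2[OF c\<eta> c\<sigma>]) auto
      show "continuous_on Q1 (\<lambda>z. f (P l z))" by (rule continuous_on_compose2[OF b(1) cP]) (use P_mem in auto)
    qed
    show "norm ((seeley l * (2 ^ l) ^ m * \<eta> (\<sigma> l z)) *\<^sub>R f (P l z)) \<le> (\<bar>seeley l\<bar> * (2 ^ l) ^ m) * (C * B)" if "z \<in> Q1" for z
    proof -
      have "norm (\<eta> (\<sigma> l z) *\<^sub>R f (P l z)) \<le> C * B"
        unfolding norm_scaleR using C[OF \<sigma>m, of l z] b(4)[OF P_mem(1)[OF that], of l] C0 by (intro mult_mono) auto
      hence "\<bar>seeley l * (2 ^ l) ^ m\<bar> * norm (\<eta> (\<sigma> l z) *\<^sub>R f (P l z)) \<le> \<bar>seeley l * (2 ^ l) ^ m\<bar> * (C * B)"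
        by (intro mult_left_mono) auto
      thus ?thesis by (simp add: abs_mult mult_ac)
    qed
    show "norm ((seeley l * (2 ^ l) ^ m * \<eta> (\<sigma> l (x, t))) *\<^sub>R f (P l (x, t)) - (seeley l * (2 ^ l) ^ m * \<eta> (\<sigma> l (y, t))) *\<^sub>R f (P l (y, t)))
        \<le> (\<bar>seeley l\<bar> * (2 ^ l) ^ Suc m) * M * dist x y powr \<alpha>" if xy: "(x, t) \<in> Q1" "(y, t) \<in> Q1" for x y t
    proof -
      have "(seeley l * (2 ^ l) ^ m * \<eta> (\<sigma> l (x, t))) *\<^sub>R f (P l (x, t)) - (seeley l * (2 ^ l) ^ m * \<eta> (\<sigma> l (y, t))) *\<^sub>R f (P l (y, t))
        = (seeley l * (2 ^ l) ^ m) *\<^sub>R (\<eta> (\<sigma> l (x, t)) *\<^sub>R f (P l (x, t)) - \<eta> (\<sigma> l (y, t)) *\<^sub>R f (P l (y, t)))"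
        by (simp add: algebra_simps)
      hence "norm ((seeley l * (2 ^ l) ^ m * \<eta> (\<sigma> l (x, t))) *\<^sub>R f (P l (x, t)) - (seeley l * (2 ^ l) ^ m * \<eta> (\<sigma> l (y, t))) *\<^sub>R f (P l (y, t)))
        = \<bar>seeley l * (2 ^ l) ^ m\<bar> * norm (\<eta> (\<sigma> l (x, t)) *\<^sub>R f (P l (x, t)) - \<eta> (\<sigma> l (y, t)) *\<^sub>R f (P l (y, t)))"
        by simp
      also have "\<dots> \<le> \<bar>seeley l * (2 ^ l) ^ m\<bar> * (2 ^ l * M * dist x y powr \<alpha>)"
        by (intro mult_left_mono trm[OF xy]) auto
      finally show ?thesis by (simp add: abs_mult mult_ac)
    qed
  qed
qed

end

section \<open>Differentiability of the extension across r = 0\<close>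

lemma has_derivative_gradmap_sum:
  assumes "finite A" "\<And>l. l \<in> A \<Longrightarrow> (g l has_derivative gradmap (a l) (b l) (d l)) F"
  shows "((\<lambda>z. \<Sum>l\<in>A. k l *\<^sub>R g l z) has_derivative
     gradmap (\<Sum>l\<in>A. k l *\<^sub>R a l) (\<Sum>l\<in>A. k l *\<^sub>R b l) (\<Sum>l\<in>A. k l *\<^sub>R d l)) F"
proof -
  have "((\<lambda>z. \<Sum>l\<in>A. k l *\<^sub>R g l z) has_derivative (\<lambda>w. \<Sum>l\<in>A. k l *\<^sub>R gradmap (a l) (b l) (d l) w)) F"
    by (intro has_derivative_sum has_derivative_scaleR_right assms(2))
  moreover have "(\<lambda>w. \<Sum>l\<in>A. k l *\<^sub>R gradmap (a l) (b l) (d l) w) =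
      gradmap (\<Sum>l\<in>A. k l *\<^sub>R a l) (\<Sum>l\<in>A. k l *\<^sub>R b l) (\<Sum>l\<in>A. k l *\<^sub>R d l)"
    unfolding gradmap_def scaleR_sum_right sum.distrib[symmetric]
    by (intro ext sum.cong refl) (simp add: algebra_simps)
  ultimately show ?thesis by simp
qed

context refl_chart
begin

text \<open>At a point z0 with r = 0 the candidate linear map is subtracted. The remainder has
  derivatives that are small near z0 on either side, and any y is joined to z0 within one side by a
  path of length comparable to |y - z0|, so the remainder changes by o(|y - z0|). On the side r > 0
  the path lemma is applied to -r and -e.\<close>

lemma crossing:
  fixes G :: "complex \<times> real \<Rightarrow> 'b::real_normed_vector"
  assumes gr: "has_grad j Q r r1 r2 rt" and cr: "continuous_on Q r"
    and br: "\<And>z. z \<in> Q \<Longrightarrow> norm (r1 z) \<le> B" "\<And>z. z \<in> Q \<Longrightarrow> norm (r2 z) \<le> B" "\<And>z. z \<in> Q \<Longrightarrow> 0 < j \<Longrightarrow> norm (rt z) \<le> B"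
    and g: "has_grad j {z \<in> Q1. r z \<noteq> 0} G F1 F2 Ft"
    and cG: "continuous_on Q1 G" and cF: "continuous_on Q1 F1" "continuous_on Q1 F2" "0 < j \<Longrightarrow> continuous_on Q1 Ft"
  shows "has_grad j Q1 G F1 F2 Ft"
  unfolding has_grad_def
proof
  fix z0 assume z0: "z0 \<in> Q1"
  show "(G has_derivative gradmap (F1 z0) (F2 z0) (Ft z0)) (at z0 within UNIV \<times> tdom j (snd z0))"
  proof (cases "r z0 = 0")
    case False
    thus ?thesis using has_gradD[OF g] z0 by simp
  next
    case r0: True
    obtain x t where zx: "z0 = (x, t)" by force
    have xt: "dist x x0 < \<rho>" "dist t t0 < \<tau>" "t \<in> {0..1}" using z0 by (auto simp: zx Q1_def tbox_iff)
    have B0: "0 \<le> B" using br(1)[of z0] z0 Q1_Q norm_ge_zero order_trans by blast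
    define K where "K = 2 * B / c + 1"
    have K1: "1 \<le> K" using B0 pos by (simp add: K_def)
    define C where "C = 4 * K + 2"
    have C0: "0 < C" using K1 by (simp add: C_def)
    have Q1e: "Q1 = (ball x0 \<rho> \<times> ball t0 \<tau>) \<inter> slab" by (simp add: Q1_def tbox_def)
    have lip: "\<bar>r z - r w\<bar> \<le> 2 * B * (dist (fst z) (fst w) + dist (snd z) (snd w))"
      if "z \<in> Q1" "w \<in> Q1" "j = 0 \<Longrightarrow> snd z = snd w" for z w
    proof -
      have "norm (r z - r w) \<le> 2 * B * (dist (fst z) (fst w) + dist (snd z) (snd w))"
        by (rule lipschitz_of_grad[OF gr Q_slab(1) _ cr br])
           (use that Q1_Q convex_tbox in \<open>auto simp: Q_def\<close>)
      thus ?thesis by simp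
    qed
    have mono1: "r (x + s *\<^sub>R e, t) \<le> r (x, t) - c * s" if "(x, t) \<in> Q1" "0 \<le> s" "(x + s *\<^sub>R e, t) \<in> Q1" for x t s
      using mono[of x t s] that Q1_Q by (auto simp: Q_def)
    have mono2: "- r (x + s *\<^sub>R (- e), t) \<le> - r (x, t) - c * s" if "(x, t) \<in> Q1" "0 \<le> s" "(x + s *\<^sub>R (- e), t) \<in> Q1" for x t s
      using mono1[of "x + s *\<^sub>R (- e)" t s] that by simp
    show ?thesis unfolding has_derivative_within_alt
    proof (intro conjI linear_gradmap allI impI)
      fix \<epsilon> :: real assume \<epsilon>: "0 < \<epsilon>"
      \<comment> \<open>C is the constant of \<open>path_bound\<close>; the factor 2 pays for
        bounding the sum of the distances in x and t by twice the norm.\<close>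
      define \<epsilon>' where "\<epsilon>' = \<epsilon> / (2 * C)"
      have e': "0 < \<epsilon>'" using \<epsilon> C0 by (simp add: \<epsilon>'_def)
      have oc: "\<exists>d>0. \<forall>w\<in>Q1. dist w z0 < d \<longrightarrow> norm (F w - F z0) \<le> \<epsilon>'" if "continuous_on Q1 F" for F :: "complex \<times> real \<Rightarrow> 'b"
        using that[unfolded continuous_on_iff, rule_format, OF z0 e'] by (auto simp: dist_norm intro: less_imp_le)
      obtain d1 where d1: "d1 > 0" "\<And>w. w \<in> Q1 \<Longrightarrow> dist w z0 < d1 \<Longrightarrow> norm (F1 w - F1 z0) \<le> \<epsilon>'" using oc[OF cF(1)] by blast
      obtain d2 where d2: "d2 > 0" "\<And>w. w \<in> Q1 \<Longrightarrow> dist w z0 < d2 \<Longrightarrow> norm (F2 w - F2 z0) \<le> \<epsilon>'" using oc[OF cF(2)] by blast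
      obtain d3 where d3: "d3 > 0" "\<And>w. w \<in> Q1 \<Longrightarrow> dist w z0 < d3 \<Longrightarrow> 0 < j \<Longrightarrow> norm (Ft w - Ft z0) \<le> \<epsilon>'"
      proof (cases "0 < j")
        case True
        thus ?thesis using oc[OF cF(3)[OF True]] that by blast
      next
        case False
        thus ?thesis using that[of 1] by auto
      qed
      define d where "d = min (min (min d1 d2) d3) (min (\<tau> - dist t t0) ((\<rho> - dist x x0) / 2))"
      have dp: "0 < d" using d1 d2 d3 xt by (simp add: d_def)
      \<comment> \<open>With |y - z0| < \<delta> one has D \<le> 2 \<delta> and K D \<le> d/8. The
        path then stays within 5 K D < d of z0, where the derivatives are close to their values at
        z0.\<close>
      define \<delta> where "\<delta> = d / (16 * K)"
      have \<delta>: "0 < \<delta>" "16 * K * \<delta> = d" using dp K1 by (auto simp: \<delta>_def)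
      define H where "H = (\<lambda>w. G w + gradmap (- F1 z0) (- F2 z0) (- Ft z0) w)"
      have gH: "has_grad j {z \<in> Q1. r z \<noteq> 0} H (\<lambda>w. F1 w + - F1 z0) (\<lambda>w. F2 w + - F2 z0) (\<lambda>w. Ft w + - Ft z0)"
        unfolding H_def
        by (rule has_grad_add[OF g]) (simp add: has_grad_def bounded_linear.has_derivative[OF linear_gradmap has_derivative_ident])
      have cH: "continuous_on Q1 H"
        unfolding H_def by (intro continuous_on_add cG bounded_linear.continuous_on[OF linear_gradmap] continuous_on_id)
      have main: "norm (H y - H z0) \<le> C * \<epsilon>' * (dist (fst y) x + dist (snd y) t)"
        if y: "y \<in> UNIV \<times> tdom j t" "norm (y - z0) < \<delta>" for y
      proof -
        define D where "D = dist (fst y) x + dist (snd y) t"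
        have dn: "dist (fst y) x \<le> norm (y - z0)" "dist (snd y) t \<le> norm (y - z0)"
          unfolding dist_norm[of y z0, symmetric] using dist_fst_le[of y z0] dist_snd_le[of y z0] by (simp_all add: zx)
        have D: "0 \<le> D" "D \<le> 2 * \<delta>" using dn y(2) by (auto simp: D_def)
        have KD: "K * D \<le> d / 8"
        proof -
          have "K * D \<le> K * (2 * \<delta>)" using D K1 by (intro mult_left_mono) auto
          thus ?thesis using \<delta> by simp
        qed
        have DK: "D \<le> K * D" using K1 D mult_right_mono[OF K1, of D] by simp
        have sy: "snd y \<in> {0..1}" using y(1) subsetD[OF tdom_subset[OF xt(3)]] by (auto simp: mem_Times_iff)
        have dx: "dist (fst y) x \<le> D" "dist (snd y) t \<le> D" by (auto simp: D_def)
        have drho: "d \<le> (\<rho> - dist x x0) / 2" "d \<le> \<tau> - dist t t0" 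
        proof -
          have "d \<le> min (\<tau> - dist t t0) ((\<rho> - dist x x0) / 2)" unfolding d_def by (rule min.cobounded2)
          thus "d \<le> (\<rho> - dist x x0) / 2" "d \<le> \<tau> - dist t t0" unfolding min.bounded_iff by auto
        qed
        have room1: "dist (fst y) x0 + K * D < \<rho>"
          using dist_triangle[of "fst y" x0 x] dx(1) DK KD dp drho xt(1) by argo
        have room2: "dist x x0 + K * D < \<rho>" using KD drho dp xt(1) by argo
        have "dist (snd y) t0 < \<tau>" using dist_triangle[of "snd y" t0 t] dx(2) DK KD dp drho xt(2) by argo
        moreover have "dist (fst y) x0 < \<rho>" using room1 DK D by argo
        ultimately have yQ: "y \<in> Q1" using sy by (cases y) (auto simp: Q1_def tbox_iff)
        have tj: "j = 0 \<Longrightarrow> snd y = snd z0" using y(1) by (auto simp: tdom_def zx mem_Times_iff)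
        have bd: "norm (F1 p + - F1 z0) \<le> \<epsilon>' \<and> norm (F2 p + - F2 z0) \<le> \<epsilon>' \<and> (0 < j \<longrightarrow> norm (Ft p + - Ft z0) \<le> \<epsilon>')"
          if p: "p \<in> Q1" "dist (fst p) (fst y) \<le> K * D + dist (fst y) x" "dist (snd p) (snd y) \<le> dist (snd y) t" for p
        proof -
          have "dist (fst p) x \<le> K * D + 2 * D" using dist_triangle[of "fst p" x "fst y"] p(2) dx(1) by argo
          moreover have "dist (snd p) t \<le> 2 * D" using dist_triangle[of "snd p" t "snd y"] p(3) dx(2) by argo
          moreover have "dist p z0 \<le> dist (fst p) x + dist (snd p) t"
            using dist_prod_le[of p z0] by (simp add: zx)
          ultimately have "dist p z0 \<le> 5 * (K * D)" using DK by argo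
          hence "dist p z0 < d" using KD dp by argo
          thus ?thesis using d1(2)[OF p(1)] d2(2)[OF p(1)] d3(2)[OF p(1)] by (simp add: d_def)
        qed
        have hK: "K * D = (2 * B / c + 1) * (dist (fst y) (fst z0) + dist (snd y) (snd z0))" by (simp add: K_def D_def zx)
        have goal: "norm (H y - H z0) \<le> (4 * (2 * B / c + 1) + 2) * \<epsilon>' * (dist (fst y) (fst z0) + dist (snd y) (snd z0))"
        proof (cases "r y \<le> 0")
          case True
          show ?thesis
          proof (rule path_bound[OF Q1e ne pos(4) _ mono1 lip refl refl _ _ _ _ tj hK])
            show "0 \<le> 2 * B" using B0 by simp
            show "has_grad j {z \<in> Q1. r z < 0} H (\<lambda>w. F1 w + - F1 z0) (\<lambda>w. F2 w + - F2 z0) (\<lambda>w. Ft w + - Ft z0)"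
              by (rule has_grad_subset[OF gH]) auto
            show "continuous_on {z \<in> Q1. r z \<le> 0} H" by (rule continuous_on_subset[OF cH]) auto
          qed (use True yQ z0 r0 room1 room2 bd in \<open>auto simp: zx\<close>)
        next
          case False
          show ?thesis
          proof (rule path_bound[where r = "\<lambda>z. - r z" and e = "- e", OF Q1e _ pos(4) _ mono2 _ refl refl _ _ _ _ tj hK])
            show "0 \<le> 2 * B" using B0 by simp
            show "norm (- e) = 1" using ne by simp
            show "\<bar>- r z - - r w\<bar> \<le> 2 * B * (dist (fst z) (fst w) + dist (snd z) (snd w))"
              if "z \<in> Q1" "w \<in> Q1" "j = 0 \<Longrightarrow> snd z = snd w" for z w
              using lip[OF that] by (simp add: abs_minus_commute)
            show "has_grad j {z \<in> Q1. - r z < 0} H (\<lambda>w. F1 w + - F1 z0) (\<lambda>w. F2 w + - F2 z0) (\<lambda>w. Ft w + - Ft z0)"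
              by (rule has_grad_subset[OF gH]) auto
            show "continuous_on {z \<in> Q1. - r z \<le> 0} H" by (rule continuous_on_subset[OF cH]) auto
          qed (use False yQ z0 r0 room1 room2 bd in \<open>auto simp: zx\<close>)
        qed
        thus ?thesis by (simp add: C_def K_def zx)
      qed
      show "\<exists>d>0. \<forall>y\<in>UNIV \<times> tdom j (snd z0). norm (y - z0) < d \<longrightarrow>
          norm (G y - G z0 - gradmap (F1 z0) (F2 z0) (Ft z0) (y - z0)) \<le> \<epsilon> * norm (y - z0)"
      proof (intro exI[of _ \<delta>] conjI \<delta>(1) ballI impI)
        fix y assume y: "y \<in> UNIV \<times> tdom j (snd z0)" "norm (y - z0) < \<delta>"
        have dn: "dist (fst y) x \<le> norm (y - z0)" "dist (snd y) t \<le> norm (y - z0)"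
          unfolding dist_norm[of y z0, symmetric] using dist_fst_le[of y z0] dist_snd_le[of y z0] by (simp_all add: zx)
        have "G y - G z0 - gradmap (F1 z0) (F2 z0) (Ft z0) (y - z0) = H y - H z0"
          by (simp add: H_def gradmap_def algebra_simps)
        hence "norm (G y - G z0 - gradmap (F1 z0) (F2 z0) (Ft z0) (y - z0)) \<le> C * \<epsilon>' * (dist (fst y) x + dist (snd y) t)"
          using main[of y] y by (simp add: zx)
        also have "\<dots> \<le> C * \<epsilon>' * (2 * norm (y - z0))" using dn C0 e' by (intro mult_left_mono) auto
        also have "\<dots> = \<epsilon> * norm (y - z0)" using C0 by (simp add: \<epsilon>'_def)
        finally show "norm (G y - G z0 - gradmap (F1 z0) (F2 z0) (Ft z0) (y - z0)) \<le> \<epsilon> * norm (y - z0)" .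
      qed
    qed
  qed
qed

text \<open>The terms of the series outside \<open>{r \<le> 0}\<close>, where only finitely many do not vanish.\<close>

lemma term_derivative:
  fixes f :: "complex \<times> real \<Rightarrow> 'b::banach"
  assumes gr: "has_grad j Q r r1 r2 rt" and cr: "continuous_on Q r"
    and gf: "has_grad j V2 f f1 f2 ft"
    and \<eta>: "\<And>x. (\<eta> has_real_derivative \<eta>' x) (at x)" "\<And>s. R / 4 < s \<Longrightarrow> \<eta> s = 0" "\<And>s. R / 4 < s \<Longrightarrow> \<eta>' s = 0"
    and z0: "z0 \<in> Q1" "0 < r z0"
  defines "D \<equiv> \<lambda>l p q. \<eta> (\<sigma> l z0) *\<^sub>R p + (2 ^ l * (2 / c * q)) *\<^sub>R (\<eta> (\<sigma> l z0) *\<^sub>R (Re e *\<^sub>R f1 (P l z0) + Im e *\<^sub>R f2 (P l z0)) + \<eta>' (\<sigma> l z0) *\<^sub>R f (P l z0))"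
  shows "((\<lambda>z. \<eta> (\<sigma> l z) *\<^sub>R f (P l z)) has_derivative
     gradmap (D l (f1 (P l z0)) (r1 z0)) (D l (f2 (P l z0)) (r2 z0)) (D l (ft (P l z0)) (rt z0))) (at z0 within UNIV \<times> tdom j (snd z0))"
proof -
  let ?T = "UNIV \<times> tdom j (snd z0)"
  have z0s: "z0 \<in> slab" using z0 Q_slab by auto
  define s where "s z = 2 ^ l * (2 / c * r z)" for z
  have s0: "0 < s z0" using z0 pos by (simp add: s_def)
  obtain d0 where d0: "d0 > 0" "\<And>w. w \<in> slab \<Longrightarrow> dist w z0 < d0 \<Longrightarrow> w \<in> Q1"
    using openin_slab_ball[OF tbox_open z0(1)[unfolded Q1_def]] unfolding Q1_def by blast
  have cs: "continuous_on Q1 s" unfolding s_def by (intro continuous_intros continuous_on_subset[OF cr Q1_Q])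
  have ev: "\<exists>d>0. \<forall>w\<in>?T. dist w z0 < d \<longrightarrow> w \<in> Q1 \<and> \<bar>s w - s z0\<bar> < \<epsilon>" if \<epsilon>: "0 < \<epsilon>" for \<epsilon>
  proof -
    obtain d where "d > 0" "\<And>w. w \<in> Q1 \<Longrightarrow> dist w z0 < d \<Longrightarrow> dist (s w) (s z0) < \<epsilon>"
      using cs[unfolded continuous_on_iff, rule_format, OF z0(1) \<epsilon>] by blast
    thus ?thesis using d0(1) subsetD[OF slab_tdom[OF z0s, of j], THEN d0(2)]
      by (intro exI[of _ "min d d0"]) (simp add: dist_real_def)
  qed
  have mem: "z0 \<in> ?T" using z0s by (auto simp: slab_def mem_Times_iff tdom_mem)
  have \<sigma>s: "\<sigma> l w = min (s w) (R / 3)" if "0 \<le> s w" for w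
  proof -
    have "0 \<le> r w"
    proof (rule ccontr)
      assume "\<not> 0 \<le> r w"
      hence "s w < 0" unfolding s_def using pos by (intro mult_pos_neg) auto
      thus False using that by simp
    qed
    thus ?thesis by (simp add: \<sigma>_def s_def)
  qed
  show ?thesis
  proof (cases "s z0 < R / 3")
    case True
    have "0 < min (s z0) (R / 3 - s z0)" using True s0 by simp
    from ev[OF this] obtain d where d: "d > 0" "\<And>w. w \<in> ?T \<Longrightarrow> dist w z0 < d \<Longrightarrow> \<bar>s w - s z0\<bar> < min (s z0) (R / 3 - s z0)" by blast
    have eq: "\<sigma> l w = s w" if "w \<in> ?T" "dist w z0 < d" for w
    proof -
      have "0 \<le> s w" "s w \<le> R / 3" using d(2)[OF that] by (simp_all, argo+)
      thus ?thesis using \<sigma>s[of w] by simp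
    qed
    have eq0: "\<sigma> l z0 = s z0" using eq[OF mem] d(1) by simp
    have ds: "(s has_derivative gradmap (2 ^ l * (2 / c * r1 z0)) (2 ^ l * (2 / c * r2 z0)) (2 ^ l * (2 / c * rt z0))) (at z0 within ?T)"
    proof -
      have "(r has_derivative gradmap (r1 z0) (r2 z0) (rt z0)) (at z0 within ?T)"
        using has_gradD[OF gr] z0 Q1_Q by blast
      hence "(s has_derivative (\<lambda>w. 2 ^ l * (2 / c * gradmap (r1 z0) (r2 z0) (rt z0) w))) (at z0 within ?T)"
        unfolding s_def by (intro has_derivative_mult_right)
      thus ?thesis by (rule has_derivative_eq_rhs) (simp add: gradmap_def fun_eq_iff algebra_simps)
    qed
    let ?gs = "gradmap (2 ^ l * (2 / c * r1 z0)) (2 ^ l * (2 / c * r2 z0)) (2 ^ l * (2 / c * rt z0))"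
    have d\<eta>: "((\<lambda>z. \<eta> (s z)) has_derivative (\<lambda>w. ?gs w * \<eta>' (s z0))) (at z0 within ?T)"
    proof -
      have "(\<eta> has_derivative (\<lambda>h. h * \<eta>' (s z0))) (at (s z0))"
        using \<eta>(1)[of "s z0"] by (simp add: has_field_derivative_def mult_commute_abs)
      from has_derivative_compose[OF ds this] show ?thesis .
    qed
    let ?P = "\<lambda>z. (fst z + s z *\<^sub>R e, snd z)"
    have Pe: "P l z0 = ?P z0" by (simp add: P_def eq0)
    have dP: "(?P has_derivative (\<lambda>w. (fst w + ?gs w *\<^sub>R e, snd w))) (at z0 within ?T)"
      by (intro has_derivative_Pair has_derivative_add has_derivative_scaleR_left ds has_derivative_fst has_derivative_snd has_derivative_ident)
    have df: "(f has_derivative gradmap (f1 (P l z0)) (f2 (P l z0)) (ft (P l z0))) (at (?P z0) within ?P ` ?T)"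
    proof -
      have "(f has_derivative gradmap (f1 (P l z0)) (f2 (P l z0)) (ft (P l z0))) (at (P l z0) within UNIV \<times> tdom j (snd z0))"
        using has_gradD[OF gf P_mem(2)[OF z0(1,2), of l]] by (simp add: P_def)
      thus ?thesis unfolding Pe by (rule has_derivative_subset) auto
    qed
    have dfP: "((\<lambda>z. f (?P z)) has_derivative (\<lambda>w. gradmap (f1 (P l z0)) (f2 (P l z0)) (ft (P l z0)) (fst w + ?gs w *\<^sub>R e, snd w))) (at z0 within ?T)"
      using diff_chain_within[OF dP df] by (simp add: o_def)
    have "((\<lambda>z. \<eta> (s z) *\<^sub>R f (?P z)) has_derivative
       gradmap (D l (f1 (P l z0)) (r1 z0)) (D l (f2 (P l z0)) (r2 z0)) (D l (ft (P l z0)) (rt z0))) (at z0 within ?T)"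
      by (rule has_derivative_eq_rhs[OF has_derivative_scaleR[OF d\<eta> dfP]])
         (simp add: fun_eq_iff gradmap_def D_def eq0 Pe scaleR_add_right scaleR_add_left algebra_simps)
    thus ?thesis
      by (rule has_derivative_transform_within[OF _ d(1) mem]) (simp add: P_def eq)
  next
    \<comment> \<open>The shift is capped or about to be, and not differentiable, but \<eta>
      vanishes on a neighbourhood of these shift values, so the term is locally zero, as is the
      claimed derivative.\<close>
    case False
    have "0 < R / 12" using pos by simp
    from ev[OF this] obtain d where d: "d > 0" "\<And>w. w \<in> ?T \<Longrightarrow> dist w z0 < d \<Longrightarrow> \<bar>s w - s z0\<bar> < R / 12" by blast
    have big: "R / 4 < \<sigma> l w" if "w \<in> ?T" "dist w z0 < d" for w
    proof -
      have "R / 4 < s w" using d(2)[OF that] False by argo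
      thus ?thesis using \<sigma>s[of w] pos by simp
    qed
    have "R / 4 < \<sigma> l z0" using big[OF mem] d(1) by simp
    hence "D l p q = 0" for p q by (simp add: D_def \<eta>(2,3))
    hence "((\<lambda>z. 0) has_derivative gradmap (D l (f1 (P l z0)) (r1 z0)) (D l (f2 (P l z0)) (r2 z0)) (D l (ft (P l z0)) (rt z0))) (at z0 within ?T)"
      by (simp add: gradmap_def[abs_def])
    thus ?thesis
      by (rule has_derivative_transform_within[OF _ d(1) mem]) (simp add: \<eta>(2)[OF big])
  qed
qed

text \<open>The chain rule: the shift of index l has gradient 2^l (2/c) grad r, so its contribution
  E is an extension of moment order m + 1, formed from the derivative of f along e and from \<eta>'.
  On r < 0 all such terms vanish and the formula is the plain derivative of the data; the two sides
  are joined by \<open>crossing\<close>.\<close>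

lemma extend_has_grad:
  fixes f :: "complex \<times> real \<Rightarrow> 'b::banach" and m :: nat
  assumes gr: "has_grad j Q r r1 r2 rt" and cr: "continuous_on Q r"
    and br: "\<And>z. z \<in> Q \<Longrightarrow> norm (r1 z) \<le> B" "\<And>z. z \<in> Q \<Longrightarrow> norm (r2 z) \<le> B" "\<And>z. z \<in> Q \<Longrightarrow> 0 < j \<Longrightarrow> norm (rt z) \<le> B"
    and gf: "has_grad j V2 f f1 f2 ft"
    and \<eta>: "\<And>x. (\<eta> has_real_derivative \<eta>' x) (at x)" "\<And>s. R / 4 < s \<Longrightarrow> \<eta> s = 0" "\<And>s. R / 4 < s \<Longrightarrow> \<eta>' s = 0"
  defines "E \<equiv> \<lambda>z. extend (Suc m) \<eta> (\<lambda>z. Re e *\<^sub>R f1 z + Im e *\<^sub>R f2 z) z + extend (Suc m) \<eta>' f z"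
  assumes cont: "continuous_on Q1 (extend m \<eta> f)"
     "continuous_on Q1 (\<lambda>z. extend m \<eta> f1 z + (2 / c * r1 z) *\<^sub>R E z)"
     "continuous_on Q1 (\<lambda>z. extend m \<eta> f2 z + (2 / c * r2 z) *\<^sub>R E z)"
     "0 < j \<Longrightarrow> continuous_on Q1 (\<lambda>z. extend m \<eta> ft z + (2 / c * rt z) *\<^sub>R E z)"
  shows "has_grad j Q1 (extend m \<eta> f) (\<lambda>z. extend m \<eta> f1 z + (2 / c * r1 z) *\<^sub>R E z)
     (\<lambda>z. extend m \<eta> f2 z + (2 / c * r2 z) *\<^sub>R E z) (\<lambda>z. extend m \<eta> ft z + (2 / c * rt z) *\<^sub>R E z)"
proof (rule crossing[OF gr cr br _ cont])
  let ?G = "\<lambda>g q z. extend m \<eta> g z + (2 / c * q z) *\<^sub>R E z"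
  show "has_grad j {z \<in> Q1. r z \<noteq> 0} (extend m \<eta> f) (?G f1 r1) (?G f2 r2) (?G ft rt)"
    unfolding has_grad_def
  proof
    fix z0 assume "z0 \<in> {z \<in> Q1. r z \<noteq> 0}"
    hence z0: "z0 \<in> Q1" "r z0 \<noteq> 0" by auto
    let ?T = "UNIV \<times> tdom j (snd z0)"
    have z0s: "z0 \<in> slab" using z0 Q_slab by auto
    have mem: "z0 \<in> ?T" using z0s by (auto simp: slab_def mem_Times_iff tdom_mem)
    obtain d0 where d0: "d0 > 0" "\<And>w. w \<in> slab \<Longrightarrow> dist w z0 < d0 \<Longrightarrow> w \<in> Q1"
      using openin_slab_ball[OF tbox_open z0(1)[unfolded Q1_def]] unfolding Q1_def by blast
    have "continuous_on Q1 r" by (rule continuous_on_subset[OF cr Q1_Q])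
    moreover have "0 < \<bar>r z0\<bar> / 2" using z0 by simp
    ultimately obtain d1 where d1: "d1 > 0" "\<And>w. w \<in> Q1 \<Longrightarrow> dist w z0 < d1 \<Longrightarrow> dist (r w) (r z0) < \<bar>r z0\<bar> / 2"
      using z0(1) unfolding continuous_on_iff by meson
    define d where "d = min d0 d1"
    have d: "d > 0" "\<And>w. w \<in> ?T \<Longrightarrow> dist w z0 < d \<Longrightarrow> w \<in> Q1 \<and> \<bar>r w - r z0\<bar> < \<bar>r z0\<bar> / 2"
    proof -
      show "d > 0" using d0 d1 by (simp add: d_def)
      fix w assume w: "w \<in> ?T" "dist w z0 < d"
      hence "w \<in> Q1" using d0(2) slab_tdom[OF z0s, of j] by (auto simp: d_def)
      thus "w \<in> Q1 \<and> \<bar>r w - r z0\<bar> < \<bar>r z0\<bar> / 2" using d1(2) w by (auto simp: d_def dist_real_def)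
    qed
    show "(extend m \<eta> f has_derivative gradmap (?G f1 r1 z0) (?G f2 r2 z0) (?G ft rt z0)) (at z0 within ?T)"
    proof (cases "r z0 < 0")
      case True
      have neg: "r w \<le> 0" if "w \<in> ?T" "dist w z0 < d" for w using d(2)[OF that] True by argo
      have E0: "E z0 = 0" using True by (simp add: E_def extend_inside)
      have z0V: "z0 \<in> V2" using z0 True tbox_mono[of \<rho> "2 * R / 3" x0 t0 \<tau>] pos by (auto simp: V2_def Q1_def)
      let ?k = "if m = 0 then \<eta> 0 else 0"
      have ek: "extend m \<eta> g w = ?k *\<^sub>R g w" if "r w \<le> 0" for g :: "complex \<times> real \<Rightarrow> 'b" and w
        using extend_inside[OF that, of m \<eta> g] by simp
      have "((\<lambda>w. ?k *\<^sub>R f w) has_derivative (\<lambda>w. ?k *\<^sub>R gradmap (f1 z0) (f2 z0) (ft z0) w)) (at z0 within ?T)"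
        by (intro has_derivative_scaleR_right has_gradD[OF gf z0V])
      hence "((\<lambda>w. ?k *\<^sub>R f w) has_derivative gradmap (?G f1 r1 z0) (?G f2 r2 z0) (?G ft rt z0)) (at z0 within ?T)"
        by (rule has_derivative_eq_rhs) (use True in \<open>simp add: ek E0 gradmap_def fun_eq_iff algebra_simps\<close>)
      thus ?thesis
        by (rule has_derivative_transform_within[OF _ d(1) mem]) (simp only: ek[OF neg])
    next
      case False
      hence rp: "0 < r z0" using z0 by simp
      \<comment> \<open>Near a point with r > 0 every shift of index at least N exceeds R/4, where
        the cutoff vanishes, so the series is locally a finite sum.\<close>
      obtain N :: nat where N: "R / 4 * c / r z0 < 2 ^ N" using real_arch_pow[of 2 "R / 4 * c / r z0"] by auto
      have big: "R / 4 < \<sigma> l w" if "w \<in> ?T" "dist w z0 < d" "N \<le> l" for w l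
      proof -
        have "r z0 / 2 < r w" using d(2)[OF that(1,2)] rp by argo
        have "(2::real) ^ N \<le> 2 ^ l" using that by (intro power_increasing) auto
        hence "R / 4 * c / r z0 < 2 ^ l" using N by linarith
        hence "R / 4 * c < 2 ^ l * r z0" using rp by (simp add: pos_divide_less_eq)
        also have "\<dots> \<le> 2 ^ l * (2 * r w)" using \<open>r z0 / 2 < r w\<close> by (intro mult_left_mono) auto
        finally have "R / 4 < 2 ^ l * (2 / c * r w)" using pos by (simp add: field_simps)
        moreover have "0 \<le> r w" using \<open>r z0 / 2 < r w\<close> rp by linarith
        ultimately show ?thesis using pos by (simp add: \<sigma>_def)
      qed
      have fin: "extend m' \<zeta> g w = (\<Sum>l<N. (seeley l * (2 ^ l) ^ m' * \<zeta> (\<sigma> l w)) *\<^sub>R g (P l w))"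
        if "w \<in> ?T" "dist w z0 < d" "\<And>s. R / 4 < s \<Longrightarrow> \<zeta> s = 0" for m' \<zeta> w and g :: "complex \<times> real \<Rightarrow> 'b"
        unfolding extend_def
        by (rule suminf_finite) (use big[OF that(1,2)] that(3) in \<open>auto simp: not_less\<close>)
      have fin1: "extend m' \<eta> g w = (\<Sum>l<N. (seeley l * (2 ^ l) ^ m' * \<eta> (\<sigma> l w)) *\<^sub>R g (P l w))"
        if "w \<in> ?T" "dist w z0 < d" for m' w and g :: "complex \<times> real \<Rightarrow> 'b"
        by (rule fin[OF that \<eta>(2)])
      have fin2: "extend m' \<eta>' g w = (\<Sum>l<N. (seeley l * (2 ^ l) ^ m' * \<eta>' (\<sigma> l w)) *\<^sub>R g (P l w))"
        if "w \<in> ?T" "dist w z0 < d" for m' w and g :: "complex \<times> real \<Rightarrow> 'b"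
        by (rule fin[OF that \<eta>(3)])
      let ?D = "\<lambda>l p q. \<eta> (\<sigma> l z0) *\<^sub>R p + (2 ^ l * (2 / c * q)) *\<^sub>R (\<eta> (\<sigma> l z0) *\<^sub>R (Re e *\<^sub>R f1 (P l z0) + Im e *\<^sub>R f2 (P l z0)) + \<eta>' (\<sigma> l z0) *\<^sub>R f (P l z0))"
      have Dsum: "(\<Sum>l<N. (seeley l * (2 ^ l) ^ m) *\<^sub>R ?D l (g (P l z0)) (q z0)) = ?G g q z0" for g q
      proof -
        have z: "dist z0 z0 < d" using d(1) by simp
        have "?G g q z0 = (\<Sum>l<N. (seeley l * (2 ^ l) ^ m * \<eta> (\<sigma> l z0)) *\<^sub>R g (P l z0)
          + (2 / c * q z0) *\<^sub>R ((seeley l * (2 ^ l) ^ Suc m * \<eta> (\<sigma> l z0)) *\<^sub>R (Re e *\<^sub>R f1 (P l z0) + Im e *\<^sub>R f2 (P l z0))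
            + (seeley l * (2 ^ l) ^ Suc m * \<eta>' (\<sigma> l z0)) *\<^sub>R f (P l z0)))"
          unfolding E_def fin1[OF mem z] fin2[OF mem z] scaleR_add_right[of "2 / c * q z0"]
          by (simp only: sum.distrib scaleR_sum_right)
        also have "\<dots> = (\<Sum>l<N. (seeley l * (2 ^ l) ^ m) *\<^sub>R ?D l (g (P l z0)) (q z0))"
          by (rule sum.cong[OF refl]) (simp add: scaleR_add_right mult_ac)
        finally show ?thesis by simp
      qed
      have "((\<lambda>z. \<Sum>l<N. (seeley l * (2 ^ l) ^ m) *\<^sub>R (\<eta> (\<sigma> l z) *\<^sub>R f (P l z))) has_derivative
        gradmap (?G f1 r1 z0) (?G f2 r2 z0) (?G ft rt z0)) (at z0 within ?T)"
        unfolding Dsum[symmetric]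
        by (rule has_derivative_gradmap_sum[OF finite_lessThan term_derivative[OF gr cr gf \<eta> z0(1) rp]])
      thus ?thesis
        by (rule has_derivative_transform_within[OF _ d(1) mem]) (simp add: fin1)
    qed
  qed
qed

text \<open>Induction on the order with m, \<eta> and f free: a derivative of an extension is a
  combination of extensions, multiplied by derivatives of r. The additional order of r makes it
  Lipschitz already at n = 0, where the Hoelder bound needs this.\<close>

theorem hreg_extend:
  fixes f :: "complex \<times> real \<Rightarrow> 'b::banach"
  assumes \<alpha>: "0 < \<alpha>" "\<alpha> < 1"
    and "hreg \<alpha> (Suc n) j Q Q r" "hreg \<alpha> n j V2 S2 f"
    and "smooth_upto (Suc n) \<eta>" "\<And>s. R / 4 < s \<Longrightarrow> \<eta> s = 0"
  shows "hreg \<alpha> n j Q1 Q1 (extend m \<eta> f)"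
  using assms(3-6)
proof (induction n arbitrary: j m \<eta> f)
  have base: "hcont \<alpha> Q1 (extend m \<eta> f)"
    if a: "hreg \<alpha> (Suc n) j Q Q r" and b: "hcont \<alpha> S2 f" "smooth_upto (Suc 0) \<eta>" for n j m \<eta> and f :: "complex \<times> real \<Rightarrow> 'b"
  proof -
    obtain r1 r2 rt where r: "hcont \<alpha> Q r" "has_grad j Q r r1 r2 rt" "hreg \<alpha> n j Q Q r1"
      "hreg \<alpha> n j Q Q r2" "0 < j \<longrightarrow> hreg \<alpha> n (j - 1) Q Q rt"
      using a by (rule hreg_SucE)
    obtain B1 where B1: "0 \<le> B1" "\<And>z. z \<in> Q \<Longrightarrow> norm (r1 z) \<le> B1" using hreg_imp_hcont[OF r(3)] by (rule hcontE) blast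
    obtain B2 where B2: "0 \<le> B2" "\<And>z. z \<in> Q \<Longrightarrow> norm (r2 z) \<le> B2" using hreg_imp_hcont[OF r(4)] by (rule hcontE) blast
    have g0: "has_grad 0 Q r r1 r2 rt" by (rule has_grad_mono[OF r(2) _ Q_slab(1)]) simp
    have cr: "continuous_on Q r" using hcont_imp_continuous_on[OF r(1)] .
    show ?thesis
    proof (rule extend_hcont[OF \<alpha> b(1) cr _ _ b(2)])
      show "0 \<le> 2 * max B1 B2" using B1 by simp
      fix x y t assume xy: "(x, t) \<in> Q" "(y, t) \<in> Q"
      have "norm (r (x, t) - r (y, t)) \<le> 2 * max B1 B2 * (dist (fst (x, t)) (fst (y, t)) + dist (snd (x, t)) (snd (y, t)))"
        by (rule lipschitz_of_grad[OF g0 Q_slab(1) _ cr _ _ _ xy])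
           (use B1(2) B2(2) convex_tbox in \<open>auto simp: Q_def simp: le_max_iff_disj\<close>)
      thus "\<bar>r (x, t) - r (y, t)\<bar> \<le> 2 * max B1 B2 * dist x y" by simp
    qed
  qed
  {
    case (0 j m \<eta> f)
    show ?case unfolding hreg_0
      by (rule base[OF 0(1) hreg_imp_hcont[OF 0(2)] 0(3)])
  next
    case (Suc n j m \<eta> f)
    obtain r1 r2 rt where r: "hcont \<alpha> Q r" "has_grad j Q r r1 r2 rt" "hreg \<alpha> (Suc n) j Q Q r1"
      "hreg \<alpha> (Suc n) j Q Q r2" "0 < j \<longrightarrow> hreg \<alpha> (Suc n) (j - 1) Q Q rt"
      using Suc.prems(1) by (rule hreg_SucE)
    obtain f1 f2 ft where f: "hcont \<alpha> S2 f" "has_grad j V2 f f1 f2 ft" "hreg \<alpha> n j V2 S2 f1"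
      "hreg \<alpha> n j V2 S2 f2" "0 < j \<longrightarrow> hreg \<alpha> n (j - 1) V2 S2 ft"
      using Suc.prems(2) by (rule hreg_SucE)
    obtain \<eta>' where \<eta>': "\<And>x. (\<eta> has_real_derivative \<eta>' x) (at x)" "smooth_upto (Suc n) \<eta>'"
      using Suc.prems(3) unfolding smooth_upto_Suc[of "Suc n"] by blast
    have \<eta>'0: "\<eta>' s = 0" if "R / 4 < s" for s
    proof -
      have "((\<lambda>s. 0) has_real_derivative 0) (at s)" by simp
      hence "(\<eta> has_real_derivative 0) (at s)"
        by (rule has_field_derivative_transform_within_open[of _ _ _ "{R/4<..}"]) (use that Suc.prems(4) in auto)
      thus ?thesis using \<eta>'(1) DERIV_unique by blast
    qed
    have s1: "smooth_upto (Suc n) \<eta>" using smooth_upto_down[OF Suc.prems(3)] .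
    have s0: "smooth_upto (Suc 0) \<eta>" using Suc.prems(3)
      by (induction n) (auto dest: smooth_upto_down)
    have rn: "hreg \<alpha> (Suc n) j Q Q r" "hreg \<alpha> (Suc n) (j - 1) Q Q r"
      using hreg_down[OF Suc.prems(1) Q_slab(1)] hreg_down'[OF Suc.prems(1) Q_slab(1)] by auto
    have fn: "hreg \<alpha> n j V2 S2 f" using hreg_down[OF Suc.prems(2) Q_slab(3)] .
    let ?fe = "\<lambda>z. Re e *\<^sub>R f1 z + Im e *\<^sub>R f2 z"
    have fe: "hreg \<alpha> n j V2 S2 ?fe"
      by (intro hreg_add hreg_bounded_linear[OF bounded_linear_scaleR_right] f)
    let ?E = "\<lambda>z. extend (Suc m) \<eta> ?fe z + extend (Suc m) \<eta>' f z"
    have E: "hreg \<alpha> n j Q1 Q1 ?E"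
      by (intro hreg_add Suc.IH[OF rn(1) fe s1 Suc.prems(4)] Suc.IH[OF rn(1) fn \<eta>'(2) \<eta>'0])
    have restr: "hreg \<alpha> n j' Q1 Q1 (\<lambda>z. 2 / c * g z)" if "hreg \<alpha> (Suc n) j' Q Q g" for j' and g :: "complex \<times> real \<Rightarrow> real"
      by (rule hreg_bounded_linear[OF bounded_linear_mult_right]) (rule hreg_mono[OF that], use Q1_Q Q_slab in auto)
    have D: "hreg \<alpha> n j' Q1 Q1 (\<lambda>z. extend m \<eta> g z + (2 / c * q z) *\<^sub>R ?E z)"
      if "hreg \<alpha> n j' V2 S2 g" "hreg \<alpha> (Suc n) j' Q Q q" "j' \<le> j" for j' q g
    proof -
      have r': "hreg \<alpha> (Suc n) j' Q Q r" by (rule hreg_mono[OF rn(1)]) (use that Q_slab in auto)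
      have E': "hreg \<alpha> n j' Q1 Q1 ?E" by (rule hreg_mono[OF E]) (use that Q_slab in auto)
      show ?thesis
        by (intro hreg_add hreg_scaleR restr that E' Q_slab Suc.IH[OF r' that(1) s1 Suc.prems(4)])
    qed
    have Dt: "hreg \<alpha> n (j - 1) Q1 Q1 (\<lambda>z. extend m \<eta> ft z + (2 / c * rt z) *\<^sub>R ?E z)" if "0 < j"
      by (rule D) (use r f that in auto)
    have D1: "hreg \<alpha> n j Q1 Q1 (\<lambda>z. extend m \<eta> f1 z + (2 / c * r1 z) *\<^sub>R ?E z)"
      and D2: "hreg \<alpha> n j Q1 Q1 (\<lambda>z. extend m \<eta> f2 z + (2 / c * r2 z) *\<^sub>R ?E z)"
      by (rule D; (rule r f order_refl))+
    obtain B1 where B1: "0 \<le> B1" "\<And>z. z \<in> Q \<Longrightarrow> norm (r1 z) \<le> B1" using hreg_imp_hcont[OF r(3)] by (rule hcontE) blast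
    obtain B2 where B2: "0 \<le> B2" "\<And>z. z \<in> Q \<Longrightarrow> norm (r2 z) \<le> B2" using hreg_imp_hcont[OF r(4)] by (rule hcontE) blast
    obtain B3 where B3: "0 \<le> B3" "\<And>z. z \<in> Q \<Longrightarrow> 0 < j \<Longrightarrow> norm (rt z) \<le> B3"
    proof (cases "0 < j")
      case True
      thus ?thesis using hreg_imp_hcont[OF r(5)[rule_format, OF True]] that by (elim hcontE) blast
    next
      case False
      thus ?thesis using that[of 0] by simp
    qed
    have hG: "hcont \<alpha> Q1 (extend m \<eta> f)" by (rule base[OF Suc.prems(1) f(1) s0])
    have G: "has_grad j Q1 (extend m \<eta> f) (\<lambda>z. extend m \<eta> f1 z + (2 / c * r1 z) *\<^sub>R ?E z)
      (\<lambda>z. extend m \<eta> f2 z + (2 / c * r2 z) *\<^sub>R ?E z) (\<lambda>z. extend m \<eta> ft z + (2 / c * rt z) *\<^sub>R ?E z)"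
      by (rule extend_has_grad[where B = "max B1 (max B2 B3)", OF r(2) hcont_imp_continuous_on[OF r(1)] _ _ _ f(2) \<eta>'(1) Suc.prems(4) \<eta>'0])
         (use B1(2) B2(2) B3(2) hcont_imp_continuous_on[OF hG] hcont_imp_continuous_on[OF hreg_imp_hcont[OF D1]]
           hcont_imp_continuous_on[OF hreg_imp_hcont[OF D2]] hcont_imp_continuous_on[OF hreg_imp_hcont[OF Dt]]
          in \<open>auto simp: le_max_iff_disj\<close>)
    show ?case by (rule hreg_SucI[OF hG G D1 D2 Dt])
  }
qed

end

subsection \<open>Convolution with compactly supported kernels\<close>

text \<open>A square rather than a disc, so that the integrals run over a \<open>cbox\<close>. It
  contains the disc of radius a, hence \<open>sq (2 / \<kappa>)\<close> carries every rescaled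
  kernel supported in the disc of radius 2.\<close>

definition sq :: "real \<Rightarrow> complex set" where "sq a = cbox (- Complex a a) (Complex a a)"

lemma sq_iff: "y \<in> sq a \<longleftrightarrow> \<bar>Re y\<bar> \<le> a \<and> \<bar>Im y\<bar> \<le> a"
  by (auto simp: sq_def in_cbox_complex_iff abs_le_iff)

lemma content_sq: "0 \<le> a \<Longrightarrow> measure lborel (cbox (- Complex a a) (Complex a a)) = 4 * a\<^sup>2"
  by (subst content_cbox) (auto simp: Basis_complex_def power2_eq_square)

text \<open>3/2 is a rational bound for sqrt 2. It is the source of the radius 3/\<kappa> in the
  later estimates.\<close>

lemma sq_norm_le: "y \<in> sq a \<Longrightarrow> norm y \<le> 3/2 * a"
proof -
  assume "y \<in> sq a"
  hence y: "\<bar>Re y\<bar> \<le> a" "\<bar>Im y\<bar> \<le> a" by (auto simp: sq_iff)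
  have a0: "0 \<le> a" using y(1) abs_ge_zero[of "Re y"] by linarith
  have "(Re y)\<^sup>2 \<le> a\<^sup>2" "(Im y)\<^sup>2 \<le> a\<^sup>2" using y a0 by (simp_all add: power2_le_iff_abs_le)
  hence "(norm y)\<^sup>2 \<le> 2 * a\<^sup>2" unfolding cmod_power2 by simp
  also have "\<dots> \<le> (3/2 * a)\<^sup>2" by (simp add: power_mult_distrib power_divide)
  finally show ?thesis by (rule power2_le_imp_le) (use a0 in simp)
qed

lemma not_sq_norm: "y \<notin> sq a \<Longrightarrow> a < norm y"
  using abs_Re_le_cmod[of y] abs_Im_le_cmod[of y] by (auto simp: sq_iff)

primrec kern :: "nat \<Rightarrow> (complex \<Rightarrow> complex) \<Rightarrow> bool" where
  "kern 0 = (\<lambda>\<Phi>. continuous_on UNIV \<Phi> \<and> (\<forall>y. 2 \<le> norm y \<longrightarrow> \<Phi> y = 0))"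
| "kern (Suc n) = (\<lambda>\<Phi>. continuous_on UNIV \<Phi> \<and> (\<forall>y. 2 \<le> norm y \<longrightarrow> \<Phi> y = 0) \<and>
     (\<exists>\<Phi>1 \<Phi>2. (\<forall>y. (\<Phi> has_derivative (\<lambda>h. Re h *\<^sub>R \<Phi>1 y + Im h *\<^sub>R \<Phi>2 y)) (at y)) \<and> kern n \<Phi>1 \<and> kern n \<Phi>2))"

declare kern.simps [simp del]

lemma kern_0: "kern 0 \<Phi> \<longleftrightarrow> continuous_on UNIV \<Phi> \<and> (\<forall>y. 2 \<le> norm y \<longrightarrow> \<Phi> y = 0)"
  by (simp add: kern.simps)

lemma kern_Suc: "kern (Suc n) \<Phi> \<longleftrightarrow> kern 0 \<Phi> \<and>
    (\<exists>\<Phi>1 \<Phi>2. (\<forall>y. (\<Phi> has_derivative (\<lambda>h. Re h *\<^sub>R \<Phi>1 y + Im h *\<^sub>R \<Phi>2 y)) (at y)) \<and> kern n \<Phi>1 \<and> kern n \<Phi>2)"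
  by (simp add: kern.simps)

lemma kern_imp_0: "kern n \<Phi> \<Longrightarrow> kern 0 \<Phi>"
  by (cases n) (auto simp: kern_0 kern.simps)

lemma kern_bounded:
  assumes "kern 0 \<Phi>" obtains M where "0 \<le> M" "\<And>y. norm (\<Phi> y) \<le> M"
proof -
  have "bounded (\<Phi> ` cball 0 2)"
    using assms by (auto intro!: compact_imp_bounded compact_continuous_image intro: continuous_on_subset simp: kern_0)
  then obtain M where M: "\<And>y. y \<in> cball 0 2 \<Longrightarrow> norm (\<Phi> y) \<le> M" unfolding bounded_iff by (meson imageI)
  have "0 \<le> M" using order_trans[OF norm_ge_zero M[of 0]] by simp
  moreover have "norm (\<Phi> y) \<le> M" for y
    using M[of y] assms \<open>0 \<le> M\<close> by (cases "norm y \<le> 2") (auto simp: kern_0)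
  ultimately show ?thesis using that by blast
qed

text \<open>Convolution of the slice of g at time t with y \<mapsto> \<Phi>(\<kappa> y), without
  normalising powers of \<kappa>; these enter later as the exponent in \<open>dyad\<close>. The area
  16/\<kappa>^2 of the square governs all bounds.\<close>

definition conv :: "real \<Rightarrow> (complex \<Rightarrow> complex) \<Rightarrow> (complex \<times> real \<Rightarrow> complex) \<Rightarrow> complex \<times> real \<Rightarrow> complex" where
  "conv \<kappa> \<Phi> g z = integral (sq (2 / \<kappa>)) (\<lambda>y. \<Phi> (\<kappa> *\<^sub>R y) * g (fst z - y, snd z))"

lemma kern_outside_sq:
  assumes "kern 0 \<Phi>" "0 < \<kappa>" "y \<notin> sq (2 / \<kappa>)" shows "\<Phi> (\<kappa> *\<^sub>R y) = 0"
proof -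
  have "2 \<le> \<kappa> * norm y" using not_sq_norm[OF assms(3)] assms(2) by (simp add: field_simps)
  thus ?thesis using assms by (simp add: kern_0)
qed

lemma conv_cont:
  assumes "kern 0 \<Phi>" "continuous_on slab g"
  shows "continuous_on slab (conv \<kappa> \<Phi> g)"
    and "t \<in> {0..1} \<Longrightarrow> (\<lambda>y. \<Phi> (\<kappa> *\<^sub>R y) * g (x - y, t)) integrable_on cbox a b"
proof -
  have c: "continuous_on UNIV \<Phi>" using assms(1) by (simp add: kern_0)
  have "continuous_on (slab \<times> cbox (- Complex (2/\<kappa>) (2/\<kappa>)) (Complex (2/\<kappa>) (2/\<kappa>))) (\<lambda>(z, y). \<Phi> (\<kappa> *\<^sub>R y) * g (fst z - y, snd z))"
    unfolding split_beta
    by (intro continuous_on_mult continuous_on_compose2[OF c] continuous_on_compose2[OF assms(2)] continuous_intros) (auto simp: slab_def)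
  from integral_continuous_on_param[OF this]
  show "continuous_on slab (conv \<kappa> \<Phi> g)" by (simp add: conv_def[abs_def] sq_def)
  show "(\<lambda>y. \<Phi> (\<kappa> *\<^sub>R y) * g (x - y, t)) integrable_on cbox a b" if "t \<in> {0..1}"
    by (intro integrable_continuous continuous_on_mult continuous_on_compose2[OF c] continuous_on_compose2[OF assms(2)] continuous_intros)
       (use that in \<open>auto simp: slab_def\<close>)
qed

lemma conv_has_integral:
  assumes "kern 0 \<Phi>" "continuous_on slab g" "t \<in> {0..1}" "0 < \<kappa>" "2 / \<kappa> \<le> a"
  shows "((\<lambda>y. \<Phi> (\<kappa> *\<^sub>R y) * g (x - y, t)) has_integral conv \<kappa> \<Phi> g (x, t)) (sq a)"
proof -
  have "((\<lambda>y. \<Phi> (\<kappa> *\<^sub>R y) * g (x - y, t)) has_integral conv \<kappa> \<Phi> g (x, t)) (sq (2 / \<kappa>))"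
    unfolding conv_def fst_conv snd_conv sq_def by (intro integrable_integral conv_cont assms)
  thus ?thesis
    by (rule has_integral_on_superset) (use assms kern_outside_sq in \<open>auto simp: sq_iff\<close>)
qed

lemma conv_bound:
  assumes "kern 0 \<Phi>" "continuous_on slab g" "t \<in> {0..1}" "0 < \<kappa>" and "\<And>y. norm (\<Phi> y) \<le> M"
    and "\<And>y. norm (g (y, t)) \<le> B" "0 \<le> M" "0 \<le> B"
  shows "norm (conv \<kappa> \<Phi> g (x, t)) \<le> M * B * (16 / \<kappa>\<^sup>2)"
proof -
  have "norm (conv \<kappa> \<Phi> g (x, t)) \<le> (M * B) * measure lborel (cbox (- Complex (2/\<kappa>) (2/\<kappa>)) (Complex (2/\<kappa>) (2/\<kappa>)))"
    using conv_has_integral[OF assms(1-4) order_refl, of x, unfolded sq_def]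
    by (rule has_integral_bound[rotated]) (use assms in \<open>auto simp: norm_mult intro!: mult_mono\<close>)
  thus ?thesis using assms(4) by (simp add: content_sq power_divide)
qed

text \<open>After g(x) is subtracted from the density, only its oscillation over distance 3/\<kappa>
  remains. For a kernel of mean zero this is a gain of \<kappa>^(-\<alpha>) over the trivial
  bound.\<close>

lemma conv_bound_mean:
  assumes "kern 0 \<Phi>" "continuous_on slab g" "t \<in> {0..1}" "0 < \<kappa>" and "\<And>y. norm (\<Phi> y) \<le> M"
    and H: "\<And>x y. norm (g (x, t) - g (y, t)) \<le> H * dist x y powr \<alpha>" "0 \<le> M" "0 \<le> H" "0 < \<alpha>"
  shows "norm (conv \<kappa> \<Phi> g (x, t) - conv \<kappa> \<Phi> (\<lambda>z. 1) (x, t) * g (x, t)) \<le> M * (H * (3 / \<kappa>) powr \<alpha>) * (16 / \<kappa>\<^sup>2)"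
proof -
  have 1: "((\<lambda>y. \<Phi> (\<kappa> *\<^sub>R y) * g (x - y, t)) has_integral conv \<kappa> \<Phi> g (x, t)) (sq (2 / \<kappa>))"
    by (rule conv_has_integral[OF assms(1-4) order_refl])
  have 2: "((\<lambda>y. \<Phi> (\<kappa> *\<^sub>R y) * 1 * g (x, t)) has_integral conv \<kappa> \<Phi> (\<lambda>z. 1) (x, t) * g (x, t)) (sq (2 / \<kappa>))"
    using has_integral_mult_left[OF conv_has_integral[OF assms(1) continuous_on_const assms(3,4) order_refl, of "1::complex" x]] by simp
  have "((\<lambda>y. \<Phi> (\<kappa> *\<^sub>R y) * (g (x - y, t) - g (x, t))) has_integral (conv \<kappa> \<Phi> g (x, t) - conv \<kappa> \<Phi> (\<lambda>z. 1) (x, t) * g (x, t))) (sq (2 / \<kappa>))"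
    using has_integral_diff[OF 1 2] by (simp add: algebra_simps)
  from this[unfolded sq_def] have "norm (conv \<kappa> \<Phi> g (x, t) - conv \<kappa> \<Phi> (\<lambda>z. 1) (x, t) * g (x, t)) \<le> (M * (H * (3 / \<kappa>) powr \<alpha>)) * measure lborel (cbox (- Complex (2/\<kappa>) (2/\<kappa>)) (Complex (2/\<kappa>) (2/\<kappa>)))"
  proof (rule has_integral_bound[rotated])
    fix y assume "y \<in> cbox (- Complex (2 / \<kappa>) (2 / \<kappa>)) (Complex (2 / \<kappa>) (2 / \<kappa>))"
    hence y: "y \<in> sq (2 / \<kappa>)" by (simp add: sq_def)
    have "dist (x - y) x powr \<alpha> \<le> (3 / \<kappa>) powr \<alpha>"
      using sq_norm_le[OF y] assms(4,9) by (intro powr_mono2) (auto simp: dist_norm)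
    hence "norm (g (x - y, t) - g (x, t)) \<le> H * (3 / \<kappa>) powr \<alpha>"
      using H(1)[of "x - y" x] mult_left_mono[of "dist (x - y) x powr \<alpha>" "(3 / \<kappa>) powr \<alpha>" H] H(3) by linarith
    thus "norm (\<Phi> (\<kappa> *\<^sub>R y) * (g (x - y, t) - g (x, t))) \<le> M * (H * (3 / \<kappa>) powr \<alpha>)"
      using assms(5)[of "\<kappa> *\<^sub>R y"] assms(7) by (auto simp: norm_mult intro!: mult_mono)
  qed (use assms in auto)
  thus ?thesis using assms(4) by (simp add: content_sq power_divide)
qed

lemma conv_has_grad:
  assumes k: "kern 0 \<Phi>" and \<kappa>: "0 < \<kappa>" and g: "has_grad j slab g g1 g2 gt"
    and c: "continuous_on slab g" "continuous_on slab g1" "continuous_on slab g2" "0 < j \<Longrightarrow> continuous_on slab gt"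
  shows "(x, t) \<in> slab \<Longrightarrow> ((\<lambda>s. conv \<kappa> \<Phi> g (x + s *\<^sub>R e, t)) has_vector_derivative
      (Re e *\<^sub>R conv \<kappa> \<Phi> g1 (x + s0 *\<^sub>R e, t) + Im e *\<^sub>R conv \<kappa> \<Phi> g2 (x + s0 *\<^sub>R e, t))) (at s0)"
    and "(x, t) \<in> slab \<Longrightarrow> 0 < j \<Longrightarrow> ((\<lambda>s. conv \<kappa> \<Phi> g (x, s)) has_vector_derivative conv \<kappa> \<Phi> gt (x, t)) (at t within {0..1})"
proof -
  have ck: "continuous_on UNIV \<Phi>" using k by (simp add: kern_0)
  let ?a = "Complex (2/\<kappa>) (2/\<kappa>)"
  assume xt: "(x, t) \<in> slab"
  hence t: "t \<in> {0..1}" by (auto simp: slab_def)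
  have "((\<lambda>s. integral (cbox (- ?a) ?a) (\<lambda>y. \<Phi> (\<kappa> *\<^sub>R y) * g (x + s *\<^sub>R e - y, t))) has_vector_derivative
     integral (cbox (- ?a) ?a) (\<lambda>y. \<Phi> (\<kappa> *\<^sub>R y) * (Re e *\<^sub>R g1 (x + s0 *\<^sub>R e - y, t) + Im e *\<^sub>R g2 (x + s0 *\<^sub>R e - y, t)))) (at s0 within UNIV)"
  proof (rule leibniz_rule_vector_derivative)
    fix s y
    have "((\<lambda>s. g ((x - y) + s *\<^sub>R e, t)) has_vector_derivative (Re e *\<^sub>R g1 ((x - y) + s *\<^sub>R e, t) + Im e *\<^sub>R g2 ((x - y) + s *\<^sub>R e, t))) (at s)"
      by (rule has_grad_dir_at[OF g _ t]) (use t in \<open>auto simp: slab_def\<close>)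
    hence "((\<lambda>s. g (x + s *\<^sub>R e - y, t)) has_vector_derivative (Re e *\<^sub>R g1 (x + s *\<^sub>R e - y, t) + Im e *\<^sub>R g2 (x + s *\<^sub>R e - y, t))) (at s)"
      by (simp add: algebra_simps)
    thus "((\<lambda>s. \<Phi> (\<kappa> *\<^sub>R y) * g (x + s *\<^sub>R e - y, t)) has_vector_derivative
       \<Phi> (\<kappa> *\<^sub>R y) * (Re e *\<^sub>R g1 (x + s *\<^sub>R e - y, t) + Im e *\<^sub>R g2 (x + s *\<^sub>R e - y, t))) (at s within UNIV)"
      by (intro has_vector_derivative_mult_right)
  next
    fix s show "(\<lambda>y. \<Phi> (\<kappa> *\<^sub>R y) * g (x + s *\<^sub>R e - y, t)) integrable_on cbox (- ?a) ?a"
      by (rule conv_cont(2)[OF k c(1) t])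
  next
    show "continuous_on (UNIV \<times> cbox (- ?a) ?a) (\<lambda>(s, y). \<Phi> (\<kappa> *\<^sub>R y) * (Re e *\<^sub>R g1 (x + s *\<^sub>R e - y, t) + Im e *\<^sub>R g2 (x + s *\<^sub>R e - y, t)))"
      unfolding split_beta
      by (intro continuous_on_mult continuous_on_add continuous_on_scaleR continuous_on_const continuous_on_compose2[OF ck]
          continuous_on_compose2[OF c(2)] continuous_on_compose2[OF c(3)] continuous_intros) (use t in \<open>auto simp: slab_def\<close>)
  qed auto
  moreover have "integral (cbox (- ?a) ?a) (\<lambda>y. \<Phi> (\<kappa> *\<^sub>R y) * (Re e *\<^sub>R g1 (x + s0 *\<^sub>R e - y, t) + Im e *\<^sub>R g2 (x + s0 *\<^sub>R e - y, t))) =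
     Re e *\<^sub>R conv \<kappa> \<Phi> g1 (x + s0 *\<^sub>R e, t) + Im e *\<^sub>R conv \<kappa> \<Phi> g2 (x + s0 *\<^sub>R e, t)"
  proof (rule integral_unique)
    have "((\<lambda>y. Re e *\<^sub>R (\<Phi> (\<kappa> *\<^sub>R y) * g1 (x + s0 *\<^sub>R e - y, t)) + Im e *\<^sub>R (\<Phi> (\<kappa> *\<^sub>R y) * g2 (x + s0 *\<^sub>R e - y, t))) has_integral
       Re e *\<^sub>R conv \<kappa> \<Phi> g1 (x + s0 *\<^sub>R e, t) + Im e *\<^sub>R conv \<kappa> \<Phi> g2 (x + s0 *\<^sub>R e, t)) (sq (2 / \<kappa>))"
      by (intro has_integral_add has_integral_cmul conv_has_integral k c t \<kappa> order_refl)
    thus "((\<lambda>y. \<Phi> (\<kappa> *\<^sub>R y) * (Re e *\<^sub>R g1 (x + s0 *\<^sub>R e - y, t) + Im e *\<^sub>R g2 (x + s0 *\<^sub>R e - y, t))) has_integral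
       Re e *\<^sub>R conv \<kappa> \<Phi> g1 (x + s0 *\<^sub>R e, t) + Im e *\<^sub>R conv \<kappa> \<Phi> g2 (x + s0 *\<^sub>R e, t)) (cbox (- ?a) ?a)"
      by (simp add: sq_def algebra_simps)
  qed
  ultimately show "((\<lambda>s. conv \<kappa> \<Phi> g (x + s *\<^sub>R e, t)) has_vector_derivative
      (Re e *\<^sub>R conv \<kappa> \<Phi> g1 (x + s0 *\<^sub>R e, t) + Im e *\<^sub>R conv \<kappa> \<Phi> g2 (x + s0 *\<^sub>R e, t))) (at s0)"
    by (simp add: conv_def[abs_def] sq_def)
  assume j: "0 < j"
  have "((\<lambda>s. integral (cbox (- ?a) ?a) (\<lambda>y. \<Phi> (\<kappa> *\<^sub>R y) * g (x - y, s))) has_vector_derivative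
     integral (cbox (- ?a) ?a) (\<lambda>y. \<Phi> (\<kappa> *\<^sub>R y) * gt (x - y, t))) (at t within {0..1})"
  proof (rule leibniz_rule_vector_derivative)
    fix s y assume s: "s \<in> {0..1::real}"
    have "((\<lambda>s. g (x - y, s)) has_vector_derivative gt (x - y, s)) (at s within {0..1})"
      by (rule has_grad_time[OF g _ s j]) (use s in \<open>auto simp: slab_def\<close>)
    thus "((\<lambda>s. \<Phi> (\<kappa> *\<^sub>R y) * g (x - y, s)) has_vector_derivative \<Phi> (\<kappa> *\<^sub>R y) * gt (x - y, s)) (at s within {0..1})"
      by (intro has_vector_derivative_mult_right)
  next
    fix s assume s: "s \<in> {0..1::real}"
    show "(\<lambda>y. \<Phi> (\<kappa> *\<^sub>R y) * g (x - y, s)) integrable_on cbox (- ?a) ?a"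
      by (rule conv_cont(2)[OF k c(1) s])
  next
    show "continuous_on ({0..1} \<times> cbox (- ?a) ?a) (\<lambda>(s, y). \<Phi> (\<kappa> *\<^sub>R y) * gt (x - y, s))"
      unfolding split_beta
      by (intro continuous_on_mult continuous_on_compose2[OF ck] continuous_on_compose2[OF c(4)[OF j]] continuous_intros) (auto simp: slab_def)
  qed (use t in auto)
  thus "((\<lambda>s. conv \<kappa> \<Phi> g (x, s)) has_vector_derivative conv \<kappa> \<Phi> gt (x, t)) (at t within {0..1})"
    by (simp add: conv_def[abs_def] sq_def)
qed

text \<open>A change of variables moves the translation from the density to the kernel. The density
  may be merely continuous, and the derivative costs a factor \<kappa>.\<close>

lemma conv_kernel_derivative:
  assumes k: "kern 0 \<Phi>" "kern 0 \<Phi>1" "kern 0 \<Phi>2" and d: "\<And>y. (\<Phi> has_derivative (\<lambda>h. Re h *\<^sub>R \<Phi>1 y + Im h *\<^sub>R \<Phi>2 y)) (at y)"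
    and \<kappa>: "0 < \<kappa>" and c: "continuous_on slab g" and t: "t \<in> {0..1}" and e: "norm e \<le> 1"
  shows "((\<lambda>s. conv \<kappa> \<Phi> g (x + s *\<^sub>R e, t)) has_vector_derivative
      \<kappa> *\<^sub>R (Re e *\<^sub>R conv \<kappa> \<Phi>1 g (x, t) + Im e *\<^sub>R conv \<kappa> \<Phi>2 g (x, t))) (at 0)"
proof -
  \<comment> \<open>A fixed square that contains the kernel squares translated by s e for all |s| <
    1, so that the domain of integration does not move with the parameter.\<close>
  define A where "A = 2 / \<kappa> + 1"
  have ck: "continuous_on UNIV \<Phi>" "continuous_on UNIV \<Phi>1" "continuous_on UNIV \<Phi>2" using k by (auto simp: kern_0)
  let ?a = "Complex A A"
  let ?k = "Complex (2/\<kappa>) (2/\<kappa>)"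
  have shift: "((\<lambda>w. \<Phi> (\<kappa> *\<^sub>R (w + s *\<^sub>R e)) * g (x - w, t)) has_integral conv \<kappa> \<Phi> g (x + s *\<^sub>R e, t)) (sq A)"
    if "s \<in> {-1<..<1}" for s
  proof -
    have "((\<lambda>y. \<Phi> (\<kappa> *\<^sub>R y) * g (x + s *\<^sub>R e - y, t)) has_integral conv \<kappa> \<Phi> g (x + s *\<^sub>R e, t)) (cbox (- ?k) ?k)"
      using conv_has_integral[OF k(1) c t \<kappa> order_refl, of "x + s *\<^sub>R e"] by (simp add: sq_def)
    from has_integral_affinity[OF this, of 1 "s *\<^sub>R e"]
    have "((\<lambda>w. \<Phi> (\<kappa> *\<^sub>R (w + s *\<^sub>R e)) * g (x - w, t)) has_integral conv \<kappa> \<Phi> g (x + s *\<^sub>R e, t)) ((\<lambda>w. w - s *\<^sub>R e) ` sq (2 / \<kappa>))"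
      by (simp add: sq_def algebra_simps)
    thus ?thesis
    proof (rule has_integral_on_superset)
      fix w assume "w \<notin> (\<lambda>w. w - s *\<^sub>R e) ` sq (2 / \<kappa>)"
      hence "w + s *\<^sub>R e \<notin> sq (2 / \<kappa>)" by (metis add_diff_cancel_right' image_eqI)
      thus "\<Phi> (\<kappa> *\<^sub>R (w + s *\<^sub>R e)) * g (x - w, t) = 0" using kern_outside_sq[OF k(1) \<kappa>] by simp
    next
      show "(\<lambda>w. w - s *\<^sub>R e) ` sq (2 / \<kappa>) \<subseteq> sq A"
      proof (rule image_subsetI)
        fix w assume w: "w \<in> sq (2 / \<kappa>)"
        have "\<bar>s\<bar> * norm e \<le> 1 * 1" by (rule mult_mono) (use that e in auto)
        hence "norm (s *\<^sub>R e) \<le> 1" by simp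
        hence "\<bar>Re (s *\<^sub>R e)\<bar> \<le> 1" "\<bar>Im (s *\<^sub>R e)\<bar> \<le> 1"
          using abs_Re_le_cmod[of "s *\<^sub>R e"] abs_Im_le_cmod[of "s *\<^sub>R e"] by linarith+
        thus "w - s *\<^sub>R e \<in> sq A" using w unfolding sq_iff A_def minus_complex.simps by linarith
      qed
    qed
  qed
  have "((\<lambda>s. integral (cbox (- ?a) ?a) (\<lambda>w. \<Phi> (\<kappa> *\<^sub>R (w + s *\<^sub>R e)) * g (x - w, t))) has_vector_derivative
     integral (cbox (- ?a) ?a) (\<lambda>w. (\<kappa> *\<^sub>R (Re e *\<^sub>R \<Phi>1 (\<kappa> *\<^sub>R (w + 0 *\<^sub>R e)) + Im e *\<^sub>R \<Phi>2 (\<kappa> *\<^sub>R (w + 0 *\<^sub>R e)))) * g (x - w, t))) (at 0 within {-1<..<1})"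
  proof (rule leibniz_rule_vector_derivative)
    fix s w
    have "((\<lambda>s. \<kappa> *\<^sub>R (w + s *\<^sub>R e)) has_derivative (\<lambda>h. \<kappa> *\<^sub>R (h *\<^sub>R e))) (at s)"
      by (auto intro!: derivative_eq_intros)
    from has_derivative_compose[OF this d]
    have "((\<lambda>s. \<Phi> (\<kappa> *\<^sub>R (w + s *\<^sub>R e))) has_vector_derivative \<kappa> *\<^sub>R (Re e *\<^sub>R \<Phi>1 (\<kappa> *\<^sub>R (w + s *\<^sub>R e)) + Im e *\<^sub>R \<Phi>2 (\<kappa> *\<^sub>R (w + s *\<^sub>R e)))) (at s)"
      unfolding has_vector_derivative_def by (rule has_derivative_eq_rhs) (simp add: algebra_simps fun_eq_iff)
    hence "((\<lambda>s. \<Phi> (\<kappa> *\<^sub>R (w + s *\<^sub>R e))) has_vector_derivative \<kappa> *\<^sub>R (Re e *\<^sub>R \<Phi>1 (\<kappa> *\<^sub>R (w + s *\<^sub>R e)) + Im e *\<^sub>R \<Phi>2 (\<kappa> *\<^sub>R (w + s *\<^sub>R e)))) (at s within {-1<..<1})"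
      by (rule has_vector_derivative_at_within)
    thus "((\<lambda>s. \<Phi> (\<kappa> *\<^sub>R (w + s *\<^sub>R e)) * g (x - w, t)) has_vector_derivative
        (\<kappa> *\<^sub>R (Re e *\<^sub>R \<Phi>1 (\<kappa> *\<^sub>R (w + s *\<^sub>R e)) + Im e *\<^sub>R \<Phi>2 (\<kappa> *\<^sub>R (w + s *\<^sub>R e)))) * g (x - w, t)) (at s within {-1<..<1})"
      by (rule has_vector_derivative_mult_left)
  next
    fix s :: real assume "s \<in> {-1<..<1}"
    thus "(\<lambda>w. \<Phi> (\<kappa> *\<^sub>R (w + s *\<^sub>R e)) * g (x - w, t)) integrable_on cbox (- ?a) ?a"
      using shift unfolding sq_def by (blast intro: has_integral_integrable)
  next
    show "continuous_on ({-1<..<1} \<times> cbox (- ?a) ?a)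
       (\<lambda>(s, w). (\<kappa> *\<^sub>R (Re e *\<^sub>R \<Phi>1 (\<kappa> *\<^sub>R (w + s *\<^sub>R e)) + Im e *\<^sub>R \<Phi>2 (\<kappa> *\<^sub>R (w + s *\<^sub>R e)))) * g (x - w, t))"
      unfolding split_beta
      by (intro continuous_on_mult continuous_on_add continuous_on_scaleR continuous_on_const continuous_on_compose2[OF ck(2)]
          continuous_on_compose2[OF ck(3)] continuous_on_compose2[OF c] continuous_intros) (use t in \<open>auto simp: slab_def\<close>)
  qed auto
  moreover have "integral (cbox (- ?a) ?a) (\<lambda>w. (\<kappa> *\<^sub>R (Re e *\<^sub>R \<Phi>1 (\<kappa> *\<^sub>R (w + 0 *\<^sub>R e)) + Im e *\<^sub>R \<Phi>2 (\<kappa> *\<^sub>R (w + 0 *\<^sub>R e)))) * g (x - w, t))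
     = \<kappa> *\<^sub>R (Re e *\<^sub>R conv \<kappa> \<Phi>1 g (x, t) + Im e *\<^sub>R conv \<kappa> \<Phi>2 g (x, t))"
  proof (rule integral_unique)
    have "((\<lambda>w. \<kappa> *\<^sub>R (Re e *\<^sub>R (\<Phi>1 (\<kappa> *\<^sub>R w) * g (x - w, t)) + Im e *\<^sub>R (\<Phi>2 (\<kappa> *\<^sub>R w) * g (x - w, t)))) has_integral
       \<kappa> *\<^sub>R (Re e *\<^sub>R conv \<kappa> \<Phi>1 g (x, t) + Im e *\<^sub>R conv \<kappa> \<Phi>2 g (x, t))) (sq A)"
      by (intro has_integral_add has_integral_cmul conv_has_integral k c t \<kappa>) (simp_all add: A_def)
    thus "((\<lambda>w. (\<kappa> *\<^sub>R (Re e *\<^sub>R \<Phi>1 (\<kappa> *\<^sub>R (w + 0 *\<^sub>R e)) + Im e *\<^sub>R \<Phi>2 (\<kappa> *\<^sub>R (w + 0 *\<^sub>R e)))) * g (x - w, t)) has_integral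
       \<kappa> *\<^sub>R (Re e *\<^sub>R conv \<kappa> \<Phi>1 g (x, t) + Im e *\<^sub>R conv \<kappa> \<Phi>2 g (x, t))) (cbox (- ?a) ?a)"
      by (simp add: sq_def algebra_simps)
  qed
  ultimately have "((\<lambda>s. integral (cbox (- ?a) ?a) (\<lambda>w. \<Phi> (\<kappa> *\<^sub>R (w + s *\<^sub>R e)) * g (x - w, t))) has_vector_derivative
     \<kappa> *\<^sub>R (Re e *\<^sub>R conv \<kappa> \<Phi>1 g (x, t) + Im e *\<^sub>R conv \<kappa> \<Phi>2 g (x, t))) (at 0 within {-1<..<1})"
    by (simp only:)
  hence D: "((\<lambda>s. integral (cbox (- ?a) ?a) (\<lambda>w. \<Phi> (\<kappa> *\<^sub>R (w + s *\<^sub>R e)) * g (x - w, t))) has_vector_derivative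
     \<kappa> *\<^sub>R (Re e *\<^sub>R conv \<kappa> \<Phi>1 g (x, t) + Im e *\<^sub>R conv \<kappa> \<Phi>2 g (x, t))) (at 0)"
    using at_within_open[of "0::real" "{-1<..<1}"] by simp
  show ?thesis
  proof (rule has_vector_derivative_transform_within_open[OF D])
    show "open {-1<..<1::real}" by simp
    show "integral (cbox (- ?a) ?a) (\<lambda>w. \<Phi> (\<kappa> *\<^sub>R (w + s *\<^sub>R e)) * g (x - w, t)) = conv \<kappa> \<Phi> g (x + s *\<^sub>R e, t)" if "s \<in> {-1<..<1}" for s
      using integral_unique[OF shift[OF that]] by (simp add: sq_def)
  qed auto
qed

text \<open>The kernel derivative has mean zero because \<open>conv \<kappa> \<Phi> 1\<close> is constant.\<close>

lemma conv_derivative_mean: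
  assumes k: "kern 0 \<Phi>" "kern 0 \<Phi>1" "kern 0 \<Phi>2" and d: "\<And>y. (\<Phi> has_derivative (\<lambda>h. Re h *\<^sub>R \<Phi>1 y + Im h *\<^sub>R \<Phi>2 y)) (at y)"
    and \<kappa>: "0 < \<kappa>" and t: "t \<in> {0..1}"
  shows "conv \<kappa> \<Phi>1 (\<lambda>z. 1) (x, t) = 0" "conv \<kappa> \<Phi>2 (\<lambda>z. 1) (x, t) = 0"
proof -
  have z: "\<kappa> *\<^sub>R (Re e *\<^sub>R conv \<kappa> \<Phi>1 (\<lambda>z. 1) (x, t) + Im e *\<^sub>R conv \<kappa> \<Phi>2 (\<lambda>z. 1) (x, t)) = 0" if e: "norm e \<le> 1" for e
  proof -
    have "((\<lambda>s. conv \<kappa> \<Phi> (\<lambda>z. 1) (x + s *\<^sub>R e, t)) has_vector_derivative 0) (at 0)"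
      by (simp add: conv_def)
    from vector_derivative_unique_at[OF conv_kernel_derivative[OF k d \<kappa> continuous_on_const t e, of 1 x] this]
    show ?thesis .
  qed
  show "conv \<kappa> \<Phi>1 (\<lambda>z. 1) (x, t) = 0" using z[of 1] \<kappa> by simp
  show "conv \<kappa> \<Phi>2 (\<lambda>z. 1) (x, t) = 0" using z[of \<i>] \<kappa> by simp
qed

lemma conv_double:
  assumes "kern 0 \<Phi>" "continuous_on slab g" "t \<in> {0..1}" "0 < \<kappa>"
  shows "conv \<kappa> (\<lambda>y. \<Phi> (2 *\<^sub>R y)) g (x, t) = conv (2 * \<kappa>) \<Phi> g (x, t)"
proof -
  have "2 / (2 * \<kappa>) \<le> 2 / \<kappa>" "0 < 2 * \<kappa>" using assms(4) by (simp_all add: field_simps)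
  from integral_unique[OF conv_has_integral[OF assms(1-3) this(2,1), of x]]
  show ?thesis by (simp add: conv_def)
qed

section \<open>Dyadic sums of convolutions and the gain of one derivative\<close>

lemma series_vector_derivative:
  fixes F :: "nat \<Rightarrow> real \<Rightarrow> 'b::banach"
  assumes S: "convex S" "s0 \<in> S"
    and d: "\<And>m s. s \<in> S \<Longrightarrow> (F m has_vector_derivative F' m s) (at s within S)"
    and b: "\<And>m s. s \<in> S \<Longrightarrow> norm (F' m s) \<le> b m" "summable b"
    and sm: "\<And>s. s \<in> S \<Longrightarrow> summable (\<lambda>m. F m s)"
  shows "((\<lambda>s. \<Sum>m. F m s) has_vector_derivative (\<Sum>m. F' m s0)) (at s0 within S)"
proof -
  have u: "uniform_limit S (\<lambda>n s. \<Sum>i<n. F' i s) (\<lambda>s. \<Sum>i. F' i s) sequentially"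
    by (rule Weierstrass_m_test[OF _ b(2)]) (use b(1) in auto)
  have "\<exists>g. \<forall>x\<in>S. (\<lambda>n. F n x) sums g x \<and> (g has_derivative (\<lambda>h. h *\<^sub>R (\<Sum>i. F' i x))) (at x within S)"
  proof (rule has_derivative_series[where f = F and f' = "\<lambda>n x h. h *\<^sub>R F' n x"
        and g' = "\<lambda>x h. h *\<^sub>R (\<Sum>i. F' i x)", OF S(1) _ _ S(2) summable_sums[OF sm[OF S(2)]]])
    show "(F n has_derivative (\<lambda>h. h *\<^sub>R F' n x)) (at x within S)" if "x \<in> S" for n x
      using d[OF that] by (simp add: has_vector_derivative_def)
    fix e :: real assume "0 < e"
    from uniform_limitD[OF u this]
    show "\<forall>\<^sub>F n in sequentially. \<forall>x\<in>S. \<forall>h. norm ((\<Sum>i<n. h *\<^sub>R F' i x) - h *\<^sub>R (\<Sum>i. F' i x)) \<le> e * norm h"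
    proof (rule eventually_mono, intro ballI allI)
      fix n x h assume a: "\<forall>x\<in>S. dist (\<Sum>i<n. F' i x) (\<Sum>i. F' i x) < e" and x: "x \<in> S"
      have "(\<Sum>i<n. h *\<^sub>R F' i x) - h *\<^sub>R (\<Sum>i. F' i x) = h *\<^sub>R ((\<Sum>i<n. F' i x) - (\<Sum>i. F' i x))"
        by (simp add: scaleR_sum_right scaleR_diff_right)
      moreover have "norm ((\<Sum>i<n. F' i x) - (\<Sum>i. F' i x)) \<le> e" using a x by (simp add: dist_norm less_imp_le)
      ultimately show "norm ((\<Sum>i<n. h *\<^sub>R F' i x) - h *\<^sub>R (\<Sum>i. F' i x)) \<le> e * norm h"
        by (simp add: mult.commute[of e] mult_left_mono)
    qed
  qed
  then obtain g where g: "\<And>x. x \<in> S \<Longrightarrow> (\<lambda>n. F n x) sums g x" "\<And>x. x \<in> S \<Longrightarrow> (g has_derivative (\<lambda>h. h *\<^sub>R (\<Sum>i. F' i x))) (at x within S)"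
    by blast
  have "g s = (\<Sum>m. F m s)" if "s \<in> S" for s using sums_unique[OF g(1)[OF that]] .
  hence "((\<lambda>s. \<Sum>m. F m s) has_derivative (\<lambda>h. h *\<^sub>R (\<Sum>i. F' i s0))) (at s0 within S)"
    by (intro has_derivative_transform[OF S(2) _ g(2)[OF S(2)]]) simp
  thus ?thesis by (simp add: has_vector_derivative_def)
qed

lemma sum_powers_le:
  fixes q :: real assumes "0 < q" "q < 1"
  shows "(\<Sum>m<N. q ^ (N - Suc m)) \<le> 1 / (1 - q)"
proof -
  have "(\<Sum>m<N. q ^ (N - Suc m)) = (\<Sum>m<N. q ^ m)" by (rule sum.nat_diff_reindex)
  also have "\<dots> \<le> (\<Sum>m. q ^ m)" using assms by (intro sum_le_suminf summable_geometric) auto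
  finally show ?thesis using assms by (simp add: suminf_geometric)
qed

text \<open>The balance of the two bounds is at the scale \<open>\<kappa> = 1/d\<close>.\<close>

lemma dyadic_min_sum:
  fixes \<kappa> :: "nat \<Rightarrow> real"
  assumes \<alpha>: "0 < \<alpha>" "\<alpha> < 1" and k0: "0 < k0" and \<kappa>: "\<And>m. \<kappa> m = 2 ^ m * k0"
  shows "\<exists>C\<ge>0. \<forall>d a. 0 < d \<longrightarrow> (\<forall>m. 0 \<le> a m \<and> a m \<le> \<kappa> m powr (-\<alpha>) \<and> a m \<le> \<kappa> m powr (1 - \<alpha>) * d)
     \<longrightarrow> summable a \<and> suminf a \<le> C * d powr \<alpha>"
proof -
  \<comment> \<open>The decay per dyadic step of the two bounds, going up and going down from the
    scale 1/d.\<close>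
  define q1 q2 :: real where "q1 = 2 powr (-\<alpha>)" and "q2 = 2 powr (-(1 - \<alpha>))"
  have q: "0 < q1" "q1 < 1" "0 < q2" "q2 < 1" using \<alpha> by (auto simp: q1_def q2_def powr_less_one)
  have kp: "0 < \<kappa> m" for m using k0 by (simp add: \<kappa>)
  show ?thesis
  proof (rule exI[of _ "1 / (1 - q1) + 1 / (1 - q2)"], rule conjI, goal_cases)
    case 1
    show "0 \<le> 1 / (1 - q1) + 1 / (1 - q2)" using q by (intro add_nonneg_nonneg) auto
  next
    case 2
    show ?case
    proof (intro allI impI)
    fix d :: real and a :: "nat \<Rightarrow> real"
    assume d: "0 < d" and "\<forall>m. 0 \<le> a m \<and> a m \<le> \<kappa> m powr (-\<alpha>) \<and> a m \<le> \<kappa> m powr (1 - \<alpha>) * d"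
    hence a: "0 \<le> a m" "a m \<le> \<kappa> m powr (-\<alpha>)" "a m \<le> \<kappa> m powr (1 - \<alpha>) * d" for m by auto
    define r where "r m = \<kappa> m * d" for m
    have rp: "0 < r m" for m using kp d by (simp add: r_def)
    have rS: "r (m + i) = 2 ^ i * r m" for m i by (simp add: r_def \<kappa> power_add)
    have a1: "a m \<le> r m powr (-\<alpha>) * d powr \<alpha>" for m
    proof -
      have "r m powr (-\<alpha>) * d powr \<alpha> = \<kappa> m powr (-\<alpha>) * (d powr (-\<alpha>) * d powr \<alpha>)"
        using kp[of m] d by (simp add: r_def powr_mult)
      also have "d powr (-\<alpha>) * d powr \<alpha> = 1" using d by (simp add: powr_add[symmetric])
      finally show ?thesis using a(2)[of m] by simp
    qed
    have a2: "a m \<le> r m powr (1 - \<alpha>) * d powr \<alpha>" for m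
    proof -
      have "r m powr (1 - \<alpha>) * d powr \<alpha> = \<kappa> m powr (1 - \<alpha>) * (d powr (1 - \<alpha>) * d powr \<alpha>)"
        using kp[of m] d by (simp add: r_def powr_mult)
      also have "d powr (1 - \<alpha>) * d powr \<alpha> = d" using d by (simp add: powr_add[symmetric])
      finally show ?thesis using a(3)[of m] by simp
    qed
    have pw: "(2 ^ i) powr (-\<alpha>) = q1 ^ i" "inverse (2 ^ i) powr (1 - \<alpha>) = q2 ^ i" for i :: nat
    proof -
      have e: "(2::real) ^ i = 2 powr real i" by (simp add: powr_realpow)
      show "(2 ^ i) powr (-\<alpha>) = q1 ^ i" unfolding e q1_def by (simp add: powr_powr powr_realpow[symmetric] mult.commute)
      show "inverse (2 ^ i) powr (1 - \<alpha>) = q2 ^ i" unfolding e q2_def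
        by (simp add: powr_powr powr_realpow[symmetric] powr_minus[symmetric] mult.commute algebra_simps)
    qed
    \<comment> \<open>The first scale with \<kappa>_N d \<ge> 1. From N on the bound by size is
      summed as a geometric series in q1; below N the Lipschitz type bound is summed backwards as
      one in q2.\<close>
    obtain N where N: "1 \<le> r N" "\<And>m. m < N \<Longrightarrow> r m < 1"
    proof -
      have "\<exists>n. 1 \<le> r n"
      proof -
        obtain n where "1 / (k0 * d) < 2 ^ n" using real_arch_pow[of 2 "1 / (k0 * d)"] by auto
        hence "1 \<le> r n" using k0 d by (simp add: r_def \<kappa> field_simps)
        thus ?thesis ..
      qed
      hence "1 \<le> r (LEAST n. 1 \<le> r n)" by (rule LeastI_ex)
      moreover have "r m < 1" if "m < (LEAST n. 1 \<le> r n)" for m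
        using not_less_Least[OF that] by simp
      ultimately show ?thesis by (rule that)
    qed
    have t1: "a (m + N) \<le> q1 ^ m * d powr \<alpha>" for m
    proof -
      have "r (m + N) powr (-\<alpha>) = (2 ^ m) powr (-\<alpha>) * r N powr (-\<alpha>)"
        unfolding add.commute[of m] rS using rp[of N] by (simp add: powr_mult)
      also have "\<dots> \<le> q1 ^ m * 1"
        unfolding pw using N(1) \<alpha> q by (intro mult_left_mono) (auto simp: powr_minus_divide ge_one_powr_ge_zero)
      finally have "r (m + N) powr (-\<alpha>) * d powr \<alpha> \<le> q1 ^ m * d powr \<alpha>" by (intro mult_right_mono) auto
      thus ?thesis using a1[of "m + N"] by linarith
    qed
    have t2: "a m \<le> q2 ^ (N - Suc m) * d powr \<alpha>" if "m < N" for m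
    proof -
      define i where "i = N - Suc m"
      have i: "m + i < N" "m + i = N - 1" using that by (auto simp: i_def)
      have "2 ^ i * r m < 1" using N(2)[OF i(1)] by (simp add: rS)
      hence "r m \<le> inverse (2 ^ i)" by (simp add: field_simps)
      hence "r m powr (1 - \<alpha>) \<le> inverse (2 ^ i) powr (1 - \<alpha>)" using rp[of m] \<alpha> by (intro powr_mono2) auto
      hence "r m powr (1 - \<alpha>) * d powr \<alpha> \<le> q2 ^ i * d powr \<alpha>" unfolding pw by (intro mult_right_mono) auto
      thus ?thesis using a2[of m] by (simp add: i_def)
    qed
    have sN: "summable (\<lambda>m. a (m + N))"
      by (rule summable_comparison_test'[where g = "\<lambda>m. q1 ^ m * d powr \<alpha>" and N = 0])
         (use q t1 a(1) in \<open>auto intro!: summable_mult2 summable_geometric\<close>)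
    hence s: "summable a" by (simp add: summable_iff_shift)
    have "suminf a = (\<Sum>m. a (m + N)) + (\<Sum>m<N. a m)" by (rule suminf_split_initial_segment[OF s])
    also have "(\<Sum>m. a (m + N)) \<le> (\<Sum>m. q1 ^ m * d powr \<alpha>)"
      by (rule suminf_le[OF t1 sN]) (use q in \<open>auto intro!: summable_mult2 summable_geometric\<close>)
    also have "(\<Sum>m. q1 ^ m * d powr \<alpha>) = 1 / (1 - q1) * d powr \<alpha>"
      using suminf_mult2[of "\<lambda>m. q1 ^ m" "d powr \<alpha>"] q by (simp add: suminf_geometric summable_geometric)
    also have "(\<Sum>m<N. a m) \<le> (\<Sum>m<N. q2 ^ (N - Suc m) * d powr \<alpha>)" by (intro sum_mono t2) auto
    also have "\<dots> \<le> 1 / (1 - q2) * d powr \<alpha>"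
      unfolding sum_distrib_right[symmetric] using sum_powers_le[OF q(3,4), of N] by (intro mult_right_mono) auto
    finally show "summable a \<and> suminf a \<le> (1 / (1 - q1) + 1 / (1 - q2)) * d powr \<alpha>"
      using s by (simp add: distrib_right)
    qed
  qed
qed

text \<open>Two orders of derivatives of K are carried along: the first ones are the kernels of the
  singular integrals, the second ones bound the variation of each of their dyadic pieces. k0 is the
  inverse of the coarsest length scale.\<close>

locale dyadic_kernel =
  fixes \<alpha> k0 :: real and K K1 K2 K11 K12 K21 K22 :: "complex \<Rightarrow> complex"
  assumes \<alpha>: "0 < \<alpha>" "\<alpha> < 1" and k0: "0 < k0"
    and k: "kern 0 K" "kern 0 K1" "kern 0 K2" "kern 0 K11" "kern 0 K12" "kern 0 K21" "kern 0 K22"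
    and dK: "\<And>y. (K has_derivative (\<lambda>h. Re h *\<^sub>R K1 y + Im h *\<^sub>R K2 y)) (at y)"
    and dK1: "\<And>y. (K1 has_derivative (\<lambda>h. Re h *\<^sub>R K11 y + Im h *\<^sub>R K12 y)) (at y)"
    and dK2: "\<And>y. (K2 has_derivative (\<lambda>h. Re h *\<^sub>R K21 y + Im h *\<^sub>R K22 y)) (at y)"
begin

definition \<kappa> :: "nat \<Rightarrow> real" where "\<kappa> m = 2 ^ m * k0"

text \<open>For p = 1 the rescaled kernels sum to one of size at most a constant times 1/|y|, an
  integrable singularity. For p = 2 the bound is 1/|y|^2, which is not integrable at 0, and
  convergence has to come from cancellation.\<close>

definition dyad :: "nat \<Rightarrow> (complex \<Rightarrow> complex) \<Rightarrow> (complex \<times> real \<Rightarrow> complex) \<Rightarrow> complex \<times> real \<Rightarrow> complex" where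
  "dyad p \<Phi> g z = (\<Sum>m. \<kappa> m ^ p *\<^sub>R conv (\<kappa> m) \<Phi> g z)"

text \<open>The dyadic pieces are summable for \<open>p = 1\<close> by size and for \<open>p = 2\<close> by cancellation.\<close>

definition good :: "nat \<Rightarrow> (complex \<Rightarrow> complex) \<Rightarrow> bool" where
  "good p \<Phi> \<longleftrightarrow> kern 0 \<Phi> \<and> (\<forall>g. hcont \<alpha> slab g \<longrightarrow>
     (\<exists>b. summable b \<and> (\<forall>m. \<forall>z\<in>slab. norm (\<kappa> m ^ p *\<^sub>R conv (\<kappa> m) \<Phi> g z) \<le> b m)))"

lemma goodE:
  assumes "good p \<Phi>" "hcont \<alpha> slab g"
  obtains b where "summable b" "\<And>m z. z \<in> slab \<Longrightarrow> norm (\<kappa> m ^ p *\<^sub>R conv (\<kappa> m) \<Phi> g z) \<le> b m"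
proof -
  have "\<exists>b. summable b \<and> (\<forall>m. \<forall>z\<in>slab. norm (\<kappa> m ^ p *\<^sub>R conv (\<kappa> m) \<Phi> g z) \<le> b m)"
    by (rule assms(1)[unfolded good_def, THEN conjunct2, THEN spec, THEN mp, OF assms(2)])
  then obtain b where b: "summable b" "\<forall>m. \<forall>z\<in>slab. norm (\<kappa> m ^ p *\<^sub>R conv (\<kappa> m) \<Phi> g z) \<le> b m"
    by (elim exE conjE)
  show ?thesis by (rule that[OF b(1)]) (use b(2) in simp)
qed

lemma \<kappa>_pos: "0 < \<kappa> m"
  using k0 by (simp add: \<kappa>_def)

lemma slab_pair: "(x, t) \<in> slab \<longleftrightarrow> t \<in> {0..1}"
  by (auto simp: slab_def)

lemma summable_\<kappa>: "0 < s \<Longrightarrow> summable (\<lambda>m. \<kappa> m powr (-s))"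
proof -
  assume s: "0 < s"
  have "\<kappa> m powr (-s) = (2 powr (-s)) ^ m * k0 powr (-s)" for m
    using k0 by (simp add: \<kappa>_def powr_mult powr_realpow[symmetric] powr_powr mult.commute)
  moreover have "2 powr (-s) < 1" using s by (simp add: powr_less_one)
  ultimately show ?thesis by (auto intro!: summable_mult2 summable_geometric)
qed

lemma good_size: "kern 0 \<Phi> \<Longrightarrow> good 1 \<Phi>"
  unfolding good_def
proof (intro conjI allI impI)
  fix g :: "complex \<times> real \<Rightarrow> complex" assume \<Phi>: "kern 0 \<Phi>" and g: "hcont \<alpha> slab g"
  obtain M where M: "0 \<le> M" "\<And>y. norm (\<Phi> y) \<le> M" using kern_bounded[OF \<Phi>] by blast
  obtain B where B: "0 \<le> B" "\<And>z. z \<in> slab \<Longrightarrow> norm (g z) \<le> B" using g by (rule hcontE) blast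
  have "norm (\<kappa> m ^ 1 *\<^sub>R conv (\<kappa> m) \<Phi> g z) \<le> (16 * M * B) * \<kappa> m powr (-1)" if "z \<in> slab" for m z
  proof -
    obtain x t where z: "z = (x, t)" by force
    have "norm (conv (\<kappa> m) \<Phi> g (x, t)) \<le> M * B * (16 / (\<kappa> m)\<^sup>2)"
      by (rule conv_bound[OF \<Phi> hcont_imp_continuous_on[OF g] _ \<kappa>_pos M(2) _ M(1) B(1)])
         (use that z B(2) in \<open>auto simp: slab_pair\<close>)
    hence "\<kappa> m * norm (conv (\<kappa> m) \<Phi> g (x, t)) \<le> \<kappa> m * (M * B * (16 / (\<kappa> m)\<^sup>2))"
      using \<kappa>_pos[of m] by (intro mult_left_mono) auto
    also have "\<dots> = (16 * M * B) * \<kappa> m powr (-1)"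
      using \<kappa>_pos[of m] by (simp add: powr_minus_divide power2_eq_square field_simps)
    finally show ?thesis using \<kappa>_pos[of m] by (simp add: z)
  qed
  thus "\<exists>b. summable b \<and> (\<forall>m. \<forall>z\<in>slab. norm (\<kappa> m ^ 1 *\<^sub>R conv (\<kappa> m) \<Phi> g z) \<le> b m)"
    using summable_mult[OF summable_\<kappa>[of 1], of "16 * M * B"] by (intro exI[of _ "\<lambda>m. (16 * M * B) * \<kappa> m powr (-1)"]) auto
qed

lemma conv_cancel:
  assumes \<Phi>: "kern 0 \<Phi>" and mean: "\<And>m x t. t \<in> {0..1} \<Longrightarrow> conv (\<kappa> m) \<Phi> (\<lambda>z. 1) (x, t) = 0"
    and M: "0 \<le> M" "\<And>y. norm (\<Phi> y) \<le> M"
    and g: "continuous_on slab g" "0 \<le> H" "\<And>t x y. (x, t) \<in> slab \<Longrightarrow> (y, t) \<in> slab \<Longrightarrow> norm (g (x, t) - g (y, t)) \<le> H * dist x y powr \<alpha>"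
    and z: "(x, t) \<in> slab"
  shows "norm (\<kappa> m ^ 2 *\<^sub>R conv (\<kappa> m) \<Phi> g (x, t)) \<le> (16 * M * H * 3 powr \<alpha>) * \<kappa> m powr (-\<alpha>)"
proof -
  have t: "t \<in> {0..1}" using z by (simp add: slab_pair)
  have "norm (conv (\<kappa> m) \<Phi> g (x, t) - conv (\<kappa> m) \<Phi> (\<lambda>z. 1) (x, t) * g (x, t)) \<le> M * (H * (3 / \<kappa> m) powr \<alpha>) * (16 / (\<kappa> m)\<^sup>2)"
    by (rule conv_bound_mean[OF \<Phi> g(1) t \<kappa>_pos M(2) _ M(1) g(2) \<alpha>(1)]) (use g(3) t in \<open>auto simp: slab_pair\<close>)
  hence "(\<kappa> m)\<^sup>2 * norm (conv (\<kappa> m) \<Phi> g (x, t)) \<le> (\<kappa> m)\<^sup>2 * (M * (H * (3 / \<kappa> m) powr \<alpha>) * (16 / (\<kappa> m)\<^sup>2))"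
    using mean[OF t] by (intro mult_left_mono) auto
  also have "\<dots> = M * (H * (3 / \<kappa> m) powr \<alpha>) * 16" using \<kappa>_pos[of m] by simp
  also have "(3 / \<kappa> m) powr \<alpha> = 3 powr \<alpha> * \<kappa> m powr (-\<alpha>)"
    using \<kappa>_pos[of m] by (simp add: powr_divide powr_minus_divide)
  finally show ?thesis by (simp add: mult_ac)
qed

lemma good_cancel:
  assumes \<Phi>: "kern 0 \<Phi>" and mean: "\<And>m x t. t \<in> {0..1} \<Longrightarrow> conv (\<kappa> m) \<Phi> (\<lambda>z. 1) (x, t) = 0"
  shows "good 2 \<Phi>"
  unfolding good_def
proof (intro conjI allI impI \<Phi>)
  fix g :: "complex \<times> real \<Rightarrow> complex" assume g: "hcont \<alpha> slab g"
  obtain M where M: "0 \<le> M" "\<And>y. norm (\<Phi> y) \<le> M" using kern_bounded[OF \<Phi>] by blast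
  obtain H where H: "0 \<le> H" "\<And>t x y. (x, t) \<in> slab \<Longrightarrow> (y, t) \<in> slab \<Longrightarrow> norm (g (x, t) - g (y, t)) \<le> H * dist x y powr \<alpha>"
    using g by (rule hcontE) blast
  have "norm (\<kappa> m ^ 2 *\<^sub>R conv (\<kappa> m) \<Phi> g z) \<le> (16 * M * H * 3 powr \<alpha>) * \<kappa> m powr (-\<alpha>)" if "z \<in> slab" for m z
    using conv_cancel[OF \<Phi> mean M hcont_imp_continuous_on[OF g] H] that by (cases z) auto
  thus "\<exists>b. summable b \<and> (\<forall>m. \<forall>z\<in>slab. norm (\<kappa> m ^ 2 *\<^sub>R conv (\<kappa> m) \<Phi> g z) \<le> b m)"
    using summable_mult[OF summable_\<kappa>[OF \<alpha>(1)]] by blast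
qed

lemma means:
  assumes "t \<in> {0..1}"
  shows "conv (\<kappa> m) K1 (\<lambda>z. 1) (x, t) = 0" "conv (\<kappa> m) K2 (\<lambda>z. 1) (x, t) = 0"
    "conv (\<kappa> m) K11 (\<lambda>z. 1) (x, t) = 0" "conv (\<kappa> m) K12 (\<lambda>z. 1) (x, t) = 0"
    "conv (\<kappa> m) K21 (\<lambda>z. 1) (x, t) = 0" "conv (\<kappa> m) K22 (\<lambda>z. 1) (x, t) = 0"
  using conv_derivative_mean[OF k(1-3) dK \<kappa>_pos assms] conv_derivative_mean[OF k(2,4,5) dK1 \<kappa>_pos assms]
    conv_derivative_mean[OF k(3,6,7) dK2 \<kappa>_pos assms] by auto

lemma good: "good 1 K" "good 2 K1" "good 2 K2"
  by (intro good_size good_cancel k means; assumption)+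

lemma good_summable:
  assumes "good p \<Phi>" "hcont \<alpha> slab g" "z \<in> slab"
  shows "summable (\<lambda>m. \<kappa> m ^ p *\<^sub>R conv (\<kappa> m) \<Phi> g z)"
proof -
  obtain b where b: "summable b" "\<And>m z. z \<in> slab \<Longrightarrow> norm (\<kappa> m ^ p *\<^sub>R conv (\<kappa> m) \<Phi> g z) \<le> b m"
    by (rule goodE[OF assms(1,2)]) (rule that; blast)
  show ?thesis by (rule summable_comparison_test'[OF b(1)]) (use b(2) assms in auto)
qed

lemma dyad_cont:
  assumes "good p \<Phi>" "hcont \<alpha> slab g"
  shows "continuous_on slab (dyad p \<Phi> g)" "\<exists>B. \<forall>z\<in>slab. norm (dyad p \<Phi> g z) \<le> B"
proof -
  obtain b where b: "summable b" "\<And>m z. z \<in> slab \<Longrightarrow> norm (\<kappa> m ^ p *\<^sub>R conv (\<kappa> m) \<Phi> g z) \<le> b m"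
    by (rule goodE[OF assms(1,2)]) (rule that; blast)
  have kk: "kern 0 \<Phi>" using assms(1) by (simp add: good_def)
  show "continuous_on slab (dyad p \<Phi> g)" unfolding dyad_def[abs_def]
    by (rule continuous_on_suminf[OF _ b(2,1)])
       (intro continuous_on_scaleR continuous_on_const conv_cont(1) kk hcont_imp_continuous_on[OF assms(2)])
  show "\<exists>B. \<forall>z\<in>slab. norm (dyad p \<Phi> g z) \<le> B" unfolding dyad_def
    by (intro exI[of _ "suminf b"] ballI norm_suminf_le b)
qed

lemma dyad_has_grad:
  assumes \<Phi>: "good p \<Phi>" and g: "has_grad j slab g g1 g2 gt"
    and h: "hcont \<alpha> slab g" "hcont \<alpha> slab g1" "hcont \<alpha> slab g2" "0 < j \<Longrightarrow> hcont \<alpha> slab gt"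
  shows "has_grad j slab (dyad p \<Phi> g) (dyad p \<Phi> g1) (dyad p \<Phi> g2) (dyad p \<Phi> gt)"
proof -
  have kk: "kern 0 \<Phi>" using \<Phi> by (simp add: good_def)
  note c = h[THEN hcont_imp_continuous_on]
  have dir: "((\<lambda>s. dyad p \<Phi> g (x + s *\<^sub>R e, t)) has_vector_derivative dyad p \<Phi> ge (x, t)) (at 0)"
    if xt: "(x, t) \<in> slab" and ge: "hcont \<alpha> slab ge" "\<And>s m. Re e *\<^sub>R conv (\<kappa> m) \<Phi> g1 (x + s *\<^sub>R e, t) + Im e *\<^sub>R conv (\<kappa> m) \<Phi> g2 (x + s *\<^sub>R e, t) = conv (\<kappa> m) \<Phi> ge (x + s *\<^sub>R e, t)" for x t e ge
  proof -
    have m: "(y, t) \<in> slab" for y using xt by (simp add: slab_pair)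
    obtain b where b: "summable b" "\<And>m z. z \<in> slab \<Longrightarrow> norm (\<kappa> m ^ p *\<^sub>R conv (\<kappa> m) \<Phi> ge z) \<le> b m"
      by (rule goodE[OF \<Phi> ge(1)]) (rule that; blast)
    have "((\<lambda>s. \<Sum>m. \<kappa> m ^ p *\<^sub>R conv (\<kappa> m) \<Phi> g (x + s *\<^sub>R e, t)) has_vector_derivative
       (\<Sum>m. \<kappa> m ^ p *\<^sub>R conv (\<kappa> m) \<Phi> ge (x + 0 *\<^sub>R e, t))) (at 0 within UNIV)"
    proof (rule series_vector_derivative[OF _ _ _ b(2) b(1)])
      fix m s
      show "((\<lambda>s. \<kappa> m ^ p *\<^sub>R conv (\<kappa> m) \<Phi> g (x + s *\<^sub>R e, t)) has_vector_derivative \<kappa> m ^ p *\<^sub>R conv (\<kappa> m) \<Phi> ge (x + s *\<^sub>R e, t)) (at s within UNIV)"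
        using bounded_linear.has_vector_derivative[OF bounded_linear_scaleR_right conv_has_grad(1)[OF kk \<kappa>_pos g c xt, of m e s], of "\<kappa> m ^ p"] ge(2)
        by simp
    qed (use m good_summable[OF \<Phi> h(1)] in auto)
    thus ?thesis by (simp add: dyad_def)
  qed
  show ?thesis
  proof (rule has_grad_partials)
    show "openin (top_of_set slab) slab" by simp
    show "continuous_on slab (dyad p \<Phi> g1)" "continuous_on slab (dyad p \<Phi> g2)" using dyad_cont \<Phi> h by auto
    fix x t assume xt: "(x, t) \<in> slab"
    show "((\<lambda>s. dyad p \<Phi> g (x + s *\<^sub>R 1, t)) has_vector_derivative dyad p \<Phi> g1 (x, t)) (at 0)"
      by (rule dir[OF xt h(2)]) simp
    show "((\<lambda>s. dyad p \<Phi> g (x + s *\<^sub>R \<i>, t)) has_vector_derivative dyad p \<Phi> g2 (x, t)) (at 0)"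
      by (rule dir[OF xt h(3)]) simp
    assume j: "0 < j"
    obtain b where b: "summable b" "\<And>m z. z \<in> slab \<Longrightarrow> norm (\<kappa> m ^ p *\<^sub>R conv (\<kappa> m) \<Phi> gt z) \<le> b m"
      by (rule goodE[OF \<Phi> h(4)[OF j]]) (rule that; blast)
    have "((\<lambda>s. \<Sum>m. \<kappa> m ^ p *\<^sub>R conv (\<kappa> m) \<Phi> g (x, s)) has_vector_derivative
       (\<Sum>m. \<kappa> m ^ p *\<^sub>R conv (\<kappa> m) \<Phi> gt (x, t))) (at t within {0..1})"
    proof (rule series_vector_derivative[OF _ _ _ b(2) b(1)])
      fix m s assume "s \<in> {0..1::real}"
      hence "(x, s) \<in> slab" by (simp add: slab_pair)
      from bounded_linear.has_vector_derivative[OF bounded_linear_scaleR_right conv_has_grad(2)[OF kk \<kappa>_pos g c this j, of m], of "\<kappa> m ^ p"]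
      show "((\<lambda>s. \<kappa> m ^ p *\<^sub>R conv (\<kappa> m) \<Phi> g (x, s)) has_vector_derivative \<kappa> m ^ p *\<^sub>R conv (\<kappa> m) \<Phi> gt (x, s)) (at s within {0..1})" .
    qed (use xt good_summable[OF \<Phi> h(1)] in \<open>auto simp: slab_pair\<close>)
    thus "((\<lambda>s. dyad p \<Phi> g (x, s)) has_vector_derivative dyad p \<Phi> gt (x, t)) (at t within {0..1})"
      by (simp add: dyad_def)
  qed
qed

text \<open>The source of the gained derivative: a derivative on the kernel turns \<kappa> K into
  \<kappa>^2 K1 or \<kappa>^2 K2, and mean zero still makes the series converge uniformly for a
  density that is only Hoelder. Nothing is claimed in t here.\<close>

lemma dyad_kernel_grad:
  assumes g: "hcont \<alpha> slab g"
  shows "has_grad 0 slab (dyad 1 K g) (dyad 2 K1 g) (dyad 2 K2 g) w"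
proof (rule has_grad_partials)
  note c = hcont_imp_continuous_on[OF g]
  show "openin (top_of_set slab) slab" by simp
  show "continuous_on slab (dyad 2 K1 g)" "continuous_on slab (dyad 2 K2 g)" using dyad_cont good g by auto
  fix x t assume xt: "(x, t) \<in> slab"
  hence t: "t \<in> {0..1}" by (simp add: slab_pair)
  have m: "(y, t) \<in> slab" for y using xt by (simp add: slab_pair)
  have dir: "((\<lambda>s. dyad 1 K g (x + s *\<^sub>R e, t)) has_vector_derivative dyad 2 Ke g (x, t)) (at 0)"
    if e: "norm e \<le> 1" and Ke: "good 2 Ke" "\<And>m y. Re e *\<^sub>R conv (\<kappa> m) K1 g (y, t) + Im e *\<^sub>R conv (\<kappa> m) K2 g (y, t) = conv (\<kappa> m) Ke g (y, t)" for e Ke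
  proof -
    obtain b where b: "summable b" "\<And>m z. z \<in> slab \<Longrightarrow> norm (\<kappa> m ^ 2 *\<^sub>R conv (\<kappa> m) Ke g z) \<le> b m"
      by (rule goodE[OF Ke(1) g]) (rule that; blast)
    have "((\<lambda>s. \<Sum>m. \<kappa> m ^ 1 *\<^sub>R conv (\<kappa> m) K g (x + s *\<^sub>R e, t)) has_vector_derivative
       (\<Sum>m. \<kappa> m ^ 2 *\<^sub>R conv (\<kappa> m) Ke g (x + 0 *\<^sub>R e, t))) (at 0 within UNIV)"
    proof (rule series_vector_derivative[OF _ _ _ b(2) b(1)])
      fix m s
      have 1: "((\<lambda>s'. conv (\<kappa> m) K g (x + s *\<^sub>R e + s' *\<^sub>R e, t)) has_derivative (\<lambda>h. h *\<^sub>R (\<kappa> m *\<^sub>R conv (\<kappa> m) Ke g (x + s *\<^sub>R e, t)))) (at (s - s))"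
        using conv_kernel_derivative[OF k(1-3) dK \<kappa>_pos c t e, of m "x + s *\<^sub>R e"] Ke(2)
        by (simp add: has_vector_derivative_def)
      have 2: "((\<lambda>s'. s' - s) has_derivative (\<lambda>h. h)) (at s)" by (auto intro!: derivative_eq_intros)
      have "((\<lambda>s. conv (\<kappa> m) K g (x + s *\<^sub>R e, t)) has_vector_derivative \<kappa> m *\<^sub>R conv (\<kappa> m) Ke g (x + s *\<^sub>R e, t)) (at s)"
        using has_derivative_compose[OF 2 1] by (simp add: has_vector_derivative_def algebra_simps)
      from bounded_linear.has_vector_derivative[OF bounded_linear_scaleR_right this, of "\<kappa> m"]
      show "((\<lambda>s. \<kappa> m ^ 1 *\<^sub>R conv (\<kappa> m) K g (x + s *\<^sub>R e, t)) has_vector_derivative \<kappa> m ^ 2 *\<^sub>R conv (\<kappa> m) Ke g (x + s *\<^sub>R e, t)) (at s within UNIV)"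
        by (simp add: power2_eq_square)
    qed (use m good_summable[OF good(1) g] in auto)
    thus ?thesis by (simp add: dyad_def)
  qed
  show "((\<lambda>s. dyad 1 K g (x + s *\<^sub>R 1, t)) has_vector_derivative dyad 2 K1 g (x, t)) (at 0)"
    by (rule dir[OF _ good(2)]) simp_all
  show "((\<lambda>s. dyad 1 K g (x + s *\<^sub>R \<i>, t)) has_vector_derivative dyad 2 K2 g (x, t)) (at 0)"
    by (rule dir[OF _ good(3)]) simp_all
qed simp

text \<open>The Schauder estimate. The dyadic piece of scale \<kappa> is of size
  \<kappa>^(-\<alpha>) by cancellation, and so are its kernel derivatives up to a factor \<kappa>,
  which bounds its increments by \<kappa>^(1-\<alpha>) |x - y|. Summing the smaller bound over all
  scales gives |x - y|^\<alpha>.\<close>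

lemma dyad_hcont_derivative:
  assumes g: "hcont \<alpha> slab g" and L: "kern 0 L" "kern 0 L1" "kern 0 L2"
    and dL: "\<And>y. (L has_derivative (\<lambda>h. Re h *\<^sub>R L1 y + Im h *\<^sub>R L2 y)) (at y)"
    and mean: "\<And>m x t. t \<in> {0..1} \<Longrightarrow> conv (\<kappa> m) L (\<lambda>z. 1) (x, t) = 0"
  shows "hcont \<alpha> slab (dyad 2 L g)"
proof -
  note c = hcont_imp_continuous_on[OF g]
  obtain H where H: "0 \<le> H" "\<And>t x y. (x, t) \<in> slab \<Longrightarrow> (y, t) \<in> slab \<Longrightarrow> norm (g (x, t) - g (y, t)) \<le> H * dist x y powr \<alpha>"
    using g by (rule hcontE) blast
  obtain M0 where M0: "0 \<le> M0" "\<And>y. norm (L y) \<le> M0" using kern_bounded[OF L(1)] by blast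
  obtain M1 where M1: "0 \<le> M1" "\<And>y. norm (L1 y) \<le> M1" using kern_bounded[OF L(2)] by blast
  obtain M2 where M2: "0 \<le> M2" "\<And>y. norm (L2 y) \<le> M2" using kern_bounded[OF L(3)] by blast
  \<comment> \<open>2 M0 covers the difference of two values of a piece, M1 + M2 its derivative
    along a unit vector.\<close>
  define A where "A = 16 * (2 * M0 + M1 + M2) * H * 3 powr \<alpha>"
  have A0: "0 \<le> A" using M0 M1 M2 H by (simp add: A_def)
  note gd = good_cancel[OF L(1) mean]
  note mean' = conv_derivative_mean[OF L dL \<kappa>_pos]
  obtain B where B: "\<And>z. z \<in> slab \<Longrightarrow> norm (dyad 2 L g z) \<le> B" using dyad_cont(2)[OF gd g] by blast
  obtain C where C: "0 \<le> C" "\<forall>d a. 0 < d \<longrightarrow> (\<forall>m. 0 \<le> a m \<and> a m \<le> \<kappa> m powr (-\<alpha>) \<and> a m \<le> \<kappa> m powr (1 - \<alpha>) * d)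
     \<longrightarrow> summable a \<and> suminf a \<le> C * d powr \<alpha>"
    using dyadic_min_sum[OF \<alpha> k0 \<kappa>_def] by (elim exE conjE)
  show ?thesis
  proof (rule hcontI[OF dyad_cont(1)[OF gd g] B])
    fix t x y assume xy: "(x, t) \<in> slab" "(y, t) \<in> slab"
    have t: "t \<in> {0..1}" using xy by (simp add: slab_pair)
    have m: "(w, t) \<in> slab" for w using t by (simp add: slab_pair)
    show "norm (dyad 2 L g (x, t) - dyad 2 L g (y, t)) \<le> ((A + 1) * C) * dist x y powr \<alpha>"
    proof (cases "x = y")
      case True
      thus ?thesis using C(1) A0 by simp
    next
      case False
      define d where "d = dist x y"
      have d: "0 < d" using False by (simp add: d_def)
      define e where "e = (1 / d) *\<^sub>R (x - y)"
      have e: "norm e = 1" "x = y + d *\<^sub>R e" using d by (simp_all add: e_def d_def dist_norm)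
      define D where "D i = \<kappa> i ^ 2 *\<^sub>R conv (\<kappa> i) L g (x, t) - \<kappa> i ^ 2 *\<^sub>R conv (\<kappa> i) L g (y, t)" for i
      have kb: "norm (\<kappa> i ^ 2 *\<^sub>R conv (\<kappa> i) L g (w, t)) \<le> (16 * M0 * H * 3 powr \<alpha>) * \<kappa> i powr (-\<alpha>)" for i w
        by (rule conv_cancel[OF L(1) mean M0 c H m])
      have b1: "norm (D i) \<le> (A + 1) * \<kappa> i powr (-\<alpha>)" for i
      proof -
        have "norm (D i) \<le> (16 * M0 * H * 3 powr \<alpha>) * \<kappa> i powr (-\<alpha>) + (16 * M0 * H * 3 powr \<alpha>) * \<kappa> i powr (-\<alpha>)"
          unfolding D_def using kb[of i x] kb[of i y] norm_triangle_ineq4 order_trans add_mono by meson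
        also have "\<dots> = (16 * (2 * M0) * H * 3 powr \<alpha>) * \<kappa> i powr (-\<alpha>)" by simp
        also have "\<dots> \<le> (A + 1) * \<kappa> i powr (-\<alpha>)"
        proof (rule mult_right_mono)
          have "16 * (2 * M0) * H * 3 powr \<alpha> \<le> A" unfolding A_def using M0 M1 M2 H by (intro mult_right_mono) auto
          thus "16 * (2 * M0) * H * 3 powr \<alpha> \<le> A + 1" by simp
        qed simp
        finally show ?thesis .
      qed
      have b2: "norm (D i) \<le> (A + 1) * (\<kappa> i powr (1 - \<alpha>) * d)" for i
      proof -
        have drv: "((\<lambda>s. \<kappa> i ^ 2 *\<^sub>R conv (\<kappa> i) L g (y + s *\<^sub>R e, t)) has_vector_derivative
           \<kappa> i *\<^sub>R (Re e *\<^sub>R (\<kappa> i ^ 2 *\<^sub>R conv (\<kappa> i) L1 g (y + s *\<^sub>R e, t)) + Im e *\<^sub>R (\<kappa> i ^ 2 *\<^sub>R conv (\<kappa> i) L2 g (y + s *\<^sub>R e, t)))) (at s)" for s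
        proof -
          have 1: "((\<lambda>s'. conv (\<kappa> i) L g (y + s *\<^sub>R e + s' *\<^sub>R e, t)) has_derivative
             (\<lambda>h. h *\<^sub>R (\<kappa> i *\<^sub>R (Re e *\<^sub>R conv (\<kappa> i) L1 g (y + s *\<^sub>R e, t) + Im e *\<^sub>R conv (\<kappa> i) L2 g (y + s *\<^sub>R e, t))))) (at (s - s))"
            using conv_kernel_derivative[OF L dL \<kappa>_pos c t, of e i "y + s *\<^sub>R e"] e(1)
            by (simp add: has_vector_derivative_def)
          have 2: "((\<lambda>s'. s' - s) has_derivative (\<lambda>h. h)) (at s)" by (auto intro!: derivative_eq_intros)
          have "((\<lambda>s. conv (\<kappa> i) L g (y + s *\<^sub>R e, t)) has_vector_derivative
             \<kappa> i *\<^sub>R (Re e *\<^sub>R conv (\<kappa> i) L1 g (y + s *\<^sub>R e, t) + Im e *\<^sub>R conv (\<kappa> i) L2 g (y + s *\<^sub>R e, t))) (at s)"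
            using has_derivative_compose[OF 2 1] by (simp add: has_vector_derivative_def algebra_simps)
          from bounded_linear.has_vector_derivative[OF bounded_linear_scaleR_right this, of "\<kappa> i ^ 2"]
          show ?thesis by (simp add: scaleR_add_right mult_ac)
        qed
        have nb: "norm (\<kappa> i *\<^sub>R (Re e *\<^sub>R (\<kappa> i ^ 2 *\<^sub>R conv (\<kappa> i) L1 g (w, t)) + Im e *\<^sub>R (\<kappa> i ^ 2 *\<^sub>R conv (\<kappa> i) L2 g (w, t))))
           \<le> (A + 1) * \<kappa> i powr (1 - \<alpha>)" for w
        proof -
          have n1: "norm (\<kappa> i ^ 2 *\<^sub>R conv (\<kappa> i) L1 g (w, t)) \<le> (16 * M1 * H * 3 powr \<alpha>) * \<kappa> i powr (-\<alpha>)"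
            by (rule conv_cancel[OF L(2) mean'(1) M1 c H m])
          have n2: "norm (\<kappa> i ^ 2 *\<^sub>R conv (\<kappa> i) L2 g (w, t)) \<le> (16 * M2 * H * 3 powr \<alpha>) * \<kappa> i powr (-\<alpha>)"
            by (rule conv_cancel[OF L(3) mean'(2) M2 c H m])
          have ee: "\<bar>Re e\<bar> \<le> 1" "\<bar>Im e\<bar> \<le> 1" using abs_Re_le_cmod[of e] abs_Im_le_cmod[of e] e(1) by auto
          have "norm (Re e *\<^sub>R (\<kappa> i ^ 2 *\<^sub>R conv (\<kappa> i) L1 g (w, t)) + Im e *\<^sub>R (\<kappa> i ^ 2 *\<^sub>R conv (\<kappa> i) L2 g (w, t)))
             \<le> 1 * ((16 * M1 * H * 3 powr \<alpha>) * \<kappa> i powr (-\<alpha>)) + 1 * ((16 * M2 * H * 3 powr \<alpha>) * \<kappa> i powr (-\<alpha>))"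
          proof (intro norm_triangle_le add_mono)
            show "norm (Re e *\<^sub>R (\<kappa> i ^ 2 *\<^sub>R conv (\<kappa> i) L1 g (w, t))) \<le> 1 * ((16 * M1 * H * 3 powr \<alpha>) * \<kappa> i powr (-\<alpha>))"
              unfolding norm_scaleR[of "Re e"] using ee n1 by (intro mult_mono) auto
            show "norm (Im e *\<^sub>R (\<kappa> i ^ 2 *\<^sub>R conv (\<kappa> i) L2 g (w, t))) \<le> 1 * ((16 * M2 * H * 3 powr \<alpha>) * \<kappa> i powr (-\<alpha>))"
              unfolding norm_scaleR[of "Im e"] using ee n2 by (intro mult_mono) auto
          qed
          also have "\<dots> = (16 * (M1 + M2) * H * 3 powr \<alpha>) * \<kappa> i powr (-\<alpha>)" by (simp add: algebra_simps)
          also have "\<dots> \<le> (A + 1) * \<kappa> i powr (-\<alpha>)"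
          proof (rule mult_right_mono)
            have "16 * (M1 + M2) * H * 3 powr \<alpha> \<le> A" unfolding A_def using M0 M1 M2 H by (intro mult_right_mono) auto
            thus "16 * (M1 + M2) * H * 3 powr \<alpha> \<le> A + 1" by simp
          qed simp
          finally have "\<kappa> i * norm (Re e *\<^sub>R (\<kappa> i ^ 2 *\<^sub>R conv (\<kappa> i) L1 g (w, t)) + Im e *\<^sub>R (\<kappa> i ^ 2 *\<^sub>R conv (\<kappa> i) L2 g (w, t)))
              \<le> \<kappa> i * ((A + 1) * \<kappa> i powr (-\<alpha>))"
            using \<kappa>_pos[of i] by (intro mult_left_mono) auto
          also have "\<dots> = (A + 1) * (\<kappa> i powr 1 * \<kappa> i powr (-\<alpha>))" using \<kappa>_pos[of i] by simp
          also have "\<dots> = (A + 1) * \<kappa> i powr (1 - \<alpha>)" using powr_add[of "\<kappa> i" 1 "-\<alpha>"] by simp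
          finally show ?thesis using \<kappa>_pos[of i] by simp
        qed
        have "norm (\<kappa> i ^ 2 *\<^sub>R conv (\<kappa> i) L g (y + d *\<^sub>R e, t) - \<kappa> i ^ 2 *\<^sub>R conv (\<kappa> i) L g (y + 0 *\<^sub>R e, t)) \<le> ((A + 1) * \<kappa> i powr (1 - \<alpha>)) * \<bar>d - 0\<bar>"
          by (rule vector_derivative_bound[where f = "\<lambda>s. \<kappa> i ^ 2 *\<^sub>R conv (\<kappa> i) L g (y + s *\<^sub>R e, t)", OF drv nb])
        thus ?thesis using d by (simp add: D_def e(2)[symmetric] mult.assoc)
      qed
      \<comment> \<open>Division by A + 1 > 0 normalises both bounds to the form required by
        \<open>dyadic_min_sum\<close>, also when A = 0.\<close>
      define a where "a i = norm (D i) / (A + 1)" for i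
      have A1: "0 < A + 1" using A0 by simp
      have "summable a \<and> suminf a \<le> C * d powr \<alpha>"
      proof (rule C(2)[THEN spec, THEN spec, THEN mp, THEN mp, OF d], intro allI conjI)
        fix i
        show "0 \<le> a i" using A1 by (simp add: a_def)
        show "a i \<le> \<kappa> i powr (-\<alpha>)" using b1[of i] A1 by (simp add: a_def pos_divide_le_eq mult.commute)
        show "a i \<le> \<kappa> i powr (1 - \<alpha>) * d" using b2[of i] A1 by (simp add: a_def pos_divide_le_eq mult.commute)
      qed
      hence sa: "summable a" "suminf a \<le> C * d powr \<alpha>" by auto
      have nD: "norm (D i) = (A + 1) * a i" for i using A1 by (simp add: a_def)
      have "dyad 2 L g (x, t) - dyad 2 L g (y, t) = (\<Sum>i. D i)"
        unfolding dyad_def D_def by (rule suminf_diff[OF good_summable[OF gd g xy(1)] good_summable[OF gd g xy(2)]])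
      also have "norm \<dots> \<le> (\<Sum>i. (A + 1) * a i)"
        by (rule norm_suminf_le) (use nD sa in \<open>auto intro: summable_mult\<close>)
      also have "\<dots> = (A + 1) * suminf a" by (rule suminf_mult[OF sa(1)])
      also have "\<dots> \<le> (A + 1) * (C * d powr \<alpha>)" using sa(2) A1 by (intro mult_left_mono) auto
      finally show ?thesis by (simp add: d_def mult.assoc)
    qed
  qed
qed

lemma dyad_hcont: "hcont \<alpha> slab g \<Longrightarrow> hcont \<alpha> slab (dyad 2 K1 g)" "hcont \<alpha> slab g \<Longrightarrow> hcont \<alpha> slab (dyad 2 K2 g)"
  using dyad_hcont_derivative[OF _ k(2,4,5) dK1 means(1)] dyad_hcont_derivative[OF _ k(3,6,7) dK2 means(2)] by auto

lemma dyad_hcont1: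
  assumes g: "hcont \<alpha> slab g" shows "hcont \<alpha> slab (dyad 1 K g)"
proof -
  obtain B where B: "\<And>z. z \<in> slab \<Longrightarrow> norm (dyad 1 K g z) \<le> B" using dyad_cont(2)[OF good(1) g] by blast
  obtain B1 where B1: "\<And>z. z \<in> slab \<Longrightarrow> norm (dyad 2 K1 g z) \<le> B1" using dyad_cont(2)[OF good(2) g] by blast
  obtain B2 where B2: "\<And>z. z \<in> slab \<Longrightarrow> norm (dyad 2 K2 g z) \<le> B2" using dyad_cont(2)[OF good(3) g] by blast
  have "convex {x::complex. (x, t) \<in> slab}" for t by (simp add: slab_pair)
  from hcont_of_grad[OF dyad_kernel_grad[OF g, of undefined] order_refl this dyad_cont(1)[OF good(1) g] B B1 B2] \<alpha>
  show ?thesis by simp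
qed

text \<open>Derivatives of the density pass through the sum, so the bound for Hoelder densities
  applies to each of them: the singular integral preserves every class.\<close>

lemma dyad_hreg2:
  assumes "good 2 \<Phi>" "\<And>g. hcont \<alpha> slab g \<Longrightarrow> hcont \<alpha> slab (dyad 2 \<Phi> g)" "hreg \<alpha> n j slab slab g"
  shows "hreg \<alpha> n j slab slab (dyad 2 \<Phi> g)"
  using assms(3)
proof (induction n arbitrary: j g)
  case 0
  thus ?case using assms(2) by (simp add: hreg_0)
next
  case (Suc n)
  obtain g1 g2 gt where g: "hcont \<alpha> slab g" "has_grad j slab g g1 g2 gt" "hreg \<alpha> n j slab slab g1"
    "hreg \<alpha> n j slab slab g2" "0 < j \<longrightarrow> hreg \<alpha> n (j - 1) slab slab gt"
    using Suc.prems by (rule hreg_SucE)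
  show ?case
    by (rule hreg_SucI[OF assms(2)[OF g(1)] dyad_has_grad[OF assms(1) g(2,1)]])
       (use g Suc.IH hreg_imp_hcont in \<open>auto simp del: One_nat_def\<close>)
qed

text \<open>Space derivatives are put on the kernel, giving singular integrals of the full density,
  while the t-derivative is put on the density and the order lost there is regained by the induction
  hypothesis. With j \<le> n no t-derivative is left at n = 0.\<close>

theorem dyad_hreg:
  assumes "hreg \<alpha> n j slab slab g" "j \<le> n"
  shows "hreg \<alpha> (Suc n) j slab slab (dyad 1 K g)"
  using assms
proof (induction n arbitrary: j g)
  case 0
  hence g: "hcont \<alpha> slab g" by (simp add: hreg_0)
  have j: "j = 0" using 0 by simp
  show ?case unfolding j
    by (rule hreg_SucI[OF dyad_hcont1[OF g] dyad_kernel_grad[OF g, of undefined]]) (use dyad_hcont[OF g] in \<open>auto simp: hreg_0\<close>)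
next
  case (Suc n)
  obtain g1 g2 gt where g: "hcont \<alpha> slab g" "has_grad j slab g g1 g2 gt" "hreg \<alpha> n j slab slab g1"
    "hreg \<alpha> n j slab slab g2" "0 < j \<longrightarrow> hreg \<alpha> n (j - 1) slab slab gt"
    using Suc.prems(1) by (rule hreg_SucE)
  have h: "hcont \<alpha> slab g1" "hcont \<alpha> slab g2" "0 < j \<Longrightarrow> hcont \<alpha> slab gt"
    using g hreg_imp_hcont by blast+
  have G: "has_grad j slab (dyad 1 K g) (dyad 1 K g1) (dyad 1 K g2) (dyad 1 K gt)"
    by (rule dyad_has_grad[OF good(1) g(2,1) h])
  have G0: "has_grad 0 slab (dyad 1 K g) (dyad 1 K g1) (dyad 1 K g2) (dyad 1 K gt)"
    by (rule has_grad_mono[OF G]) auto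
  \<comment> \<open>Differentiating through the kernel and through the density gives the same
    gradient; the first form has the better regularity in x, the second supplies the joint
    derivative in t.\<close>
  note eq = has_grad_unique[OF dyad_kernel_grad[OF g(1), of undefined] G0]
  have G': "has_grad j slab (dyad 1 K g) (dyad 2 K1 g) (dyad 2 K2 g) (dyad 1 K gt)"
    by (rule has_grad_cong[OF G]) (use eq in auto)
  show ?case
  proof (rule hreg_SucI[OF dyad_hcont1[OF g(1)] G'])
    show "hreg \<alpha> (Suc n) j slab slab (dyad 2 K1 g)" "hreg \<alpha> (Suc n) j slab slab (dyad 2 K2 g)"
      by (rule dyad_hreg2[OF _ _ Suc.prems(1)]; (rule good | rule dyad_hcont; assumption))+
    show "hreg \<alpha> (Suc n) (j - 1) slab slab (dyad 1 K gt)" if "0 < j"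
      by (rule Suc.IH) (use g(5) that Suc.prems(2) in auto)
  qed
qed

end

section \<open>Construction of the truncated Cauchy kernel\<close>

lemma kern_of_hreg:
  assumes "hreg \<alpha> n 0 slab slab u" "\<And>z. z \<in> slab \<Longrightarrow> 3/2 < norm (fst z) \<Longrightarrow> u z = 0"
  shows "kern n (\<lambda>y. u (y, 0))"
  using assms
proof (induction n arbitrary: u)
  have m: "(y, 0) \<in> slab" for y by (simp add: slab_def)
  have base: "kern 0 (\<lambda>y. u (y, 0))" if "hcont \<alpha> slab u" "\<And>z. z \<in> slab \<Longrightarrow> 3/2 < norm (fst z) \<Longrightarrow> u z = 0"
    for u :: "complex \<times> real \<Rightarrow> complex"
  proof -
    have "continuous_on UNIV (\<lambda>y. u (y, 0))"
      by (rule continuous_on_compose2[OF hcont_imp_continuous_on[OF that(1)]]) (use m in \<open>auto intro!: continuous_intros\<close>)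
    moreover have "u (y, 0) = 0" if "2 \<le> norm y" for y using \<open>\<And>z. z \<in> slab \<Longrightarrow> 3/2 < norm (fst z) \<Longrightarrow> u z = 0\<close>[OF m, of y] that by simp
    ultimately show ?thesis by (simp add: kern_0)
  qed
  {
    case (0 u)
    show ?case using base[of u] 0 by (simp add: hreg_0)
  next
    case (Suc n u)
    obtain u1 u2 ut where u: "hcont \<alpha> slab u" "has_grad 0 slab u u1 u2 ut" "hreg \<alpha> n 0 slab slab u1"
      "hreg \<alpha> n 0 slab slab u2" "0 < (0::nat) \<longrightarrow> hreg \<alpha> n (0 - 1) slab slab ut"
      using Suc.prems(1) by (rule hreg_SucE)
    \<comment> \<open>The function vanishes on an open set, so its derivatives vanish there too. The
      radius 3/2 lies below the radius 2 required of a kernel.\<close>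
    have "open ({x::complex. 3/2 < norm x} \<times> (UNIV :: real set))"
      by (intro open_Times open_Collect_less continuous_intros) auto
    moreover have "{z \<in> slab. 3/2 < norm (fst z)} = slab \<inter> ({x::complex. 3/2 < norm x} \<times> UNIV)" by auto
    ultimately have W: "openin (top_of_set slab) {z \<in> slab. 3/2 < norm (fst z)}"
      by (metis openin_open_Int)
    have z: "u1 z = 0" "u2 z = 0" if "z \<in> slab" "3/2 < norm (fst z)" for z
      using has_grad_zero(1,2)[OF u(2) W, of z] Suc.prems(2) that by auto
    have d: "((\<lambda>y. u (y, 0)) has_derivative (\<lambda>h. Re h *\<^sub>R u1 (y, 0) + Im h *\<^sub>R u2 (y, 0))) (at y)" for y
    proof -
      have 1: "((\<lambda>y. (y, 0::real)) has_derivative (\<lambda>h. (h, 0))) (at y)" by (auto intro!: derivative_eq_intros)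
      have "(u has_derivative gradmap (u1 (y, 0)) (u2 (y, 0)) (ut (y, 0))) (at (y, 0) within UNIV \<times> {0})"
        using has_gradD[OF u(2) m[of y]] by (simp add: tdom_def)
      hence 2: "(u has_derivative gradmap (u1 (y, 0)) (u2 (y, 0)) (ut (y, 0))) (at (y, 0) within (\<lambda>y. (y, 0)) ` UNIV)"
        by (rule has_derivative_subset) auto
      show ?thesis
        by (rule has_derivative_eq_rhs[OF diff_chain_within[unfolded o_def, OF 1 2]]) (simp add: gradmap_def fun_eq_iff)
    qed
    have "kern n (\<lambda>y. u1 (y, 0))" "kern n (\<lambda>y. u2 (y, 0))" using Suc.IH u z by auto
    moreover have "kern 0 (\<lambda>y. u (y, 0))" by (rule base[OF u(1)]) (rule Suc.prems(2))
    ultimately show ?case unfolding kern_Suc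
      by (intro conjI exI[of _ "\<lambda>y. u1 (y, 0)"] exI[of _ "\<lambda>y. u2 (y, 0)"] allI d)
  }
qed

lemma cutoff_nonneg: "0 \<le> cutoff s"
  using cutoff_antimono[of s "max s 2"] cutoff_eq_0[of "max s 2"] by simp

text \<open>A smooth truncation of \<open>1/y = cnj y/|y|\<^sup>2\<close> to the annulus \<open>1/2 \<le> |y| \<le> 2\<close>; its dyadic rescalings add up
  to the Cauchy kernel near \<open>0\<close>, and their \<open>\<partial>\<close>-bar derivatives telescope.\<close>

lemma cauchy_kernel_exists:
  obtains K K1 K2 K11 K12 K21 K22 :: "complex \<Rightarrow> complex" and p :: "complex \<Rightarrow> real"
  where "kern 0 K" "kern 0 K1" "kern 0 K2" "kern 0 K11" "kern 0 K12" "kern 0 K21" "kern 0 K22"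
    "\<And>y. (K has_derivative (\<lambda>h. Re h *\<^sub>R K1 y + Im h *\<^sub>R K2 y)) (at y)"
    "\<And>y. (K1 has_derivative (\<lambda>h. Re h *\<^sub>R K11 y + Im h *\<^sub>R K12 y)) (at y)"
    "\<And>y. (K2 has_derivative (\<lambda>h. Re h *\<^sub>R K21 y + Im h *\<^sub>R K22 y)) (at y)"
    "kern 0 (\<lambda>y. of_real (p y))" "\<And>y. 0 \<le> p y" "\<exists>y. 0 < p y" "\<And>y. norm y < 1 \<Longrightarrow> p y = 0"
    "\<And>y. K1 y + \<i> * K2 y = 2 * (4 * of_real (p (2 *\<^sub>R y)) - of_real (p y))"
proof -
  obtain \<theta> where \<theta>: "\<And>s. (cutoff has_real_derivative \<theta> s) (at s)" "\<And>n. smooth_upto n \<theta>"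
    "\<And>s. \<theta> s \<le> 0" "\<And>s. s < 1 \<Longrightarrow> \<theta> s = 0" "\<And>s. s > 2 \<Longrightarrow> \<theta> s = 0" "\<exists>s. 1 < s \<and> s < 2 \<and> \<theta> s < 0"
    by (rule cutoff_derivative) (rule that; (assumption | simp))
  \<comment> \<open>A smooth form of (cutoff s - cutoff (4s)) / s. The numerator vanishes for s
    \<le> 1/4, and for larger s the term \<open>cutoff (8 * s)\<close> is 0, so the quotient is the
    intended one, while the denominator never vanishes. With s = |y|^2 the factor 4 is one dyadic
    step in |y|.\<close>
  define q where "q s = (cutoff s + (- 1) * cutoff (4 * s)) * (s * inverse (s * s + cutoff (8 * s)))" for s
  have den: "s * s + cutoff (8 * s) \<noteq> 0" for s :: real
  proof (cases "s \<le> 1/8")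
    case True
    hence "cutoff (8 * s) = 1" by (simp add: cutoff_eq_1)
    thus ?thesis by (metis add_nonneg_pos less_irrefl zero_le_square zero_less_one)
  next
    case False
    hence "0 < s * s" by simp
    thus ?thesis using cutoff_nonneg[of "8 * s"] by linarith
  qed
  have sc: "smooth_upto n (\<lambda>s. cutoff (m * s))" for n m
    using smooth_upto_affine[OF smooth_upto_cutoff, of n m 0] by simp
  have sq: "smooth_upto n q" for n unfolding q_def
    by (intro smooth_upto_mult smooth_upto_add smooth_upto_const smooth_upto_cutoff sc smooth_upto_ident smooth_upto_inverse den)
  have sqs: "s * q s = cutoff s - cutoff (4 * s)" for s
  proof (cases "s \<le> 1/4")
    case True
    thus ?thesis by (simp add: q_def cutoff_eq_1)
  next
    case False
    hence "cutoff (8 * s) = 0" by (simp add: cutoff_eq_0)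
    thus ?thesis using False by (simp add: q_def field_simps)
  qed
  have q0: "q s = 0" if "2 \<le> s" for s using that by (simp add: q_def cutoff_eq_0)
  define Kz where "Kz z = q ((norm (fst z - 0))\<^sup>2) *\<^sub>R cnj (fst z)" for z :: "complex \<times> real"
  \<comment> \<open>The time interval is so wide that both V and \<open>boxsupp\<close> contain all
    times of [0,1]; only the space variable can leave the box.\<close>
  define V where "V = (ball 0 2 \<times> ball (1/2) 1) \<inter> slab"
  have bV: "bounded V" unfolding V_def by (intro bounded_Int disjI1 bounded_Times) auto
  have Vs: "V \<subseteq> slab" by (auto simp: V_def)
  have slabV: "z \<in> V \<longleftrightarrow> norm (fst z) < 2" if "z \<in> slab" for z
    using that by (cases z) (auto simp: V_def slab_def dist_real_def)
  have KV: "hreg (1/2) 2 0 V V Kz" unfolding Kz_def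
    by (intro hreg_scaleR hreg_compose_real[OF hreg_normsq(1)[OF bV _ _ Vs] sq]
        hreg_linear[OF bounded_linear_compose[OF bounded_linear_cnj bounded_linear_fst] bV] Vs) auto
  have nsq: "2 \<le> (norm x)\<^sup>2" if "3/2 \<le> norm x" for x :: complex
  proof -
    have "(3/2)\<^sup>2 \<le> (norm x)\<^sup>2" using that by (intro power_mono) auto
    thus ?thesis by (simp add: power2_eq_square)
  qed
  have K0: "Kz z = 0" if "3/2 \<le> norm (fst z)" for z
    using q0[OF nsq[OF that]] by (simp add: Kz_def)
  have "hreg (1/2) 2 0 slab slab (\<lambda>z. if z \<in> V then Kz z else 0)"
  proof (rule hreg_box_extend[OF _ _ _ V_def KV])
    fix z assume z: "z \<in> V - boxsupp 0 2 (1/2) 1"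
    obtain x t where zx: "z = (x, t)" by force
    have "0 \<le> t" "t \<le> 1" using z by (auto simp: zx V_def slab_def)
    hence "\<bar>1/2 - t\<bar> \<le> 3/4 * 1" by (intro abs_leI) linarith+
    hence "t \<in> cball (1/2) (3/4 * 1)" by (simp only: mem_cball dist_real_def)
    hence "3/2 < norm x" using z by (auto simp: zx V_def boxsupp_def)
    thus "Kz z = 0" using K0 by (simp add: zx)
  qed auto
  hence "hreg (1/2) 2 0 slab slab Kz"
    by (rule hreg_cong) (use slabV K0 in auto)
  from kern_of_hreg[OF this] K0 have k2: "kern (Suc (Suc 0)) (\<lambda>y. Kz (y, 0))" by (simp add: numeral_2_eq_2)
  define K where "K y = Kz (y, 0)" for y
  have kK: "kern (Suc (Suc 0)) K" using k2 by (simp add: K_def[abs_def])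
  obtain K1 K2 where K: "\<And>y. (K has_derivative (\<lambda>h. Re h *\<^sub>R K1 y + Im h *\<^sub>R K2 y)) (at y)" "kern (Suc 0) K1" "kern (Suc 0) K2"
    using kK unfolding kern_Suc[of "Suc 0"] by blast
  obtain K11 K12 where K1: "\<And>y. (K1 has_derivative (\<lambda>h. Re h *\<^sub>R K11 y + Im h *\<^sub>R K12 y)) (at y)" "kern 0 K11" "kern 0 K12"
    using K(2) unfolding kern_Suc[of 0] by blast
  obtain K21 K22 where K2: "\<And>y. (K2 has_derivative (\<lambda>h. Re h *\<^sub>R K21 y + Im h *\<^sub>R K22 y)) (at y)" "kern 0 K21" "kern 0 K22"
    using K(3) unfolding kern_Suc[of 0] by blast
  \<comment> \<open>Supported where 1 \<le> |y|^2 \<le> 2. Its vanishing for |y| < 1 later removes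
    the contribution of the coarsest scale.\<close>
  define p where "p y = - \<theta> ((norm y)\<^sup>2)" for y :: complex
  have c\<theta>: "continuous_on UNIV \<theta>" using smooth_upto_imp_continuous \<theta>(2) by blast
  have kp: "kern 0 (\<lambda>y. of_real (p y))" unfolding kern_0
  proof (intro conjI allI impI)
    show "continuous_on UNIV (\<lambda>y. complex_of_real (p y))" unfolding p_def
      by (intro continuous_intros continuous_on_compose2[OF c\<theta>]) auto
    fix y :: complex assume "2 \<le> norm y"
    hence "2\<^sup>2 \<le> (norm y)\<^sup>2" by (intro power_mono) auto
    thus "complex_of_real (p y) = 0" using \<theta>(5)[of "(norm y)\<^sup>2"] by (simp add: p_def)
  qed
  have p1: "p y = 0" if "norm y < 1" for y
    using \<theta>(4)[of "(norm y)\<^sup>2"] that by (simp add: p_def power_less_one_iff)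
  have pp: "\<exists>y. 0 < p y"
  proof -
    obtain s where s: "1 < s" "s < 2" "\<theta> s < 0" using \<theta>(6) by blast
    thus ?thesis by (intro exI[of _ "of_real (sqrt s)"]) (simp add: p_def)
  qed
  \<comment> \<open>Differentiating s q(s) = cutoff s - cutoff (4s) gives q + s q' = \<theta>(s) - 4
    \<theta>(4s), and the operator d_1 + i d_2 applied to q(|y|^2) cnj y is 2 (q + |y|^2 q'). The
    term 4 \<theta>(4s) is -4 p(2y).\<close>
  have id: "K1 y + \<i> * K2 y = 2 * (4 * of_real (p (2 *\<^sub>R y)) - of_real (p y))" for y
  proof -
    obtain q' where q': "\<And>s. (q has_real_derivative q' s) (at s)"
      using sq[of "Suc 0"] unfolding smooth_upto_Suc by blast
    let ?s = "(norm y)\<^sup>2"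
    have "((\<lambda>s. s * q s) has_real_derivative (1 * q ?s + q' ?s * ?s)) (at ?s)"
      by (intro DERIV_mult DERIV_ident q')
    moreover have "((\<lambda>s. cutoff s - cutoff (4 * s)) has_real_derivative (\<theta> ?s - \<theta> (4 * ?s) * 4)) (at ?s)"
    proof -
      have "((\<lambda>s. 4 * s) has_real_derivative 4) (at ?s)" by (auto intro!: derivative_eq_intros)
      from DERIV_chain2[OF \<theta>(1) this] show ?thesis by (intro DERIV_diff \<theta>(1))
    qed
    ultimately have e: "q ?s + q' ?s * ?s = \<theta> ?s - \<theta> (4 * ?s) * 4"
      using DERIV_unique[of "\<lambda>s. s * q s"] unfolding sqs by force
    have d: "(K has_derivative (\<lambda>h. q ?s *\<^sub>R cnj h + (2 * (y \<bullet> h) * q' ?s) *\<^sub>R cnj y)) (at y)"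
    proof -
      have n: "((\<lambda>y::complex. (norm y)\<^sup>2) has_derivative (\<lambda>h. 2 * (y \<bullet> h))) (at y)"
        unfolding power2_norm_eq_inner by (auto intro!: derivative_eq_intros simp: inner_commute)
      have "(q has_derivative (\<lambda>h. h * q' ?s)) (at ?s)"
        using q'[of ?s] by (simp add: has_field_derivative_def mult_commute_abs)
      from has_derivative_compose[OF n this]
      have "((\<lambda>y. q ((norm y)\<^sup>2)) has_derivative (\<lambda>h. 2 * (y \<bullet> h) * q' ?s)) (at y)" .
      from has_derivative_scaleR[OF this bounded_linear.has_derivative[OF bounded_linear_cnj has_derivative_ident]]
      show ?thesis by (simp add: K_def[abs_def] Kz_def)
    qed
    have eq: "(\<lambda>h. Re h *\<^sub>R K1 y + Im h *\<^sub>R K2 y) = (\<lambda>h. q ?s *\<^sub>R cnj h + (2 * (y \<bullet> h) * q' ?s) *\<^sub>R cnj y)"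
      by (rule has_derivative_unique[OF K(1) d])
    have v1: "K1 y = of_real (q ?s) + of_real (2 * Re y * q' ?s) * cnj y"
      using fun_cong[OF eq, of 1] by (simp add: inner_complex_def scaleR_conv_of_real)
    have v2: "K2 y = - of_real (q ?s) * \<i> + of_real (2 * Im y * q' ?s) * cnj y"
      using fun_cong[OF eq, of \<i>] by (simp add: inner_complex_def scaleR_conv_of_real)
    have "K1 y + \<i> * K2 y = 2 * of_real (q ?s) + 2 * of_real (q' ?s) * ((of_real (Re y) + \<i> * of_real (Im y)) * cnj y)"
      unfolding v1 v2 by (simp add: algebra_simps)
    also have "(of_real (Re y) + \<i> * of_real (Im y)) * cnj y = of_real ?s"
      using complex_eq[of y] complex_norm_square[of y] by simp
    also have "2 * complex_of_real (q ?s) + 2 * of_real (q' ?s) * of_real ?s = 2 * of_real (q ?s + q' ?s * ?s)" by simp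
    also have "\<dots> = 2 * (4 * of_real (p (2 *\<^sub>R y)) - of_real (p y))" unfolding e p_def by (simp add: power_mult_distrib)
    finally show ?thesis .
  qed
  show ?thesis
    by (rule that[OF kern_imp_0[OF kK] kern_imp_0[OF K(2)] kern_imp_0[OF K(3)] K1(2,3) K2(2,3) K(1) K1(1) K2(1) kp _ pp p1 id])
       (use \<theta>(3) in \<open>simp add: p_def\<close>)
qed

section \<open>The d-bar equation on the whole plane\<close>

locale cauchy_kernel = dyadic_kernel +
  fixes p :: "complex \<Rightarrow> real"
  assumes kp: "kern 0 (\<lambda>y. of_real (p y))" and p_nonneg: "\<And>y. 0 \<le> p y" and p_pos: "\<exists>y. 0 < p y"
    and p_zero: "\<And>y. norm y < 1 \<Longrightarrow> p y = 0"
    and dbar_id: "\<And>y. K1 y + \<i> * K2 y = 2 * (4 * of_real (p (2 *\<^sub>R y)) - of_real (p y))"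
begin

definition \<psi> :: "complex \<Rightarrow> complex" where "\<psi> y = of_real (p y)"

text \<open>The total mass of \<psi>, which plays the role of the factor \<pi> of the usual Cauchy
  formula.\<close>

definition cst :: complex where "cst = \<kappa> 0 ^ 2 *\<^sub>R conv (\<kappa> 0) \<psi> (\<lambda>z. 1) (0, 0)"

lemma k\<psi>: "kern 0 \<psi>"
  using kp by (simp add: \<psi>_def[abs_def])

text \<open>The d-bar derivative of one dyadic piece is a difference of the averaging kernel at two
  neighbouring scales; the factor 4 of \<open>dbar_id\<close> is exactly the ratio of the
  normalisations \<kappa>^2.\<close>

lemma telescope_step:
  assumes c: "continuous_on slab g" and t: "t \<in> {0..1}"
  shows "\<kappa> m ^ 2 *\<^sub>R (conv (\<kappa> m) K1 g (x, t) + \<i> * conv (\<kappa> m) K2 g (x, t)) =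
     2 * (\<kappa> (Suc m) ^ 2 *\<^sub>R conv (\<kappa> (Suc m)) \<psi> g (x, t) - \<kappa> m ^ 2 *\<^sub>R conv (\<kappa> m) \<psi> g (x, t))"
proof -
  have k2: "kern 0 (\<lambda>y. \<psi> (2 *\<^sub>R y))"
    using k\<psi> unfolding kern_0 by (auto intro!: continuous_intros continuous_on_compose2[of UNIV \<psi>])
  let ?Q = "sq (2 / \<kappa> m)"
  have 1: "((\<lambda>y. K1 (\<kappa> m *\<^sub>R y) * g (x - y, t) + \<i> * (K2 (\<kappa> m *\<^sub>R y) * g (x - y, t))) has_integral
      (conv (\<kappa> m) K1 g (x, t) + \<i> * conv (\<kappa> m) K2 g (x, t))) ?Q"
    by (intro has_integral_add has_integral_mult_right conv_has_integral k c t \<kappa>_pos order_refl)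
  have 2: "((\<lambda>y. 2 * (4 * (\<psi> (2 *\<^sub>R (\<kappa> m *\<^sub>R y)) * g (x - y, t)) - \<psi> (\<kappa> m *\<^sub>R y) * g (x - y, t))) has_integral
      2 * (4 * conv (\<kappa> m) (\<lambda>y. \<psi> (2 *\<^sub>R y)) g (x, t) - conv (\<kappa> m) \<psi> g (x, t))) ?Q"
  proof -
    have "((\<lambda>y. \<psi> (2 *\<^sub>R (\<kappa> m *\<^sub>R y)) * g (x - y, t)) has_integral conv (\<kappa> m) (\<lambda>y. \<psi> (2 *\<^sub>R y)) g (x, t)) ?Q"
      by (rule conv_has_integral[OF k2 c t \<kappa>_pos order_refl])
    thus ?thesis
      by (intro has_integral_diff has_integral_mult_right conv_has_integral k2 k\<psi> c t \<kappa>_pos order_refl)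
  qed
  have "(\<lambda>y. K1 (\<kappa> m *\<^sub>R y) * g (x - y, t) + \<i> * (K2 (\<kappa> m *\<^sub>R y) * g (x - y, t))) =
     (\<lambda>y. 2 * (4 * (\<psi> (2 *\<^sub>R (\<kappa> m *\<^sub>R y)) * g (x - y, t)) - \<psi> (\<kappa> m *\<^sub>R y) * g (x - y, t)))"
  proof
    fix y
    have "K1 (\<kappa> m *\<^sub>R y) * g (x - y, t) + \<i> * (K2 (\<kappa> m *\<^sub>R y) * g (x - y, t)) = (K1 (\<kappa> m *\<^sub>R y) + \<i> * K2 (\<kappa> m *\<^sub>R y)) * g (x - y, t)"
      by (simp add: algebra_simps)
    also have "\<dots> = 2 * (4 * (\<psi> (2 *\<^sub>R (\<kappa> m *\<^sub>R y)) * g (x - y, t)) - \<psi> (\<kappa> m *\<^sub>R y) * g (x - y, t))"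
      unfolding dbar_id \<psi>_def by (simp only: left_diff_distrib right_diff_distrib mult.assoc)
    finally show "K1 (\<kappa> m *\<^sub>R y) * g (x - y, t) + \<i> * (K2 (\<kappa> m *\<^sub>R y) * g (x - y, t)) =
      2 * (4 * (\<psi> (2 *\<^sub>R (\<kappa> m *\<^sub>R y)) * g (x - y, t)) - \<psi> (\<kappa> m *\<^sub>R y) * g (x - y, t))" .
  qed
  hence "conv (\<kappa> m) K1 g (x, t) + \<i> * conv (\<kappa> m) K2 g (x, t) =
     2 * (4 * conv (\<kappa> m) (\<lambda>y. \<psi> (2 *\<^sub>R y)) g (x, t) - conv (\<kappa> m) \<psi> g (x, t))"
    using integral_unique[OF 1] integral_unique[OF 2] by simp
  also have "conv (\<kappa> m) (\<lambda>y. \<psi> (2 *\<^sub>R y)) g (x, t) = conv (\<kappa> (Suc m)) \<psi> g (x, t)"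
    using conv_double[OF k\<psi> c t \<kappa>_pos, of m x] by (simp add: \<kappa>_def mult.assoc)
  finally have e: "conv (\<kappa> m) K1 g (x, t) + \<i> * conv (\<kappa> m) K2 g (x, t) =
     2 * (4 * conv (\<kappa> (Suc m)) \<psi> g (x, t) - conv (\<kappa> m) \<psi> g (x, t))" .
  have "\<kappa> (Suc m) ^ 2 = \<kappa> m ^ 2 * 4" by (simp add: \<kappa>_def power_mult_distrib)
  thus ?thesis unfolding e by (simp add: scaleR_conv_of_real algebra_simps)
qed

lemma conv_const: "conv \<kappa>' \<Phi> (\<lambda>z. 1) (x, t) = conv \<kappa>' \<Phi> (\<lambda>z. 1) (0, 0)"
  by (simp add: conv_def)

text \<open>Independence of the scale is the telescoping identity for the density 1: its left side
  is zero, since derivatives of kernels have mean zero.\<close>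

lemma mass: "\<kappa> m ^ 2 *\<^sub>R conv (\<kappa> m) \<psi> (\<lambda>z. 1) (x, t) = cst"
proof (induction m)
  case 0
  thus ?case unfolding cst_def conv_const[of _ _ x t] by simp
next
  case (Suc m)
  have "\<kappa> m ^ 2 *\<^sub>R (conv (\<kappa> m) K1 (\<lambda>z. 1) (0, 0) + \<i> * conv (\<kappa> m) K2 (\<lambda>z. 1) (0, 0)) = 0"
    using means(1,2)[of 0 m 0] by simp
  hence "2 * (\<kappa> (Suc m) ^ 2 *\<^sub>R conv (\<kappa> (Suc m)) \<psi> (\<lambda>z. 1) (0, 0) - \<kappa> m ^ 2 *\<^sub>R conv (\<kappa> m) \<psi> (\<lambda>z. 1) (0, 0)) = 0"
    using telescope_step[OF continuous_on_const, of 0 m 1 0] by simp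
  hence "\<kappa> (Suc m) ^ 2 *\<^sub>R conv (\<kappa> (Suc m)) \<psi> (\<lambda>z. 1) (0, 0) = \<kappa> m ^ 2 *\<^sub>R conv (\<kappa> m) \<psi> (\<lambda>z. 1) (0, 0)"
    by (metis (no_types) eq_iff_diff_eq_0 mult_eq_0_iff zero_neq_numeral)
  thus ?case using Suc unfolding conv_const[of _ _ x t] by simp
qed

text \<open>p is continuous, nonnegative and positive somewhere, necessarily inside the square of
  integration, so its integral cannot vanish.\<close>

lemma cst_nonzero: "cst \<noteq> 0"
proof
  assume "cst = 0"
  hence "conv (\<kappa> 0) \<psi> (\<lambda>z. 1) (0, 0) = 0" using \<kappa>_pos[of 0] by (simp add: cst_def)
  hence "((\<lambda>y. \<psi> (\<kappa> 0 *\<^sub>R y) * 1) has_integral 0) (sq (2 / \<kappa> 0))"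
    using conv_has_integral[OF k\<psi> continuous_on_const _ \<kappa>_pos order_refl, of 0 0 1 0] by simp
  from has_integral_linear[OF this bounded_linear_Re]
  have i: "((\<lambda>y. p (\<kappa> 0 *\<^sub>R y)) has_integral 0) (sq (2 / \<kappa> 0))" by (simp add: \<psi>_def o_def)
  have c: "continuous_on UNIV p"
  proof -
    have "continuous_on UNIV (\<lambda>y. Re (\<psi> y))" using k\<psi> by (auto simp: kern_0 intro!: continuous_intros)
    thus ?thesis by (simp add: \<psi>_def)
  qed
  obtain y where y: "0 < p y" using p_pos by blast
  let ?y = "(1 / \<kappa> 0) *\<^sub>R y"
  have yk: "\<kappa> 0 *\<^sub>R ?y = y" using \<kappa>_pos[of 0] by simp
  have "?y \<in> sq (2 / \<kappa> 0)"
  proof (rule ccontr)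
    assume "?y \<notin> sq (2 / \<kappa> 0)"
    from kern_outside_sq[OF k\<psi> \<kappa>_pos this] show False using y unfolding yk by (simp add: \<psi>_def)
  qed
  have "p (\<kappa> 0 *\<^sub>R ?y) = 0"
  proof (rule has_integral_0_cbox_imp_0[OF _ _ i[unfolded sq_def]])
    show "continuous_on (cbox (- Complex (2/\<kappa> 0) (2/\<kappa> 0)) (Complex (2/\<kappa> 0) (2/\<kappa> 0))) (\<lambda>y. p (\<kappa> 0 *\<^sub>R y))"
      by (intro continuous_on_compose2[OF c] continuous_intros) auto
    show "box (- Complex (2/\<kappa> 0) (2/\<kappa> 0)) (Complex (2/\<kappa> 0) (2/\<kappa> 0)) \<noteq> {}"
      using \<kappa>_pos[of 0] by (auto simp: box_ne_empty Basis_complex_def)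
    show "?y \<in> cbox (- Complex (2/\<kappa> 0) (2/\<kappa> 0)) (Complex (2/\<kappa> 0) (2/\<kappa> 0))" using \<open>?y \<in> sq (2 / \<kappa> 0)\<close> by (simp add: sq_def)
  qed (use p_nonneg in auto)
  thus False using y unfolding yk by simp
qed

text \<open>The averages over scale 1/\<kappa> differ from cst g(x) only by the oscillation of g
  over that scale, of order \<kappa>^(-\<alpha>).\<close>

lemma mass_limit:
  assumes g: "hcont \<alpha> slab g" and z: "(x, t) \<in> slab"
  shows "(\<lambda>m. \<kappa> m ^ 2 *\<^sub>R conv (\<kappa> m) \<psi> g (x, t)) \<longlonglongrightarrow> cst * g (x, t)"
proof -
  have t: "t \<in> {0..1}" using z by (simp add: slab_pair)
  obtain H where H: "0 \<le> H" "\<And>t x y. (x, t) \<in> slab \<Longrightarrow> (y, t) \<in> slab \<Longrightarrow> norm (g (x, t) - g (y, t)) \<le> H * dist x y powr \<alpha>"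
    using g by (rule hcontE) blast
  obtain M where M: "0 \<le> M" "\<And>y. norm (\<psi> y) \<le> M" using kern_bounded[OF k\<psi>] by blast
  have "\<forall>m. norm (\<kappa> m ^ 2 *\<^sub>R conv (\<kappa> m) \<psi> g (x, t) - cst * g (x, t)) \<le> (16 * M * H * 3 powr \<alpha>) * \<kappa> m powr (-\<alpha>)"
  proof
    fix m
    have "norm (conv (\<kappa> m) \<psi> g (x, t) - conv (\<kappa> m) \<psi> (\<lambda>z. 1) (x, t) * g (x, t)) \<le> M * (H * (3 / \<kappa> m) powr \<alpha>) * (16 / (\<kappa> m)\<^sup>2)"
      by (rule conv_bound_mean[OF k\<psi> hcont_imp_continuous_on[OF g] t \<kappa>_pos M(2) _ M(1) H(1) \<alpha>(1)]) (use H(2) t in \<open>auto simp: slab_pair\<close>)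
    hence "(\<kappa> m)\<^sup>2 * norm (conv (\<kappa> m) \<psi> g (x, t) - conv (\<kappa> m) \<psi> (\<lambda>z. 1) (x, t) * g (x, t)) \<le> (\<kappa> m)\<^sup>2 * (M * (H * (3 / \<kappa> m) powr \<alpha>) * (16 / (\<kappa> m)\<^sup>2))"
      by (intro mult_left_mono) auto
    also have "\<dots> = M * (H * (3 / \<kappa> m) powr \<alpha>) * 16" using \<kappa>_pos[of m] by simp
    also have "(3 / \<kappa> m) powr \<alpha> = 3 powr \<alpha> * \<kappa> m powr (-\<alpha>)"
      using \<kappa>_pos[of m] by (simp add: powr_divide powr_minus_divide)
    finally have b: "(\<kappa> m)\<^sup>2 * norm (conv (\<kappa> m) \<psi> g (x, t) - conv (\<kappa> m) \<psi> (\<lambda>z. 1) (x, t) * g (x, t)) \<le> (16 * M * H * 3 powr \<alpha>) * \<kappa> m powr (-\<alpha>)"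
      by (simp add: mult_ac)
    have "\<kappa> m ^ 2 *\<^sub>R conv (\<kappa> m) \<psi> g (x, t) - cst * g (x, t) =
        \<kappa> m ^ 2 *\<^sub>R (conv (\<kappa> m) \<psi> g (x, t) - conv (\<kappa> m) \<psi> (\<lambda>z. 1) (x, t) * g (x, t))"
      unfolding mass[of m x t, symmetric] by (simp add: scaleR_diff_right)
    thus "norm (\<kappa> m ^ 2 *\<^sub>R conv (\<kappa> m) \<psi> g (x, t) - cst * g (x, t)) \<le> (16 * M * H * 3 powr \<alpha>) * \<kappa> m powr (-\<alpha>)"
      using b by (simp only: norm_scaleR abs_power2)
  qed
  moreover have "(\<lambda>m. (16 * M * H * 3 powr \<alpha>) * \<kappa> m powr (-\<alpha>)) \<longlonglongrightarrow> 0"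
    by (rule summable_LIMSEQ_zero[OF summable_mult[OF summable_\<kappa>[OF \<alpha>(1)]]])
  ultimately have "(\<lambda>m. \<kappa> m ^ 2 *\<^sub>R conv (\<kappa> m) \<psi> g (x, t) - cst * g (x, t)) \<longlonglongrightarrow> 0"
    by (rule Lim_null_comparison[OF always_eventually])
  thus ?thesis by (simp add: LIM_zero_iff)
qed

text \<open>The d-bar derivatives of the dyadic pieces telescope to 2 (cst g(x) minus the average at
  the coarsest scale). That average only sees g(x - y) with |y| \<ge> 1/k0, where it vanishes by
  \<open>far\<close>; so the truncated kernel solves the equation exactly at x.\<close>

lemma dyad_dbar:
  assumes g: "hcont \<alpha> slab g" and z: "(x, t) \<in> slab"
    and far: "\<And>y. 1 / k0 \<le> norm y \<Longrightarrow> g (x - y, t) = 0"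
  shows "dyad 2 K1 g (x, t) + \<i> * dyad 2 K2 g (x, t) = 2 * (cst * g (x, t))"
proof -
  have t: "t \<in> {0..1}" using z by (simp add: slab_pair)
  let ?B = "\<lambda>m. \<kappa> m ^ 2 *\<^sub>R conv (\<kappa> m) \<psi> g (x, t)"
  have B0: "?B 0 = 0"
  proof -
    have "(\<lambda>y. \<psi> (\<kappa> 0 *\<^sub>R y) * g (x - y, t)) = (\<lambda>y. 0)"
    proof
      fix y show "\<psi> (\<kappa> 0 *\<^sub>R y) * g (x - y, t) = 0"
      proof (cases "1 / k0 \<le> norm y")
        case True
        thus ?thesis using far by simp
      next
        case False
        hence "norm (\<kappa> 0 *\<^sub>R y) < 1" using k0 by (simp add: \<kappa>_def field_simps)
        thus ?thesis using p_zero by (simp add: \<psi>_def)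
      qed
    qed
    thus ?thesis by (simp add: conv_def)
  qed
  have "(\<lambda>m. ?B (Suc m) - ?B m) sums (cst * g (x, t) - ?B 0)"
    by (rule telescope_sums[OF mass_limit[OF g z]])
  hence s1: "(\<lambda>m. 2 * (?B (Suc m) - ?B m)) sums (2 * (cst * g (x, t) - ?B 0))" by (rule sums_mult)
  have s2: "(\<lambda>m. \<kappa> m ^ 2 *\<^sub>R conv (\<kappa> m) K1 g (x, t) + \<i> * (\<kappa> m ^ 2 *\<^sub>R conv (\<kappa> m) K2 g (x, t))) sums
      (dyad 2 K1 g (x, t) + \<i> * dyad 2 K2 g (x, t))"
    unfolding dyad_def by (intro sums_add sums_mult summable_sums good_summable[OF _ g z] good)
  have e: "\<kappa> m ^ 2 *\<^sub>R conv (\<kappa> m) K1 g (x, t) + \<i> * (\<kappa> m ^ 2 *\<^sub>R conv (\<kappa> m) K2 g (x, t)) = 2 * (?B (Suc m) - ?B m)" for m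
    unfolding telescope_step[OF hcont_imp_continuous_on[OF g] t, symmetric] by (simp add: scaleR_add_right)
  have "dyad 2 K1 g (x, t) + \<i> * dyad 2 K2 g (x, t) = 2 * (cst * g (x, t) - ?B 0)"
    by (rule sums_unique2[OF s2[unfolded e] s1])
  thus ?thesis unfolding B0 by simp
qed

text \<open>A function on the plane is treated as a density constant in t and evaluated at t = 0.
  Convolution at (x, t) sees only the slice at t, so this agrees with the sum for any family having
  the given slice, and the operator acts slice by slice.\<close>

definition solve :: "(complex \<Rightarrow> complex) \<Rightarrow> complex \<Rightarrow> complex" where
  "solve h x = inverse cst * dyad 1 K (\<lambda>z. h (fst z)) (x, 0)"

lemma solve_eq: "solve (\<lambda>y. g (y, t)) x = inverse cst * dyad 1 K g (x, t)"
  by (simp add: solve_def dyad_def conv_def)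

lemma solve_dbar:
  assumes g: "hcont \<alpha> slab g" and z: "(x, t) \<in> slab"
    and far: "\<And>y. 1 / k0 \<le> norm y \<Longrightarrow> g (x - y, t) = 0"
  shows "dbar (solve (\<lambda>y. g (y, t))) x = g (x, t)"
proof -
  have t: "t \<in> {0..1}" using z by (simp add: slab_pair)
  have G: "has_grad 0 slab (\<lambda>z. inverse cst * dyad 1 K g z) (\<lambda>z. inverse cst * dyad 2 K1 g z) (\<lambda>z. inverse cst * dyad 2 K2 g z) (\<lambda>z. inverse cst * 0)"
    by (rule has_grad_bounded_linear[OF bounded_linear_mult_right dyad_kernel_grad[OF g, of "\<lambda>z. 0"]])
  have e: "solve (\<lambda>y. g (y, t)) = (\<lambda>x. inverse cst * dyad 1 K g (x, t))" using solve_eq by blast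
  have "dbar (solve (\<lambda>y. g (y, t))) x = inverse cst * (dyad 2 K1 g (x, t) + \<i> * dyad 2 K2 g (x, t)) / 2"
    unfolding dbar_def e has_grad_ddir[OF G z t] by (simp add: algebra_simps)
  also have "dyad 2 K1 g (x, t) + \<i> * dyad 2 K2 g (x, t) = 2 * (cst * g (x, t))" by (rule dyad_dbar[OF g z far])
  also have "inverse cst * (2 * (cst * g (x, t))) / 2 = g (x, t)" using cst_nonzero by simp
  finally show ?thesis .
qed

lemma solve_hreg:
  assumes "hreg \<alpha> n j slab slab g" "j \<le> n"
  shows "hreg \<alpha> (Suc n) j slab slab (\<lambda>(x, t). solve (\<lambda>y. g (y, t)) x)"
proof -
  have "(\<lambda>(x, t). solve (\<lambda>y. g (y, t)) x) = (\<lambda>z. inverse cst * dyad 1 K g z)"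
    by (auto simp: solve_eq)
  thus ?thesis using hreg_bounded_linear[OF bounded_linear_mult_right dyad_hreg[OF assms]] by simp
qed

lemma solve_linear:
  assumes "hcont \<alpha> slab g" "hcont \<alpha> slab h" "t \<in> {0..1}"
  shows "solve (\<lambda>y. a * g (y, t) + b * h (y, t)) x = a * solve (\<lambda>y. g (y, t)) x + b * solve (\<lambda>y. h (y, t)) x"
proof -
  have z: "(x, t) \<in> slab" using assms by (simp add: slab_pair)
  note c = assms(1,2)[THEN hcont_imp_continuous_on]
  have "conv (\<kappa> m) K (\<lambda>z. a * g z + b * h z) (x, t) = a * conv (\<kappa> m) K g (x, t) + b * conv (\<kappa> m) K h (x, t)" for m
  proof -
    have "((\<lambda>y. a * (K (\<kappa> m *\<^sub>R y) * g (x - y, t)) + b * (K (\<kappa> m *\<^sub>R y) * h (x - y, t))) has_integral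
        (a * conv (\<kappa> m) K g (x, t) + b * conv (\<kappa> m) K h (x, t))) (sq (2 / \<kappa> m))"
      by (intro has_integral_add has_integral_mult_right conv_has_integral k c assms \<kappa>_pos order_refl)
    from integral_unique[OF this] show ?thesis by (simp add: conv_def algebra_simps)
  qed
  hence e: "(\<lambda>m. \<kappa> m ^ 1 *\<^sub>R conv (\<kappa> m) K (\<lambda>z. a * g z + b * h z) (x, t)) =
      (\<lambda>m. a * (\<kappa> m ^ 1 *\<^sub>R conv (\<kappa> m) K g (x, t)) + b * (\<kappa> m ^ 1 *\<^sub>R conv (\<kappa> m) K h (x, t)))"
    by (simp add: algebra_simps)
  have s: "(\<lambda>m. a * (\<kappa> m ^ 1 *\<^sub>R conv (\<kappa> m) K g (x, t)) + b * (\<kappa> m ^ 1 *\<^sub>R conv (\<kappa> m) K h (x, t))) sums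
     (a * dyad 1 K g (x, t) + b * dyad 1 K h (x, t))"
    unfolding dyad_def by (intro sums_add sums_mult summable_sums good_summable[OF good(1) _ z] assms)
  have "dyad 1 K (\<lambda>z. a * g z + b * h z) (x, t) = a * dyad 1 K g (x, t) + b * dyad 1 K h (x, t)"
    unfolding dyad_def[of 1 K "\<lambda>z. a * g z + b * h z"] e by (rule sums_unique[OF s, symmetric])
  thus ?thesis
    using solve_eq[of "\<lambda>z. a * g z + b * h z" t x] unfolding solve_eq by (simp add: algebra_simps)
qed

end

subsection \<open>Iterated partial derivatives of a family\<close>

text \<open>Exchange of mixed derivatives when only one order is known to exist: the increment of w
  in s is the integral of \<open>wa\<close>, which may be differentiated in \<tau> under the
  integral sign. By uniqueness the increment of \<open>wb\<close> is the integral of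
  \<open>wab\<close>, and the fundamental theorem differentiates it. T may be one-sided at
  \<open>\<tau>0\<close>.\<close>

lemma swap_derivatives:
  fixes w :: "real \<Rightarrow> real \<Rightarrow> 'b::banach"
  assumes \<delta>: "0 < \<delta>" and T: "convex T" "\<tau>0 \<in> T" "at \<tau>0 within T \<noteq> bot"
    and wa: "\<And>s \<tau>. s \<in> {-\<delta>..\<delta>} \<Longrightarrow> \<tau> \<in> T \<Longrightarrow> ((\<lambda>s. w s \<tau>) has_vector_derivative wa s \<tau>) (at s)"
    and wab: "\<And>s \<tau>. s \<in> {-\<delta>..\<delta>} \<Longrightarrow> \<tau> \<in> T \<Longrightarrow> ((\<lambda>\<tau>. wa s \<tau>) has_vector_derivative wab s \<tau>) (at \<tau> within T)"
    and c: "continuous_on ({-\<delta>..\<delta>} \<times> T) (\<lambda>(s, \<tau>). wab s \<tau>)"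
    and wb: "\<And>s. s \<in> {-\<delta>..\<delta>} \<Longrightarrow> ((\<lambda>\<tau>. w s \<tau>) has_vector_derivative wb s) (at \<tau>0 within T)"
  shows "(wb has_vector_derivative wab 0 \<tau>0) (at 0)"
proof -
  have I: "((\<lambda>\<sigma>. wa \<sigma> \<tau>) has_integral (w s \<tau> - w (-\<delta>) \<tau>)) {-\<delta>..s}" if "s \<in> {-\<delta>..\<delta>}" "\<tau> \<in> T" for s \<tau>
    by (rule fundamental_theorem_of_calculus) (use that wa in \<open>auto intro: has_vector_derivative_at_within\<close>)
  have eq: "wb s = wb (-\<delta>) + integral {-\<delta>..s} (\<lambda>\<sigma>. wab \<sigma> \<tau>0)" if s: "s \<in> {-\<delta>..\<delta>}" for s
  proof -
    have "((\<lambda>\<tau>. integral (cbox (-\<delta>) s) (\<lambda>\<sigma>. wa \<sigma> \<tau>)) has_vector_derivative integral (cbox (-\<delta>) s) (\<lambda>\<sigma>. wab \<sigma> \<tau>0)) (at \<tau>0 within T)"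
    proof (rule leibniz_rule_vector_derivative)
      show "((\<lambda>\<tau>. wa \<sigma> \<tau>) has_vector_derivative wab \<sigma> \<tau>) (at \<tau> within T)" if "\<tau> \<in> T" "\<sigma> \<in> cbox (-\<delta>) s" for \<tau> \<sigma>
        using wab that s by auto
      show "(\<lambda>\<sigma>. wa \<sigma> \<tau>) integrable_on cbox (-\<delta>) s" if "\<tau> \<in> T" for \<tau>
        using I[OF s that] by (auto simp: integrable_on_def)
      have "continuous_on (T \<times> cbox (-\<delta>) s) (\<lambda>z. (case (snd z, fst z) of (s, \<tau>) \<Rightarrow> wab s \<tau>))"
        by (rule continuous_on_compose2[OF c]) (use s in \<open>auto intro!: continuous_intros\<close>)
      thus "continuous_on (T \<times> cbox (-\<delta>) s) (\<lambda>(\<tau>, \<sigma>). wab \<sigma> \<tau>)" by (simp add: split_beta)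
    qed (use T in auto)
    hence 1: "((\<lambda>\<tau>. integral {-\<delta>..s} (\<lambda>\<sigma>. wa \<sigma> \<tau>)) has_vector_derivative integral {-\<delta>..s} (\<lambda>\<sigma>. wab \<sigma> \<tau>0)) (at \<tau>0 within T)"
      by simp
    have m: "-\<delta> \<in> {-\<delta>..\<delta>}" using \<delta> by simp
    have "((\<lambda>\<tau>. w s \<tau> - w (-\<delta>) \<tau>) has_vector_derivative wb s - wb (-\<delta>)) (at \<tau>0 within T)"
      by (intro has_vector_derivative_diff wb s m)
    hence 2: "((\<lambda>\<tau>. integral {-\<delta>..s} (\<lambda>\<sigma>. wa \<sigma> \<tau>)) has_vector_derivative wb s - wb (-\<delta>)) (at \<tau>0 within T)"
      by (rule has_vector_derivative_transform[OF T(2), rotated]) (use integral_unique[OF I[OF s]] in simp)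
    have "wb s - wb (-\<delta>) = integral {-\<delta>..s} (\<lambda>\<sigma>. wab \<sigma> \<tau>0)"
      by (rule vector_derivative_unique_within[OF T(3) 2 1])
    thus ?thesis by (simp add: algebra_simps)
  qed
  have "continuous_on {-\<delta>..\<delta>} (\<lambda>s. (case (s, \<tau>0) of (s, \<tau>) \<Rightarrow> wab s \<tau>))"
    by (rule continuous_on_compose2[OF c]) (use T in \<open>auto intro!: continuous_intros\<close>)
  hence "((\<lambda>s. integral {-\<delta>..s} (\<lambda>\<sigma>. wab \<sigma> \<tau>0)) has_vector_derivative wab 0 \<tau>0) (at 0 within {-\<delta>..\<delta>})"
    using \<delta> by (intro integral_has_vector_derivative) auto
  hence "((\<lambda>s. wb (-\<delta>) + integral {-\<delta>..s} (\<lambda>\<sigma>. wab \<sigma> \<tau>0)) has_vector_derivative 0 + wab 0 \<tau>0) (at 0 within {-\<delta>..\<delta>})"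
    by (intro has_vector_derivative_add has_vector_derivative_const)
  hence D: "((\<lambda>s. wb (-\<delta>) + integral {-\<delta>..s} (\<lambda>\<sigma>. wab \<sigma> \<tau>0)) has_vector_derivative wab 0 \<tau>0) (at 0 within {-\<delta>..\<delta>})"
    by simp
  have m0: "0 \<in> {-\<delta>..\<delta>}" using \<delta> by simp
  have "(wb has_vector_derivative wab 0 \<tau>0) (at 0 within {-\<delta>..\<delta>})"
    by (rule has_vector_derivative_transform[OF m0 eq D])
  thus ?thesis using \<delta> by (simp add: at_within_Icc_at)
qed

lemma ddir_shift:
  fixes f :: "complex \<Rightarrow> 'b::real_normed_vector"
  shows "((\<lambda>s. f (p + s0 *\<^sub>R e + s *\<^sub>R e)) has_vector_derivative D) (at 0) \<Longrightarrow>
   ((\<lambda>s. f (p + s *\<^sub>R e)) has_vector_derivative D) (at (s0::real))"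
proof -
  assume "((\<lambda>s. f (p + s0 *\<^sub>R e + s *\<^sub>R e)) has_vector_derivative D) (at 0)"
  hence 1: "((\<lambda>s. f (p + s0 *\<^sub>R e + s *\<^sub>R e)) has_derivative (\<lambda>h. h *\<^sub>R D)) (at (s0 - s0))"
    by (simp add: has_vector_derivative_def)
  have 2: "((\<lambda>s. s - s0) has_derivative (\<lambda>h. h)) (at s0)" by (auto intro!: derivative_eq_intros)
  have e: "p + s0 *\<^sub>R e + (s - s0) *\<^sub>R e = p + s *\<^sub>R e" for s by (simp add: algebra_simps)
  show ?thesis using has_derivative_compose[OF 2 1] by (simp only: has_vector_derivative_def e)
qed

lemma swap_space_time:
  fixes w :: "complex \<times> real \<Rightarrow> 'b::banach"
  assumes V: "openin (top_of_set slab) V" "(x, t) \<in> V"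
    and wa: "\<And>x t. (x, t) \<in> V \<Longrightarrow> ((\<lambda>s. w (x + s *\<^sub>R e, t)) has_vector_derivative wa (x, t)) (at 0)"
    and wb: "\<And>x t. (x, t) \<in> V \<Longrightarrow> ((\<lambda>s. w (x, s)) has_vector_derivative wb (x, t)) (at t within {0..1})"
    and wab: "\<And>x t. (x, t) \<in> V \<Longrightarrow> ((\<lambda>s. wa (x, s)) has_vector_derivative wab (x, t)) (at t within {0..1})"
    and c: "continuous_on V wab" and e: "norm e = 1"
  shows "((\<lambda>s. wb (x + s *\<^sub>R e, t)) has_vector_derivative wab (x, t)) (at 0)"
proof -
  obtain d where d: "d > 0" "\<And>w. w \<in> slab \<Longrightarrow> dist w (x, t) < d \<Longrightarrow> w \<in> V"
    using openin_slab_ball[OF V] by blast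
  have t: "t \<in> {0..1}" using V openin_subset[OF V(1)] by (auto simp: slab_def)
  define \<delta> where "\<delta> = d / 3"
  have \<delta>: "0 < \<delta>" using d by (simp add: \<delta>_def)
  \<comment> \<open>An interval of times that stays in [0,1] and has positive length even if t is an
    end point.\<close>
  define T where "T = {max 0 (t - \<delta>)..min 1 (t + \<delta>)}"
  have m: "(x + s *\<^sub>R e, \<tau>) \<in> V" if "s \<in> {-\<delta>..\<delta>}" "\<tau> \<in> T" for s \<tau>
  proof (rule d(2))
    show "(x + s *\<^sub>R e, \<tau>) \<in> slab" using that by (auto simp: slab_def T_def)
    have "dist (x + s *\<^sub>R e, \<tau>) (x, t) \<le> dist (x + s *\<^sub>R e) x + dist \<tau> t"
      using dist_prod_le[of "(x + s *\<^sub>R e, \<tau>)" "(x, t)"] by simp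
    also have "\<dots> \<le> \<delta> + \<delta>" using that e by (intro add_mono) (auto simp: dist_norm T_def)
    also have "\<dots> < d" using d by (simp add: \<delta>_def)
    finally show "dist (x + s *\<^sub>R e, \<tau>) (x, t) < d" .
  qed
  have lt: "max 0 (t - \<delta>) < min 1 (t + \<delta>)" using t \<delta> by auto
  have tT: "t \<in> T" using t \<delta> by (auto simp: T_def)
  have Tsub: "T \<subseteq> {0..1}" by (auto simp: T_def)
  have lim: "at t within T \<noteq> bot" unfolding T_def using lt tT[unfolded T_def] by (simp add: trivial_limit_within)
  have "((\<lambda>s. wb (x + s *\<^sub>R e, t)) has_vector_derivative wab (x + 0 *\<^sub>R e, t)) (at 0)"
  proof (rule swap_derivatives[OF \<delta> _ tT lim, where w = "\<lambda>s \<tau>. w (x + s *\<^sub>R e, \<tau>)" and wa = "\<lambda>s \<tau>. wa (x + s *\<^sub>R e, \<tau>)"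
      and wb = "\<lambda>s. wb (x + s *\<^sub>R e, t)" and wab = "\<lambda>s \<tau>. wab (x + s *\<^sub>R e, \<tau>)"])
    show "convex T" by (simp add: T_def)
    fix s assume s: "s \<in> {-\<delta>..\<delta>}"
    show "((\<lambda>\<tau>. w (x + s *\<^sub>R e, \<tau>)) has_vector_derivative wb (x + s *\<^sub>R e, t)) (at t within T)"
      by (rule has_vector_derivative_within_subset[OF wb[OF m[OF s tT]] Tsub])
    fix \<tau> assume \<tau>: "\<tau> \<in> T"
    show "((\<lambda>s. w (x + s *\<^sub>R e, \<tau>)) has_vector_derivative wa (x + s *\<^sub>R e, \<tau>)) (at s)"
      by (rule ddir_shift[where f = "\<lambda>x. w (x, \<tau>)", OF wa[OF m[OF s \<tau>]]])
    show "((\<lambda>\<tau>. wa (x + s *\<^sub>R e, \<tau>)) has_vector_derivative wab (x + s *\<^sub>R e, \<tau>)) (at \<tau> within T)"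
      by (rule has_vector_derivative_within_subset[OF wab[OF m[OF s \<tau>]] Tsub])
  next
    show "continuous_on ({-\<delta>..\<delta>} \<times> T) (\<lambda>(s, \<tau>). wab (x + s *\<^sub>R e, \<tau>))" unfolding split_beta
      by (rule continuous_on_compose2[OF c]) (use m in \<open>auto intro!: continuous_intros\<close>)
  qed
  thus ?thesis by simp
qed

lemma swap_space_space:
  fixes w :: "complex \<times> real \<Rightarrow> 'b::banach"
  assumes V: "openin (top_of_set slab) V" "(x, t) \<in> V"
    and wa: "\<And>x t. (x, t) \<in> V \<Longrightarrow> ((\<lambda>s. w (x + s *\<^sub>R e, t)) has_vector_derivative wa (x, t)) (at 0)"
    and wb: "\<And>x t. (x, t) \<in> V \<Longrightarrow> ((\<lambda>s. w (x + s *\<^sub>R e', t)) has_vector_derivative wb (x, t)) (at 0)"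
    and wab: "\<And>x t. (x, t) \<in> V \<Longrightarrow> ((\<lambda>s. wa (x + s *\<^sub>R e', t)) has_vector_derivative wab (x, t)) (at 0)"
    and c: "continuous_on V wab" and e: "norm e = 1" "norm e' = 1"
  shows "((\<lambda>s. wb (x + s *\<^sub>R e, t)) has_vector_derivative wab (x, t)) (at 0)"
proof -
  obtain d where d: "d > 0" "\<And>w. w \<in> slab \<Longrightarrow> dist w (x, t) < d \<Longrightarrow> w \<in> V"
    using openin_slab_ball[OF V] by blast
  have t: "t \<in> {0..1}" using V openin_subset[OF V(1)] by (auto simp: slab_def)
  define \<delta> where "\<delta> = d / 3"
  have \<delta>: "0 < \<delta>" using d by (simp add: \<delta>_def)
  have m: "(x + s *\<^sub>R e + \<tau> *\<^sub>R e', t) \<in> V" if "s \<in> {-\<delta>..\<delta>}" "\<tau> \<in> {-\<delta>..\<delta>}" for s \<tau>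
  proof (rule d(2))
    show "(x + s *\<^sub>R e + \<tau> *\<^sub>R e', t) \<in> slab" using t by (auto simp: slab_def)
    have "dist (x + s *\<^sub>R e + \<tau> *\<^sub>R e', t) (x, t) = norm (s *\<^sub>R e + \<tau> *\<^sub>R e')"
      by (simp add: dist_Pair_Pair dist_norm add.assoc)
    also have "\<dots> \<le> \<delta> + \<delta>" using that e by (intro norm_triangle_le add_mono) auto
    also have "\<dots> < d" using d by (simp add: \<delta>_def)
    finally show "dist (x + s *\<^sub>R e + \<tau> *\<^sub>R e', t) (x, t) < d" .
  qed
  have z: "0 \<in> {-\<delta>..\<delta>}" using \<delta> by simp
  have sw: "x + s *\<^sub>R e + \<tau> *\<^sub>R e' = x + \<tau> *\<^sub>R e' + s *\<^sub>R e" for s \<tau> by simp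
  have "((\<lambda>s. wb (x + s *\<^sub>R e + 0 *\<^sub>R e', t)) has_vector_derivative wab (x + 0 *\<^sub>R e + 0 *\<^sub>R e', t)) (at 0)"
  proof (rule swap_derivatives[OF \<delta> convex_real_interval(5) z, where w = "\<lambda>s \<tau>. w (x + s *\<^sub>R e + \<tau> *\<^sub>R e', t)" and wa = "\<lambda>s \<tau>. wa (x + s *\<^sub>R e + \<tau> *\<^sub>R e', t)"
      and wb = "\<lambda>s. wb (x + s *\<^sub>R e + 0 *\<^sub>R e', t)" and wab = "\<lambda>s \<tau>. wab (x + s *\<^sub>R e + \<tau> *\<^sub>R e', t)"])
    show "at 0 within {-\<delta>..\<delta>} \<noteq> bot" using \<delta> by (simp add: trivial_limit_within)
    fix s assume s: "s \<in> {-\<delta>..\<delta>}"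
    show "((\<lambda>\<tau>. w (x + s *\<^sub>R e + \<tau> *\<^sub>R e', t)) has_vector_derivative wb (x + s *\<^sub>R e + 0 *\<^sub>R e', t)) (at 0 within {-\<delta>..\<delta>})"
      by (rule has_vector_derivative_at_within[OF ddir_shift[where f = "\<lambda>x. w (x, t)", OF wb[OF m[OF s z]]]])
    fix \<tau> assume \<tau>: "\<tau> \<in> {-\<delta>..\<delta>}"
    show "((\<lambda>s. w (x + s *\<^sub>R e + \<tau> *\<^sub>R e', t)) has_vector_derivative wa (x + s *\<^sub>R e + \<tau> *\<^sub>R e', t)) (at s)"
      unfolding sw by (rule ddir_shift[where f = "\<lambda>x. w (x, t)", OF wa[OF m[OF s \<tau>, unfolded sw]]])
    show "((\<lambda>\<tau>. wa (x + s *\<^sub>R e + \<tau> *\<^sub>R e', t)) has_vector_derivative wab (x + s *\<^sub>R e + \<tau> *\<^sub>R e', t)) (at \<tau> within {-\<delta>..\<delta>})"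
      by (rule has_vector_derivative_at_within[OF ddir_shift[where f = "\<lambda>x. wa (x, t)", OF wab[OF m[OF s \<tau>]]]])
  next
    show "continuous_on ({-\<delta>..\<delta>} \<times> {-\<delta>..\<delta>}) (\<lambda>(s, \<tau>). wab (x + s *\<^sub>R e + \<tau> *\<^sub>R e', t))" unfolding split_beta
      by (rule continuous_on_compose2[OF c]) (use m in \<open>auto intro!: continuous_intros\<close>)
  qed
  thus ?thesis by simp
qed

lemma total_space_iff: "(x, t) \<in> total_space D \<longleftrightarrow> t \<in> {0..1} \<and> x \<in> D t"
  by (simp add: total_space_def)

lemma dtx_Suc: "dtx (Suc i) p q u = dt (dtx i p q u)"
  by (simp add: dtx_def)

lemma dx_Suc: "dx (Suc p) q u = ddir 1 (dx p q u)"
  by (simp add: dx_def)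

lemma dx_0_Suc: "dx 0 (Suc q) u = ddir \<i> (dx 0 q u)"
  by (simp add: dx_def)

lemma dx_0_0: "dx 0 0 u = u"
  by (simp add: dx_def)

lemma dtx_0: "dtx 0 p q u t = dx p q (u t)"
  by (simp add: dtx_def)

lemma dtx_0_0: "dtx i 0 0 u = (dt ^^ i) u"
  by (simp add: dtx_def dx_0_0)

lemma ddir_cong:
  assumes "open \<Omega>" "x \<in> \<Omega>" "\<And>y. y \<in> \<Omega> \<Longrightarrow> f y = g y" "((\<lambda>s. g (x + s *\<^sub>R e)) has_vector_derivative D) (at 0)"
  shows "ddir e f x = D"
proof -
  have "open ((\<lambda>s. x + s *\<^sub>R e) -` \<Omega>)"
    by (rule open_vimage[OF assms(1)]) (auto intro!: continuous_intros)
  from has_vector_derivative_transform_within_open[OF assms(4) this, of "\<lambda>s. f (x + s *\<^sub>R e)"]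
  have "((\<lambda>s. f (x + s *\<^sub>R e)) has_vector_derivative D) (at 0)" using assms by simp
  thus ?thesis unfolding ddir_def by (rule vector_derivative_at)
qed

lemma has_dx_D1:
  assumes "has_dx (Suc p) q \<Omega> u" "x \<in> \<Omega>"
  shows "((\<lambda>s. dx p q u (x + s *\<^sub>R 1)) has_vector_derivative dx (Suc p) q u x) (at 0)"
  using assms unfolding has_dx_def has_ddir_def dx_Suc ddir_def by (simp add: vector_derivative_works[symmetric])

lemma has_dx_D2:
  assumes "has_dx 0 (Suc q) \<Omega> u" "x \<in> \<Omega>"
  shows "((\<lambda>s. dx 0 q u (x + s *\<^sub>R \<i>)) has_vector_derivative dx 0 (Suc q) u x) (at 0)"
  using assms unfolding has_dx_def has_ddir_def dx_0_Suc ddir_def by (simp add: vector_derivative_works[symmetric])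

text \<open>The definitions take the derivatives in the order \<open>\<partial>\<^sub>2\<close>, \<open>\<partial>\<^sub>1\<close>, \<open>\<partial>\<^sub>t\<close>; their continuity makes all
  other orders available.\<close>

lemma hoelder_fin_jet:
  fixes u :: "real \<Rightarrow> complex \<Rightarrow> 'b::banach"
  assumes \<alpha>: "0 < \<alpha>" "\<alpha> < 1" and u: "u \<in> hoelder_fin (real n + \<alpha>) j D" and jn: "j \<le> n"
    and V: "openin (top_of_set slab) (total_space D)" and oD: "\<And>t. t \<in> {0..1} \<Longrightarrow> open (D t)"
  obtains G :: "nat \<Rightarrow> nat \<Rightarrow> nat \<Rightarrow> complex \<times> real \<Rightarrow> 'b"
  where "\<forall>i p q. i \<le> j \<longrightarrow> i + p + q \<le> n \<longrightarrow> continuous_on (closure (total_space D)) (G i p q)"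
    "\<forall>i p q. i \<le> j \<longrightarrow> i + p + q < n \<longrightarrow>
       has_grad (j - i) (total_space D) (G i p q) (G i (Suc p) q) (G i p (Suc q)) (G (Suc i) p q)"
    "\<forall>i p q. i \<le> j \<longrightarrow> i + p + q = n \<longrightarrow>
       (\<exists>H. \<forall>x y t. (x, t) \<in> total_space D \<longrightarrow> (y, t) \<in> total_space D \<longrightarrow> norm (G i p q (x, t) - G i p q (y, t)) \<le> H * dist x y powr \<alpha>)"
    "\<forall>x t. (x, t) \<in> total_space D \<longrightarrow> G 0 0 0 (x, t) = u t x"
proof -
  let ?V = "total_space D"
  define w where "w i p q = (\<lambda>(x, t). dtx i p q u t x)" for i p q
  have st: "u \<in> hoelder_star (real n + \<alpha> - real i) i D" if "i \<le> j" for i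
    using u that by (auto simp: hoelder_fin_def)
  have hd: "has_dtx i p q D u" if "i \<le> j" "i + p + q \<le> n" for i p q
  proof -
    have "real (p + q) \<le> real n + \<alpha> - real i" using that \<alpha> by simp
    thus ?thesis using st[OF that(1)] unfolding hoelder_star_def by blast
  qed
  have ex: "\<exists>g. continuous_on (closure ?V) g \<and> (\<forall>z\<in>?V. g z = w i p q z)" if "i \<le> j" "i + p + q \<le> n" for i p q
  proof -
    have "real (p + q) \<le> real n + \<alpha> - real i" using that \<alpha> by simp
    hence "\<exists>g. continuous_on (closure ?V) g \<and> (\<forall>(x, t)\<in>?V. g (x, t) = dtx i p q u t x)"
      using st[OF that(1)] unfolding hoelder_star_def by blast
    thus ?thesis by (fastforce simp: w_def)
  qed
  \<comment> \<open>The continuous extensions of the derivatives to the closure, one for each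
    index.\<close>
  define G where "G i p q = (SOME g. continuous_on (closure ?V) g \<and> (\<forall>z\<in>?V. g z = w i p q z))" for i p q
  have G: "continuous_on (closure ?V) (G i p q)" "\<And>z. z \<in> ?V \<Longrightarrow> G i p q z = w i p q z" if "i \<le> j" "i + p + q \<le> n" for i p q
    using someI_ex[OF ex[OF that]] unfolding G_def[symmetric] by auto
  have cw: "continuous_on ?V (w i p q)" if "i \<le> j" "i + p + q \<le> n" for i p q
    using continuous_on_subset[OF G(1)[OF that] closure_subset] G(2)[OF that] by (simp cong: continuous_on_cong)
  have T: "((\<lambda>s. w i p q (x, s)) has_vector_derivative w (Suc i) p q (x, t)) (at t within {0..1})"
    if "Suc i \<le> j" "Suc i + p + q \<le> n" "(x, t) \<in> ?V" for i p q x t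
  proof -
    have "(\<lambda>s. dtx i p q u s x) differentiable (at t within {0..1})"
      using hd[OF that(1,2)] that(3) unfolding has_dtx_def by (simp add: total_space_iff)
    thus ?thesis unfolding w_def dtx_Suc dt_def vector_derivative_works by simp
  qed
  have X0: "((\<lambda>s. w 0 p q (x + s *\<^sub>R 1, t)) has_vector_derivative w 0 (Suc p) q (x, t)) (at 0)"
    if "Suc p + q \<le> n" "(x, t) \<in> ?V" for p q x t
    using has_dx_D1[of p q "D t" "u t" x] hd[of 0 "Suc p" q] that
    by (simp add: w_def dtx_0 has_dtx_def total_space_iff)
  have Y00: "((\<lambda>s. w 0 0 q (x + s *\<^sub>R \<i>, t)) has_vector_derivative w 0 0 (Suc q) (x, t)) (at 0)"
    if "Suc q \<le> n" "(x, t) \<in> ?V" for q x t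
    using has_dx_D2[of q "D t" "u t" x] hd[of 0 0 "Suc q"] that
    by (simp add: w_def dtx_0 has_dtx_def total_space_iff)
  \<comment> \<open>The next derivative along i is given by definition only when p = 0, because
    \<open>dx\<close> applies the derivatives along i first; for p > 0 it is moved past the
    derivatives along 1.\<close>
  have Y0: "((\<lambda>s. w 0 p q (x + s *\<^sub>R \<i>, t)) has_vector_derivative w 0 p (Suc q) (x, t)) (at 0)"
    if "p + Suc q \<le> n" "(x, t) \<in> ?V" for p q x t
    using that
  proof (induction p arbitrary: x t)
    case 0
    thus ?case using Y00 by simp
  next
    case (Suc p)
    show ?case
      by (rule swap_space_space[OF V Suc.prems(2), where w = "w 0 p q" and wa = "w 0 p (Suc q)" and e' = 1])
         (use Suc in \<open>auto intro!: Suc.IH X0[simplified] cw\<close>)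
  qed
  have X: "((\<lambda>s. w i p q (x + s *\<^sub>R 1, t)) has_vector_derivative w i (Suc p) q (x, t)) (at 0)"
    if "i \<le> j" "i + Suc p + q \<le> n" "(x, t) \<in> ?V" for i p q x t
    using that
  proof (induction i arbitrary: x t)
    case 0
    thus ?case using X0 by simp
  next
    case (Suc i)
    show ?case
      by (rule swap_space_time[OF V Suc.prems(3), where w = "w i p q" and wa = "w i (Suc p) q"])
         (use Suc in \<open>auto intro!: Suc.IH[simplified] T cw\<close>)
  qed
  have Y: "((\<lambda>s. w i p q (x + s *\<^sub>R \<i>, t)) has_vector_derivative w i p (Suc q) (x, t)) (at 0)"
    if "i \<le> j" "i + p + Suc q \<le> n" "(x, t) \<in> ?V" for i p q x t
    using that
  proof (induction i arbitrary: x t)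
    case 0
    thus ?case using Y0 by simp
  next
    case (Suc i)
    show ?case
      by (rule swap_space_time[OF V Suc.prems(3), where w = "w i p q" and wa = "w i p (Suc q)"])
         (use Suc in \<open>auto intro!: Suc.IH[simplified] T cw\<close>)
  qed
  have gw: "has_grad (j - i) ?V (w i p q) (w i (Suc p) q) (w i p (Suc q)) (w (Suc i) p q)"
    if "i \<le> j" "i + p + q < n" for i p q
    by (rule has_grad_partials[OF V]) (use that X Y T cw in auto)
  have gG: "has_grad (j - i) ?V (G i p q) (G i (Suc p) q) (G i p (Suc q)) (G (Suc i) p q)"
    if "i \<le> j" "i + p + q < n" for i p q
    by (rule has_grad_cong[OF gw[OF that] V]) (use that G(2) in auto)
  have top: "\<exists>H. \<forall>x y t. (x, t) \<in> ?V \<longrightarrow> (y, t) \<in> ?V \<longrightarrow> norm (G i p q (x, t) - G i p q (y, t)) \<le> H * dist x y powr \<alpha>"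
    if ij: "i \<le> j" "i + p + q = n" for i p q
  proof -
    \<comment> \<open>The Hoelder order that goes with i derivatives in t. As i + p + q = n, its
      integer part is p + q and its fractional part \<alpha>, so derivatives of orders p, q carry
      its Hoelder seminorm.\<close>
    let ?b = "real n + \<alpha> - real i"
    have b: "?b = real (p + q) + \<alpha>" using ij by simp
    have fl: "nat \<lfloor>?b\<rfloor> = p + q" "frac ?b = \<alpha>"
    proof -
      have "\<lfloor>real (p + q) + \<alpha>\<rfloor> = int (p + q)" using \<alpha> by (intro floor_unique) auto
      thus "nat \<lfloor>?b\<rfloor> = p + q" "frac ?b = \<alpha>" unfolding b frac_def by auto
    qed
    define X where "X = (SUP i'\<in>{..i}. SUP t\<in>{0..1}. hoelder_norm (D t) ?b ((dt ^^ i') u t))"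
    have "X < \<infinity>"
      using st[OF ij(1)] unfolding X_def hoelder_star_def by blast
    then obtain C where C: "X = ennreal C" "0 \<le> C"
      by (cases X rule: ennreal_cases) auto
    \<comment> \<open>The Hoelder norm differentiates in x after t, the table w the other way round;
      the exchanged derivatives X and Y identify the two.\<close>
    have wd: "dx p' q' ((dt ^^ i) u t) x = w i p' q' (x, t)" if "p' + q' \<le> p + q" "t \<in> {0..1}" "x \<in> D t" for p' q' x t
    proof -
      have 0: "dx 0 q' ((dt ^^ i) u t) x = w i 0 q' (x, t)" if "q' \<le> p + q" "x \<in> D t" for q' x
        using that
      proof (induction q' arbitrary: x)
        case 0
        thus ?case by (simp add: dx_0_0 w_def dtx_0_0)
      next
        case (Suc q')
        show ?case unfolding dx_0_Suc
          by (rule ddir_cong[OF oD[OF \<open>t \<in> {0..1}\<close>] Suc.prems(2), where g = "\<lambda>x. w i 0 q' (x, t)"])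
             (use Suc ij \<open>t \<in> {0..1}\<close> in \<open>auto intro!: Y simp: total_space_iff\<close>)
      qed
      show ?thesis using that
      proof (induction p' arbitrary: x)
        case 0
        thus ?case using \<open>\<And>x q'. q' \<le> p + q \<Longrightarrow> x \<in> D t \<Longrightarrow> dx 0 q' ((dt ^^ i) u t) x = w i 0 q' (x, t)\<close> by simp
      next
        case (Suc p')
        show ?case unfolding dx_Suc
          by (rule ddir_cong[OF oD[OF \<open>t \<in> {0..1}\<close>] Suc.prems(3), where g = "\<lambda>x. w i p' q' (x, t)"])
             (use Suc ij \<open>t \<in> {0..1}\<close> in \<open>auto intro!: X[simplified] simp: total_space_iff\<close>)
      qed
    qed
    have "norm (G i p q (x, t) - G i p q (y, t)) \<le> C * dist x y powr \<alpha>" if xy: "(x, t) \<in> ?V" "(y, t) \<in> ?V" for x y t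
    proof (cases "x = y")
      case True
      thus ?thesis using \<alpha> by simp
    next
      case False
      have t: "t \<in> {0..1}" "x \<in> D t" "y \<in> D t" using xy by (auto simp: total_space_iff)
      let ?v = "(dt ^^ i) u t"
      have N: "hoelder_norm (D t) ?b ?v \<le> ennreal C"
        unfolding C(1)[symmetric] X_def using t by (intro SUP_upper2[of i] SUP_upper2[of t]) auto
      define T where "T p' q' = (SUP x\<in>D t. SUP y\<in>D t - {x}. ennreal (norm (dx p' q' ?v x - dx p' q' ?v y) / dist x y powr \<alpha>))" for p' q'
      have fin: "finite {(p', q'). p' + q' = p + q}"
        by (rule finite_subset[of _ "{..p + q} \<times> {..p + q}"]) auto
      have "ennreal (norm (dx p q ?v x - dx p q ?v y) / dist x y powr \<alpha>) \<le> T p q"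
        unfolding T_def using t False by (intro SUP_upper2[of x] SUP_upper2[of y]) auto
      also have "\<dots> \<le> (\<Sum>(p', q')\<in>{(p', q'). p' + q' = p + q}. T p' q')"
        using member_le_sum[of "(p, q)" "{(p', q'). p' + q' = p + q}" "\<lambda>(p', q'). T p' q'"] fin by auto
      also have "\<dots> \<le> hoelder_norm (D t) ?b ?v"
      proof -
        have "\<forall>p' q'. p' + q' \<le> nat \<lfloor>?b\<rfloor> \<longrightarrow> has_dx p' q' (D t) ?v"
        proof (rule ccontr)
          assume a: "\<not> ?thesis"
          have "hoelder_norm (D t) ?b ?v = \<infinity>" unfolding hoelder_norm_def Let_def if_not_P[OF a] ..
          thus False using N by (simp add: top_unique)
        qed
        thus ?thesis unfolding hoelder_norm_def Let_def fl T_def using \<alpha> by (simp add: add_increasing)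
      qed
      finally have "ennreal (norm (dx p q ?v x - dx p q ?v y) / dist x y powr \<alpha>) \<le> ennreal C" using N by simp
      hence "norm (dx p q ?v x - dx p q ?v y) / dist x y powr \<alpha> \<le> C" using C(2) by (simp add: ennreal_le_iff)
      hence "norm (dx p q ?v x - dx p q ?v y) \<le> C * dist x y powr \<alpha>" using False by (simp add: pos_divide_le_eq)
      thus ?thesis using wd[OF order_refl t(1,2)] wd[OF order_refl t(1,3)] G(2)[OF ij(1)] ij xy by simp
    qed
    thus ?thesis by blast
  qed
  show ?thesis
    by (rule that[of G]) (use G gG top in \<open>auto simp: w_def dtx_0 dx_0_0\<close>)
qed

subsection \<open>Smooth families on the whole plane\<close>

text \<open>A family given on the whole plane by a function of class \<open>hreg\<close> on the
  slab. All iterated derivatives of the family are again of this kind, which turns regularity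
  statements into induction.\<close>

definition rep :: "real \<Rightarrow> nat \<Rightarrow> nat \<Rightarrow> (real \<Rightarrow> complex \<Rightarrow> 'b::banach) \<Rightarrow> bool" where
  "rep \<alpha> n j v \<longleftrightarrow> (\<exists>U. hreg \<alpha> n j slab slab U \<and> (\<forall>t\<in>{0..1}. \<forall>x. v t x = U (x, t)))"

lemma rep_ddir:
  assumes "rep \<alpha> (Suc n) j v"
  shows "rep \<alpha> n j (\<lambda>t. ddir e (v t))"
    and "t \<in> {0..1} \<Longrightarrow> has_ddir e \<Omega> (v t)"
proof -
  obtain U where U: "hreg \<alpha> (Suc n) j slab slab U" "\<And>t x. t \<in> {0..1} \<Longrightarrow> v t x = U (x, t)"
    using assms unfolding rep_def by blast
  obtain u1 u2 ut where u: "hcont \<alpha> slab U" "has_grad j slab U u1 u2 ut" "hreg \<alpha> n j slab slab u1"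
    "hreg \<alpha> n j slab slab u2" "0 < j \<longrightarrow> hreg \<alpha> n (j - 1) slab slab ut"
    using U(1) by (rule hreg_SucE)
  have m: "(x, t) \<in> slab" if "t \<in> {0..1}" for x t using that by (simp add: slab_def)
  have vt: "v t = (\<lambda>x. U (x, t))" if "t \<in> {0..1}" for t using U(2)[OF that] by blast
  show "rep \<alpha> n j (\<lambda>t. ddir e (v t))" unfolding rep_def
  proof (intro exI[of _ "\<lambda>z. Re e *\<^sub>R u1 z + Im e *\<^sub>R u2 z"] conjI ballI allI)
    show "hreg \<alpha> n j slab slab (\<lambda>z. Re e *\<^sub>R u1 z + Im e *\<^sub>R u2 z)"
      by (intro hreg_add hreg_bounded_linear[OF bounded_linear_scaleR_right] u)
    show "ddir e (v t) x = Re e *\<^sub>R u1 (x, t) + Im e *\<^sub>R u2 (x, t)" if "t \<in> {0..1}" for t x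
      unfolding vt[OF that] by (rule has_grad_ddir[OF u(2) m[OF that] that])
  qed
  show "has_ddir e \<Omega> (v t)" if "t \<in> {0..1}"
    unfolding has_ddir_def vt[OF that]
    using has_grad_dir[OF u(2) m[OF that] that] by (blast intro: differentiableI_vector)
qed

lemma rep_dt:
  assumes "rep \<alpha> (Suc n) j v" "0 < j"
  shows "rep \<alpha> n (j - 1) (dt v)"
    and "t \<in> {0..1} \<Longrightarrow> (\<lambda>s. v s x) differentiable (at t within {0..1})"
proof -
  obtain U where U: "hreg \<alpha> (Suc n) j slab slab U" "\<And>t x. t \<in> {0..1} \<Longrightarrow> v t x = U (x, t)"
    using assms unfolding rep_def by blast
  obtain u1 u2 ut where u: "hcont \<alpha> slab U" "has_grad j slab U u1 u2 ut" "hreg \<alpha> n j slab slab u1"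
    "hreg \<alpha> n j slab slab u2" "0 < j \<longrightarrow> hreg \<alpha> n (j - 1) slab slab ut"
    using U(1) by (rule hreg_SucE)
  have m: "(x, t) \<in> slab" if "t \<in> {0..1}" for x t using that by (simp add: slab_def)
  have d: "((\<lambda>s. v s x) has_vector_derivative ut (x, t)) (at t within {0..1})" if "t \<in> {0..1}" for x t
    by (rule has_vector_derivative_transform[OF that U(2) has_grad_time[OF u(2) m[OF that] that assms(2)]])
  show "(\<lambda>s. v s x) differentiable (at t within {0..1})" if "t \<in> {0..1}"
    using d[OF that] by (rule differentiableI_vector)
  show "rep \<alpha> n (j - 1) (dt v)" unfolding rep_def
  proof (intro exI[of _ ut] conjI ballI allI)
    show "hreg \<alpha> n (j - 1) slab slab ut" using u(5) assms(2) by blast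
    show "dt v t x = ut (x, t)" if "t \<in> {0..1}" for t x
      unfolding dt_def using that by (intro vector_derivative_within d[OF that]) (simp add: trivial_limit_within)
  qed
qed

lemma rep_dx:
  assumes "rep \<alpha> (n + p + q) j v"
  shows "rep \<alpha> n j (\<lambda>t. dx p q (v t))" and "t \<in> {0..1} \<Longrightarrow> has_dx p q \<Omega> (v t)"
proof -
  have z0: "rep \<alpha> n j (\<lambda>t. dx 0 q (v t))" if "rep \<alpha> (n + q) j v" for n q
    using that
  proof (induction q arbitrary: n)
    case 0
    thus ?case by (simp add: dx_0_0)
  next
    case (Suc q)
    have "rep \<alpha> (Suc n) j (\<lambda>t. dx 0 q (v t))" by (rule Suc.IH) (use Suc.prems in simp)
    from rep_ddir(1)[OF this] show ?case by (simp add: dx_0_Suc)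
  qed
  have 1: "rep \<alpha> n j (\<lambda>t. dx p q (v t))" if "rep \<alpha> (n + p + q) j v" for n p
    using that
  proof (induction p arbitrary: n)
    case 0
    thus ?case using z0 by simp
  next
    case (Suc p)
    have "rep \<alpha> (Suc n) j (\<lambda>t. dx p q (v t))" by (rule Suc.IH) (use Suc.prems in simp)
    from rep_ddir(1)[OF this] show ?case by (simp add: dx_Suc)
  qed
  show "rep \<alpha> n j (\<lambda>t. dx p q (v t))" by (rule 1[OF assms])
  show "has_dx p q \<Omega> (v t)" if t: "t \<in> {0..1}"
    unfolding has_dx_def
  proof (intro conjI allI impI)
    fix m assume "m < q"
    hence e: "n + p + q = Suc (n + p + (q - Suc m)) + m" by simp
    have "rep \<alpha> (Suc (n + p + (q - Suc m))) j (\<lambda>t. dx 0 m (v t))" by (rule z0[OF assms[unfolded e]])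
    from rep_ddir(2)[OF this t] show "has_ddir \<i> \<Omega> (dx 0 m (v t))" .
  next
    fix m assume "m < p"
    hence e: "n + p + q = Suc (n + (p - Suc m)) + m + q" by simp
    have "rep \<alpha> (Suc (n + (p - Suc m))) j (\<lambda>t. dx m q (v t))" by (rule 1[OF assms[unfolded e]])
    from rep_ddir(2)[OF this t] show "has_ddir 1 \<Omega> (dx m q (v t))" .
  qed
qed

lemma rep_dtx:
  assumes "rep \<alpha> (n + i + p + q) j v" "i \<le> j"
  shows "rep \<alpha> n (j - i) (dtx i p q v)" and "has_dtx i p q D v"
proof -
  have 1: "rep \<alpha> n (j - i) (dtx i p q v)" if "rep \<alpha> (n + i + p + q) j v" "i \<le> j" for n i
    using that
  proof (induction i arbitrary: n)
    case 0
    have "dtx 0 p q v = (\<lambda>t. dx p q (v t))" by (simp add: dtx_def)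
    thus ?case using rep_dx(1)[of \<alpha> n p q j v] 0 by simp
  next
    case (Suc i)
    have "rep \<alpha> (Suc n) (j - i) (dtx i p q v)" by (rule Suc.IH) (use Suc.prems in simp_all)
    from rep_dt(1)[OF this] Suc.prems show ?case by (simp add: dtx_Suc)
  qed
  show "rep \<alpha> n (j - i) (dtx i p q v)" by (rule 1[OF assms])
  show "has_dtx i p q D v" unfolding has_dtx_def
  proof (intro conjI ballI allI impI)
    show "has_dx p q (D t) (v t)" if "t \<in> {0..1}" for t
      using rep_dx(2)[of \<alpha> "n + i" p q j v] assms that by simp
    fix m t x assume m: "m < i" and t: "t \<in> {0..1::real}"
    have "n + i + p + q = Suc (n + (i - Suc m)) + m + p + q" using m by simp
    hence "rep \<alpha> (Suc (n + (i - Suc m))) (j - m) (dtx m p q v)" using assms m by (intro 1) auto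
    from rep_dt(2)[OF this _ t] m assms(2) show "(\<lambda>s. dtx m p q v s x) differentiable (at t within {0..1})" by simp
  qed
qed

text \<open>With a derivative to spare the function is Lipschitz in x and so Hoelder of every
  exponent. This serves an infinite index, where the finite orders to be checked may have any
  fractional part.\<close>

lemma rep_bounds:
  assumes "rep \<alpha> n j v" and \<beta>: "\<beta> = \<alpha> \<or> 0 < n" "0 < \<beta>" "\<beta> < 1"
  shows "\<exists>B\<ge>0. \<exists>H\<ge>0. \<forall>t\<in>{0..1}. \<forall>x y. norm (v t x) \<le> B \<and> norm (v t x - v t y) \<le> H * dist x y powr \<beta>"
proof -
  obtain U where U: "hreg \<alpha> n j slab slab U" "\<And>t x. t \<in> {0..1} \<Longrightarrow> v t x = U (x, t)"
    using assms unfolding rep_def by blast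
  have "hcont \<beta> slab U"
  proof (cases "\<beta> = \<alpha>")
    case True
    thus ?thesis using hreg_imp_hcont[OF U(1)] by simp
  next
    case False
    then obtain m where m: "n = Suc m" using \<beta>(1) by (metis gr0_conv_Suc)
    obtain u1 u2 ut where u: "hcont \<alpha> slab U" "has_grad j slab U u1 u2 ut" "hreg \<alpha> m j slab slab u1"
      "hreg \<alpha> m j slab slab u2" "0 < j \<longrightarrow> hreg \<alpha> m (j - 1) slab slab ut"
      using U(1) unfolding m by (rule hreg_SucE)
    obtain B where B: "\<And>z. z \<in> slab \<Longrightarrow> norm (U z) \<le> B" using u(1) by (rule hcontE) blast
    obtain B1 where B1: "\<And>z. z \<in> slab \<Longrightarrow> norm (u1 z) \<le> B1" using hreg_imp_hcont[OF u(3)] by (rule hcontE) blast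
    obtain B2 where B2: "\<And>z. z \<in> slab \<Longrightarrow> norm (u2 z) \<le> B2" using hreg_imp_hcont[OF u(4)] by (rule hcontE) blast
    show ?thesis
      by (rule hcont_of_grad[OF u(2) order_refl _ hcont_imp_continuous_on[OF u(1)] B B1 B2 \<beta>(2)])
         (use \<beta>(3) in \<open>auto simp: slab_def\<close>)
  qed
  then obtain B H where b: "0 \<le> B" "0 \<le> H" "\<And>z. z \<in> slab \<Longrightarrow> norm (U z) \<le> B"
    "\<And>t x y. (x, t) \<in> slab \<Longrightarrow> (y, t) \<in> slab \<Longrightarrow> norm (U (x, t) - U (y, t)) \<le> H * dist x y powr \<beta>"
    by (rule hcontE) blast
  show ?thesis
    by (intro exI[of _ B] exI[of _ H] conjI b(1,2) ballI allI) (use b(3,4) U(2) in \<open>auto simp: slab_def\<close>)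
qed

lemma rep_hoelder_star:
  assumes v: "rep \<alpha> N j v" and ij: "i \<le> j" and b: "0 \<le> b" and \<alpha>: "0 < \<alpha>" "\<alpha> < 1"
    and N: "i + nat \<lfloor>b\<rfloor> \<le> N" "frac b \<noteq> \<alpha> \<Longrightarrow> i + nat \<lfloor>b\<rfloor> < N"
    and D: "total_space D \<subseteq> slab" "bounded (total_space D)"
  shows "v \<in> hoelder_star b i D"
proof -
  have pq: "p + q \<le> nat \<lfloor>b\<rfloor>" if "real (p + q) \<le> b" for p q
    using that by (simp add: le_nat_floor)
  have clo: "closure (total_space D) \<subseteq> slab"
    using D(1) by (intro closure_minimal) (auto simp: slab_def intro!: closed_Times)
  have A: "has_dtx i' p q D v \<and> (\<exists>g. continuous_on (closure (total_space D)) g \<and> (\<forall>(x, t)\<in>total_space D. g (x, t) = dtx i' p q v t x))"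
    if "i' \<le> i" "real (p + q) \<le> b" for i' p q
  proof
    have e: "N = (N - (i' + p + q)) + i' + p + q" using pq[OF that(2)] that(1) N(1) by simp
    have "i' \<le> j" using that ij by simp
    note r = rep_dtx[of \<alpha> "N - (i' + p + q)" i' p q j v, folded e, OF v this]
    show "has_dtx i' p q D v" by (rule r(2))
    obtain U where U: "hreg \<alpha> (N - (i' + p + q)) (j - i') slab slab U" "\<And>t x. t \<in> {0..1} \<Longrightarrow> dtx i' p q v t x = U (x, t)"
      using r(1) unfolding rep_def by blast
    show "\<exists>g. continuous_on (closure (total_space D)) g \<and> (\<forall>(x, t)\<in>total_space D. g (x, t) = dtx i' p q v t x)"
      by (intro exI[of _ U] conjI continuous_on_subset[OF hcont_imp_continuous_on[OF hreg_imp_hcont[OF U(1)]] clo])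
         (auto simp: total_space_iff U(2))
  qed
  define nb where "nb = nat \<lfloor>b\<rfloor>"
  define I where "I = {(p, q). p + q \<le> nb}"
  have finI: "finite I" unfolding I_def by (rule finite_subset[of _ "{..nb} \<times> {..nb}"]) auto
  have fb: "frac b < 1" by (rule frac_lt_1)
  have vi: "rep \<alpha> (N - i') (j - i') ((dt ^^ i') v)" if "i' \<le> i" for i'
  proof -
    have "N = (N - i') + i' + 0 + 0" using that N(1) by simp
    thus ?thesis using rep_dtx(1)[of \<alpha> "N - i'" i' 0 0 j v] v that ij by (simp add: dtx_0_0)
  qed
  have vd: "rep \<alpha> (N - i' - p - q) (j - i') (\<lambda>t. dx p q ((dt ^^ i') v t))"
    "\<And>t \<Omega>. t \<in> {0..1} \<Longrightarrow> has_dx p q \<Omega> ((dt ^^ i') v t)" if "i' \<le> i" "p + q \<le> nb" for i' p q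
  proof -
    have "N - i' = (N - i' - p - q) + p + q" using that N(1) nb_def by simp
    thus "rep \<alpha> (N - i' - p - q) (j - i') (\<lambda>t. dx p q ((dt ^^ i') v t))"
      "\<And>t \<Omega>. t \<in> {0..1} \<Longrightarrow> has_dx p q \<Omega> ((dt ^^ i') v t)"
      using rep_dx[of \<alpha> "N - i' - p - q" p q "j - i'" "(dt ^^ i') v"] vi[OF that(1)] by simp_all
  qed
  \<comment> \<open>For an integer b no seminorm occurs in the norm, and \<alpha> merely stands in
    as an exponent for which bounds are available.\<close>
  define \<beta> where "\<beta> = (if 0 < frac b then frac b else \<alpha>)"
  have \<beta>: "0 < \<beta>" "\<beta> < 1" using \<alpha> fb by (auto simp: \<beta>_def)
  have "\<forall>i' p q. \<exists>B H. i' \<le> i \<longrightarrow> p + q \<le> nb \<longrightarrow> 0 \<le> B \<and> 0 \<le> H \<and> (\<forall>t\<in>{0..1}. \<forall>x y. norm (dx p q ((dt ^^ i') v t) x) \<le> B \<and>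
     norm (dx p q ((dt ^^ i') v t) x - dx p q ((dt ^^ i') v t) y) \<le> H * dist x y powr \<beta>)"
  proof (intro allI)
    fix i' p q
    show "\<exists>B H. i' \<le> i \<longrightarrow> p + q \<le> nb \<longrightarrow> 0 \<le> B \<and> 0 \<le> H \<and> (\<forall>t\<in>{0..1}. \<forall>x y. norm (dx p q ((dt ^^ i') v t) x) \<le> B \<and>
       norm (dx p q ((dt ^^ i') v t) x - dx p q ((dt ^^ i') v t) y) \<le> H * dist x y powr \<beta>)"
    proof (cases "i' \<le> i \<and> p + q \<le> nb")
      case True
      have "\<beta> = \<alpha> \<or> 0 < N - i' - p - q"
      proof (cases "frac b = \<alpha>")
        case False
        have "i + nb < N" using N(2)[OF False] by (simp add: nb_def)
        thus ?thesis using True by simp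
      qed (simp add: \<beta>_def)
      from rep_bounds[OF vd(1) this \<beta>] True show ?thesis by blast
    qed auto
  qed
  then obtain B H where BH: "\<And>i' p q. i' \<le> i \<Longrightarrow> p + q \<le> nb \<Longrightarrow> 0 \<le> B i' p q \<and> 0 \<le> H i' p q \<and> (\<forall>t\<in>{0..1}. \<forall>x y. norm (dx p q ((dt ^^ i') v t) x) \<le> B i' p q \<and>
     norm (dx p q ((dt ^^ i') v t) x - dx p q ((dt ^^ i') v t) y) \<le> H i' p q * dist x y powr \<beta>)"
    by metis
  define C where "C = (\<Sum>i'\<le>i. \<Sum>(p, q)\<in>I. B i' p q + H i' p q)"
  have hn: "hoelder_norm (D t) b ((dt ^^ i') v t) \<le> (\<Sum>(p, q)\<in>I. ennreal (B i' p q)) + (\<Sum>(p, q)\<in>I. ennreal (H i' p q))"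
    if "i' \<le> i" "t \<in> {0..1}" for i' t
  proof -
    let ?v = "(dt ^^ i') v t"
    have c: "\<forall>p q. p + q \<le> nat \<lfloor>b\<rfloor> \<longrightarrow> has_dx p q (D t) ?v" using vd(2)[OF that(1)] that(2) by (simp add: nb_def)
    have s1: "(\<Sum>(p, q)\<in>{(p, q). p + q \<le> nat \<lfloor>b\<rfloor>}. SUP x\<in>D t. ennreal (norm (dx p q ?v x))) \<le> (\<Sum>(p, q)\<in>I. ennreal (B i' p q))"
      unfolding I_def nb_def[symmetric]
    proof (rule sum_mono, clarify)
      fix p q assume "p + q \<le> nb"
      thus "(SUP x\<in>D t. ennreal (norm (dx p q ?v x))) \<le> ennreal (B i' p q)"
        using BH[OF that(1)] that(2) by (intro SUP_least ennreal_leI) blast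
    qed
    have s2: "(if 0 < frac b then (\<Sum>(p, q)\<in>{(p, q). p + q = nat \<lfloor>b\<rfloor>}.
              SUP x\<in>D t. SUP y\<in>D t - {x}. ennreal (norm (dx p q ?v x - dx p q ?v y) / dist x y powr frac b)) else 0)
       \<le> (\<Sum>(p, q)\<in>I. ennreal (H i' p q))"
    proof (cases "0 < frac b")
      case True
      hence be: "\<beta> = frac b" by (simp add: \<beta>_def)
      have "(\<Sum>(p, q)\<in>{(p, q). p + q = nat \<lfloor>b\<rfloor>}.
              SUP x\<in>D t. SUP y\<in>D t - {x}. ennreal (norm (dx p q ?v x - dx p q ?v y) / dist x y powr frac b))
          \<le> (\<Sum>(p, q)\<in>{(p, q). p + q = nat \<lfloor>b\<rfloor>}. ennreal (H i' p q))"
        unfolding nb_def[symmetric]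
      proof (rule sum_mono)
        fix z assume "z \<in> {(p, q). p + q = nb}"
        then obtain p q where z: "z = (p, q)" and pq: "p + q = nb" by (cases z) auto
        have "(SUP x\<in>D t. SUP y\<in>D t - {x}. ennreal (norm (dx p q ?v x - dx p q ?v y) / dist x y powr frac b)) \<le> ennreal (H i' p q)"
        proof (intro SUP_least ennreal_leI)
          fix x y assume "y \<in> D t - {x}"
          hence "0 < dist x y powr frac b" by auto
          thus "norm (dx p q ?v x - dx p q ?v y) / dist x y powr frac b \<le> H i' p q"
            using BH[OF that(1), of p q] pq that(2) by (simp add: pos_divide_le_eq be)
        qed
        thus "(case z of (p, q) \<Rightarrow> SUP x\<in>D t. SUP y\<in>D t - {x}. ennreal (norm (dx p q ?v x - dx p q ?v y) / dist x y powr frac b))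
            \<le> (case z of (p, q) \<Rightarrow> ennreal (H i' p q))" by (simp add: z)
      qed
      also have "\<dots> \<le> (\<Sum>(p, q)\<in>I. ennreal (H i' p q))"
        by (rule sum_mono2[OF finI]) (auto simp: I_def nb_def)
      finally show ?thesis using True by simp
    qed auto
    show ?thesis unfolding hoelder_norm_def Let_def if_P[OF c] by (rule add_mono[OF s1 s2])
  qed
  have "(SUP i'\<in>{..i}. SUP t\<in>{0..1}. hoelder_norm (D t) b ((dt ^^ i') v t)) \<le>
     (\<Sum>i'\<le>i. (\<Sum>(p, q)\<in>I. ennreal (B i' p q)) + (\<Sum>(p, q)\<in>I. ennreal (H i' p q)))"
  proof (intro SUP_least)
    fix i' t assume i': "i' \<in> {..i}" and t: "t \<in> {0..1::real}"
    have "hoelder_norm (D t) b ((dt ^^ i') v t) \<le> (\<Sum>(p, q)\<in>I. ennreal (B i' p q)) + (\<Sum>(p, q)\<in>I. ennreal (H i' p q))"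
      using hn i' t by simp
    also have "\<dots> \<le> (\<Sum>i'\<le>i. (\<Sum>(p, q)\<in>I. ennreal (B i' p q)) + (\<Sum>(p, q)\<in>I. ennreal (H i' p q)))"
      using i' by (intro member_le_sum) auto
    finally show "hoelder_norm (D t) b ((dt ^^ i') v t) \<le> (\<Sum>i'\<le>i. (\<Sum>(p, q)\<in>I. ennreal (B i' p q)) + (\<Sum>(p, q)\<in>I. ennreal (H i' p q)))" .
  qed
  also have "\<dots> < \<infinity>" using finI by (simp add: less_top[symmetric] ennreal_sum_eq_top split_beta)
  finally show ?thesis unfolding hoelder_star_def using A by blast
qed

text \<open>The finite indices \<open>(n, m)\<close> whose spaces \<open>C\<^bsup>n+\<alpha>,m\<^esup>\<close> intersect to \<open>C\<^bsup>k+\<alpha>,j\<^esup>\<close>.\<close>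

definition admissible :: "enat \<Rightarrow> enat \<Rightarrow> nat \<Rightarrow> nat \<Rightarrow> bool" where
  "admissible k j n m \<longleftrightarrow> (k \<noteq> \<infinity> \<longrightarrow> enat n = k) \<and> (j \<noteq> \<infinity> \<longrightarrow> enat m = j) \<and> m \<le> n"

lemma hoelder_closedD:
  assumes "u \<in> hoelder_closed (ereal_of_enat k + ereal \<alpha>) j D" "admissible k j n m" "0 < \<alpha>"
  shows "u \<in> hoelder_fin (real n + \<alpha>) m D"
proof -
  have "ereal (real n + \<alpha>) = ereal_of_enat k + ereal \<alpha>" if "ereal_of_enat k + ereal \<alpha> \<noteq> \<infinity>"
    using assms(2) that by (cases k) (auto simp: admissible_def)
  moreover have "real m \<le> real n + \<alpha>" using assms(2,3) by (simp add: admissible_def)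
  ultimately show ?thesis using assms unfolding hoelder_closed_def admissible_def by blast
qed

lemma hoelder_closed_SucD:
  assumes "u \<in> hoelder_closed (ereal_of_enat k + 1 + ereal \<alpha>) j D" "admissible k j n m" "0 < \<alpha>"
  shows "u \<in> hoelder_fin (real (Suc n) + \<alpha>) m D"
proof -
  have "ereal (real (Suc n) + \<alpha>) = ereal_of_enat k + 1 + ereal \<alpha>" if "ereal_of_enat k + 1 + ereal \<alpha> \<noteq> \<infinity>"
    using assms(2) that by (cases k) (auto simp: admissible_def one_ereal_def)
  moreover have "real m \<le> real (Suc n) + \<alpha>" using assms(2,3) by (simp add: admissible_def)
  ultimately show ?thesis using assms unfolding hoelder_closed_def admissible_def by blast
qed

text \<open>For finite k there is a single order to check and its fractional part is \<alpha>. For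
  infinite k every real order has to be checked, and each is reached from a larger admissible
  integer order.\<close>

lemma hoelder_closed_SucI:
  assumes \<alpha>: "0 < \<alpha>" "\<alpha> < 1" and jk: "j \<le> k" and D: "total_space D \<subseteq> slab" "bounded (total_space D)"
    and r: "\<And>n m. admissible k j n m \<Longrightarrow> rep \<alpha> (Suc n) m v"
  shows "v \<in> hoelder_closed (ereal_of_enat k + 1 + ereal \<alpha>) j D"
  unfolding hoelder_closed_def
proof (intro CollectI conjI allI impI)
  show "ereal_of_enat j \<le> ereal_of_enat k + 1 + ereal \<alpha>"
  proof (cases k)
    case (enat K)
    then obtain J where "j = enat J" "J \<le> K" using jk by (cases j) auto
    thus ?thesis using enat \<alpha> by (simp add: one_ereal_def)
  next
    case infinity
    thus ?thesis by simp
  qed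
  fix a' j'
  assume a: "real j' \<le> a' \<and> (ereal_of_enat k + 1 + ereal \<alpha> \<noteq> \<infinity> \<longrightarrow> ereal a' = ereal_of_enat k + 1 + ereal \<alpha>) \<and> (j \<noteq> \<infinity> \<longrightarrow> enat j' = j)"
  show "v \<in> hoelder_fin a' j' D"
    unfolding hoelder_fin_def
  proof (rule INT_I)
    fix i assume i: "i \<in> {..j'}"
    hence ai: "0 \<le> a' - real i" using a by simp
    show "v \<in> hoelder_star (a' - real i) i D"
    proof (cases k)
      case (enat K)
      obtain J where J: "j = enat J" "J \<le> K" using jk enat by (cases j) auto
      have j': "j' = J" using a J by simp
      have a': "a' = real (Suc K) + \<alpha>" using a enat by (simp add: one_ereal_def)
      have adm: "admissible k j K J" using enat J by (simp add: admissible_def)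
      have iJ: "i \<le> J" using i j' by simp
      have b: "a' - real i = real (Suc K - i) + \<alpha>" using iJ J(2) by (simp add: a' of_nat_diff)
      have fl: "nat \<lfloor>a' - real i\<rfloor> = Suc K - i" "frac (a' - real i) = \<alpha>"
      proof -
        have "\<lfloor>real (Suc K - i) + \<alpha>\<rfloor> = int (Suc K - i)" using \<alpha> by (intro floor_unique) auto
        thus "nat \<lfloor>a' - real i\<rfloor> = Suc K - i" "frac (a' - real i) = \<alpha>" unfolding b frac_def by auto
      qed
      show ?thesis
        by (rule rep_hoelder_star[OF r[OF adm] iJ ai \<alpha> _ _ D]) (use fl iJ J(2) in auto)
    next
      case infinity
      \<comment> \<open>At least the order a', so that \<open>Suc n\<close> leaves one derivative to
        spare for an arbitrary fractional part, and at least j', so that the pair is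
        admissible.\<close>
      define n where "n = max (nat \<lceil>a'\<rceil>) j'"
      have adm: "admissible k j n j'" using infinity a by (simp add: admissible_def n_def)
      have "i + nat \<lfloor>a' - real i\<rfloor> \<le> nat \<lceil>a'\<rceil>"
      proof -
        have "real (nat \<lfloor>a' - real i\<rfloor>) \<le> a' - real i" using ai by simp
        hence "real (i + nat \<lfloor>a' - real i\<rfloor>) \<le> a'" by simp
        also have "\<dots> \<le> real (nat \<lceil>a'\<rceil>)" by (rule real_nat_ceiling_ge)
        finally show ?thesis by simp
      qed
      hence "i + nat \<lfloor>a' - real i\<rfloor> < Suc n" by (simp add: n_def)
      thus ?thesis
        by (intro rep_hoelder_star[OF r[OF adm] _ ai \<alpha> _ _ D]) (use i in auto)
    qed
  qed
qed

lemma slab_eq: "UNIV \<times> {0..1} = slab"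
  by (simp add: slab_def)

lemma closed_slab: "closed slab"
  unfolding slab_def by (intro closed_Times) auto

lemma tbox_closure: "closure (tbox x0 s t0 \<tau>) \<subseteq> (cball x0 s \<times> cball t0 \<tau>) \<inter> slab"
  by (intro closure_minimal closed_Int closed_Times closed_slab) (auto simp: tbox_def)

lemma bounded_tbox: "bounded (tbox x0 s t0 \<tau>)"
  unfolding tbox_def by (intro bounded_Int disjI1 bounded_Times) auto

text \<open>Top order derivatives carry the given Hoelder bound; the lower ones are bounded on a
  compact closure and get theirs from the next derivatives, as the slices are convex.\<close>

lemma hcont_of_jet:
  fixes G :: "nat \<Rightarrow> nat \<Rightarrow> nat \<Rightarrow> complex \<times> real \<Rightarrow> 'b::banach"
  assumes \<alpha>: "0 < \<alpha>" "\<alpha> < 1" and V: "V \<subseteq> slab" "bounded V" "\<And>t. convex {x. (x, t) \<in> V}"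
    and c: "\<forall>i p q. i \<le> m \<longrightarrow> i + p + q \<le> n \<longrightarrow> continuous_on (closure V) (G i p q)"
    and g: "\<forall>i p q. i \<le> m \<longrightarrow> i + p + q < n \<longrightarrow> has_grad (m - i) V (G i p q) (G i (Suc p) q) (G i p (Suc q)) (G (Suc i) p q)"
    and top: "\<forall>i p q. i \<le> m \<longrightarrow> i + p + q = n \<longrightarrow>
       (\<exists>H. \<forall>x y t. (x, t) \<in> V \<longrightarrow> (y, t) \<in> V \<longrightarrow> norm (G i p q (x, t) - G i p q (y, t)) \<le> H * dist x y powr \<alpha>)"
    and ipq: "i \<le> m" "i + p + q \<le> n"
  shows "hcont \<alpha> V (G i p q)"
proof -
  have cV: "continuous_on V (G i p q)" if "i \<le> m" "i + p + q \<le> n" for i p q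
    using c that continuous_on_subset[OF _ closure_subset] by blast
  have b: "\<exists>B. \<forall>z\<in>V. norm (G i p q z) \<le> B" if "i \<le> m" "i + p + q \<le> n" for i p q
  proof -
    have "bounded (G i p q ` closure V)"
      using c that V(2) by (intro compact_imp_bounded compact_continuous_image) (auto simp: compact_closure)
    then obtain B where "\<forall>z\<in>closure V. norm (G i p q z) \<le> B" unfolding bounded_iff by auto
    thus ?thesis using closure_subset by blast
  qed
  obtain B where B: "\<And>z. z \<in> V \<Longrightarrow> norm (G i p q z) \<le> B" using b[OF ipq] by blast
  show ?thesis
  proof (cases "i + p + q = n")
    case True
    then obtain H where H: "\<forall>x y t. (x, t) \<in> V \<longrightarrow> (y, t) \<in> V \<longrightarrow> norm (G i p q (x, t) - G i p q (y, t)) \<le> H * dist x y powr \<alpha>"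
      using top ipq by blast
    show ?thesis by (rule hcontI[OF cV[OF ipq] B]) (use H in auto)
  next
    case False
    hence lt: "i + p + q < n" using ipq by simp
    have i1: "i + Suc p + q \<le> n" and i2: "i + p + Suc q \<le> n" using lt by auto
    obtain B1 where B1: "\<And>z. z \<in> V \<Longrightarrow> norm (G i (Suc p) q z) \<le> B1" using b[OF ipq(1) i1] by blast
    obtain B2 where B2: "\<And>z. z \<in> V \<Longrightarrow> norm (G i p (Suc q) z) \<le> B2" using b[OF ipq(1) i2] by blast
    have gr: "has_grad (m - i) V (G i p q) (G i (Suc p) q) (G i p (Suc q)) (G (Suc i) p q)" using g ipq(1) lt by blast
    show ?thesis
      by (rule hcont_of_grad[OF gr V(1,3) cV[OF ipq] B B1 B2 \<alpha>(1) less_imp_le[OF \<alpha>(2)]])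
  qed
qed

subsection \<open>Charts at the points of the closed total space\<close>

locale smooth_domain_family =
  fixes \<alpha> :: real and j k :: enat and D U :: "real \<Rightarrow> complex set" and r0 :: "real \<Rightarrow> complex \<Rightarrow> real"
  assumes \<alpha>: "0 < \<alpha>" "\<alpha> < 1" and jk: "j \<le> k"
    and dom: "\<And>t. t \<in> {0..1} \<Longrightarrow> open (D t) \<and> connected (D t) \<and> D t \<noteq> {} \<and> bounded (D t)"
    and U: "continuous_family U" "bounded (total_space U)" "closure (total_space D) \<subseteq> total_space U"
    and r0: "r0 \<in> hoelder_local (ereal_of_enat k + 1 + ereal \<alpha>) j U"
    and Dr: "\<And>t. t \<in> {0..1} \<Longrightarrow> D t = {x \<in> U t. r0 t x < 0}"
    and grad: "\<And>t x. t \<in> {0..1} \<Longrightarrow> x \<in> frontier (D t) \<Longrightarrow> (ddir 1 (r0 t) x, ddir \<i> (r0 t) x) \<noteq> (0, 0)"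
begin

definition r :: "complex \<times> real \<Rightarrow> real" where "r z = r0 (snd z) (fst z)"

abbreviation "V \<equiv> total_space D"
abbreviation "W \<equiv> total_space U"

lemma W_open: "openin (top_of_set slab) W"
  using U(1) by (simp add: continuous_family_def slab_eq)

lemma W_slab: "W \<subseteq> slab"
  using openin_subset[OF W_open] by simp

lemma V_W: "V \<subseteq> W"
  using U(3) closure_subset by blast

lemma V_slab: "V \<subseteq> slab"
  using V_W W_slab by blast

lemma V_iff: "z \<in> V \<longleftrightarrow> z \<in> W \<and> r z < 0"
  by (cases z) (auto simp: total_space_iff Dr r_def)

lemma adm_ex: "\<exists>n m. admissible k j n m"
proof (cases k)
  case (enat K)
  then obtain J where "j = enat J" "J \<le> K" using jk by (cases j) auto
  thus ?thesis using enat by (auto simp: admissible_def)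
next
  case infinity
  show ?thesis
  proof (cases j)
    case (enat J)
    thus ?thesis using infinity by (intro exI[of _ J]) (auto simp: admissible_def)
  next
    case j: infinity
    thus ?thesis using infinity by (auto simp: admissible_def)
  qed
qed

text \<open>A box whose closure lies in W is an admissible test set of \<open>hoelder_local\<close>.
  The rest is the passage from iterated partial derivatives to \<open>hreg\<close>.\<close>

lemma box_reg:
  assumes box: "(cball x0 s \<times> cball t0 \<tau>) \<inter> slab \<subseteq> W" and adm: "admissible k j n m"
  shows "hreg \<alpha> (Suc n) m (tbox x0 s t0 \<tau>) (tbox x0 s t0 \<tau>) r"
proof -
  let ?\<omega> = "tbox x0 s t0 \<tau>"
  define D' where "D' t = {x. (x, t) \<in> ?\<omega>}" for t
  have ts: "total_space D' = ?\<omega>" by (auto simp: total_space_def D'_def tbox_iff)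
  have cl: "closure ?\<omega> \<subseteq> W" using tbox_closure box by blast
  have om: "?\<omega> \<subseteq> W" using cl closure_subset by blast
  have "openin (top_of_set W) ?\<omega>"
    using openin_subset_trans[OF tbox_open om W_slab] .
  moreover have "compact (closure ?\<omega>)" using bounded_tbox by (simp add: compact_closure)
  ultimately have "r0 \<in> hoelder_closed (ereal_of_enat k + 1 + ereal \<alpha>) j D'"
    using r0 cl unfolding hoelder_local_def D'_def by blast
  hence fin: "r0 \<in> hoelder_fin (real (Suc n) + \<alpha>) m D'" by (rule hoelder_closed_SucD[OF _ adm \<alpha>(1)])
  have oD: "open (D' t)" if "t \<in> {0..1}" for t
  proof -
    have "D' t = (if dist t t0 < \<tau> then ball x0 s else {})" using that by (auto simp: D'_def tbox_iff dist_commute)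
    thus ?thesis by simp
  qed
  have mn: "m \<le> Suc n" using adm by (simp add: admissible_def)
  obtain G where G: "\<forall>i p q. i \<le> m \<longrightarrow> i + p + q \<le> Suc n \<longrightarrow> continuous_on (closure ?\<omega>) (G i p q)"
    "\<forall>i p q. i \<le> m \<longrightarrow> i + p + q < Suc n \<longrightarrow>
       has_grad (m - i) ?\<omega> (G i p q) (G i (Suc p) q) (G i p (Suc q)) (G (Suc i) p q)"
    "\<forall>i p q. i \<le> m \<longrightarrow> i + p + q = Suc n \<longrightarrow>
       (\<exists>H. \<forall>x y t. (x, t) \<in> ?\<omega> \<longrightarrow> (y, t) \<in> ?\<omega> \<longrightarrow> norm (G i p q (x, t) - G i p q (y, t)) \<le> H * dist x y powr \<alpha>)"
    "\<forall>x t. (x, t) \<in> ?\<omega> \<longrightarrow> G 0 0 0 (x, t) = r0 t x"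
    by (rule hoelder_fin_jet[OF \<alpha> fin mn, unfolded ts, OF tbox_open]) (erule oD, (rule that; assumption))
  have cv: "convex {x. (x, t) \<in> ?\<omega>}" for t
  proof -
    have "{x. (x, t) \<in> ?\<omega>} = (if dist t t0 < \<tau> \<and> t \<in> {0..1} then ball x0 s else {})" by (auto simp: tbox_iff dist_commute)
    thus ?thesis by simp
  qed
  have "hreg \<alpha> (Suc n) (m - 0) ?\<omega> ?\<omega> (G 0 0 0)"
  proof (rule hreg_jet[where N = "Suc n" and w = G and J = m and i = 0 and p = 0 and q = 0])
    show "hcont \<alpha> ?\<omega> (G i p q)" if "i \<le> m" "i + p + q \<le> Suc n" for i p q
      by (rule hcont_of_jet[OF \<alpha> tbox_subset_slab bounded_tbox cv G(1-3) that])
    show "has_grad (m - i) ?\<omega> (G i p q) (G i (Suc p) q) (G i p (Suc q)) (G (Suc i) p q)" if "i \<le> m" "i + p + q < Suc n" for i p q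
      using G(2) that by blast
  qed auto
  hence "hreg \<alpha> (Suc n) m ?\<omega> ?\<omega> (G 0 0 0)" by simp
  thus ?thesis
    by (rule hreg_cong) (use G(4) tbox_open in \<open>auto simp: r_def\<close>)
qed

lemma W_box:
  assumes "(x0, t0) \<in> W"
  obtains s where "0 < s" "(cball x0 s \<times> cball t0 s) \<inter> slab \<subseteq> W"
proof -
  obtain d where d: "d > 0" "\<And>w. w \<in> slab \<Longrightarrow> dist w (x0, t0) < d \<Longrightarrow> w \<in> W"
    using openin_slab_ball[OF W_open assms] by blast
  have "(cball x0 (d/3) \<times> cball t0 (d/3)) \<inter> slab \<subseteq> W"
  proof
    fix z assume z: "z \<in> (cball x0 (d/3) \<times> cball t0 (d/3)) \<inter> slab"
    have "dist z (x0, t0) \<le> dist (fst z) x0 + dist (snd z) t0"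
      using dist_prod_le[of z "(x0, t0)"] by simp
    also have "\<dots> \<le> d/3 + d/3" using z by (intro add_mono) (auto simp: dist_commute mem_Times_iff)
    also have "\<dots> < d" using d by simp
    finally show "z \<in> W" using d(2) z by blast
  qed
  thus ?thesis using that[of "d/3"] d by simp
qed

lemma r_cont: "continuous_on W r"
  unfolding continuous_on_iff
proof (intro ballI allI impI)
  fix z and e :: real assume z: "z \<in> W" and e: "0 < e"
  obtain x t where zx: "z = (x, t)" by force
  obtain s where s: "0 < s" "(cball x s \<times> cball t s) \<inter> slab \<subseteq> W" using W_box z zx by blast
  obtain n m where "admissible k j n m" using adm_ex by blast
  from hcont_imp_continuous_on[OF hreg_imp_hcont[OF box_reg[OF s(2) this]]]
  have c: "continuous_on (tbox x s t s) r" .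
  have zb: "z \<in> tbox x s t s" using s(1) z W_slab by (auto simp: zx tbox_def)
  obtain d1 where d1: "d1 > 0" "\<And>w. w \<in> tbox x s t s \<Longrightarrow> dist w z < d1 \<Longrightarrow> dist (r w) (r z) < e"
    using c[unfolded continuous_on_iff, rule_format, OF zb e] by blast
  obtain d2 where d2: "d2 > 0" "\<And>w. w \<in> slab \<Longrightarrow> dist w z < d2 \<Longrightarrow> w \<in> tbox x s t s"
    using openin_slab_ball[OF tbox_open zb] by blast
  show "\<exists>d>0. \<forall>x'\<in>W. dist x' z < d \<longrightarrow> dist (r x') (r z) < e"
    by (intro exI[of _ "min d1 d2"]) (use d1 d2 W_slab in auto)
qed

lemma sublevel_open: "open T \<Longrightarrow> openin (top_of_set slab) {z \<in> W. r z \<in> T}"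
proof -
  assume "open T"
  hence "openin (top_of_set W) (W \<inter> r -` T)" by (rule continuous_openin_preimage_gen[OF r_cont])
  hence "openin (top_of_set slab) (W \<inter> r -` T)" using W_open by (rule openin_trans)
  moreover have "W \<inter> r -` T = {z \<in> W. r z \<in> T}" by auto
  ultimately show ?thesis by simp
qed

lemma V_open: "openin (top_of_set slab) V"
proof -
  have "V = {z \<in> W. r z \<in> {..<0}}" using V_iff by auto
  thus ?thesis using sublevel_open[of "{..<0}"] by simp
qed

lemma closure_V: "z \<in> closure V \<Longrightarrow> z \<in> W \<and> r z \<le> 0"
proof
  assume z: "z \<in> closure V"
  thus zW: "z \<in> W" using U(3) by blast
  have cc: "continuous_on (closure V) r" using continuous_on_subset[OF r_cont U(3)] .
  show "r z \<le> 0"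
    by (rule continuous_le_on_closure[OF cc z]) (use V_iff in \<open>auto intro: less_imp_le\<close>)
qed

lemma compact_closure_V: "compact (closure V)"
  using bounded_subset[OF U(2) V_W] by (simp add: compact_closure)

text \<open>e is the direction of steepest descent of r at the point. Its slope there is minus the
  length of the gradient, and continuity of the gradient keeps it below minus half that length on a
  smaller box.\<close>

lemma boundary_box:
  assumes z0: "(x0, t0) \<in> W" and g: "(ddir 1 (r0 t0) x0, ddir \<i> (r0 t0) x0) \<noteq> (0, 0)"
  obtains e c R \<tau> where "norm e = 1" "0 < c" "0 < R" "0 < \<tau>" "(cball x0 R \<times> cball t0 \<tau>) \<inter> slab \<subseteq> W"
    "\<forall>x t s. (x, t) \<in> tbox x0 R t0 \<tau> \<longrightarrow> 0 \<le> s \<longrightarrow> (x + s *\<^sub>R e, t) \<in> tbox x0 R t0 \<tau> \<longrightarrow> r (x + s *\<^sub>R e, t) \<le> r (x, t) - c * s"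
proof -
  obtain s where s: "0 < s" "(cball x0 s \<times> cball t0 s) \<inter> slab \<subseteq> W" using W_box[OF z0] by blast
  obtain n m where adm: "admissible k j n m" using adm_ex by blast
  let ?\<omega> = "tbox x0 s t0 s"
  obtain r1 r2 rt where rr: "hcont \<alpha> ?\<omega> r" "has_grad m ?\<omega> r r1 r2 rt" "hreg \<alpha> n m ?\<omega> ?\<omega> r1"
    "hreg \<alpha> n m ?\<omega> ?\<omega> r2" "0 < m \<longrightarrow> hreg \<alpha> n (m - 1) ?\<omega> ?\<omega> rt"
    using box_reg[OF s(2) adm] by (rule hreg_SucE)
  have t0: "t0 \<in> {0..1}" using z0 W_slab by (auto simp: slab_def)
  have zb: "(x0, t0) \<in> ?\<omega>" using s(1) t0 by (simp add: tbox_iff)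
  have e0: "(\<lambda>x. r (x, t0)) = r0 t0" by (simp add: r_def)
  define a where "a = Complex (r1 (x0, t0)) (r2 (x0, t0))"
  have a0: "a \<noteq> 0"
    using has_grad_ddir[OF rr(2) zb t0, of 1] has_grad_ddir[OF rr(2) zb t0, of \<i>] g unfolding e0 a_def
    by (auto simp: complex_eq_iff)
  define e where "e = - sgn a"
  have e: "norm e = 1" using a0 by (simp add: e_def norm_sgn)
  define D1 where "D1 z = Re e * r1 z + Im e * r2 z" for z
  have "D1 (x0, t0) = - norm a"
  proof -
    have "D1 (x0, t0) = - ((Re a)\<^sup>2 + (Im a)\<^sup>2) / norm a"
      by (simp add: D1_def e_def sgn_eq a_def power2_eq_square add_divide_distrib diff_divide_distrib)
    also have "(Re a)\<^sup>2 + (Im a)\<^sup>2 = norm a * norm a" using cmod_power2[of a] by (simp add: power2_eq_square)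
    finally show ?thesis using a0 by simp
  qed
  define c where "c = norm a / 2"
  have c: "0 < c" using a0 by (simp add: c_def)
  have "continuous_on ?\<omega> D1" unfolding D1_def
    by (intro continuous_intros hcont_imp_continuous_on[OF hreg_imp_hcont[OF rr(3)]] hcont_imp_continuous_on[OF hreg_imp_hcont[OF rr(4)]])
  then obtain d where d: "d > 0" "\<And>w. w \<in> ?\<omega> \<Longrightarrow> dist w (x0, t0) < d \<Longrightarrow> dist (D1 w) (D1 (x0, t0)) < c"
    using zb c unfolding continuous_on_iff by meson
  define R where "R = min s (d / 3)"
  have R: "0 < R" "R \<le> s" using s d by (auto simp: R_def)
  have sub: "tbox x0 R t0 R \<subseteq> ?\<omega>" using R by (auto simp: tbox_def)
  have neg: "D1 w \<le> - c" if "w \<in> tbox x0 R t0 R" for w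
  proof -
    obtain x t where w: "w = (x, t)" by force
    have "dist w (x0, t0) \<le> dist x x0 + dist t t0"
      using dist_prod_le[of w "(x0, t0)"] by (simp add: w)
    also have "\<dots> < d" using that d(1) by (simp add: w tbox_iff R_def)
    finally have "dist (D1 w) (D1 (x0, t0)) < c" using d(2) that sub by blast
    thus ?thesis unfolding \<open>D1 (x0, t0) = - norm a\<close> dist_real_def c_def by linarith
  qed
  have mono: "r (x + h *\<^sub>R e, t) \<le> r (x, t) - c * h"
    if m: "(x, t) \<in> tbox x0 R t0 R" "0 \<le> h" "(x + h *\<^sub>R e, t) \<in> tbox x0 R t0 R" for x t h
  proof -
    have t: "t \<in> {0..1}" using m by (simp add: tbox_iff)
    have seg: "(x + \<sigma> *\<^sub>R e, t) \<in> tbox x0 R t0 R" if "0 \<le> \<sigma>" "\<sigma> \<le> h" for \<sigma>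
    proof (cases "h = 0")
      case True
      thus ?thesis using that m by simp
    next
      case False
      hence h: "0 < h" using m by simp
      have "(1 - \<sigma> / h) *\<^sub>R (x, t) + (\<sigma> / h) *\<^sub>R (x + h *\<^sub>R e, t) \<in> tbox x0 R t0 R"
        by (rule convexD[OF convex_tbox m(1,3)]) (use that h in auto)
      moreover have "(1 - \<sigma> / h) *\<^sub>R (x, t) + (\<sigma> / h) *\<^sub>R (x + h *\<^sub>R e, t) = (x + \<sigma> *\<^sub>R e, t)"
        using h by (simp add: algebra_simps)
      ultimately show ?thesis by simp
    qed
    have "(\<lambda>\<sigma>. r (x + \<sigma> *\<^sub>R e, t) + c * \<sigma>) h \<le> (\<lambda>\<sigma>. r (x + \<sigma> *\<^sub>R e, t) + c * \<sigma>) 0"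
    proof (rule DERIV_nonpos_imp_nonincreasing[OF m(2)])
      fix \<sigma> assume \<sigma>: "0 \<le> \<sigma>" "\<sigma> \<le> h"
      have "((\<lambda>\<sigma>. r (x + \<sigma> *\<^sub>R e, t)) has_real_derivative D1 (x + \<sigma> *\<^sub>R e, t)) (at \<sigma>)"
        using has_grad_dir_at[OF rr(2) subsetD[OF sub seg[OF \<sigma>]] t]
        by (simp add: has_real_derivative_iff_has_vector_derivative D1_def)
      hence "((\<lambda>\<sigma>. r (x + \<sigma> *\<^sub>R e, t) + c * \<sigma>) has_real_derivative D1 (x + \<sigma> *\<^sub>R e, t) + c) (at \<sigma>)"
        by (auto intro!: derivative_eq_intros)
      moreover have "D1 (x + \<sigma> *\<^sub>R e, t) + c \<le> 0" using neg[OF seg[OF \<sigma>]] by simp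
      ultimately show "\<exists>y. ((\<lambda>\<sigma>. r (x + \<sigma> *\<^sub>R e, t) + c * \<sigma>) has_real_derivative y) (at \<sigma>) \<and> y \<le> 0" by blast
    qed
    thus ?thesis by simp
  qed
  have "(cball x0 R \<times> cball t0 R) \<inter> slab \<subseteq> W" using s(2) R by auto
  from that[OF e c R(1) R(1) this] mono show ?thesis by blast
qed

text \<open>Here connectedness enters: a part of \<open>D\<^sup>t\<close> at a distance from \<open>D\<^bsup>t\<^sub>0\<^esup>\<close> would have to be attached to
  the rest of \<open>D\<^sup>t\<close> across a shell around \<open>D\<^bsup>t\<^sub>0\<^esup>\<close> on which \<open>r > 0\<close>.\<close>

lemma closure_section:
  assumes z0: "(x0, t0) \<in> closure V"
  shows "x0 \<in> closure (D t0)"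
proof (rule ccontr)
  assume x0: "x0 \<notin> closure (D t0)"
  have z0W: "(x0, t0) \<in> W" using closure_V[OF z0] by simp
  hence t0: "t0 \<in> {0..1}" using W_slab by (auto simp: slab_def)
  define K where "K = closure (D t0)"
  have K: "compact K" "K \<noteq> {}" using dom[OF t0] by (auto simp: K_def compact_closure)
  have Kcl: "(x, t0) \<in> closure V" if "x \<in> K" for x
  proof -
    have "(\<lambda>x. (x, t0)) ` closure (D t0) \<subseteq> closure V"
    proof (rule image_closure_subset)
      show "continuous_on (closure (D t0)) (\<lambda>x. (x, t0))" by (intro continuous_intros)
      show "(\<lambda>x. (x, t0)) ` D t0 \<subseteq> closure V" using closure_subset t0 by (force simp: total_space_iff)
    qed simp
    thus ?thesis using that K_def by blast
  qed
  have KU: "(x, t0) \<in> W" "r (x, t0) \<le> 0" if "x \<in> K" for x using closure_V[OF Kcl[OF that]] by auto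
  \<comment> \<open>Near the closure K of the slice, r \<le> 0 at time t0 forces membership in K: at
    a frontier point the gradient is nonzero, and moving along e turns r \<le> 0 into r < 0.\<close>
  have loc: "\<exists>\<rho>>0. \<forall>y\<in>ball x \<rho>. (y, t0) \<in> W \<and> (r (y, t0) \<le> 0 \<longrightarrow> y \<in> K)" if x: "x \<in> K" for x
  proof (cases "x \<in> D t0")
    case True
    then obtain \<rho> where \<rho>: "\<rho> > 0" "ball x \<rho> \<subseteq> D t0" using dom[OF t0] open_contains_ball by blast
    have "(y, t0) \<in> W \<and> (r (y, t0) \<le> 0 \<longrightarrow> y \<in> K)" if "y \<in> ball x \<rho>" for y
    proof -
      have "y \<in> D t0" using that \<rho>(2) by blast
      moreover from this have "(y, t0) \<in> V" using t0 by (simp add: total_space_iff)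
      ultimately show ?thesis using V_W closure_subset unfolding K_def by blast
    qed
    thus ?thesis using \<rho>(1) by blast
  next
    case False
    hence fr: "x \<in> frontier (D t0)" using x dom[OF t0] by (simp add: K_def frontier_def interior_open)
    obtain e c R \<tau> where b: "norm e = 1" "0 < c" "0 < R" "0 < \<tau>" "(cball x R \<times> cball t0 \<tau>) \<inter> slab \<subseteq> W"
      "\<forall>x' t s. (x', t) \<in> tbox x R t0 \<tau> \<longrightarrow> 0 \<le> s \<longrightarrow> (x' + s *\<^sub>R e, t) \<in> tbox x R t0 \<tau> \<longrightarrow> r (x' + s *\<^sub>R e, t) \<le> r (x', t) - c * s"
      by (rule boundary_box[OF KU(1)[OF x] grad[OF t0 fr]]) (rule that; assumption)
    show ?thesis
    proof (intro exI[of _ R] conjI b(3) ballI impI)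
      fix y assume y: "y \<in> ball x R"
      have yb: "(y, t0) \<in> tbox x R t0 \<tau>" using y b(4) t0 by (simp add: tbox_iff dist_commute)
      show "(y, t0) \<in> W" using yb b(5) by (auto simp: tbox_def)
      assume ry: "r (y, t0) \<le> 0"
      show "y \<in> K" unfolding K_def closure_approachable
      proof (intro allI impI)
        fix \<epsilon> :: real assume \<epsilon>: "0 < \<epsilon>"
        define s where "s = min (\<epsilon> / 2) ((R - dist y x) / 2)"
        have s: "0 < s" "s < \<epsilon>" "dist y x + s < R" using \<epsilon> y by (auto simp: s_def dist_commute min_def field_simps)
        have "dist (y + s *\<^sub>R e) x \<le> dist y x + norm (s *\<^sub>R e)"
          using norm_triangle_ineq[of "y - x" "s *\<^sub>R e"] by (simp add: dist_norm algebra_simps)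
        hence m: "(y + s *\<^sub>R e, t0) \<in> tbox x R t0 \<tau>" using s b(1,4) t0 by (simp add: tbox_iff)
        have "r (y + s *\<^sub>R e, t0) \<le> r (y, t0) - c * s" using b(6) yb m s(1) by simp
        moreover have "0 < c * s" using b(2) s(1) by simp
        ultimately have "r (y + s *\<^sub>R e, t0) < 0" using ry by linarith
        moreover have "(y + s *\<^sub>R e, t0) \<in> W" using m b(5) by (auto simp: tbox_def)
        ultimately have "(y + s *\<^sub>R e, t0) \<in> V" using V_iff by blast
        thus "\<exists>z\<in>D t0. dist z y < \<epsilon>" using s b(1) by (intro bexI[of _ "y + s *\<^sub>R e"]) (auto simp: total_space_iff dist_norm)
      qed
    qed
  qed
  hence "\<forall>x\<in>K. \<exists>\<rho>>0. \<forall>y\<in>ball x \<rho>. (y, t0) \<in> W \<and> (r (y, t0) \<le> 0 \<longrightarrow> y \<in> K)" by blast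
  then obtain \<rho> where \<rho>0: "\<forall>x\<in>K. 0 < \<rho> x \<and> (\<forall>y\<in>ball x (\<rho> x). (y, t0) \<in> W \<and> (r (y, t0) \<le> 0 \<longrightarrow> y \<in> K))"
    unfolding bchoice_iff by blast
  have \<rho>: "0 < \<rho> x" "y \<in> ball x (\<rho> x) \<Longrightarrow> (y, t0) \<in> W \<and> (r (y, t0) \<le> 0 \<longrightarrow> y \<in> K)" if "x \<in> K" for x y
    using \<rho>0 that by blast+
  define B where "B = (\<Union>x\<in>K. ball x (\<rho> x))"
  have "open B" "K \<subseteq> B" using \<rho>(1) by (auto simp: B_def)
  then obtain \<epsilon>1 where \<epsilon>1: "\<epsilon>1 > 0" "{x. infdist x K \<le> \<epsilon>1} \<subseteq> B"
    using compact_in_open_separated[OF K(2,1)] by blast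
  have ix0: "0 < infdist x0 K"
    using x0 K by (simp add: infdist_pos_not_in_closed K_def)
  define \<epsilon> where "\<epsilon> = min \<epsilon>1 (infdist x0 K / 2)"
  have \<epsilon>: "0 < \<epsilon>" "\<epsilon> \<le> \<epsilon>1" "\<epsilon> < infdist x0 K" using \<epsilon>1 ix0 by (auto simp: \<epsilon>_def min_def)
  \<comment> \<open>The shell. It lies in the neighbourhood of K described above but outside K, so r
    > 0 on it at time t0.\<close>
  define F where "F = {x. infdist x K = \<epsilon>}"
  have F: "(x, t0) \<in> W \<and> 0 < r (x, t0)" if "x \<in> F" for x
  proof -
    have "x \<in> B" using that \<epsilon> \<epsilon>1 by (auto simp: F_def)
    then obtain y where "y \<in> K" "x \<in> ball y (\<rho> y)" by (auto simp: B_def)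
    moreover have "x \<notin> K" using that \<epsilon> by (auto simp: F_def)
    ultimately show ?thesis using \<rho>(2)[of y x] by auto
  qed
  have cF: "compact F"
  proof -
    have "closed F" unfolding F_def by (intro closed_Collect_eq continuous_intros)
    moreover have "bounded F"
    proof -
      obtain M where M: "\<And>y. y \<in> K \<Longrightarrow> norm y \<le> M" using compact_imp_bounded[OF K(1)] bounded_iff by blast
      have "norm x \<le> M + \<epsilon>" if "x \<in> F" for x
      proof -
        obtain y where y: "y \<in> K" "infdist x K = dist x y" using infdist_attains_inf[of K x] K compact_imp_closed by blast
        thus ?thesis using that M[OF y(1)] norm_triangle_ineq2[of x y] by (auto simp: F_def dist_norm)
      qed
      thus ?thesis using bounded_iff by blast
    qed
    ultimately show ?thesis by (simp add: compact_eq_bounded_closed)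
  qed
  \<comment> \<open>By compactness of the shell r stays positive on it for all times within
    \<open>e2\<close> of t0, so these slices miss it.\<close>
  obtain P where P: "open P" "{z \<in> W. r z \<in> {0<..}} = slab \<inter> P"
    using sublevel_open[of "{0<..}"] by (auto simp: openin_open)
  obtain e2 where e2: "0 < e2" "\<And>x t. x \<in> F \<Longrightarrow> t \<in> {0..1} \<Longrightarrow> \<bar>t - t0\<bar> \<le> e2 \<Longrightarrow> (x, t) \<notin> V"
  proof (cases "F = {}")
    case True
    thus ?thesis using that[of 1] by simp
  next
    case False
    let ?A = "F \<times> {t0}"
    have "compact ?A" "?A \<noteq> {}" using cF False by (auto intro: compact_Times)
    moreover have "?A \<subseteq> P" using F P(2) t0 by (auto simp: slab_def)
    ultimately obtain e where e: "e > 0" "{z. infdist z ?A \<le> e} \<subseteq> P"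
      using compact_in_open_separated[OF _ _ P(1)] by metis
    show ?thesis
    proof (rule that[OF e(1)])
      fix x t assume xt: "x \<in> F" "t \<in> {0..1}" "\<bar>t - t0\<bar> \<le> e"
      have "infdist (x, t) ?A \<le> dist (x, t) (x, t0)" using xt(1) by (intro infdist_le) auto
      also have "\<dots> \<le> e" using xt(3) by (simp add: dist_Pair_Pair dist_real_def)
      finally have "(x, t) \<in> P" using e(2) by blast
      hence "(x, t) \<in> {z \<in> W. r z \<in> {0<..}}" unfolding P(2) using xt(2) by (simp add: slab_def)
      hence "0 < r (x, t)" by simp
      thus "(x, t) \<notin> V" using V_iff[of "(x, t)"] by simp
    qed
  qed
  obtain y0 where y0: "y0 \<in> D t0" using dom[OF t0] by blast
  hence "(y0, t0) \<in> V" using t0 by (simp add: total_space_iff)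
  then obtain e3 where e3: "e3 > 0" "\<And>w. w \<in> slab \<Longrightarrow> dist w (y0, t0) < e3 \<Longrightarrow> w \<in> V"
    using openin_slab_ball[OF V_open] by blast
  define d where "d = min (min e2 e3) (infdist x0 K - \<epsilon>)"
  have d: "0 < d" using e2 e3 \<epsilon> by (simp add: d_def)
  obtain z1 where z1: "z1 \<in> V" "dist z1 (x0, t0) < d" using z0 d unfolding closure_approachable by blast
  obtain x1 t1 where zx: "z1 = (x1, t1)" by force
  have t1: "t1 \<in> {0..1}" "x1 \<in> D t1" using z1(1) by (auto simp: zx total_space_iff)
  have dd: "dist x1 x0 < d" "dist t1 t0 < d"
    using dist_fst_le[of z1 "(x0, t0)"] dist_snd_le[of z1 "(x0, t0)"] z1(2) by (auto simp: zx)
  have "y0 \<in> D t1"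
  proof -
    have "(y0, t1) \<in> V" by (rule e3(2)) (use t1 dd in \<open>auto simp: slab_def dist_Pair_Pair d_def\<close>)
    thus ?thesis by (simp add: total_space_iff)
  qed
  \<comment> \<open>A nearby slice contains both a fixed point y0 of the slice at t0 and a point x1
    close to x0. The distance to K takes on it the value 0 and a value above \<epsilon>, hence also
    \<epsilon>, that is, the slice meets the shell.\<close>
  have c: "connected ((\<lambda>x. infdist x K) ` D t1)"
    using dom[OF t1(1)] by (intro connected_continuous_image continuous_intros) auto
  have "infdist y0 K = 0" using y0 closure_subset by (intro infdist_zero) (auto simp: K_def)
  moreover have "\<epsilon> < infdist x1 K"
    using infdist_triangle[of x0 K x1] dd(1) by (simp add: d_def dist_commute)
  ultimately have "\<epsilon> \<in> {infdist y0 K..infdist x1 K}" using \<epsilon> by simp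
  hence "\<epsilon> \<in> (\<lambda>x. infdist x K) ` D t1"
    using connected_contains_Icc[OF c] \<open>y0 \<in> D t1\<close> t1(2) by blast
  then obtain x where x: "x \<in> D t1" "infdist x K = \<epsilon>" by auto
  have "(x, t1) \<notin> V" by (rule e2(2)) (use x t1 dd in \<open>auto simp: F_def d_def dist_real_def\<close>)
  thus False using x t1 by (simp add: total_space_iff)
qed

text \<open>Interior points also get a chart, with an artificial defining function; all points of
  the compact closure can then be treated alike when the extensions are glued.\<close>

lemma chart_exists:
  assumes z0: "(x0, t0) \<in> closure V"
  shows "\<exists>R \<rho> \<tau> c e rr. refl_chart x0 R \<rho> t0 \<tau> c e rr \<and> (\<forall>z\<in>tbox x0 R t0 \<tau>. z \<in> V \<longleftrightarrow> rr z < 0) \<and>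
    (\<forall>n m. admissible k j n m \<longrightarrow> hreg \<alpha> (Suc n) m (tbox x0 R t0 \<tau>) (tbox x0 R t0 \<tau>) rr)"
proof -
  have zW: "(x0, t0) \<in> W" "r (x0, t0) \<le> 0" using closure_V[OF z0] by auto
  have t0: "t0 \<in> {0..1}" using zW W_slab by (auto simp: slab_def)
  show ?thesis
  proof (cases "(x0, t0) \<in> V")
    case True
    then obtain d where d: "d > 0" "\<And>w. w \<in> slab \<Longrightarrow> dist w (x0, t0) < d \<Longrightarrow> w \<in> V"
      using openin_slab_ball[OF V_open] by blast
    define R where "R = d / 3"
    have R: "0 < R" using d by (simp add: R_def)
    have sub: "z \<in> V" if "z \<in> tbox x0 R t0 R" for z
    proof -
      obtain x t where z: "z = (x, t)" by force
      have "dist z (x0, t0) \<le> dist x x0 + dist t t0"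
        using dist_prod_le[of z "(x0, t0)"] by (simp add: z)
      also have "\<dots> < d" using that R by (simp add: z tbox_iff R_def)
      finally show ?thesis using d(2) that tbox_subset_slab by blast
    qed
    \<comment> \<open>An affine function below -R on the whole box that decreases at rate 1 in the
      direction 1; in this chart there is no boundary to cross.\<close>
    define rr where "rr z = - Re (fst z) + (Re x0 - 2 * R)" for z :: "complex \<times> real"
    have neg: "rr z < 0" if "z \<in> tbox x0 R t0 R" for z
    proof -
      obtain x t where z: "z = (x, t)" by force
      have "\<bar>Re (x - x0)\<bar> < R" using that abs_Re_le_cmod[of "x - x0"] by (simp add: z tbox_iff dist_norm)
      thus ?thesis using R by (simp add: rr_def z abs_less_iff)
    qed
    have "refl_chart x0 R (R / 3) t0 R 1 1 rr"
    proof
      fix z assume "z \<in> tbox x0 (R / 3) t0 R"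
      hence "z \<in> tbox x0 R t0 R" using tbox_mono[of "R / 3" R] R by auto
      thus "rr z < 1 * (R / 3)" using neg[of z] R by simp
    qed (use R in \<open>auto simp: rr_def\<close>)
    moreover have "hreg \<alpha> n m (tbox x0 R t0 R) (tbox x0 R t0 R) rr" for n m
      unfolding rr_def
      by (intro hreg_add hreg_const hreg_linear[OF bounded_linear_minus[OF bounded_linear_compose[OF bounded_linear_Re bounded_linear_fst]] bounded_tbox \<alpha>])
    ultimately show ?thesis using sub neg by blast
  next
    case False
    have "x0 \<notin> D t0" using False t0 by (simp add: total_space_iff)
    \<comment> \<open>The gradient of r is known to be nonzero only on the frontier of the slice; a
      point with r = 0 that is a limit of other slices alone is excluded by
      \<open>closure_section\<close>.\<close>
    hence fr: "x0 \<in> frontier (D t0)" using closure_section[OF z0] dom[OF t0] by (simp add: frontier_def interior_open)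
    obtain e c R \<tau> where b: "norm e = 1" "0 < c" "0 < R" "0 < \<tau>" "(cball x0 R \<times> cball t0 \<tau>) \<inter> slab \<subseteq> W"
      "\<forall>x t s. (x, t) \<in> tbox x0 R t0 \<tau> \<longrightarrow> 0 \<le> s \<longrightarrow> (x + s *\<^sub>R e, t) \<in> tbox x0 R t0 \<tau> \<longrightarrow> r (x + s *\<^sub>R e, t) \<le> r (x, t) - c * s"
      by (rule boundary_box[OF zW(1) grad[OF t0 fr]]) (rule that; assumption)
    have "0 < c * (R / 3)" using b by simp
    \<comment> \<open>Since r \<le> 0 at the centre, continuity gives the smallness condition of the
      chart on a small box; space and time each use half of d.\<close>
    then obtain d where d: "d > 0" "\<And>w. w \<in> W \<Longrightarrow> dist w (x0, t0) < d \<Longrightarrow> dist (r w) (r (x0, t0)) < c * (R / 3)"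
      using r_cont zW(1) unfolding continuous_on_iff by meson
    define \<rho> where "\<rho> = min (R / 3) (d / 2)"
    define \<tau>' where "\<tau>' = min \<tau> (d / 2)"
    have pos: "0 < \<rho>" "0 < \<tau>'" "3 * \<rho> \<le> R" using b d by (auto simp: \<rho>_def \<tau>'_def)
    have sub: "tbox x0 R t0 \<tau>' \<subseteq> tbox x0 R t0 \<tau>" by (auto simp: tbox_def \<tau>'_def)
    have box': "(cball x0 R \<times> cball t0 \<tau>') \<inter> slab \<subseteq> W" using b(5) by (auto simp: \<tau>'_def)
    have subW: "tbox x0 R t0 \<tau>' \<subseteq> W" using box' by (auto simp: tbox_def)
    have "refl_chart x0 R \<rho> t0 \<tau>' c e r"
    proof
      fix z assume z: "z \<in> tbox x0 \<rho> t0 \<tau>'"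
      obtain x t where zx: "z = (x, t)" by force
      have "z \<in> W" using z tbox_mono[of \<rho> R x0 t0 \<tau>'] pos subW by auto
      have "dist z (x0, t0) \<le> dist x x0 + dist t t0"
        using dist_prod_le[of z "(x0, t0)"] by (simp add: zx)
      also have "\<dots> < d" using z by (simp add: zx tbox_iff \<rho>_def \<tau>'_def)
      finally have "dist (r z) (r (x0, t0)) < c * (R / 3)" using d(2) \<open>z \<in> W\<close> by blast
      thus "r z < c * (R / 3)" using zW(2) unfolding dist_real_def by linarith
    next
      fix x t s assume "(x, t) \<in> tbox x0 R t0 \<tau>'" "0 \<le> s" "(x + s *\<^sub>R e, t) \<in> tbox x0 R t0 \<tau>'"
      thus "r (x + s *\<^sub>R e, t) \<le> r (x, t) - c * s" using b(6) sub by blast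
    qed (use pos b in auto)
    moreover have "\<forall>z\<in>tbox x0 R t0 \<tau>'. z \<in> V \<longleftrightarrow> r z < 0" using V_iff subW by blast
    ultimately show ?thesis using box_reg[OF box'] by blast
  qed
qed

end

section \<open>Boundary values of the data in a chart\<close>

context refl_chart
begin

text \<open>Every point of r \<le> 0 is reached from r < 0 along e. Statements about the open side
  are carried to the hypersurface by this limit.\<close>

lemma up:
  assumes xt: "(x, t) \<in> tbox x0 s' t0 \<tau>" "r (x, t) \<le> 0" and s': "s' \<le> R"
  shows "\<forall>\<^sub>F s in at_right 0. (x + s *\<^sub>R e, t) \<in> tbox x0 s' t0 \<tau> \<and> r (x + s *\<^sub>R e, t) < 0"
  unfolding eventually_at_right_field
proof (intro exI[of _ "s' - dist x x0"] conjI allI impI)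
  show "0 < s' - dist x x0" using xt by (simp add: tbox_iff)
  fix s :: real assume s: "0 < s" "s < s' - dist x x0"
  have "dist (x + s *\<^sub>R e) x0 \<le> dist x x0 + norm (s *\<^sub>R e)"
    using norm_triangle_ineq[of "x - x0" "s *\<^sub>R e"] by (simp add: dist_norm algebra_simps)
  hence m: "(x + s *\<^sub>R e, t) \<in> tbox x0 s' t0 \<tau>" using s xt ne by (simp add: tbox_iff)
  have sub: "tbox x0 s' t0 \<tau> \<subseteq> tbox x0 R t0 \<tau>" by (rule tbox_mono[OF s'])
  have "r (x + s *\<^sub>R e, t) \<le> r (x, t) - c * s" using mono[of x t s] subsetD[OF sub m] subsetD[OF sub xt(1)] s by simp
  moreover have "0 < c * s" using pos s by simp
  ultimately have "r (x + s *\<^sub>R e, t) < 0" using xt(2) by linarith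
  with m show "(x + s *\<^sub>R e, t) \<in> tbox x0 s' t0 \<tau>" "r (x + s *\<^sub>R e, t) < 0" by auto
qed

lemma tendsto_up_ident: "((\<lambda>s. (x + s *\<^sub>R e, t)) \<longlongrightarrow> (x, t)) (at_right 0)"
proof -
  have "((\<lambda>s. (x + s *\<^sub>R e, t)) \<longlongrightarrow> (x + 0 *\<^sub>R e, t)) (at_right 0)" by (intro tendsto_intros)
  thus ?thesis by simp
qed

lemma tendsto_up:
  assumes xt: "(x, t) \<in> tbox x0 s' t0 \<tau>" "r (x, t) \<le> 0" and s': "s' \<le> R"
    and u: "continuous_on {z \<in> tbox x0 s' t0 \<tau>. r z \<le> 0} u"
  shows "((\<lambda>s. u (x + s *\<^sub>R e, t)) \<longlongrightarrow> u (x, t)) (at_right 0)"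
proof (rule continuous_on_tendsto_compose[OF u tendsto_up_ident])
  show "\<forall>\<^sub>F s in at_right 0. (x + s *\<^sub>R e, t) \<in> {z \<in> tbox x0 s' t0 \<tau>. r z \<le> 0}"
    using up[OF xt s'] by (rule eventually_mono) simp
qed (use xt in simp)

text \<open>The slices of r \<le> 0 are not convex, so the mean value estimate runs along the
  three-segment paths; points too far apart for a path inside the chart are compared by the uniform
  bound.\<close>

lemma hcont_lower_order:
  fixes u :: "complex \<times> real \<Rightarrow> 'b::real_normed_vector"
  assumes \<alpha>: "0 < \<alpha>" "\<alpha> < 1" and reg: "hreg \<alpha> (Suc n) m Q Q r"
    and g: "has_grad j {z \<in> Q. r z < 0} u u1 u2 ut" and cu: "continuous_on {z \<in> Q. r z \<le> 0} u"
    and B: "\<And>z. z \<in> Q \<Longrightarrow> r z \<le> 0 \<Longrightarrow> norm (u z) \<le> B \<and> norm (u1 z) \<le> B \<and> norm (u2 z) \<le> B"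
  shows "hcont \<alpha> S2 u"
proof -
  have S2Q: "S2 \<subseteq> {z \<in> Q. r z \<le> 0}"
    using tbox_mono[of "2 * R / 3" R x0 t0 \<tau>] pos by (auto simp: S2_def Q_def)
  obtain r1 r2 rt where rr: "hcont \<alpha> Q r" "has_grad m Q r r1 r2 rt" "hreg \<alpha> n m Q Q r1"
    "hreg \<alpha> n m Q Q r2" "0 < m \<longrightarrow> hreg \<alpha> n (m - 1) Q Q rt"
    using reg by (rule hreg_SucE)
  obtain B1 where B1: "0 \<le> B1" "\<And>z. z \<in> Q \<Longrightarrow> norm (r1 z) \<le> B1" using hreg_imp_hcont[OF rr(3)] by (rule hcontE) blast
  obtain B2 where B2: "0 \<le> B2" "\<And>z. z \<in> Q \<Longrightarrow> norm (r2 z) \<le> B2" using hreg_imp_hcont[OF rr(4)] by (rule hcontE) blast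
  define L where "L = 2 * (B1 + B2)"
  have L0: "0 \<le> L" using B1 B2 by (simp add: L_def)
  have gr0: "has_grad 0 Q r r1 r2 rt" by (rule has_grad_mono[OF rr(2) _ Q_slab(1)]) simp
  have lip: "\<bar>r z - r w\<bar> \<le> L * (dist (fst z) (fst w) + dist (snd z) (snd w))"
    if "z \<in> Q" "w \<in> Q" "(0::nat) = 0 \<Longrightarrow> snd z = snd w" for z w
  proof -
    have "norm (r z - r w) \<le> 2 * (B1 + B2) * (dist (fst z) (fst w) + dist (snd z) (snd w))"
    proof (rule lipschitz_of_grad[OF gr0 Q_slab(1) _ hcont_imp_continuous_on[OF rr(1)]])
      show "convex Q" by (simp add: Q_def convex_tbox)
      show "norm (r1 z) \<le> B1 + B2" if "z \<in> Q" for z using B1(2)[OF that] B2(1) by simp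
      show "norm (r2 z) \<le> B1 + B2" if "z \<in> Q" for z using B2(2)[OF that] B1(1) by simp
    qed (use that in auto)
    thus ?thesis by (simp add: L_def)
  qed
  define K where "K = L / c + 1"
  have K: "1 \<le> K" using L0 pos by (simp add: K_def)
  have g0: "has_grad 0 {z \<in> Q. r z < 0} u u1 u2 ut"
    by (rule has_grad_mono[OF g]) (use Q_slab(1) in auto)
  show ?thesis
  proof (rule hcontI[where B = B and H = "((4 * K + 2) * B + 2 * B * (3 * K / R)) + 2 * B"])
    show "continuous_on S2 u" by (rule continuous_on_subset[OF cu S2Q])
    show "norm (u z) \<le> B" if "z \<in> S2" for z using B[of z] that S2Q by blast
    fix t x y assume xy: "(x, t) \<in> S2" "(y, t) \<in> S2"
    have B0: "0 \<le> B"
    proof -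
      have "norm (u (x, t)) \<le> B" using B[of "(x, t)"] xy(1) S2Q by blast
      thus ?thesis using norm_ge_zero order_trans by blast
    qed
    have two: "norm (u (x, t) - u (y, t)) \<le> 2 * B"
    proof -
      have "norm (u (x, t)) \<le> B" "norm (u (y, t)) \<le> B" using B[of "(x, t)"] B[of "(y, t)"] xy S2Q by blast+
      thus ?thesis using norm_triangle_ineq4[of "u (x, t)" "u (y, t)"] by linarith
    qed
    have A: "0 \<le> (4 * K + 2) * B" "0 \<le> 2 * B * (3 * K / R)" using K B0 pos by auto
    have "norm (u (x, t) - u (y, t)) \<le> ((4 * K + 2) * B + 2 * B * (3 * K / R)) * dist x y"
    \<comment> \<open>The path rises by K |x - y|. Starting within radius 2R/3 it stays within
      radius R exactly in the first case; in the second, 3 K |x - y| / R is at least 1.\<close>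
    proof (cases "K * dist x y < R / 3")
      case True
      have d: "dist x x0 < 2 * R / 3" "dist y x0 < 2 * R / 3" using xy by (auto simp: S2_def tbox_iff)
      have "norm (u (x, t) - u (y, t)) \<le>
        (4 * (L / c + 1) + 2) * B * (dist (fst (x, t)) (fst (y, t)) + dist (snd (x, t)) (snd (y, t)))"
      proof (rule path_bound[where j = 0 and V = "{z \<in> Q. r z < 0}" and S = "{z \<in> Q. r z \<le> 0}" and Q = Q and r = r
            and e = e and R = R and \<tau> = \<tau> and h = "K * dist x y"])
        show "Q = (ball x0 R \<times> ball t0 \<tau>) \<inter> slab" by (simp add: Q_def tbox_def)
        show "r (x + s *\<^sub>R e, t) \<le> r (x, t) - c * s" if "(x, t) \<in> Q" "0 \<le> s" "(x + s *\<^sub>R e, t) \<in> Q" for x t s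
          using mono[of x t s] that by (simp add: Q_def)
        show "\<bar>r z - r w\<bar> \<le> L * (dist (fst z) (fst w) + dist (snd z) (snd w))"
          if "z \<in> Q" "w \<in> Q" "(0::nat) = 0 \<Longrightarrow> snd z = snd w" for z w by (rule lip) (use that in auto)
        show "has_grad 0 {z \<in> Q. r z < 0} u u1 u2 ut" by (rule g0)
        show "continuous_on {z \<in> Q. r z \<le> 0} u" by (rule cu)
        show "(x, t) \<in> {z \<in> Q. r z \<le> 0}" "(y, t) \<in> {z \<in> Q. r z \<le> 0}" using xy S2Q by auto
        show "norm (u1 p) \<le> B \<and> norm (u2 p) \<le> B \<and> (0 < (0::nat) \<longrightarrow> norm (ut p) \<le> B)" if "p \<in> {z \<in> Q. r z < 0}" for p
          using B[of p] that by auto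
        show "dist (fst (x, t)) x0 + K * dist x y < R" "dist (fst (y, t)) x0 + K * dist x y < R"
          using True d by simp_all
      qed (use ne pos L0 in \<open>auto simp: K_def\<close>)
      also have "\<dots> = (4 * K + 2) * B * dist x y" by (simp add: K_def)
      also have "\<dots> \<le> ((4 * K + 2) * B + 2 * B * (3 * K / R)) * dist x y" using A by (intro mult_right_mono) auto
      finally show ?thesis .
    next
      case False
      hence "1 \<le> 3 * K / R * dist x y" using pos by (simp add: field_simps)
      hence "2 * B * 1 \<le> 2 * B * (3 * K / R * dist x y)" using B0 by (intro mult_left_mono) auto
      also have "\<dots> = (2 * B * (3 * K / R)) * dist x y" by simp
      also have "\<dots> \<le> ((4 * K + 2) * B + 2 * B * (3 * K / R)) * dist x y" using A by (intro mult_right_mono) auto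
      finally show ?thesis using two by simp
    qed
    thus "norm (u (x, t) - u (y, t)) \<le> ((4 * K + 2) * B + 2 * B * (3 * K / R) + 2 * B) * dist x y powr \<alpha>"
      by (rule lipschitz_imp_hoelder[OF \<alpha>(1) less_imp_le[OF \<alpha>(2)] _ two]) (use A B0 in auto)
  qed
qed

text \<open>Both points are moved by the same s e, which keeps their distance and puts them in r <
  0; then s tends to 0.\<close>

lemma hcont_top_order:
  fixes u :: "complex \<times> real \<Rightarrow> 'b::real_normed_vector"
  assumes cu: "continuous_on S2 u" and B: "\<And>z. z \<in> S2 \<Longrightarrow> norm (u z) \<le> B"
    and H: "\<And>x y t. (x, t) \<in> V2 \<Longrightarrow> (y, t) \<in> V2 \<Longrightarrow> norm (u (x, t) - u (y, t)) \<le> H * dist x y powr \<alpha>"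
  shows "hcont \<alpha> S2 u"
proof (rule hcontI[OF cu B])
  fix t x y assume xy: "(x, t) \<in> S2" "(y, t) \<in> S2"
  have s': "2 * R / 3 \<le> R" using pos by simp
  have x: "(x, t) \<in> tbox x0 (2 * R / 3) t0 \<tau>" "r (x, t) \<le> 0" and y: "(y, t) \<in> tbox x0 (2 * R / 3) t0 \<tau>" "r (y, t) \<le> 0"
    using xy by (auto simp: S2_def)
  note cu' = cu[unfolded S2_def]
  have l: "((\<lambda>s. norm (u (x + s *\<^sub>R e, t) - u (y + s *\<^sub>R e, t))) \<longlongrightarrow> norm (u (x, t) - u (y, t))) (at_right 0)"
    by (intro tendsto_norm tendsto_diff tendsto_up[OF x s' cu'] tendsto_up[OF y s' cu'])
  show "norm (u (x, t) - u (y, t)) \<le> H * dist x y powr \<alpha>"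
  proof (rule tendsto_upperbound[OF l])
    show "\<forall>\<^sub>F s in at_right 0. norm (u (x + s *\<^sub>R e, t) - u (y + s *\<^sub>R e, t)) \<le> H * dist x y powr \<alpha>"
      using up[OF x s'] up[OF y s']
    proof eventually_elim
      case (elim s)
      have "norm (u (x + s *\<^sub>R e, t) - u (y + s *\<^sub>R e, t)) \<le> H * dist (x + s *\<^sub>R e) (y + s *\<^sub>R e) powr \<alpha>"
        by (rule H) (use elim in \<open>auto simp: V2_def\<close>)
      thus ?case by simp
    qed
  qed simp
qed

text \<open>The derivatives of f extend continuously to the closed total space. Their values on r =
  0 are limits along e of values of f^t, so the function g to be reflected depends on the single
  slice f^t although its regularity is joint in x and t.\<close>

lemma trace_regular:
  fixes f :: "real \<Rightarrow> complex \<Rightarrow> complex"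
  assumes \<alpha>: "0 < \<alpha>" "\<alpha> < 1" and V: "openin (top_of_set slab) (total_space D)" "bounded (total_space D)"
    and oD: "\<And>t. t \<in> {0..1} \<Longrightarrow> open (D t)" and sect: "\<And>z. z \<in> Q \<Longrightarrow> z \<in> total_space D \<longleftrightarrow> r z < 0"
    and reg: "hreg \<alpha> (Suc n) m Q Q r" and f: "f \<in> hoelder_fin (real n + \<alpha>) m D" and mn: "m \<le> n"
  obtains g where "hreg \<alpha> n m V2 S2 g"
    "\<forall>x t. (x, t) \<in> S2 \<longrightarrow> ((\<lambda>s. if x + s *\<^sub>R e \<in> D t then f t (x + s *\<^sub>R e) else 0) \<longlongrightarrow> g (x, t)) (at_right 0)"
    "\<forall>x t. (x, t) \<in> S2 \<longrightarrow> r (x, t) < 0 \<longrightarrow> g (x, t) = f t x"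
proof -
  let ?V = "total_space D"
  obtain G where G: "\<forall>i p q. i \<le> m \<longrightarrow> i + p + q \<le> n \<longrightarrow> continuous_on (closure ?V) (G i p q)"
    "\<forall>i p q. i \<le> m \<longrightarrow> i + p + q < n \<longrightarrow>
       has_grad (m - i) ?V (G i p q) (G i (Suc p) q) (G i p (Suc q)) (G (Suc i) p q)"
    "\<forall>i p q. i \<le> m \<longrightarrow> i + p + q = n \<longrightarrow>
       (\<exists>H. \<forall>x y t. (x, t) \<in> ?V \<longrightarrow> (y, t) \<in> ?V \<longrightarrow> norm (G i p q (x, t) - G i p q (y, t)) \<le> H * dist x y powr \<alpha>)"
    "\<forall>x t. (x, t) \<in> ?V \<longrightarrow> G 0 0 0 (x, t) = f t x"
    by (rule hoelder_fin_jet[OF \<alpha> f mn V(1)]) (erule oD, (rule that; assumption))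
  have VQ: "{z \<in> Q. r z < 0} \<subseteq> ?V" using sect by blast
  \<comment> \<open>The continuous extensions are given on the closure of the total space; moving
    along e shows that it contains the part r = 0 of the chart.\<close>
  have SQ: "{z \<in> Q. r z \<le> 0} \<subseteq> closure ?V"
  proof
    fix z assume "z \<in> {z \<in> Q. r z \<le> 0}"
    moreover obtain x t where z: "z = (x, t)" by force
    ultimately have xt: "(x, t) \<in> tbox x0 R t0 \<tau>" "r (x, t) \<le> 0" by (auto simp: Q_def)
    show "z \<in> closure ?V" unfolding z
    proof (rule Lim_in_closed_set[OF closed_closure _ _ tendsto_up_ident])
      show "\<forall>\<^sub>F s in at_right 0. (x + s *\<^sub>R e, t) \<in> closure ?V"
        using up[OF xt order_refl] by (rule eventually_mono) (use VQ closure_subset in \<open>auto simp: Q_def\<close>)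
    qed simp
  qed
  have s23: "2 * R / 3 \<le> R" using pos by simp
  have S2Q: "S2 \<subseteq> {z \<in> Q. r z \<le> 0}" "V2 \<subseteq> {z \<in> Q. r z < 0}"
    using tbox_mono[OF s23, of x0 t0 \<tau>] by (auto simp: S2_def V2_def Q_def)
  have cS: "continuous_on {z \<in> Q. r z \<le> 0} (G i p q)" if "i \<le> m" "i + p + q \<le> n" for i p q
    using G(1) that continuous_on_subset[OF _ SQ] by blast
  have b: "\<exists>B. \<forall>z\<in>{z \<in> Q. r z \<le> 0}. norm (G i p q z) \<le> B" if "i \<le> m" "i + p + q \<le> n" for i p q
  proof -
    have "bounded (G i p q ` closure ?V)"
      using G(1) that V(2) by (intro compact_imp_bounded compact_continuous_image) (auto simp: compact_closure)
    then obtain B where "\<forall>z\<in>closure ?V. norm (G i p q z) \<le> B" unfolding bounded_iff by auto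
    thus ?thesis using SQ by blast
  qed
  have hc: "hcont \<alpha> S2 (G i p q)" if ipq: "i \<le> m" "i + p + q \<le> n" for i p q
  proof -
    obtain B where B: "\<forall>z\<in>{z \<in> Q. r z \<le> 0}. norm (G i p q z) \<le> B" using b[OF ipq] by blast
    show ?thesis
    proof (cases "i + p + q = n")
      case True
      then obtain H where H: "\<forall>x y t. (x, t) \<in> ?V \<longrightarrow> (y, t) \<in> ?V \<longrightarrow> norm (G i p q (x, t) - G i p q (y, t)) \<le> H * dist x y powr \<alpha>"
        using G(3) ipq by blast
      have V2V: "V2 \<subseteq> ?V" using S2Q(2) VQ by blast
      show ?thesis
      proof (rule hcont_top_order[where B = B and H = H])
        show "continuous_on S2 (G i p q)" by (rule continuous_on_subset[OF cS[OF ipq] S2Q(1)])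
        show "norm (G i p q z) \<le> B" if "z \<in> S2" for z using B that S2Q(1) by blast
        show "norm (G i p q (x, t) - G i p q (y, t)) \<le> H * dist x y powr \<alpha>" if "(x, t) \<in> V2" "(y, t) \<in> V2" for x y t
          using H that V2V by blast
      qed
    next
      case False
      hence lt: "i + p + q < n" using ipq by simp
      have i1: "i + Suc p + q \<le> n" and i2: "i + p + Suc q \<le> n" using lt by auto
      obtain B1 where B1: "\<forall>z\<in>{z \<in> Q. r z \<le> 0}. norm (G i (Suc p) q z) \<le> B1" using b[OF ipq(1) i1] by blast
      obtain B2 where B2: "\<forall>z\<in>{z \<in> Q. r z \<le> 0}. norm (G i p (Suc q) z) \<le> B2" using b[OF ipq(1) i2] by blast
      have gr: "has_grad (m - i) ?V (G i p q) (G i (Suc p) q) (G i p (Suc q)) (G (Suc i) p q)" using G(2) ipq(1) lt by blast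
      show ?thesis
      proof (rule hcont_lower_order[OF \<alpha> reg has_grad_subset[OF gr VQ] cS[OF ipq], where B = "max B (max B1 B2)"])
        fix z assume "z \<in> Q" "r z \<le> 0"
        hence "norm (G i p q z) \<le> B" "norm (G i (Suc p) q z) \<le> B1" "norm (G i p (Suc q) z) \<le> B2" using B B1 B2 by blast+
        thus "norm (G i p q z) \<le> max B (max B1 B2) \<and> norm (G i (Suc p) q z) \<le> max B (max B1 B2) \<and>
          norm (G i p (Suc q) z) \<le> max B (max B1 B2)" by (simp add: le_max_iff_disj)
      qed
    qed
  qed
  have "hreg \<alpha> n (m - 0) V2 S2 (G 0 0 0)"
  proof (rule hreg_jet[where N = n and w = G and J = m and i = 0 and p = 0 and q = 0])
    show "hcont \<alpha> S2 (G i p q)" if "i \<le> m" "i + p + q \<le> n" for i p q by (rule hc[OF that])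
    show "has_grad (m - i) V2 (G i p q) (G i (Suc p) q) (G i p (Suc q)) (G (Suc i) p q)" if "i \<le> m" "i + p + q < n" for i p q
      using G(2) that has_grad_subset S2Q(2) VQ by (meson order_trans)
  qed auto
  moreover have "((\<lambda>s. if x + s *\<^sub>R e \<in> D t then f t (x + s *\<^sub>R e) else 0) \<longlongrightarrow> G 0 0 0 (x, t)) (at_right 0)"
    if "(x, t) \<in> S2" for x t
  proof -
    have xt: "(x, t) \<in> tbox x0 R t0 \<tau>" "r (x, t) \<le> 0" using that S2Q by (auto simp: Q_def)
    have "((\<lambda>s. G 0 0 0 (x + s *\<^sub>R e, t)) \<longlongrightarrow> G 0 0 0 (x, t)) (at_right 0)"
      by (rule tendsto_up[OF xt order_refl]) (use cS[of 0 0 0] in \<open>simp add: Q_def\<close>)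
    moreover have "\<forall>\<^sub>F s in at_right 0. G 0 0 0 (x + s *\<^sub>R e, t) = (if x + s *\<^sub>R e \<in> D t then f t (x + s *\<^sub>R e) else 0)"
      using up[OF xt order_refl]
    proof (rule eventually_mono)
      fix s assume "(x + s *\<^sub>R e, t) \<in> tbox x0 R t0 \<tau> \<and> r (x + s *\<^sub>R e, t) < 0"
      hence "(x + s *\<^sub>R e, t) \<in> ?V" using VQ by (auto simp: Q_def)
      thus "G 0 0 0 (x + s *\<^sub>R e, t) = (if x + s *\<^sub>R e \<in> D t then f t (x + s *\<^sub>R e) else 0)"
        using G(4) by (simp add: total_space_iff)
    qed
    ultimately show ?thesis by (rule Lim_transform_eventually)
  qed
  moreover have "G 0 0 0 (x, t) = f t x" if "(x, t) \<in> S2" "r (x, t) < 0" for x t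
    using G(4) that S2Q(1) VQ by blast
  ultimately show ?thesis using that by simp
qed

lemma extend_summable:
  fixes f :: "complex \<times> real \<Rightarrow> 'b::banach"
  assumes z: "z \<in> Q1" and f: "\<And>w. w \<in> S2 \<Longrightarrow> norm (f w) \<le> B" and \<eta>: "continuous_on {0..R} \<eta>"
  shows "summable (\<lambda>l. (seeley l * (2 ^ l) ^ m * \<eta> (\<sigma> l z)) *\<^sub>R f (P l z))"
proof -
  have "bounded (\<eta> ` {0..R})" by (intro compact_imp_bounded compact_continuous_image \<eta>) simp
  then obtain M where M: "\<forall>s\<in>{0..R}. norm (\<eta> s) \<le> M" unfolding bounded_iff by auto
  have M0: "0 \<le> M" using bspec[OF M, of 0] pos norm_ge_zero[of "\<eta> 0"] by (simp del: norm_ge_zero)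
  show ?thesis
  proof (rule summable_comparison_test'[OF summable_mult2[OF seeley_summable[of m], of "M * B"]])
    fix l :: nat
    have "\<bar>\<eta> (\<sigma> l z)\<bar> \<le> M" using M \<sigma>_bounds[of l z] pos by auto
    moreover have "norm (f (P l z)) \<le> B" by (rule f[OF P_mem(1)[OF z]])
    ultimately have "\<bar>\<eta> (\<sigma> l z)\<bar> * norm (f (P l z)) \<le> M * B" using M0 by (intro mult_mono) auto
    hence "(\<bar>seeley l\<bar> * (2 ^ l) ^ m) * (\<bar>\<eta> (\<sigma> l z)\<bar> * norm (f (P l z))) \<le> (\<bar>seeley l\<bar> * (2 ^ l) ^ m) * (M * B)"
      by (intro mult_left_mono) auto
    thus "norm ((seeley l * (2 ^ l) ^ m * \<eta> (\<sigma> l z)) *\<^sub>R f (P l z)) \<le> \<bar>seeley l\<bar> * (2 ^ l) ^ m * (M * B)"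
      by (simp add: abs_mult mult.assoc)
  qed
qed

lemma extend_cong:
  assumes "z \<in> Q1" "\<And>w. w \<in> S2 \<Longrightarrow> snd w = snd z \<Longrightarrow> f w = g w"
  shows "extend m \<eta> f z = extend m \<eta> g z"
proof -
  have "f (P l z) = g (P l z)" for l by (rule assms(2)[OF P_mem(1)[OF assms(1)]]) (simp add: P_def)
  thus ?thesis by (simp add: extend_def)
qed

lemma extend_linear:
  fixes f g :: "complex \<times> real \<Rightarrow> complex"
  assumes z: "z \<in> Q1" and f: "\<And>w. w \<in> S2 \<Longrightarrow> norm (f w) \<le> B" and g: "\<And>w. w \<in> S2 \<Longrightarrow> norm (g w) \<le> B'"
    and \<eta>: "continuous_on {0..R} \<eta>"
  shows "extend m \<eta> (\<lambda>w. a * f w + b * g w) z = a * extend m \<eta> f z + b * extend m \<eta> g z"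
proof -
  have sf: "summable (\<lambda>l. (seeley l * (2 ^ l) ^ m * \<eta> (\<sigma> l z)) *\<^sub>R f (P l z))" by (rule extend_summable[OF z f \<eta>])
  have sg: "summable (\<lambda>l. (seeley l * (2 ^ l) ^ m * \<eta> (\<sigma> l z)) *\<^sub>R g (P l z))" by (rule extend_summable[OF z g \<eta>])
  have "a * extend m \<eta> f z + b * extend m \<eta> g z =
    (\<Sum>l. a * ((seeley l * (2 ^ l) ^ m * \<eta> (\<sigma> l z)) *\<^sub>R f (P l z)) + b * ((seeley l * (2 ^ l) ^ m * \<eta> (\<sigma> l z)) *\<^sub>R g (P l z)))"
    unfolding extend_def
    using suminf_add[OF summable_mult[OF sf, of a] summable_mult[OF sg, of b]] suminf_mult[OF sf, of a] suminf_mult[OF sg, of b]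
    by simp
  also have "\<dots> = extend m \<eta> (\<lambda>w. a * f w + b * g w) z"
    unfolding extend_def by (simp add: scaleR_add_right)
  finally show ?thesis by simp
qed

end

subsection \<open>The extension and the solution operator\<close>

lemma ex_cauchy_kernel:
  assumes "0 < \<alpha>" "\<alpha> < 1" "0 < k0"
  obtains K K1 K2 K11 K12 K21 K22 p where "cauchy_kernel \<alpha> k0 K K1 K2 K11 K12 K21 K22 p"
proof (rule cauchy_kernel_exists, goal_cases)
  case (1 K K1 K2 K11 K12 K21 K22 p)
  show ?thesis
  proof (rule that, rule cauchy_kernel.intro, rule dyadic_kernel.intro)
    show "cauchy_kernel_axioms K1 K2 p" by (rule cauchy_kernel_axioms.intro) (fact 1)+
  qed (fact assms 1)+
qed

context smooth_domain_family
begin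

abbreviation "\<F> \<equiv> hoelder_closed (ereal_of_enat k + ereal \<alpha>) j D :: (real \<Rightarrow> complex \<Rightarrow> complex) set"

text \<open>The boundary value of \<open>h\<close> as a limit along \<open>e\<close>. The value \<open>0\<close> outside \<open>D\<^sup>t\<close> only makes the definition depend on
  nothing but \<open>h\<close> on \<open>D\<^sup>t\<close>.\<close>

definition trace :: "complex \<Rightarrow> real \<Rightarrow> (complex \<Rightarrow> complex) \<Rightarrow> complex \<Rightarrow> complex" where
  "trace e t h x = Lim (at_right 0) (\<lambda>s. if x + s *\<^sub>R e \<in> D t then h (x + s *\<^sub>R e) else 0)"

text \<open>B is the region of linearity and regularity, A the one where the data are reproduced;
  gluing works with B the slab and enlarges A. E receives one slice h and may use only its values on
  the domain, and the same E has to serve all admissible pairs of indices.\<close>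

definition extension_on :: "(complex \<times> real) set \<Rightarrow> (complex \<times> real) set \<Rightarrow> (real \<Rightarrow> (complex \<Rightarrow> complex) \<Rightarrow> complex \<Rightarrow> complex) \<Rightarrow> bool" where
  "extension_on B A E \<longleftrightarrow>
     (\<forall>t\<in>{0..1}. \<forall>g h. (\<forall>x\<in>D t. g x = h x) \<longrightarrow> E t g = E t h) \<and>
     (\<forall>f\<in>\<F>. \<forall>g\<in>\<F>. \<forall>a b x t. (x, t) \<in> B \<longrightarrow> E t (\<lambda>z. a * f t z + b * g t z) x = a * E t (f t) x + b * E t (g t) x) \<and>
     (\<forall>f\<in>\<F>. \<forall>x t. (x, t) \<in> V \<inter> A \<longrightarrow> E t (f t) x = f t x) \<and>
     (\<forall>f\<in>\<F>. \<forall>n m. admissible k j n m \<longrightarrow> hreg \<alpha> n m B B (\<lambda>z. E (snd z) (f (snd z)) (fst z)))"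

lemma extension_on_cong:
  assumes "extension_on B A E" "t \<in> {0..1}" "\<And>x. x \<in> D t \<Longrightarrow> g x = h x"
  shows "E t g = E t h"
  using conjunct1[OF assms(1)[unfolded extension_on_def], rule_format, OF assms(2,3)] .

lemma oD: "t \<in> {0..1} \<Longrightarrow> open (D t)"
  using dom by blast

lemma local_extension:
  assumes z0: "(x0, t0) \<in> closure V"
  shows "\<exists>\<rho> \<tau> E. 0 < \<rho> \<and> 0 < \<tau> \<and> extension_on (tbox x0 \<rho> t0 \<tau>) (tbox x0 \<rho> t0 \<tau>) E"
proof -
  obtain R \<rho> \<tau> c e rr where ch: "refl_chart x0 R \<rho> t0 \<tau> c e rr"
    and sect: "\<forall>z\<in>tbox x0 R t0 \<tau>. z \<in> V \<longleftrightarrow> rr z < 0"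
    and reg: "\<forall>n m. admissible k j n m \<longrightarrow> hreg \<alpha> (Suc n) m (tbox x0 R t0 \<tau>) (tbox x0 R t0 \<tau>) rr"
    using chart_exists[OF z0] by (elim exE conjE) (rule that)
  interpret ch: refl_chart x0 R \<rho> t0 \<tau> c e rr by (rule ch)
  have bV: "bounded V" using bounded_subset[OF U(2) V_W] .
  have tr: "\<exists>g. hreg \<alpha> n m ch.V2 ch.S2 g \<and>
      (\<forall>x t. (x, t) \<in> ch.S2 \<longrightarrow> ((\<lambda>s. if x + s *\<^sub>R e \<in> D t then f t (x + s *\<^sub>R e) else 0) \<longlongrightarrow> g (x, t)) (at_right 0)) \<and>
      (\<forall>x t. (x, t) \<in> ch.S2 \<longrightarrow> rr (x, t) < 0 \<longrightarrow> g (x, t) = f t x)"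
    if f: "f \<in> \<F>" and adm: "admissible k j n m" for f n m
  proof -
    have 1: "z \<in> V \<longleftrightarrow> rr z < 0" if "z \<in> ch.Q" for z using sect that by (simp add: ch.Q_def)
    have 2: "hreg \<alpha> (Suc n) m ch.Q ch.Q rr" using reg adm by (simp add: ch.Q_def)
    have 3: "m \<le> n" using adm by (simp add: admissible_def)
    show ?thesis
      by (rule ch.trace_regular[OF \<alpha> V_open bV oD 1 2 hoelder_closedD[OF f adm \<alpha>(1)] 3]) (assumption, assumption, blast)
  qed
  \<comment> \<open>Equal to 1 for s \<le> R/8 and to 0 for s \<ge> R/4, as the cap of the shift at
    R/3 requires.\<close>
  define \<eta> :: "real \<Rightarrow> real" where "\<eta> s = cutoff (8 / R * s + 0)" for s
  have \<eta>: "smooth_upto n \<eta>" for n unfolding \<eta>_def by (rule smooth_upto_affine[OF smooth_upto_cutoff])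
  have \<eta>0: "\<eta> 0 = 1" by (simp add: \<eta>_def cutoff_eq_1)
  have \<eta>R: "\<eta> s = 0" if "R / 4 < s" for s
  proof -
    have "2 \<le> 8 / R * s" using that ch.pos by (simp add: field_simps)
    thus ?thesis by (simp add: \<eta>_def cutoff_eq_0)
  qed
  have c\<eta>: "continuous_on {0..R} \<eta>" by (rule continuous_on_subset[OF smooth_upto_imp_continuous[OF \<eta>[of 0]]]) simp
  \<comment> \<open>Reflection is applied to the limits along e, not to f itself: the value on r = 0
    is needed, and f is arbitrary there.\<close>
  define E where "E t h x = ch.extend 0 \<eta> (\<lambda>w. trace e (snd w) h (fst w)) (x, t)" for t h x
  \<comment> \<open>All shifted points have the time of z, so only the slice of g at that time
    matters.\<close>
  have EI: "E t h x = ch.extend 0 \<eta> g (x, t)"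
    if xt: "(x, t) \<in> ch.Q1"
      and g: "\<And>y. (y, t) \<in> ch.S2 \<Longrightarrow> ((\<lambda>s. if y + s *\<^sub>R e \<in> D t then h (y + s *\<^sub>R e) else 0) \<longlongrightarrow> g (y, t)) (at_right 0)" for t h x g
    unfolding E_def
  proof (rule ch.extend_cong[OF xt])
    fix w assume w: "w \<in> ch.S2" "snd w = snd (x, t)"
    have "(fst w, t) \<in> ch.S2" using w by (metis prod.collapse snd_conv)
    from tendsto_Lim[OF trivial_limit_at_right_real g[OF this]]
    show "trace e (snd w) h (fst w) = g w" using w(2) by (simp add: trace_def) (metis prod.collapse)
  qed
  have "extension_on ch.Q1 ch.Q1 E"
    unfolding extension_on_def
  proof (intro conjI ballI allI impI)
    fix t and g h :: "complex \<Rightarrow> complex" assume "\<forall>x\<in>D t. g x = h x"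
    hence "(\<lambda>s. if x + s *\<^sub>R e \<in> D t then g (x + s *\<^sub>R e) else 0) = (\<lambda>s. if x + s *\<^sub>R e \<in> D t then h (x + s *\<^sub>R e) else 0)" for x
      by auto
    hence tt: "trace e t g x = trace e t h x" for x by (simp add: trace_def)
    show "E t g = E t h"
      unfolding E_def ch.extend_def ch.P_def snd_conv tt ..
  next
    fix f g a b x t assume fg: "f \<in> \<F>" "g \<in> \<F>" and xt: "(x, t) \<in> ch.Q1"
    obtain n m where adm: "admissible k j n m" using adm_ex by blast
    obtain f' where f': "hreg \<alpha> n m ch.V2 ch.S2 f'"
      "\<forall>x t. (x, t) \<in> ch.S2 \<longrightarrow> ((\<lambda>s. if x + s *\<^sub>R e \<in> D t then f t (x + s *\<^sub>R e) else 0) \<longlongrightarrow> f' (x, t)) (at_right 0)"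
      using tr[OF fg(1) adm] by blast
    obtain g' where g': "hreg \<alpha> n m ch.V2 ch.S2 g'"
      "\<forall>x t. (x, t) \<in> ch.S2 \<longrightarrow> ((\<lambda>s. if x + s *\<^sub>R e \<in> D t then g t (x + s *\<^sub>R e) else 0) \<longlongrightarrow> g' (x, t)) (at_right 0)"
      using tr[OF fg(2) adm] by blast
    obtain Bf where Bf: "\<And>z. z \<in> ch.S2 \<Longrightarrow> norm (f' z) \<le> Bf" using hreg_imp_hcont[OF f'(1)] by (rule hcontE) blast
    obtain Bg where Bg: "\<And>z. z \<in> ch.S2 \<Longrightarrow> norm (g' z) \<le> Bg" using hreg_imp_hcont[OF g'(1)] by (rule hcontE) blast
    have 1: "E t (f t) x = ch.extend 0 \<eta> f' (x, t)" by (rule EI[OF xt]) (use f'(2) in blast)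
    have 2: "E t (g t) x = ch.extend 0 \<eta> g' (x, t)" by (rule EI[OF xt]) (use g'(2) in blast)
    have 3: "E t (\<lambda>z. a * f t z + b * g t z) x = ch.extend 0 \<eta> (\<lambda>w. a * f' w + b * g' w) (x, t)"
    proof (rule EI[OF xt])
      fix y assume y: "(y, t) \<in> ch.S2"
      have "((\<lambda>s. a * (if y + s *\<^sub>R e \<in> D t then f t (y + s *\<^sub>R e) else 0) + b * (if y + s *\<^sub>R e \<in> D t then g t (y + s *\<^sub>R e) else 0))
          \<longlongrightarrow> a * f' (y, t) + b * g' (y, t)) (at_right 0)"
        using f'(2) g'(2) y by (intro tendsto_add tendsto_mult_left) blast+
      moreover have "(\<lambda>s. a * (if y + s *\<^sub>R e \<in> D t then f t (y + s *\<^sub>R e) else 0) + b * (if y + s *\<^sub>R e \<in> D t then g t (y + s *\<^sub>R e) else 0)) =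
          (\<lambda>s. if y + s *\<^sub>R e \<in> D t then a * f t (y + s *\<^sub>R e) + b * g t (y + s *\<^sub>R e) else 0)"
        by auto
      ultimately show "((\<lambda>s. if y + s *\<^sub>R e \<in> D t then a * f t (y + s *\<^sub>R e) + b * g t (y + s *\<^sub>R e) else 0)
          \<longlongrightarrow> a * f' (y, t) + b * g' (y, t)) (at_right 0)" by simp
    qed
    show "E t (\<lambda>z. a * f t z + b * g t z) x = a * E t (f t) x + b * E t (g t) x"
      unfolding 1 2 3 by (rule ch.extend_linear[OF xt Bf Bg c\<eta>])
  next
    fix f x t assume f: "f \<in> \<F>" and xt: "(x, t) \<in> V \<inter> ch.Q1"
    obtain n m where adm: "admissible k j n m" using adm_ex by blast
    obtain g where g: "\<forall>x t. (x, t) \<in> ch.S2 \<longrightarrow> ((\<lambda>s. if x + s *\<^sub>R e \<in> D t then f t (x + s *\<^sub>R e) else 0) \<longlongrightarrow> g (x, t)) (at_right 0)"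
      "\<forall>x t. (x, t) \<in> ch.S2 \<longrightarrow> rr (x, t) < 0 \<longrightarrow> g (x, t) = f t x"
      using tr[OF f adm] by blast
    have Q: "(x, t) \<in> ch.Q1" using xt by simp
    have neg: "rr (x, t) < 0" using xt ch.Q1_Q sect by (auto simp: ch.Q_def)
    have "(x, t) \<in> ch.S2"
      using xt neg tbox_mono[of \<rho> "2 * R / 3" x0 t0 \<tau>] ch.pos by (auto simp: ch.Q1_def ch.S2_def)
    hence "g (x, t) = f t x" using g(2) neg by blast
    moreover have "E t (f t) x = ch.extend 0 \<eta> g (x, t)" by (rule EI[OF Q]) (use g(1) in blast)
    ultimately show "E t (f t) x = f t x" using ch.extend_inside[of "(x, t)" 0 \<eta> g] neg \<eta>0 by simp
  next
    fix f n m assume f: "f \<in> \<F>" and adm: "admissible k j n m"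
    obtain g where g: "hreg \<alpha> n m ch.V2 ch.S2 g"
      "\<forall>x t. (x, t) \<in> ch.S2 \<longrightarrow> ((\<lambda>s. if x + s *\<^sub>R e \<in> D t then f t (x + s *\<^sub>R e) else 0) \<longlongrightarrow> g (x, t)) (at_right 0)"
      using tr[OF f adm] by blast
    have rQ: "hreg \<alpha> (Suc n) m ch.Q ch.Q rr" using reg adm by (simp add: ch.Q_def)
    show "hreg \<alpha> n m ch.Q1 ch.Q1 (\<lambda>z. E (snd z) (f (snd z)) (fst z))"
    proof (rule hreg_cong[OF ch.hreg_extend[OF \<alpha> rQ g(1) \<eta> \<eta>R, where m = 0]])
      fix z assume z: "z \<in> ch.Q1"
      have "E (snd z) (f (snd z)) (fst z) = ch.extend 0 \<eta> g (fst z, snd z)"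
        by (rule EI) (use z g(2) in auto)
      thus "E (snd z) (f (snd z)) (fst z) = ch.extend 0 \<eta> g z" by simp
    qed (auto simp: ch.Q1_def tbox_open)
  qed
  thus ?thesis using ch.pos unfolding ch.Q1_def by blast
qed

text \<open>The new operator is b E1 + (1 - b) E2. On the half-size box b = 1 and E1 reproduces the
  data; on A both operators do so where b is nonzero, and the weights add up to 1. Cutting off by b
  makes the local operator regular on the whole slab.\<close>

lemma glue_extension:
  assumes pos: "0 < \<rho>" "0 < \<tau>" and E1: "extension_on (tbox x0 \<rho> t0 \<tau>) (tbox x0 \<rho> t0 \<tau>) E1"
    and E2: "extension_on slab A E2"
  shows "extension_on slab (ball x0 (\<rho> / 2) \<times> ball t0 (\<tau> / 2) \<union> A)
    (\<lambda>t h x. (if (x, t) \<in> tbox x0 \<rho> t0 \<tau> then boxbump x0 \<rho> t0 \<tau> (x, t) *\<^sub>R E1 t h x else 0) +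
       (1 - boxbump x0 \<rho> t0 \<tau> (x, t)) *\<^sub>R E2 t h x)"
  (is "extension_on _ _ ?E")
proof -
  let ?Q = "tbox x0 \<rho> t0 \<tau>" and ?b = "boxbump x0 \<rho> t0 \<tau>"
  have sup: "boxsupp x0 \<rho> t0 \<tau> \<subseteq> ?Q" using pos by (auto simp: boxsupp_def tbox_def)
  have b0: "?b (x, t) = 0" if "(x, t) \<in> slab" "(x, t) \<notin> ?Q" for x t
    by (rule boxbump_eq_0[OF pos]) (use that sup in auto)
  show ?thesis
    unfolding extension_on_def
  proof (intro conjI ballI allI impI)
    fix t and g h :: "complex \<Rightarrow> complex" assume "t \<in> {0..1}" "\<forall>x\<in>D t. g x = h x"
    hence a: "t \<in> {0..1}" "\<And>x. x \<in> D t \<Longrightarrow> g x = h x" by auto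
    have "E1 t g = E1 t h" by (rule extension_on_cong[OF E1 a(1)]) (rule a(2))
    moreover have "E2 t g = E2 t h" by (rule extension_on_cong[OF E2 a(1)]) (rule a(2))
    ultimately show "?E t g = ?E t h" by (simp cong: if_cong)
  next
    fix f g a b x t assume fg: "f \<in> \<F>" "g \<in> \<F>" and xt: "(x, t) \<in> slab"
    have 2: "E2 t (\<lambda>z. a * f t z + b * g t z) x = a * E2 t (f t) x + b * E2 t (g t) x"
      using E2 fg xt unfolding extension_on_def by blast
    show "?E t (\<lambda>z. a * f t z + b * g t z) x = a * ?E t (f t) x + b * ?E t (g t) x"
    proof (cases "(x, t) \<in> ?Q")
      case True
      hence "E1 t (\<lambda>z. a * f t z + b * g t z) x = a * E1 t (f t) x + b * E1 t (g t) x"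
        using E1 fg unfolding extension_on_def by blast
      thus ?thesis using True 2 by (simp add: scaleR_conv_of_real algebra_simps)
    next
      case False
      thus ?thesis using 2 by (simp add: scaleR_conv_of_real algebra_simps)
    qed
  next
    fix f x t assume f: "f \<in> \<F>" and xt: "(x, t) \<in> V \<inter> (ball x0 (\<rho> / 2) \<times> ball t0 (\<tau> / 2) \<union> A)"
    have s: "(x, t) \<in> slab" using xt V_slab by blast
    have 1: "E1 t (f t) x = f t x" if "(x, t) \<in> ?Q" using E1 f xt that unfolding extension_on_def by blast
    show "?E t (f t) x = f t x"
    proof (cases "(x, t) \<in> A")
      case True
      hence "E2 t (f t) x = f t x" using E2 f xt unfolding extension_on_def by blast
      thus ?thesis using 1 b0[OF s] by (cases "(x, t) \<in> ?Q") (auto simp: scaleR_left_diff_distrib)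
    next
      case False
      hence c: "dist x x0 < \<rho> / 2" "\<bar>t - t0\<bar> < \<tau> / 2" using xt by (auto simp: dist_commute dist_real_def abs_minus_commute)
      hence "(x, t) \<in> ?Q" using pos s by (auto simp: tbox_iff slab_def dist_real_def)
      moreover have "?b (x, t) = 1" using c pos by (intro boxbump_eq_1) auto
      ultimately show ?thesis using 1 by simp
    qed
  next
    fix f n m assume f: "f \<in> \<F>" and adm: "admissible k j n m"
    have 1: "hreg \<alpha> n m ?Q ?Q (\<lambda>z. E1 (snd z) (f (snd z)) (fst z))" using E1 f adm unfolding extension_on_def by blast
    have 2: "hreg \<alpha> n m slab slab (\<lambda>z. E2 (snd z) (f (snd z)) (fst z))" using E2 f adm unfolding extension_on_def by blast
    note hb = hreg_boxbump[OF pos \<alpha>, of n m x0 t0]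
    have h1: "hreg \<alpha> n m slab slab (\<lambda>z. if z \<in> ?Q then ?b z *\<^sub>R E1 (snd z) (f (snd z)) (fst z) else 0)"
    proof (rule hreg_box_extend[OF pos \<alpha>(1) tbox_def])
      show "hreg \<alpha> n m ?Q ?Q (\<lambda>z. ?b z *\<^sub>R E1 (snd z) (f (snd z)) (fst z))"
        by (rule hreg_scaleR[OF hreg_mono[OF hb] 1]) (use tbox_subset_slab in auto)
      fix z assume z: "z \<in> ?Q - boxsupp x0 \<rho> t0 \<tau>"
      have "?b (fst z, snd z) = 0" by (rule boxbump_eq_0[OF pos]) (use z subsetD[OF tbox_subset_slab, of z x0 \<rho> t0 \<tau>] in auto)
      thus "?b z *\<^sub>R E1 (snd z) (f (snd z)) (fst z) = 0" by simp
    qed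
    have "hreg \<alpha> n m slab slab (\<lambda>z. 1 + (- 1) * ?b z)"
      by (intro hreg_add hreg_const hreg_mult hb) simp
    from hreg_add[OF h1 hreg_scaleR[OF this 2 order_refl]]
    show "hreg \<alpha> n m slab slab (\<lambda>z. ?E (snd z) (f (snd z)) (fst z))" by (simp cong: if_cong)
  qed
qed

lemma global_extension:
  obtains E M where "extension_on slab (closure V) E" "\<forall>t h x. M \<le> norm x \<longrightarrow> E t h x = 0"
proof -
  have "\<forall>z\<in>closure V. \<exists>\<rho> \<tau> E. 0 < \<rho> \<and> 0 < \<tau> \<and>
      extension_on (tbox (fst z) \<rho> (snd z) \<tau>) (tbox (fst z) \<rho> (snd z) \<tau>) E"
    using local_extension by (metis prod.collapse)
  then obtain \<rho> \<tau> E1 where loc: "\<And>z. z \<in> closure V \<Longrightarrow> 0 < \<rho> z \<and> 0 < \<tau> z \<and>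
      extension_on (tbox (fst z) (\<rho> z) (snd z) (\<tau> z)) (tbox (fst z) (\<rho> z) (snd z) (\<tau> z)) (E1 z)"
    by metis
  \<comment> \<open>Half-size boxes, on which the bump equals 1; finitely many cover the compact
    closure.\<close>
  define C where "C z = ball (fst z) (\<rho> z / 2) \<times> ball (snd z) (\<tau> z / 2)" for z
  have "closure V \<subseteq> (\<Union>z\<in>closure V. C z)"
  proof
    fix z assume z: "z \<in> closure V"
    have "z \<in> C z" using loc[OF z] by (simp add: C_def mem_Times_iff)
    thus "z \<in> (\<Union>z\<in>closure V. C z)" using z by blast
  qed
  moreover have "open (C z)" for z by (simp add: C_def open_Times)
  ultimately obtain Z where Z: "Z \<subseteq> closure V" "finite Z" "closure V \<subseteq> (\<Union>z\<in>Z. C z)"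
    using compactE_image[OF compact_closure_V] by metis
  have "\<exists>E M. extension_on slab (\<Union>z\<in>Z. C z) E \<and> (\<forall>t h x. M \<le> norm x \<longrightarrow> E t h x = 0)"
    using Z(2,1)
  proof (induction Z rule: finite_induct)
    case empty
    \<comment> \<open>The zero operator reproduces the data on the empty set and starts the
      gluing.\<close>
    have "extension_on slab (\<Union>z\<in>{}. C z) (\<lambda>t h x. 0)" by (simp add: extension_on_def hreg_const)
    thus ?case by blast
  next
    case (insert z Z)
    then obtain E M where E: "extension_on slab (\<Union>z\<in>Z. C z) E" "\<forall>t h x. M \<le> norm x \<longrightarrow> E t h x = 0" by blast
    have z: "z \<in> closure V" using insert by simp
    note l = loc[OF z]
    note g = glue_extension[OF conjunct1[OF l] conjunct1[OF conjunct2[OF l]] conjunct2[OF conjunct2[OF l]] E(1)]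
    have supp: "(if (x, t) \<in> tbox (fst z) (\<rho> z) (snd z) (\<tau> z) then boxbump (fst z) (\<rho> z) (snd z) (\<tau> z) (x, t) *\<^sub>R E1 z t h x else 0) +
       (1 - boxbump (fst z) (\<rho> z) (snd z) (\<tau> z) (x, t)) *\<^sub>R E t h x = 0"
      if "max M (norm (fst z) + \<rho> z) \<le> norm x" for t h x
    proof -
      have "dist x (fst z) \<ge> \<rho> z" using that norm_triangle_ineq2[of x "fst z"] by (simp add: dist_norm)
      hence "(x, t) \<notin> tbox (fst z) (\<rho> z) (snd z) (\<tau> z)" by (simp add: tbox_iff)
      thus ?thesis using E(2) that by simp
    qed
    have un: "(\<Union>z\<in>insert z Z. C z) = ball (fst z) (\<rho> z / 2) \<times> ball (snd z) (\<tau> z / 2) \<union> (\<Union>z\<in>Z. C z)"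
      by (simp add: C_def)
    show ?case
      unfolding un by (rule exI, rule exI, rule conjI, rule g, intro allI impI, rule supp)
  qed
  then obtain E M where E: "extension_on slab (\<Union>z\<in>Z. C z) E" "\<forall>t h x. M \<le> norm x \<longrightarrow> E t h x = 0" by blast
  have "extension_on slab (closure V) E"
    using E(1) Z(3) unfolding extension_on_def by (meson IntD1 IntD2 IntI subsetD)
  thus ?thesis using E(2) that by blast
qed

lemma solution_operator:
  "\<exists>S :: real \<Rightarrow> (complex \<Rightarrow> complex) \<Rightarrow> (complex \<Rightarrow> complex).
    (\<forall>f\<in>\<F>. \<forall>g\<in>\<F>. \<forall>t\<in>{0..1}.
       ((\<forall>x\<in>D t. f t x = g t x) \<longrightarrow> (\<forall>x\<in>D t. S t (f t) x = S t (g t) x)) \<and>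
       (\<forall>c d. \<forall>x\<in>D t. S t (\<lambda>z. c * f t z + d * g t z) x = c * S t (f t) x + d * S t (g t) x)) \<and>
    (\<forall>f\<in>\<F>. (\<forall>t\<in>{0..1}. \<forall>x\<in>D t. dbar (S t (f t)) x = f t x) \<and>
       (\<lambda>t. S t (f t)) \<in> hoelder_closed (ereal_of_enat k + 1 + ereal \<alpha>) j D)"
proof -
  obtain E M where E: "extension_on slab (closure V) E" and M: "\<forall>t h x. M \<le> norm x \<longrightarrow> E t h x = 0"
    by (rule global_extension)
  obtain N where N: "\<forall>z\<in>V. norm z \<le> N" using bounded_subset[OF U(2) V_W] bounded_iff by blast
  \<comment> \<open>For |x| \<le> N and |y| \<ge> 1/k0 one has |x - y| \<ge> M, where the extension
    vanishes; this is the hypothesis \<open>far\<close> at every point of the domains.\<close>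
  define k0 where "k0 = 1 / (\<bar>M\<bar> + \<bar>N\<bar> + 1)"
  have k0: "0 < k0" by (simp add: k0_def)
  obtain K K1 K2 K11 K12 K21 K22 p where "cauchy_kernel \<alpha> k0 K K1 K2 K11 K12 K21 K22 p"
    using \<alpha> k0 by (rule ex_cauchy_kernel)
  then interpret ck: cauchy_kernel \<alpha> k0 K K1 K2 K11 K12 K21 K22 p .
  have hr: "hreg \<alpha> n m slab slab (\<lambda>z. E (snd z) (f (snd z)) (fst z))" if "f \<in> \<F>" "admissible k j n m" for f n m
    using E that unfolding extension_on_def by blast
  have hc: "hcont \<alpha> slab (\<lambda>z. E (snd z) (f (snd z)) (fst z))" if f: "f \<in> \<F>" for f
    using adm_ex hreg_imp_hcont[OF hr[OF f]] by blast
  define S where "S t h = ck.solve (E t h)" for t h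
  have S: "S t (f t) x = ck.solve (\<lambda>y. (\<lambda>z. E (snd z) (f (snd z)) (fst z)) (y, t)) x" for t f x by (simp add: S_def)
  show ?thesis
  proof (intro exI[of _ S] conjI ballI allI impI)
    fix f g :: "real \<Rightarrow> complex \<Rightarrow> complex" and t :: real and x assume "f \<in> \<F>" "g \<in> \<F>" and t: "t \<in> {0..1}" and "\<forall>x\<in>D t. f t x = g t x"
    hence "E t (f t) = E t (g t)" by (intro extension_on_cong[OF E t]) simp
    thus "S t (f t) x = S t (g t) x" by (simp add: S_def)
  next
    fix f g :: "real \<Rightarrow> complex \<Rightarrow> complex" and t :: real and c d x assume fg: "f \<in> \<F>" "g \<in> \<F>" and t: "t \<in> {0..1}"
    have "E t (\<lambda>z. c * f t z + d * g t z) = (\<lambda>y. c * E t (f t) y + d * E t (g t) y)"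
    proof
      fix y
      have "(y, t) \<in> slab" using t by (simp add: slab_def)
      thus "E t (\<lambda>z. c * f t z + d * g t z) y = c * E t (f t) y + d * E t (g t) y"
        using E fg unfolding extension_on_def by blast
    qed
    thus "S t (\<lambda>z. c * f t z + d * g t z) x = c * S t (f t) x + d * S t (g t) x"
      using ck.solve_linear[OF hc[OF fg(1)] hc[OF fg(2)] t, of c d x] by (simp add: S_def)
  next
    fix f :: "real \<Rightarrow> complex \<Rightarrow> complex" and t :: real and x assume f: "f \<in> \<F>" and t: "t \<in> {0..1}" and x: "x \<in> D t"
    have xt: "(x, t) \<in> V" using t x by (simp add: total_space_iff)
    have "norm x \<le> norm (x, t)" by (rule norm_fst_le)
    also have "\<dots> \<le> N" using N xt by blast
    finally have far: "(\<lambda>z. E (snd z) (f (snd z)) (fst z)) (x - y, t) = 0" if "1 / k0 \<le> norm y" for y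
      using that M norm_triangle_ineq2[of y x] by (simp add: k0_def norm_minus_commute)
    have "dbar (S t (f t)) x = E t (f t) x"
      using ck.solve_dbar[OF hc[OF f] subsetD[OF V_slab xt] far] by (simp add: S_def)
    also have "\<dots> = f t x"
    proof -
      have "(x, t) \<in> V \<inter> closure V" using xt closure_subset by blast
      thus ?thesis using E f unfolding extension_on_def by blast
    qed
    finally show "dbar (S t (f t)) x = f t x" .
  next
    fix f assume f: "f \<in> \<F>"
    show "(\<lambda>t. S t (f t)) \<in> hoelder_closed (ereal_of_enat k + 1 + ereal \<alpha>) j D"
    proof (rule hoelder_closed_SucI[OF \<alpha> jk V_slab bounded_subset[OF U(2) V_W]])
      fix n m assume adm: "admissible k j n m"
      hence "m \<le> n" by (simp add: admissible_def)
      from ck.solve_hreg[OF hr[OF f adm] this]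
      show "rep \<alpha> (Suc n) m (\<lambda>t. S t (f t))"
        unfolding rep_def by (intro exI conjI) (assumption, simp add: S_def)
    qed
  qed
qed

end

theorem theorem4p5:
  fixes \<alpha> :: real and j k :: enat and D :: "real \<Rightarrow> complex set"
  assumes "0 < \<alpha>" and "\<alpha> < 1" and "j \<le> k"
    and "\<forall>t\<in>{0..1}. open (D t) \<and> connected (D t) \<and> D t \<noteq> {} \<and> bounded (D t)"
    and "smooth_family (ereal_of_enat k + 1 + ereal \<alpha>) j D"
  shows "\<exists>S :: real \<Rightarrow> (complex \<Rightarrow> complex) \<Rightarrow> (complex \<Rightarrow> complex).
    (\<forall>f \<in> hoelder_closed (ereal_of_enat k + ereal \<alpha>) j D.
     \<forall>g \<in> hoelder_closed (ereal_of_enat k + ereal \<alpha>) j D. \<forall>t\<in>{0..1}.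
       ((\<forall>x\<in>D t. f t x = g t x) \<longrightarrow> (\<forall>x\<in>D t. S t (f t) x = S t (g t) x)) \<and>
       (\<forall>c d. \<forall>x\<in>D t. S t (\<lambda>z. c * f t z + d * g t z) x = c * S t (f t) x + d * S t (g t) x)) \<and>
    (\<forall>f \<in> hoelder_closed (ereal_of_enat k + ereal \<alpha>) j D.
       (\<forall>t\<in>{0..1}. \<forall>x\<in>D t. dbar (S t (f t)) x = f t x) \<and>
       (\<lambda>t. S t (f t)) \<in> hoelder_closed (ereal_of_enat k + 1 + ereal \<alpha>) j D)"
proof -
  obtain U r where "continuous_family U \<and> bounded (total_space U) \<and>
        closure (total_space D) \<subseteq> total_space U \<and>
        (r :: real \<Rightarrow> complex \<Rightarrow> real) \<in> hoelder_local (ereal_of_enat k + 1 + ereal \<alpha>) j U \<and>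
        (\<forall>t\<in>{0..1}. D t = {x \<in> U t. r t x < 0}) \<and>
        (\<forall>t\<in>{0..1}. \<forall>x\<in>frontier (D t). (ddir 1 (r t) x, ddir \<i> (r t) x) \<noteq> (0, 0))"
    using assms(5) unfolding smooth_family_def by (elim exE) (rule that)
  with assms(1-4) interpret smooth_domain_family \<alpha> j k D U r
    by unfold_locales blast+
  show ?thesis by (rule solution_operator)
qed

end
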